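(* For all $0\le a\le 1/2$ and $b>2\pi$, one has $$\Lambda_1(\mathbb{T}^2,[g_{a,b}],S_0)=\bar\lambda_1(\mathbb{T}^2,g_{a,b},S_0)=\frac{2\pi}{\sqrt b}.$$ Furthermore, the flat metric $g_{a,b}$ is, up to multiplication by a positive constant, the unique smooth minimiser, i.e. the unique smooth metric $g\in[g_{a,b}]$ with $\bar\lambda_1(\mathbb{T}^2,g,S_0)=\Lambda_1(\mathbb{T}^2,[g_{a,b}],S_0)$.
   Context: For $(a,b)\in\mathbb{R}^2$, $b\neq0$, let $\Gamma_{a,b}=\mathbb{Z}(1,0)+\mathbb{Z}(a,b)$, $\mathbb{T}^2=\mathbb{R}^2/\Gamma_{a,b}$, $g_{a,b}$ the flat metric induced from $\mathbb{R}^2$, and $[g_{a,b}]$ its conformal class (smooth metrics). Spin structures and Dirac operator. On a compact oriented surface $M$ with conformal class $\mathcal{C}$ (hence a complex structure) and canonical bundle $K=(T^{(1,0)}M)^*$, a spin structure is a holomorphic line bundle $S$ with a holomorphic isomorphism $S\otimes S\cong K$; the spinor bundle is $S\oplus\bar S$. A metric $g\in\mathcal{C}$, $g=\mathrm{Re}(h)$ with $h$ Hermitian, induces a Hermitian metric on $S$ by $|s|_g^2=|s\otimes s|_h$; if $s_0$ is a local section with $s_0\otimes s_0=dz$, then $g=|s_0|_g^{-4}(dx^2+dy^2)$. The Dirac operator is $\mathcal{D}_g(\psi_+,\psi_-)=2(\partial_g\psi_-,\,-\bar\partial_g\psi_+)$, where locally $\bar\partial_g(fs_0)=|s_0|_g^2(\partial_{\bar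 z}f)\bar s_0$, $\partial_g(f\bar s_0)=|s_0|_g^2(\partial_zf)s_0$. Its spectrum is real, discrete and symmetric about $0$. $\lambda_1(M,g,S)$ is the smallest positive eigenvalue, $$\bar\lambda_1(M,g,S)=\lambda_1(M,g,S)\,\mathrm{Area}(M,g)^{1/2},\qquad \Lambda_1(M,\mathcal{C},S)=\inf_{g\in\mathcal{C}}\bar\lambda_1(M,g,S).$$ The trivial spin structure $S_0$ on $\mathbb{T}^2$ is the trivial holomorphic line bundle with the isomorphism $S_0\otimes S_0\to K$, $f_1\otimes f_2\mapsto f_1f_2\,dz$ (sections of $S_0$ are $\Gamma_{a,b}$-periodic complex functions on $\mathbb{C}=\mathbb{R}^2$). *)

theory Defs
  imports "HOL-Analysis.Analysis"
begin

text \<open>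
  The plane \<open>\<real>\<^sup>2\<close> is identified with \<open>complex\<close>; functions, tensors and sections on the torus
  \<open>\<real>\<^sup>2 / \<Gamma>\<close> are given by their \<open>\<Gamma>\<close>-periodic lifts to the plane.
\<close>

definition lattice :: "real \<Rightarrow> real \<Rightarrow> complex set" where
  "lattice a b = {of_int m + of_int n * Complex a b | m n. True}"

definition periodic :: "real \<Rightarrow> real \<Rightarrow> (complex \<Rightarrow> 'v) \<Rightarrow> bool" where
  "periodic a b f \<longleftrightarrow> (\<forall>\<gamma>\<in>lattice a b. \<forall>z. f (z + \<gamma>) = f z)"

definition fundamental_domain :: "real \<Rightarrow> real \<Rightarrow> complex set" where
  "fundamental_domain a b =
     {of_real s + of_real t * Complex a b | s t. s \<in> {0..<1} \<and> t \<in> {0..<1}}"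

text \<open>
  Real (not complex) differentiability classes on the plane: \<open>f\<close> is \<open>C\<^sup>k\<^sup>+\<^sup>1\<close> if it is differentiable
  and all its directional derivatives are \<open>C\<^sup>k\<close>.
\<close>

primrec Ck :: "nat \<Rightarrow> (complex \<Rightarrow> 'v::real_normed_vector) \<Rightarrow> bool" where
  "Ck 0 f \<longleftrightarrow> continuous_on UNIV f"
| "Ck (Suc k) f \<longleftrightarrow> (\<forall>z. f differentiable (at z)) \<and>
     (\<forall>v. Ck k (\<lambda>z. frechet_derivative f (at z) v))"

definition smooth :: "(complex \<Rightarrow> 'v::real_normed_vector) \<Rightarrow> bool" where
  "smooth f \<longleftrightarrow> (\<forall>k. Ck k f)"

text \<open>A metric is written \<open>g p u v\<close>, for tangent vectors \<open>u\<close>, \<open>v\<close> at the point \<open>p\<close>.\<close>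

type_synonym metric = "complex \<Rightarrow> complex \<Rightarrow> complex \<Rightarrow> real"

definition torus_metric :: "real \<Rightarrow> real \<Rightarrow> metric \<Rightarrow> bool" where
  "torus_metric a b g \<longleftrightarrow>
     (\<forall>p. bilinear (g p) \<and> (\<forall>u v. g p u v = g p v u) \<and> (\<forall>u. u \<noteq> 0 \<longrightarrow> g p u u > 0)) \<and>
     (\<forall>u v. smooth (\<lambda>p. g p u v)) \<and> periodic a b g"

definition flat_metric :: metric where
  "flat_metric p u v = u \<bullet> v"

definition conformal_class :: "real \<Rightarrow> real \<Rightarrow> metric \<Rightarrow> metric set" where
  "conformal_class a b g0 =
     {g. torus_metric a b g \<and>
         (\<exists>\<phi>::complex \<Rightarrow> real. smooth \<phi> \<and> periodic a b \<phi> \<and> (\<forall>p. \<phi> p > 0) \<and>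
            g = (\<lambda>p u v. \<phi> p * g0 p u v))}"

definition torus_area :: "real \<Rightarrow> real \<Rightarrow> metric \<Rightarrow> real" where
  "torus_area a b g =
     (LINT p:fundamental_domain a b|lborel. sqrt (g p 1 1 * g p \<i> \<i> - (g p 1 \<i>)\<^sup>2))"

text \<open>
  The trivial spin structure \<open>S\<^sub>0\<close> is the trivial line bundle with the isomorphism
  \<open>f\<^sub>1 \<otimes> f\<^sub>2 \<mapsto> f\<^sub>1 f\<^sub>2 dz\<close>.  Its constant section \<open>s\<^sub>0 = 1\<close> is global and satisfies
  \<open>s\<^sub>0 \<otimes> s\<^sub>0 = dz\<close>, so \<open>\<bar>s\<^sub>0\<bar>\<^sup>2\<close> is the norm of \<open>dz\<close>; for \<open>g\<close> conformal to the flat metric it is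
  determined by \<open>g = \<bar>s\<^sub>0\<bar>\<^sup>-\<^sup>4 (dx\<^sup>2 + dy\<^sup>2)\<close>, which is evaluated here on the unit vector \<open>1\<close>.
\<close>

definition s0_norm_sq :: "metric \<Rightarrow> complex \<Rightarrow> real" where
  "s0_norm_sq g p = 1 / sqrt (g p 1 1)"

lemma flat_metric_in_conformal_class: "flat_metric \<in> conformal_class a b flat_metric"
proof -
  have const: "Ck k (\<lambda>z. c)" for k and c :: real
    by (induction k arbitrary: c) auto
  have "bilinear (\<lambda>u v. u \<bullet> v :: real)" for u :: complex
    by (simp add: bilinear_def linear_iff inner_add_left inner_add_right)
  then have "torus_metric a b flat_metric"
    by (auto simp: torus_metric_def flat_metric_def[abs_def] smooth_def periodic_def const
        inner_commute)
  then show ?thesis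
    unfolding conformal_class_def
    by (auto intro!: exI[of _ "\<lambda>_. 1"] simp: smooth_def periodic_def const)
qed

lemma metric_eq_s0_norm:
  assumes "g \<in> conformal_class a b flat_metric"
  shows "g p u v = flat_metric p u v / s0_norm_sq g p ^ 2"
  using assms
  by (auto simp: conformal_class_def flat_metric_def s0_norm_sq_def power_divide
      less_imp_le inner_complex_def)

definition d_z :: "(complex \<Rightarrow> complex) \<Rightarrow> complex \<Rightarrow> complex" where
  "d_z f z = (frechet_derivative f (at z) 1 - \<i> * frechet_derivative f (at z) \<i>) / 2"

definition d_zbar :: "(complex \<Rightarrow> complex) \<Rightarrow> complex \<Rightarrow> complex" where
  "d_zbar f z = (frechet_derivative f (at z) 1 + \<i> * frechet_derivative f (at z) \<i>) / 2"

text \<open>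
  A spinor \<open>(f\<^sub>+ s\<^sub>0, f\<^sub>- cnj s\<^sub>0)\<close> for \<open>S\<^sub>0\<close> is represented by the pair \<open>(f\<^sub>+, f\<^sub>-)\<close> of periodic functions.
\<close>

type_synonym spinor = "(complex \<Rightarrow> complex) \<times> (complex \<Rightarrow> complex)"

definition smooth_spinor :: "real \<Rightarrow> real \<Rightarrow> spinor \<Rightarrow> bool" where
  "smooth_spinor a b \<psi> \<longleftrightarrow>
     smooth (fst \<psi>) \<and> periodic a b (fst \<psi>) \<and> smooth (snd \<psi>) \<and> periodic a b (snd \<psi>)"

definition dirac :: "metric \<Rightarrow> spinor \<Rightarrow> spinor" where
  "dirac g \<psi> =
     ((\<lambda>z. 2 * (of_real (s0_norm_sq g z) * d_z (snd \<psi>) z)),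
      (\<lambda>z. 2 * - (of_real (s0_norm_sq g z) * d_zbar (fst \<psi>) z)))"

definition dirac_eigenvalue :: "real \<Rightarrow> real \<Rightarrow> metric \<Rightarrow> real \<Rightarrow> bool" where
  "dirac_eigenvalue a b g l \<longleftrightarrow>
     (\<exists>\<psi>. smooth_spinor a b \<psi> \<and> \<psi> \<noteq> ((\<lambda>_. 0), (\<lambda>_. 0)) \<and>
        dirac g \<psi> = ((\<lambda>z. of_real l * fst \<psi> z), (\<lambda>z. of_real l * snd \<psi> z)))"

text \<open>
  The spectrum being discrete, the infimum of the positive eigenvalues is the smallest one; it is
  taken in \<open>ereal\<close> so that no value has to be chosen for an empty set (see \<open>lambda1_eq\<close>).
\<close>

definition lambda1 :: "real \<Rightarrow> real \<Rightarrow> metric \<Rightarrow> ereal" where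
  "lambda1 a b g = Inf {ereal l | l. l > 0 \<and> dirac_eigenvalue a b g l}"

lemma lambda1_eq:
  assumes "l > 0" "dirac_eigenvalue a b g l"
    and "\<And>m. m > 0 \<Longrightarrow> dirac_eigenvalue a b g m \<Longrightarrow> l \<le> m"
  shows "lambda1 a b g = ereal l"
  unfolding lambda1_def using assms by (intro Inf_eqI) auto

definition lambda1_bar :: "real \<Rightarrow> real \<Rightarrow> metric \<Rightarrow> ereal" where
  "lambda1_bar a b g = lambda1 a b g * ereal (sqrt (torus_area a b g))"

definition Lambda1 :: "real \<Rightarrow> real \<Rightarrow> metric set \<Rightarrow> ereal" where
  "Lambda1 a b C = (INF g\<in>C. lambda1_bar a b g)"

end

theory Submission
  imports Defs
begin

text \<open>
  Let \<open>\<rho>\<^sup>2\<close> be the conformal factor of \<open>g\<close>, \<open>A\<close> its area and \<open>D\<close> the flat Dirac operator. An eigenspinor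
  solves \<open>D \<psi> = \<lambda> \<rho> \<psi>\<close>, so \<open>\<lambda> \<ge> \<kappa>\<close> follows from the inequality
  \<open>\<integral> \<langle>D \<xi>, \<xi>\<rangle> \<le> \<integral> |D \<xi>|\<^sup>2 / W\<close> for all spinors \<open>\<xi>\<close>, with \<open>W = \<kappa> \<rho>\<close>. For \<open>\<kappa> = 2 \<pi> / sqrt (b A)\<close> it has to
  be shown for every positive \<open>W\<close> with \<open>\<integral> W\<^sup>2 = 4 \<pi>\<^sup>2 / b\<close>.

  Split \<open>W\<close> and \<open>\<xi>\<close> into even and odd parts under the shift of \<open>x\<close> by half a period. If \<open>V, Z \<ge> W\<^sub>e\<close> and
  \<open>(V - W\<^sub>e) (Z - W\<^sub>e) \<ge> W\<^sub>o\<^sup>2\<close>, then the inequality for \<open>W\<close> follows from the one for \<open>V\<close> on even spinors and the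
  one for \<open>Z\<close> on odd spinors. With \<open>R\<^sup>2 = W\<^sub>e\<^sup>2 + W\<^sub>o\<^sup>2\<close>, the choice \<open>V = W\<^sub>e + W\<^sub>o\<^sup>2 / (2 R) \<le> R\<close> and
  \<open>Z = W\<^sub>e + 2 R \<le> 3 R\<close> does not increase the \<open>L\<^sup>2\<close> norms on the circles \<open>y = const\<close>. Even spinors have half
  the period, and the step is iterated. Once the period \<open>1 / K\<close> is small compared with \<open>1 / sup W\<close>, averaging over
  the circles leaves a weighted Wirtinger inequality in \<open>y\<close>, which holds because the circle norms of \<open>W\<close> have
  integral at most \<open>2 \<pi>\<close>.

  If the inequality for odd spinors failed, maximising a quadratic form \<open>\<langle>D\<^sup>-\<^sup>1 q u, q u\<rangle>\<close> would give a nonzero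
  odd solution of \<open>D \<psi> = Z' \<psi>\<close> with \<open>Z'\<close> close to \<open>Z\<close>. On every circle such a \<open>\<psi>\<close> goes from a vector to its
  negative in each half period, hence turns by at least \<open>\<pi>\<close>. This makes the circle mean of \<open>\<partial>\<^sub>y log |\<psi>|\<close> satisfy
  a differential inequality which excludes that it is periodic with mean zero.

  If \<open>W\<close> is not constant, one of the steps is strict.
\<close>

section \<open>Doubly periodic functions\<close>

text \<open>The spectrum is unbounded in both directions, so no minimum of a quotient characterises
  the first positive eigenvalue; the quadratic inequality takes its place and needs no existence
  theory for eigenspinors. The obstacle is the kernel of D, the constant spinors. On spinors that
  change sign after a half period the frequencies are half-integers, so D has a compact inverse and
  a failure of the inequality produces an eigenvector. On even spinors this breaks down, and they
  are passed on to shorter periods until W is felt only through its circle norms. The bound on b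
  enters twice. With c = 2 \<pi> / b \<le> 1 the circle norms u satisfy u \<le> (u^2 / c + c) / 2, a
  majorant with integral exactly 2 \<pi>; for large u it exceeds u by a margin that absorbs the
  growth of the norms where u is too large for Z = W_e + 2 R. And sqrt (b / 2) is at least sqrt
  \<pi>, which makes the circle in y long enough for the differential inequality to be
  contradictory. Strictness for nonconstant W is obtained as the same inequality for t W with some t
  > 1.\<close>

definition cont2 :: "(real \<Rightarrow> real \<Rightarrow> 'a::topological_space) \<Rightarrow> bool" where
  "cont2 F \<longleftrightarrow> continuous_on UNIV (\<lambda>p. F (fst p) (snd p))"

text \<open>Partial derivatives are parameters rather than terms: regularity of second order is then
  \<open>C1\<close> applied to one of them, and only those derivatives that occur have to
  exist.\<close>

definition C1 :: "(real \<Rightarrow> real \<Rightarrow> 'a::real_normed_vector) \<Rightarrow> (real \<Rightarrow> real \<Rightarrow> 'a) \<Rightarrow> (real \<Rightarrow> real \<Rightarrow> 'a) \<Rightarrow> bool" where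
  "C1 F Fx Fy \<longleftrightarrow> cont2 F \<and> cont2 Fx \<and> cont2 Fy \<and>
     (\<forall>x y. ((\<lambda>s. F s y) has_vector_derivative Fx x y) (at x)) \<and>
     (\<forall>x y. ((\<lambda>t. F x t) has_vector_derivative Fy x y) (at y))"

text \<open>The circle has length 1, so the integral is at the same time the mean over the circle at
  height \<open>y\<close>.\<close>

definition xint :: "(real \<Rightarrow> real \<Rightarrow> 'a::euclidean_space) \<Rightarrow> real \<Rightarrow> 'a" where
  "xint F y = integral {0..1} (\<lambda>x. F x y)"

lemma cont2D:
  assumes "cont2 F" "continuous_on S u" "continuous_on S v"
  shows "continuous_on S (\<lambda>t. F (u t) (v t))"
proof -
  have "continuous_on S (\<lambda>t. (\<lambda>p. F (fst p) (snd p)) (u t, v t))"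
    using assms(1) unfolding cont2_def
    by (rule continuous_on_compose2) (auto intro!: continuous_intros assms(2,3))
  then show ?thesis by simp
qed

lemma cont2_C1: "C1 F Fx Fy \<Longrightarrow> cont2 F" "C1 F Fx Fy \<Longrightarrow> cont2 Fx" "C1 F Fx Fy \<Longrightarrow> cont2 Fy"
  by (auto simp: C1_def)

lemma C1_dx: "C1 F Fx Fy \<Longrightarrow> ((\<lambda>s. F s y) has_vector_derivative Fx x y) (at x within S)"
  and C1_dy: "C1 F Fx Fy \<Longrightarrow> ((\<lambda>t. F x t) has_vector_derivative Fy x y) (at y within S)"
  by (auto simp: C1_def intro: has_vector_derivative_at_within)

lemma cont2_line:
  assumes "cont2 F"
  shows "continuous_on S (\<lambda>x. F x y)" "continuous_on S (\<lambda>y. F x y)"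
  using cont2D[OF assms, of S "\<lambda>x. x" "\<lambda>_. y"] cont2D[OF assms, of S "\<lambda>_. x" "\<lambda>x. x"] by auto

lemma cont2_integrable:
  fixes F :: "real \<Rightarrow> real \<Rightarrow> 'a::euclidean_space"
  assumes "cont2 F"
  shows "(\<lambda>x. F x y) integrable_on {c..d}"
  by (intro integrable_continuous_interval cont2_line assms)

lemma xint_cont:
  fixes F :: "real \<Rightarrow> real \<Rightarrow> 'a::euclidean_space"
  assumes "cont2 F"
  shows "continuous_on S (xint F)"
proof -
  have "continuous_on S (\<lambda>y. integral (cbox 0 1) (\<lambda>x. F x y))"
    by (rule integral_continuous_on_param)
       (auto simp: split_beta intro!: continuous_intros cont2D[OF assms])
  then show ?thesis by (simp add: xint_def[abs_def])
qed

lemma xint_deriv: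
  fixes F :: "real \<Rightarrow> real \<Rightarrow> 'a::euclidean_space"
  assumes "cont2 F" "cont2 Fy" "\<And>x y. ((\<lambda>t. F x t) has_vector_derivative Fy x y) (at y)"
  shows "(xint F has_vector_derivative xint Fy y) (at y)"
proof -
  have "((\<lambda>y. integral (cbox 0 1) (\<lambda>x. F x y)) has_vector_derivative
     integral (cbox 0 1) (\<lambda>x. Fy x y)) (at y within UNIV)"
    by (rule leibniz_rule_vector_derivative)
       (auto simp: split_beta intro!: continuous_intros cont2D[OF assms(2)] assms(3)
          cont2_integrable[OF assms(1)])
  then show ?thesis by (simp add: xint_def[abs_def])
qed

lemma xint_ftc:
  fixes F :: "real \<Rightarrow> real \<Rightarrow> 'a::euclidean_space"
  assumes "\<And>x. ((\<lambda>s. F s y) has_vector_derivative Fx x y) (at x)"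
  shows "xint Fx y = F 1 y - F 0 y"
proof -
  have "((\<lambda>x. Fx x y) has_integral (F 1 y - F 0 y)) {0..1}"
    by (rule fundamental_theorem_of_calculus)
       (auto intro: has_vector_derivative_at_within assms)
  then show ?thesis by (simp add: xint_def integral_unique)
qed

lemma xint_add:
  fixes F :: "real \<Rightarrow> real \<Rightarrow> 'a::euclidean_space"
  assumes "cont2 F" "cont2 G"
  shows "xint (\<lambda>x y. F x y + G x y) y = xint F y + xint G y"
  unfolding xint_def by (rule integral_add) (auto intro: cont2_integrable assms)

lemma xint_diff:
  fixes F :: "real \<Rightarrow> real \<Rightarrow> 'a::euclidean_space"
  assumes "cont2 F" "cont2 G"
  shows "xint (\<lambda>x y. F x y - G x y) y = xint F y - xint G y"
  unfolding xint_def by (rule integral_diff) (auto intro: cont2_integrable assms)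

lemma xint_cmult: "xint (\<lambda>x y. c y * (F x y::real)) y = c y * xint F y"
  unfolding xint_def by simp

lemma xint_mono:
  fixes F :: "real \<Rightarrow> real \<Rightarrow> real"
  assumes "cont2 F" "cont2 G" "\<And>x. F x y \<le> G x y"
  shows "xint F y \<le> xint G y"
  unfolding xint_def by (rule integral_le) (auto intro: cont2_integrable assms)

lemma xint_const [simp]: "xint (\<lambda>x y. c y) y = c y"
  unfolding xint_def by simp

lemma xint_nonneg:
  fixes F :: "real \<Rightarrow> real \<Rightarrow> real"
  assumes "cont2 F" "\<And>x. F x y \<ge> 0"
  shows "0 \<le> xint F y"
  unfolding xint_def by (rule integral_nonneg) (auto intro: cont2_integrable assms)

section \<open>Cauchy-Schwarz inequality and integrals over periods\<close>

lemma CS_integral: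
  fixes f g :: "real \<Rightarrow> real"
  assumes f: "continuous_on {a..b} f" and g: "continuous_on {a..b} g"
  shows "(integral {a..b} (\<lambda>x. f x * g x))\<^sup>2 \<le> integral {a..b} (\<lambda>x. (f x)\<^sup>2) * integral {a..b} (\<lambda>x. (g x)\<^sup>2)"
proof -
  define A B C where "A = integral {a..b} (\<lambda>x. (f x)\<^sup>2)" and "B = integral {a..b} (\<lambda>x. f x * g x)"
    and "C = integral {a..b} (\<lambda>x. (g x)\<^sup>2)"
  have i: "(\<lambda>x. (f x)\<^sup>2) integrable_on {a..b}" "(\<lambda>x. f x * g x) integrable_on {a..b}"
    "(\<lambda>x. (g x)\<^sup>2) integrable_on {a..b}"
    using f g by (auto intro!: integrable_continuous_interval continuous_intros)
  \<comment> \<open>The quadratic form \<open>\<integral> (s f - t g)^2\<close> is nonnegative; its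
    discriminant gives the claim, with \<open>A = 0\<close> treated apart because the choice
    \<open>s = B\<close>, \<open>t = A\<close> is void there.\<close>
  have q: "0 \<le> A * s\<^sup>2 - 2 * B * s * t + C * t\<^sup>2" for s t
  proof -
    have "0 \<le> integral {a..b} (\<lambda>x. (s * f x - t * g x)\<^sup>2)"
      using f g by (intro integral_nonneg integrable_continuous_interval) (auto intro!: continuous_intros)
    also have "(\<lambda>x. (s * f x - t * g x)\<^sup>2) = (\<lambda>x. s\<^sup>2 * (f x)\<^sup>2 - (2 * s * t) * (f x * g x) + t\<^sup>2 * (g x)\<^sup>2)"
      by (auto simp: power2_eq_square algebra_simps)
    also have "integral {a..b} \<dots> = s\<^sup>2 * A - (2 * s * t) * B + t\<^sup>2 * C"
      unfolding A_def B_def C_def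
      by (intro integral_unique has_integral_add has_integral_diff has_integral_mult_right integrable_integral i)
    finally show ?thesis by (simp add: algebra_simps)
  qed
  have "0 \<le> C" using q[of 0 1] by simp
  have "0 \<le> A" using q[of 1 0] by simp
  show ?thesis unfolding A_def[symmetric] B_def[symmetric] C_def[symmetric]
  proof (cases "A = 0")
    case True
    have "B = 0"
    proof (rule ccontr)
      assume "B \<noteq> 0"
      have "0 \<le> - 2 * B * ((C + 1) / (2 * B)) * 1 + C" using q[of "(C + 1) / (2 * B)" 1] True by simp
      with \<open>B \<noteq> 0\<close> show False by simp
    qed
    then show "B\<^sup>2 \<le> A * C" using True by simp
  next
    case False
    then have "A > 0" using \<open>0 \<le> A\<close> by simp
    have "0 \<le> A * B\<^sup>2 - 2 * B * B * A + C * A\<^sup>2" using q[of B A] by simp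
    then have "0 \<le> A * (A * C - B\<^sup>2)" by (simp add: power2_eq_square algebra_simps)
    then show "B\<^sup>2 \<le> A * C" using \<open>A > 0\<close> by (simp add: zero_le_mult_iff)
  qed
qed

lemma CS_xint:
  fixes F G :: "real \<Rightarrow> real \<Rightarrow> real"
  assumes "cont2 F" "cont2 G"
  shows "(xint (\<lambda>x y. F x y * G x y) y)\<^sup>2 \<le> xint (\<lambda>x y. (F x y)\<^sup>2) y * xint (\<lambda>x y. (G x y)\<^sup>2) y"
  unfolding xint_def by (rule CS_integral) (auto intro: cont2_line assms)

lemma integral_translate:
  fixes g :: "real \<Rightarrow> 'a::euclidean_space"
  shows "integral {a + T..b + T} g = integral {a..b} (\<lambda>x. g (x + T))"
  using integral_shift_real_ivl[of "a + T" T "b + T" g] by simp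

lemma periodic_integral:
  fixes g :: "real \<Rightarrow> 'a::euclidean_space"
  assumes c: "continuous_on UNIV g" and p: "\<And>x. g (x + T) = g x" and T: "0 \<le> s" "s \<le> T"
  shows "integral {s..s + T} g = integral {0..T} g"
proof -
  have i: "g integrable_on {u..v}" for u v
    by (intro integrable_continuous_interval continuous_on_subset[OF c]) auto
  have "integral {s..s + T} g = integral {s..T} g + integral {T..s + T} g"
    by (rule Henstock_Kurzweil_Integration.integral_combine[symmetric]) (use T i in auto)
  also have "integral {T..s + T} g = integral {0..s} g"
    using integral_translate[of 0 T s g] by (simp add: p)
  also have "integral {s..T} g + integral {0..s} g = integral {0..T} g"
    using Henstock_Kurzweil_Integration.integral_combine[of 0 s T g] T i by (simp add: add.commute)
  finally show ?thesis .
qed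

lemma periodic_integral_multiple:
  fixes g :: "real \<Rightarrow> 'a::euclidean_space"
  assumes c: "continuous_on UNIV g" and p: "\<And>x. g (x + T) = g x" and T: "0 \<le> T"
  shows "integral {0..real n * T} g = real n *\<^sub>R integral {0..T} g"
proof (induction n)
  case (Suc n)
  have i: "g integrable_on {u..v}" for u v
    by (intro integrable_continuous_interval continuous_on_subset[OF c]) auto
  have pn: "g (x + real n * T) = g x" for x
  proof (induction n)
    case (Suc n)
    have "x + real (Suc n) * T = (x + real n * T) + T" by (simp add: algebra_simps)
    then show ?case using Suc p by metis
  qed simp
  have "integral {0..real (Suc n) * T} g = integral {0..real n * T} g + integral {real n * T..real (Suc n) * T} g"
    by (rule Henstock_Kurzweil_Integration.integral_combine[symmetric]) (use T i in \<open>auto simp: algebra_simps\<close>)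
  also have "integral {real n * T..real (Suc n) * T} g = integral {0..T} g"
    using integral_translate[of 0 "real n * T" T g] by (simp add: pn distrib_right add.commute)
  finally show ?case using Suc by (simp add: algebra_simps)
qed simp

section \<open>The spinor algebra\<close>

type_synonym spin = "complex \<times> complex"

text \<open>\<open>e1\<close> and \<open>e2\<close> are the anticommuting Clifford multiplications
  for which the flat operator \<open>2 (d_z, - d_zbar)\<close> reads
  \<open>e1 \<partial>x + e2 \<partial>y\<close>; both are isometries and skew for the real inner
  product. \<open>JJ\<close> is the product of \<open>e2\<close> after \<open>e1\<close>.\<close>

definition e1 :: "spin \<Rightarrow> spin" where "e1 p = (snd p, - fst p)"
definition e2 :: "spin \<Rightarrow> spin" where "e2 p = (- \<i> * snd p, - \<i> * fst p)"
definition JJ :: "spin \<Rightarrow> spin" where "JJ p = (\<i> * fst p, - \<i> * snd p)"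

lemma bl_e1: "bounded_linear e1" unfolding e1_def[abs_def]
  by (intro bounded_linear_Pair bounded_linear_minus bounded_linear_snd bounded_linear_fst)
lemma bl_e2: "bounded_linear e2" unfolding e2_def[abs_def]
  by (intro bounded_linear_Pair bounded_linear_const_mult bounded_linear_snd bounded_linear_fst)
lemma bl_JJ: "bounded_linear JJ" unfolding JJ_def[abs_def]
  by (intro bounded_linear_Pair bounded_linear_const_mult bounded_linear_snd bounded_linear_fst)

lemma e_inner:
  "inner (e1 p) (e1 q) = inner p q" "inner (e2 p) (e2 q) = inner p q" "inner (JJ p) (JJ q) = inner p q"
  "inner (e1 p) q = - inner p (e1 q)" "inner (e2 p) q = - inner p (e2 q)" "inner (JJ p) q = - inner p (JJ q)"
  by (simp_all add: e1_def e2_def JJ_def inner_prod_def inner_complex_def)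

lemma e_self: "inner p (e1 p) = 0" "inner p (e2 p) = 0" "inner p (JJ p) = 0"
  "inner (e1 p) p = 0" "inner (e2 p) p = 0" "inner (JJ p) p = 0"
  by (simp_all add: e1_def e2_def JJ_def inner_prod_def inner_complex_def)

lemma e_norm: "norm (e1 p) = norm p" "norm (e2 p) = norm p" "norm (JJ p) = norm p"
  by (simp_all add: norm_eq_sqrt_inner e_inner(1-3))

lemma e_alg: "e1 (e1 p) = - p" "e2 (e2 p) = - p" "e2 (e1 p) = JJ p" "e1 (e2 p) = - JJ p"
  "e2 (JJ p) = - e1 p" "JJ (JJ p) = - p" "e1 (JJ p) = e2 p" "JJ (e1 p) = - e2 p" "JJ (e2 p) = e1 p"
  by (simp_all add: e1_def e2_def JJ_def prod_eq_iff)

lemmas lin_e1 = bounded_linear.linear[OF bl_e1]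
lemmas lin_e2 = bounded_linear.linear[OF bl_e2]
lemmas lin_JJ = bounded_linear.linear[OF bl_JJ]

lemmas e_lin = linear_add[OF lin_e1] linear_add[OF lin_e2] linear_add[OF lin_JJ]
  linear_diff[OF lin_e1] linear_diff[OF lin_e2] linear_diff[OF lin_JJ]
  linear_neg[OF lin_e1] linear_neg[OF lin_e2] linear_neg[OF lin_JJ]
  linear_scale[OF lin_e1] linear_scale[OF lin_e2] linear_scale[OF lin_JJ]
  linear_0[OF lin_e1] linear_0[OF lin_e2] linear_0[OF lin_JJ]

text \<open>Multiplicativity of the quaternion norm. The four squares on the right are the squared
  products of \<open>q\<close> with the frame \<open>p\<close>, \<open>JJ p\<close>,
  \<open>e1 p\<close>, \<open>e2 p\<close>.\<close>

lemma euler_four_squares: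
  fixes a b c d x y z w :: real
  shows "(x * x + y * y + (z * z + w * w)) * (a * a + b * b + (c * c + d * d)) =
    (x * a + y * b + (z * c + w * d))\<^sup>2 + (y * a - x * b + (z * d - w * c))\<^sup>2 +
    (x * c + y * d - (z * a + w * b))\<^sup>2 + (x * d - y * c + (z * b - w * a))\<^sup>2"
  by algebra

text \<open>Bessel's inequality: \<open>p\<close>, \<open>JJ p\<close>, \<open>e1 p\<close>,
  \<open>e2 p\<close> are orthogonal and of equal length in real dimension four, and the component
  along \<open>e2 p\<close> is dropped.\<close>

lemma frame_ineq:
  "(inner q p)\<^sup>2 + (inner q (JJ p))\<^sup>2 + (inner q (e1 p))\<^sup>2 \<le> (norm q)\<^sup>2 * (norm p)\<^sup>2"
proof -
  obtain x y z w a b c d where q: "q = (Complex x y, Complex z w)" and p: "p = (Complex a b, Complex c d)"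
    by (metis complex_surj surj_pair)
  have n: "(norm q)\<^sup>2 = x * x + y * y + (z * z + w * w)" "(norm p)\<^sup>2 = a * a + b * b + (c * c + d * d)"
    unfolding power2_norm_eq_inner q p by (simp_all add: inner_complex_def)
  have i: "inner q p = x * a + y * b + (z * c + w * d)" "inner q (JJ p) = y * a - x * b + (z * d - w * c)"
    "inner q (e1 p) = x * c + y * d - (z * a + w * b)"
    unfolding q p by (simp_all add: inner_complex_def JJ_def e1_def)
  show ?thesis unfolding n i euler_four_squares[of x y z w a b c d] by simp
qed

section \<open>A differential inequality on the circle\<close>

lemma integral_deriv:
  fixes f f' :: "real \<Rightarrow> real"
  assumes "a \<le> b" "\<And>x. (f has_real_derivative f' x) (at x)"
  shows "integral {a..b} f' = f b - f a"
  by (rule integral_unique, rule fundamental_theorem_of_calculus)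
     (use assms in \<open>auto simp: has_real_derivative_iff_has_vector_derivative[symmetric] intro: has_field_derivative_at_within\<close>)

lemma periodic_of_int:
  fixes g :: "real \<Rightarrow> 'a"
  assumes p: "\<And>x. g (x + T) = g x"
  shows "g (x + of_int n * T) = g x"
proof -
  have pn: "g (x + real n * T) = g x" for x n
  proof (induction n)
    case (Suc n)
    have "x + real (Suc n) * T = (x + real n * T) + T" by (simp add: algebra_simps)
    then show ?case using Suc p by metis
  qed simp
  show ?thesis
  proof (cases "n \<ge> 0")
    case True
    then show ?thesis using pn[of x "nat n"] by simp
  next
    case False
    have "g x = g ((x + of_int n * T) + real (nat (- n)) * T)" using False by (simp add: algebra_simps)
    also have "\<dots> = g (x + of_int n * T)" by (rule pn)
    finally show ?thesis by simp
  qed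
qed

lemma periodic_integral_any:
  fixes g :: "real \<Rightarrow> 'a::euclidean_space"
  assumes c: "continuous_on UNIV g" and p: "\<And>x. g (x + T) = g x" and T: "0 < T"
  shows "integral {s..s + T} g = integral {0..T} g"
proof -
  define n where "n = \<lfloor>s / T\<rfloor>"
  define r where "r = s - of_int n * T"
  have r: "0 \<le> r" "r \<le> T"
  proof -
    have "of_int n \<le> s / T" "s / T < of_int n + 1" unfolding n_def by linarith+
    then have "of_int n * T \<le> s" "s < (of_int n + 1) * T"
      using T by (simp_all add: pos_le_divide_eq pos_divide_less_eq)
    then show "0 \<le> r" "r \<le> T" by (auto simp: r_def algebra_simps)
  qed
  have "integral {s..s + T} g = integral {r + of_int n * T..(r + T) + of_int n * T} g"
    by (simp add: r_def)
  also have "\<dots> = integral {r..r + T} g"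
    by (subst integral_translate) (simp add: periodic_of_int[of g, OF p])
  also have "\<dots> = integral {0..T} g" using periodic_integral[OF c p r] .
  finally show ?thesis .
qed

text \<open>The angle from the starting point grows no faster than the arc length: \<open>G'\<close>
  is tangent to the sphere, so it pairs only with the tangential part of \<open>G a\<close> at
  \<open>G x\<close>, and the length of that part is the sine of the angle.\<close>

lemma arc_length_ge_angle:
  fixes G G' :: "real \<Rightarrow> 'a::real_inner"
  assumes ab: "a \<le> b"
    and d: "\<And>x. x \<in> {a..b} \<Longrightarrow> (G has_vector_derivative G' x) (at x within {a..b})"
    and n: "\<And>x. x \<in> {a..b} \<Longrightarrow> norm (G x) = 1"
    and s: "continuous_on {a..b} s" "\<And>x. x \<in> {a..b} \<Longrightarrow> norm (G' x) \<le> s x"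
    and orth: "\<And>x. x \<in> {a..b} \<Longrightarrow> inner (G x) (G' x) = 0"
  shows "arccos (inner (G a) (G b)) \<le> integral {a..b} s"
proof -
  define q where "q x = inner (G a) (G x)" for x
  define q' where "q' x = inner (G a) (G' x)" for x
  have q1: "\<bar>q x\<bar> \<le> 1" if "x \<in> {a..b}" for x
    unfolding q_def using Cauchy_Schwarz_ineq2[of "G a" "G x"] n that ab by simp
  have q'b: "\<bar>q' x\<bar> \<le> s x * sqrt (1 - (q x)\<^sup>2)" if x: "x \<in> {a..b}" for x
  proof -
    define v where "v = G a - q x *\<^sub>R G x"
    have "q' x = inner v (G' x)" using orth[OF x] by (simp add: q'_def v_def inner_diff_left)
    then have "\<bar>q' x\<bar> \<le> norm v * norm (G' x)" using Cauchy_Schwarz_ineq2[of v "G' x"] by simp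
    also have "norm v = sqrt (1 - (q x)\<^sup>2)"
    proof -
      have "inner (G a) (G a) = 1" "inner (G x) (G x) = 1"
        using n[OF x] n[of a] ab by (auto simp: dot_square_norm)
      then have "inner v v = 1 - (q x)\<^sup>2"
        by (simp add: v_def q_def inner_diff_left inner_diff_right inner_commute[of "G x" "G a"] power2_eq_square)
      then show ?thesis by (simp add: norm_eq_sqrt_inner)
    qed
    also have "sqrt (1 - (q x)\<^sup>2) * norm (G' x) \<le> sqrt (1 - (q x)\<^sup>2) * s x"
      using s(2)[OF x] q1[OF x] by (intro mult_left_mono) (auto simp: abs_square_le_1)
    finally show ?thesis by (simp add: mult.commute)
  qed
  have dq: "(q has_real_derivative q' x) (at x within {a..b})" if "x \<in> {a..b}" for x
    unfolding q_def[abs_def] q'_def has_real_derivative_iff_has_vector_derivative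
    by (rule bounded_linear.has_vector_derivative[OF bounded_linear_inner_right d[OF that]])
  \<comment> \<open>\<open>arccos\<close> is not differentiable at 1 and -1, and \<open>q\<close>
    starts at 1. The factor \<open>r < 1\<close> keeps the argument inside the open interval;
    finally \<open>r\<close> tends to 1.\<close>
  have main: "arccos (r * q b) - arccos (r * q a) \<le> integral {a..b} s" if r: "0 < r" "r < 1" for r
  proof -
    define p where "p x = inverse (- sqrt (1 - (r * q x)\<^sup>2)) * (r * q' x)" for x
    have rq: "\<bar>r * q x\<bar> < 1" if "x \<in> {a..b}" for x
    proof -
      have "\<bar>r * q x\<bar> = r * \<bar>q x\<bar>" using r by (simp add: abs_mult)
      also have "\<dots> \<le> r * 1" using q1[OF that] r by (intro mult_left_mono) auto
      finally show ?thesis using r by simp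
    qed
    have dp: "((\<lambda>x. arccos (r * q x)) has_real_derivative p x) (at x within {a..b})" if x: "x \<in> {a..b}" for x
    proof -
      have "((\<lambda>x. r * q x) has_real_derivative r * q' x) (at x within {a..b})"
        by (rule DERIV_cmult[OF dq[OF x]])
      from DERIV_chain2[OF DERIV_arccos this] rq[OF x] show ?thesis unfolding p_def by auto
    qed
    have pb: "p x \<le> s x" if x: "x \<in> {a..b}" for x
    proof -
      have s0: "0 \<le> s x" using s(2)[OF x] norm_ge_zero order_trans by blast
      have pos: "0 < 1 - (r * q x)\<^sup>2" using rq[OF x] by (simp add: abs_square_less_1)
      have "r\<^sup>2 * (1 - (q x)\<^sup>2) \<le> 1 - (r * q x)\<^sup>2"
        using r by (simp add: algebra_simps power_mult_distrib) (simp add: power_le_one)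
      then have "sqrt (r\<^sup>2 * (1 - (q x)\<^sup>2)) \<le> sqrt (1 - (r * q x)\<^sup>2)" by simp
      then have *: "r * sqrt (1 - (q x)\<^sup>2) \<le> sqrt (1 - (r * q x)\<^sup>2)"
        using r by (simp add: real_sqrt_mult)
      have "p x \<le> \<bar>p x\<bar>" by simp
      also have "\<dots> = r * \<bar>q' x\<bar> / sqrt (1 - (r * q x)\<^sup>2)"
        using r pos by (simp add: p_def abs_mult divide_inverse)
      also have "\<dots> \<le> r * (s x * sqrt (1 - (q x)\<^sup>2)) / sqrt (1 - (r * q x)\<^sup>2)"
        using r pos q'b[OF x] by (intro divide_right_mono mult_left_mono) auto
      also have "\<dots> = s x * (r * sqrt (1 - (q x)\<^sup>2)) / sqrt (1 - (r * q x)\<^sup>2)" by simp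
      also have "\<dots> \<le> s x * sqrt (1 - (r * q x)\<^sup>2) / sqrt (1 - (r * q x)\<^sup>2)"
        using s0 pos * by (intro divide_right_mono mult_left_mono) auto
      also have "\<dots> = s x" using pos by simp
      finally show ?thesis .
    qed
    have "(p has_integral (arccos (r * q b) - arccos (r * q a))) {a..b}"
      by (rule fundamental_theorem_of_calculus[OF ab])
         (use dp in \<open>simp add: has_real_derivative_iff_has_vector_derivative\<close>)
    moreover have "(s has_integral integral {a..b} s) {a..b}"
      by (intro integrable_integral integrable_continuous_interval s)
    ultimately show ?thesis by (rule has_integral_le) (use pb in auto)
  qed
  have qa: "q a = 1" using n[of a] ab by (simp add: q_def dot_square_norm)
  have qb: "\<bar>q b\<bar> \<le> 1" using q1[of b] ab by simp
  have "((\<lambda>r. arccos (r * q b) - arccos (r * q a)) \<longlongrightarrow> arccos (1 * q b) - arccos (1 * q a)) (at_left 1)"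
  proof -
    have c: "continuous_on {0..1} (\<lambda>r. arccos (r * q b) - arccos (r * q a))"
    proof (intro continuous_intros)
      have *: "- 1 \<le> r * q b \<and> r * q b \<le> 1" if "r \<in> {0..1}" for r
      proof -
        have "\<bar>r * q b\<bar> \<le> 1 * 1" unfolding abs_mult using that qb by (intro mult_mono) auto
        then show ?thesis by auto
      qed
      show "\<forall>r\<in>{0..1}. - 1 \<le> r * q b \<and> r * q b \<le> 1" using * by blast
      show "\<forall>r\<in>{0..1}. - 1 \<le> r * q a \<and> r * q a \<le> 1" by (auto simp: qa)
    qed
    then have "((\<lambda>r. arccos (r * q b) - arccos (r * q a)) \<longlongrightarrow> arccos (1 * q b) - arccos (1 * q a)) (at 1 within {0..1})"
      unfolding continuous_on_def by (rule bspec) simp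
    then show ?thesis by (simp add: at_within_Icc_at_left)
  qed
  moreover have "\<forall>\<^sub>F r in at_left (1::real). arccos (r * q b) - arccos (r * q a) \<le> integral {a..b} s"
    by (rule eventually_mono[OF eventually_at_left_real[of 0 "1::real"]]) (use main in auto)
  ultimately have "arccos (1 * q b) - arccos (1 * q a) \<le> integral {a..b} s"
    by (rule tendsto_upperbound) simp
  then have "arccos (q b) \<le> integral {a..b} s" by (simp add: qa)
  then show ?thesis by (simp add: q_def)
qed

text \<open>The squared positive part is differentiable even at 0; it supplies an antiderivative of
  \<open>h'\<close> times the cut-off of \<open>h\<close>.\<close>

lemma deriv_pos_part_sq:
  "((\<lambda>u::real. (max 0 u)\<^sup>2) has_real_derivative 2 * max 0 u) (at u)"
proof (cases u "0::real" rule: linorder_cases)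
  case less
  have "((\<lambda>u::real. 0) has_real_derivative 2 * max 0 u) (at u)" using less by simp
  then show ?thesis
    by (rule has_field_derivative_transform_within_open[of _ _ _ "{..<0}"]) (use less in auto)
next
  case equal
  have "((\<lambda>h. ((max 0 (0 + h))\<^sup>2 - (max 0 0)\<^sup>2) / h) \<longlongrightarrow> 0) (at (0::real))"
  proof (rule Lim_null_comparison)
    show "\<forall>\<^sub>F x in at 0. norm (((max 0 (0 + x))\<^sup>2 - (max 0 0)\<^sup>2) / x) \<le> \<bar>x::real\<bar>"
      by (intro always_eventually allI) (auto simp: max_def power2_eq_square)
    show "((\<lambda>x::real. \<bar>x\<bar>) \<longlongrightarrow> 0) (at 0)" by (rule tendsto_rabs_zero) (rule tendsto_ident_at)
  qed
  then show ?thesis using equal by (simp add: DERIV_def)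
next
  case greater
  have "((\<lambda>u::real. u\<^sup>2) has_real_derivative 2 * max 0 u) (at u)"
    using greater by (auto intro!: derivative_eq_intros)
  then show ?thesis
    by (rule has_field_derivative_transform_within_open[of _ _ _ "{0<..}"]) (use greater in auto)
qed


text \<open>Multiply the differential inequality by the cut-off
  \<open>k = max 0 (H - h) / (2 H)\<close> and integrate over a period: \<open>k h'\<close> is an
  exact derivative and contributes 0. By \<open>low\<close>, \<open>k\<close> is supported in the
  slab where \<open>T\<close> is large, and its integral is at least \<open>b / 2\<close> since
  \<open>h\<close> has mean zero. The loss from \<open>z\<close> is bounded by Cauchy-Schwarz; where
  \<open>z > t0\<close>, only \<open>h' \<ge> - z^2 / 2\<close> is available, and this is paid for
  by \<open>e\<close>.\<close>

lemma ode_contra_aux: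
  fixes h h' T z e :: "real \<Rightarrow> real"
  assumes b: "b > 0" and H: "H > 0" and t0: "t0 > 0"
    and dh: "\<And>y. (h has_real_derivative h' y) (at y)" and ch': "continuous_on UNIV h'"
    and ph: "\<And>y. h (y + b) = h y" and mean: "integral {0..b} h = 0"
    and T: "\<And>y. 0 \<le> T y" "\<And>y. h' y \<ge> 2 * T y - 2 * z y * sqrt (T y)"
    and Tl: "\<And>y. \<bar>h y\<bar> \<le> H \<Longrightarrow> t0\<^sup>2 \<le> T y"
    and z: "continuous_on UNIV z" "\<And>y. 0 \<le> z y"
    and e: "continuous_on UNIV e" "\<And>y. 0 \<le> e y" "\<And>y. z y \<le> t0 \<or> (z y)\<^sup>2 / 2 \<le> e y"
    and I: "integral {0..b} e < 2 * H"
    and slab: "2 * t0 * sqrt (b/2) * (t0 * sqrt (b/2) - sqrt (integral {0..b} (\<lambda>y. (z y)\<^sup>2))) \<ge> 2 * H"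
    and low: "\<And>y. h y > - H"
  shows False
proof -
  have ch: "continuous_on UNIV h"
    by (intro continuous_at_imp_continuous_on ballI DERIV_isCont) (rule dh)
  define k where "k y = max 0 (H - h y) / (2 * H)" for y
  have ck: "continuous_on UNIV k" unfolding k_def by (intro continuous_intros ch) (use H in auto)
  have k01: "0 \<le> k y" "k y \<le> 1" for y using H low[of y] by (auto simp: k_def field_simps max_def)
  note cs = continuous_on_subset[OF _ subset_UNIV]
  have int: "f integrable_on {u..v}" if "continuous_on UNIV f" for f :: "real \<Rightarrow> real" and u v
    by (intro integrable_continuous_interval cs[OF that])
  have kh: "integral {0..b} (\<lambda>y. k y * h' y) = 0"
  proof -
    define P where "P y = - (max 0 (H - h y))\<^sup>2 / (4 * H)" for y
    have "(P has_real_derivative k y * h' y) (at y)" for y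
    proof -
      have "((\<lambda>y. H - h y) has_real_derivative - h' y) (at y)"
        by (auto intro!: derivative_eq_intros dh)
      from DERIV_chain2[OF deriv_pos_part_sq this]
      have "((\<lambda>y. - (max 0 (H - h y))\<^sup>2 / (4 * H)) has_real_derivative
         - (2 * max 0 (H - h y) * - h' y) / (4 * H)) (at y)"
        by (intro DERIV_cdivide DERIV_minus)
      then show ?thesis using H by (simp add: P_def[abs_def] k_def mult.commute)
    qed
    then have "integral {0..b} (\<lambda>y. k y * h' y) = P b - P 0" by (intro integral_deriv) (use b in auto)
    also have "P b = P 0" using ph[of 0] by (simp add: P_def)
    finally show ?thesis by simp
  qed
  have pt: "k y * (2 * t0 * (t0 - z y)) - e y \<le> k y * h' y" for y
  proof (cases "h y < H")
    case False
    then show ?thesis using e(2)[of y] by (simp add: k_def)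
  next
    case True
    then have Ty: "t0\<^sup>2 \<le> T y" using low[of y] by (intro Tl) auto
    then have st: "t0 \<le> sqrt (T y)" using t0 real_le_rsqrt by blast
    have sq: "(sqrt (T y))\<^sup>2 = T y" using T(1) by simp
    show ?thesis
    proof (cases "z y \<le> t0")
      case True
      have "2 * t0 * (t0 - z y) \<le> 2 * sqrt (T y) * (sqrt (T y) - z y)"
        using True st t0 z(2)[of y] T(1)[of y] by (intro mult_mono) auto
      also have "\<dots> = 2 * T y - 2 * z y * sqrt (T y)" using sq by (simp add: algebra_simps power2_eq_square)
      also have "\<dots> \<le> h' y" by (rule T)
      finally have "k y * (2 * t0 * (t0 - z y)) \<le> k y * h' y" using k01 by (intro mult_left_mono) auto
      then show ?thesis using e(2)[of y] by linarith
    next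
      case False
      then have ee: "(z y)\<^sup>2 / 2 \<le> e y" using e(3)[of y] by auto
      \<comment> \<open>The minimum of \<open>2 T - 2 z sqrt T\<close> over all \<open>T\<close> is
        \<open>- z^2 / 2\<close>.\<close>
      have "0 \<le> (2 * sqrt (T y) - z y)\<^sup>2" by simp
      then have "- ((z y)\<^sup>2 / 2) \<le> 2 * T y - 2 * z y * sqrt (T y)"
        using sq by (simp add: power2_diff power_mult_distrib algebra_simps)
      then have he: "- e y \<le> h' y" using T(2)[of y] ee by linarith
      have "- e y \<le> k y * h' y"
      proof (cases "h' y \<ge> 0")
        case True
        then show ?thesis using k01[of y] e(2)[of y] mult_nonneg_nonneg[of "k y" "h' y"] by linarith
      next
        case False
        then have "1 * h' y \<le> k y * h' y" using k01 by (intro mult_right_mono_neg) auto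
        then show ?thesis using he by simp
      qed
      moreover have "k y * (2 * t0 * (t0 - z y)) \<le> 0"
        using k01 t0 False by (intro mult_nonneg_nonpos) (auto simp: mult_le_0_iff)
      ultimately show ?thesis by linarith
    qed
  qed
  define kI E where "kI = integral {0..b} k" and "E = integral {0..b} (\<lambda>y. (z y)\<^sup>2)"
  have E0: "0 \<le> E" unfolding E_def by (intro integral_nonneg int continuous_intros z) auto
  have "integral {0..b} (\<lambda>y. k y * (2 * t0 * (t0 - z y)) - e y) \<le> integral {0..b} (\<lambda>y. k y * h' y)"
    by (intro integral_le int continuous_intros ck z e ch' pt)
  also have "\<dots> = 0" by (rule kh)
  also have "integral {0..b} (\<lambda>y. k y * (2 * t0 * (t0 - z y)) - e y) =
     2 * t0 * (t0 * kI - integral {0..b} (\<lambda>y. k y * z y)) - integral {0..b} e"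
  proof -
    have "(\<lambda>y. k y * (2 * t0 * (t0 - z y)) - e y) = (\<lambda>y. 2 * t0 * (t0 * k y - k y * z y) - e y)"
      by (auto simp: algebra_simps)
    moreover have "((\<lambda>y. 2 * t0 * (t0 * k y - k y * z y) - e y) has_integral
       2 * t0 * (t0 * kI - integral {0..b} (\<lambda>y. k y * z y)) - integral {0..b} e) {0..b}"
      unfolding kI_def
      by (intro has_integral_diff has_integral_mult_right integrable_integral int continuous_intros ck z e)
    ultimately show ?thesis by (simp add: integral_unique)
  qed
  finally have A: "2 * t0 * (t0 * kI - integral {0..b} (\<lambda>y. k y * z y)) \<le> integral {0..b} e" by simp
  have kI: "b / 2 \<le> kI"
  proof -
    have "((\<lambda>y. (H - h y) / (2 * H)) has_integral (H * b - 0) / (2 * H)) {0..b}"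
    proof (intro has_integral_divide has_integral_diff)
      show "((\<lambda>y. H) has_integral H * b) {0..b}" using has_integral_const_real[of H 0 b] b by (simp add: mult.commute)
      show "(h has_integral 0) {0..b}" using integrable_integral[OF int[OF ch, of 0 b]] mean by simp
    qed
    from integral_unique[OF this] have "integral {0..b} (\<lambda>y. (H - h y) / (2 * H)) = b / 2" using H by simp
    moreover have "integral {0..b} (\<lambda>y. (H - h y) / (2 * H)) \<le> kI"
      unfolding kI_def by (intro integral_le int continuous_intros ch ck) (use H in \<open>auto simp: k_def divide_right_mono\<close>)
    ultimately show ?thesis by simp
  qed
  have kz: "integral {0..b} (\<lambda>y. k y * z y) \<le> sqrt kI * sqrt E"
  proof -
    have "(integral {0..b} (\<lambda>y. k y * z y))\<^sup>2 \<le> integral {0..b} (\<lambda>y. (k y)\<^sup>2) * E"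
      unfolding E_def by (rule CS_integral[OF cs[OF ck] cs[OF z(1)]])
    also have "\<dots> \<le> kI * E"
    proof (rule mult_right_mono[OF _ E0])
      show "integral {0..b} (\<lambda>y. (k y)\<^sup>2) \<le> kI" unfolding kI_def
        by (intro integral_le int continuous_intros ck) (use k01 in \<open>auto simp: power2_eq_square mult_left_le\<close>)
    qed
    finally show ?thesis by (simp add: real_le_rsqrt flip: real_sqrt_mult)
  qed
  define r where "r = sqrt kI"
  define s where "s = sqrt (b / 2)"
  have rs: "s \<le> r" "0 < s" using kI b by (auto simp: r_def s_def)
  have kIr: "kI = r * r" using kI b by (simp add: r_def)
  \<comment> \<open>\<open>slab\<close> forces this factor to be positive; then
    \<open>r (t0 r - sqrt E)\<close> increases for \<open>r \<ge> s\<close>, and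
    \<open>kI = b / 2\<close> is the worst case.\<close>
  have "t0 * s - sqrt E > 0"
  proof (rule ccontr)
    assume "\<not> ?thesis"
    then have "2 * t0 * s * (t0 * s - sqrt E) \<le> 0" using t0 rs by (intro mult_nonneg_nonpos) auto
    then show False using slab H by (simp add: s_def E_def)
  qed
  then have "s * (t0 * s - sqrt E) \<le> r * (t0 * r - sqrt E)"
    using rs t0 by (intro mult_mono) (auto intro: order.strict_implies_order)
  then have "2 * t0 * (s * (t0 * s - sqrt E)) \<le> 2 * t0 * (r * (t0 * r - sqrt E))"
    using t0 by (intro mult_left_mono) auto
  also have "\<dots> \<le> 2 * t0 * (t0 * kI - integral {0..b} (\<lambda>y. k y * z y))"
    using kz t0 rs unfolding kIr r_def[symmetric] by (intro mult_left_mono) (auto simp: algebra_simps)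
  also have "\<dots> < 2 * H" using A I by simp
  finally show False using slab by (simp add: s_def E_def mult.assoc)
qed

text \<open>Either \<open>h\<close> reaches both \<open>H\<close> and \<open>- H\<close>, and its descent from one to the other exceeds the budget
  \<open>\<integral> e\<close>, or cutting \<open>h\<close> off at one of these levels contradicts the periodicity.\<close>

lemma ode_contra:
  fixes h h' T z e :: "real \<Rightarrow> real"
  assumes b: "b > 0" and H: "H > 0" and t0: "t0 > 0"
    and dh: "\<And>y. (h has_real_derivative h' y) (at y)" and ch': "continuous_on UNIV h'"
    and ph: "\<And>y. h (y + b) = h y" and mean: "integral {0..b} h = 0"
    and T: "\<And>y. 0 \<le> T y" "\<And>y. h' y \<ge> 2 * T y - 2 * z y * sqrt (T y)"
    and Tl: "\<And>y. \<bar>h y\<bar> \<le> H \<Longrightarrow> t0\<^sup>2 \<le> T y"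
    and z: "continuous_on UNIV z" "\<And>y. 0 \<le> z y" "\<And>y. z (y + b) = z y"
    and e: "continuous_on UNIV e" "\<And>y. 0 \<le> e y" "\<And>y. z y \<le> t0 \<or> (z y)\<^sup>2 / 2 \<le> e y" "\<And>y. e (y + b) = e y"
    and I: "integral {0..b} e < 2 * H"
    and slab: "2 * t0 * sqrt (b/2) * (t0 * sqrt (b/2) - sqrt (integral {0..b} (\<lambda>y. (z y)\<^sup>2))) \<ge> 2 * H"
  shows False
proof (cases "(\<exists>p. h p \<ge> H) \<and> (\<exists>r. h r \<le> - H)")
  case False
  then consider "\<And>y. h y > - H" | "\<And>y. h y < H" by (meson not_le)
  then show False
  proof cases
    case 1
    show False by (rule ode_contra_aux[OF b H t0 dh ch' ph mean T Tl z(1,2) e(1-3) I slab 1])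
  next
    case 2
    have refl: "integral {0..b} (\<lambda>y. f (- y)) = integral {0..b} f"
      if c: "continuous_on UNIV f" and p: "\<And>y. f (y + b) = f y" for f :: "real \<Rightarrow> real"
    proof -
      have "integral {0..b} (\<lambda>y. f (- y)) = integral {- b..0} f"
        using Henstock_Kurzweil_Integration.integral_reflect_real[of b 0 "\<lambda>y. f (- y)"] by simp
      also have "\<dots> = integral {0..b} f"
        using periodic_integral_any[OF c p b, of "- b"] by simp
      finally show ?thesis .
    qed
    have ch: "continuous_on UNIV h"
      by (intro continuous_at_imp_continuous_on ballI DERIV_isCont) (rule dh)
    have pm: "f (- (y + b)) = f (- y)" if "\<And>y. f (y + b) = f y" for f :: "real \<Rightarrow> real" and y
      using that[of "- y - b"] by simp
    have cm: "continuous_on UNIV (\<lambda>y. f (- y))" if "continuous_on UNIV f" for f :: "real \<Rightarrow> real"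
      by (rule continuous_on_compose2[OF that]) (auto intro: continuous_intros)
    \<comment> \<open>Reflecting \<open>y\<close> and changing the sign of \<open>h\<close>
      preserves the differential inequality and turns the upper bound for \<open>h\<close> into the
      lower bound that the cut-off argument requires.\<close>
    show False
    proof (rule ode_contra_aux[of b H t0 "\<lambda>y. - h (- y)" "\<lambda>y. h' (- y)" "\<lambda>y. T (- y)" "\<lambda>y. z (- y)" "\<lambda>y. e (- y)"])
      show "((\<lambda>y. - h (- y)) has_real_derivative h' (- y)) (at y)" for y
        using DERIV_minus[OF DERIV_chain2[OF dh[of "- y"] DERIV_minus[OF DERIV_ident]]] by simp
      show "integral {0..b} (\<lambda>y. - h (- y)) = 0" using refl[OF ch ph] mean by simp
      show "integral {0..b} (\<lambda>y. e (- y)) < 2 * H" using refl[OF e(1) e(4)] I by simp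
      have "integral {0..b} (\<lambda>y. (z (- y))\<^sup>2) = integral {0..b} (\<lambda>y. (z y)\<^sup>2)"
        by (rule refl) (auto intro!: continuous_intros z(1) simp: z(3))
      then show "2 * H \<le> 2 * t0 * sqrt (b/2) * (t0 * sqrt (b/2) - sqrt (integral {0..b} (\<lambda>y. (z (- y))\<^sup>2)))"
        using slab by simp
      show "\<bar>- h (- y)\<bar> \<le> H \<Longrightarrow> t0\<^sup>2 \<le> T (- y)" for y using Tl[of "- y"] by simp
      show "- h (- (y + b)) = - h (- y)" for y using pm[of h, OF ph] by simp
      show "- H < - h (- y)" for y using 2[of "- y"] by simp
    qed (fact b H t0 T z e slab cm[OF ch'] cm[OF z(1)] cm[OF e(1)])+
  qed
next
  case True
  then obtain p r0 where p: "h p \<ge> H" and r0: "h r0 \<le> - H" by auto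
  have ch: "continuous_on UNIV h"
    by (intro continuous_at_imp_continuous_on ballI DERIV_isCont) (rule dh)
  note cs = continuous_on_subset[OF _ subset_UNIV]
  have int: "f integrable_on {u..v}" if "continuous_on UNIV f" for f :: "real \<Rightarrow> real" and u v
    by (intro integrable_continuous_interval cs[OF that])
  \<comment> \<open>Some translate of the low point lies within one period after
    \<open>p\<close>.\<close>
  obtain r where r: "h r \<le> - H" "p \<le> r" "r \<le> p + b"
  proof -
    define n where "n = \<lceil>(p - r0) / b\<rceil>"
    have "(p - r0) / b \<le> of_int n" "of_int n - 1 < (p - r0) / b" unfolding n_def by linarith+
    then have "p - r0 \<le> of_int n * b" "(of_int n - 1) * b < p - r0"
      using b by (simp_all add: pos_divide_le_eq pos_less_divide_eq)
    moreover have "h (r0 + of_int n * b) = h r0" by (rule periodic_of_int) (rule ph)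
    ultimately show ?thesis using that[of "r0 + of_int n * b"] r0
      by (simp add: left_diff_distrib)
  qed
  \<comment> \<open>\<open>y2\<close> is the first point after \<open>p\<close> at which
    \<open>h\<close> has come down to \<open>- H\<close>, \<open>y1\<close> the last point before it
    with \<open>h \<ge> H\<close>; in between \<open>h\<close> stays in the slab.\<close>
  define y2 where "y2 = Inf {y \<in> {p..r}. h y \<le> - H}"
  have "closed ({p..r} \<inter> {y. h y \<le> - H})"
    by (intro closed_Int closed_atLeastAtMost closed_Collect_le continuous_intros ch)
  then have cl: "closed {y \<in> {p..r}. h y \<le> - H}" by (simp add: Int_def)
  have ne: "r \<in> {y \<in> {p..r}. h y \<le> - H}" using r by auto
  have bb: "bdd_below {y \<in> {p..r}. h y \<le> - H}" by (auto intro: bdd_belowI[of _ p])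
  have y2: "y2 \<in> {p..r}" "h y2 \<le> - H"
    using closed_contains_Inf[OF _ bb cl] ne by (auto simp: y2_def)
  have y2m: "h y > - H" if "p \<le> y" "y < y2" for y
  proof (rule ccontr)
    assume "\<not> ?thesis"
    then have "y2 \<le> y" unfolding y2_def using that y2 by (intro cInf_lower[OF _ bb]) auto
    then show False using that by simp
  qed
  define y1 where "y1 = Sup {y \<in> {p..y2}. h y \<ge> H}"
  have "closed ({p..y2} \<inter> {y. H \<le> h y})"
    by (intro closed_Int closed_atLeastAtMost closed_Collect_le continuous_intros ch)
  then have cl1: "closed {y \<in> {p..y2}. h y \<ge> H}" by (simp add: Int_def)
  have ne1: "p \<in> {y \<in> {p..y2}. h y \<ge> H}" using p y2 by auto
  have bb1: "bdd_above {y \<in> {p..y2}. h y \<ge> H}" by (auto intro: bdd_aboveI[of _ y2])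
  have y1: "y1 \<in> {p..y2}" "h y1 \<ge> H"
    using closed_contains_Sup[OF _ bb1 cl1] ne1 by (auto simp: y1_def)
  have y1m: "h y < H" if "y1 < y" "y \<le> y2" for y
  proof (rule ccontr)
    assume "\<not> ?thesis"
    then have "y \<le> y1" unfolding y1_def using that y1 by (intro cSup_upper[OF _ bb1]) auto
    then show False using that by simp
  qed
  have slabh: "\<bar>h y\<bar> \<le> H" if "y1 < y" "y < y2" for y
    using y1m[of y] y2m[of y] that y1 by auto
  have le: "- e y \<le> h' y" if "y1 < y" "y < y2" for y
  proof -
    have Ty: "t0\<^sup>2 \<le> T y" using slabh[OF that] by (rule Tl)
    then have st: "t0 \<le> sqrt (T y)" using t0 real_le_rsqrt by blast
    have sq: "(sqrt (T y))\<^sup>2 = T y" using T(1) by simp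
    show ?thesis
    proof (cases "z y \<le> t0")
      case True
      have "0 \<le> 2 * sqrt (T y) * (sqrt (T y) - z y)"
        using True st t0 T(1)[of y] by (intro mult_nonneg_nonneg) auto
      also have "\<dots> = 2 * T y - 2 * z y * sqrt (T y)" using sq by (simp add: algebra_simps power2_eq_square)
      also have "\<dots> \<le> h' y" by (rule T)
      finally show ?thesis using e(2)[of y] by linarith
    next
      case False
      then have ee: "(z y)\<^sup>2 / 2 \<le> e y" using e(3)[of y] by auto
      have "0 \<le> (2 * sqrt (T y) - z y)\<^sup>2" by simp
      then have "- ((z y)\<^sup>2 / 2) \<le> 2 * T y - 2 * z y * sqrt (T y)"
        using sq by (simp add: power2_diff power_mult_distrib algebra_simps)
      then show ?thesis using T(2)[of y] ee by linarith
    qed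
  qed
  have le': "- e y \<le> h' y" if "y1 \<le> y" "y \<le> y2" for y
  proof -
    have "y1 < y2" using y1 y2 H by (cases "y1 = y2") auto
    then have "y \<in> closure {y1<..<y2}" using that by (simp add: closure_greaterThanLessThan)
    moreover have "closed {y. - e y \<le> h' y}" by (intro closed_Collect_le continuous_intros e ch')
    then have "closure {y1<..<y2} \<subseteq> {y. - e y \<le> h' y}" using le by (intro closure_minimal) auto
    ultimately show ?thesis by auto
  qed
  have "- integral {y1..y2} e = integral {y1..y2} (\<lambda>y. - e y)" by simp
  also have "\<dots> \<le> integral {y1..y2} h'"
    by (intro integral_le int continuous_intros e ch') (use le' in auto)
  also have "\<dots> = h y2 - h y1" by (rule integral_deriv) (use y1 dh in auto)
  also have "\<dots> \<le> - 2 * H" using y1 y2 by simp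
  finally have "2 * H \<le> integral {y1..y2} e" by simp
  also have "\<dots> \<le> integral {p..p + b} e"
    by (rule integral_subset_le) (use y1 y2 r e int[OF e(1)] in auto)
  also have "\<dots> = integral {0..b} e" by (rule periodic_integral_any[OF e(1) e(4) b])
  finally show False using I by simp
qed

section \<open>Kernel spinors\<close>

text \<open>\<open>F s t = F c t + \<integral> Fx\<close> is differentiated in \<open>t\<close>
  under the integral sign; the result shows that \<open>Fy\<close> is differentiable in
  \<open>x\<close> although only \<open>Fx\<close> is assumed to be \<open>C1\<close>.\<close>

lemma mixed_partial:
  fixes F :: "real \<Rightarrow> real \<Rightarrow> 'a::euclidean_space"
  assumes F: "C1 F Fx Fy" and Fx: "C1 Fx Fxx Fxy"
  shows "((\<lambda>s. Fy s y) has_vector_derivative Fxy x y) (at x)"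
proof -
  define c where "c = x - 1"
  have eq: "F s t = F c t + integral {c..s} (\<lambda>u. Fx u t)" if "c \<le> s" for s t
  proof -
    have "((\<lambda>u. Fx u t) has_integral (F s t - F c t)) {c..s}"
      by (rule fundamental_theorem_of_calculus[OF that]) (rule C1_dx[OF F])
    then show ?thesis by (simp add: integral_unique)
  qed
  have eqy: "Fy s y = Fy c y + integral {c..s} (\<lambda>u. Fxy u y)" if "c \<le> s" for s
  proof -
    have "continuous_on (UNIV \<times> cbox c s) (\<lambda>p. Fxy (snd p) (fst p))"
      by (rule cont2D[OF cont2_C1(3)[OF Fx]]) (auto intro: continuous_intros)
    then have "((\<lambda>t. integral (cbox c s) (\<lambda>u. Fx u t)) has_vector_derivative
     integral (cbox c s) (\<lambda>u. Fxy u y)) (at y within UNIV)"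
    proof (intro leibniz_rule_vector_derivative)
      show "((\<lambda>t. Fx u t) has_vector_derivative Fxy u t) (at t within UNIV)" for t u by (rule C1_dy[OF Fx])
      show "(\<lambda>u. Fx u t) integrable_on cbox c s" for t
        using cont2_integrable[OF cont2_C1(2)[OF F]] by simp
    qed (simp_all add: split_beta)
    then have "((\<lambda>t. F c t + integral {c..s} (\<lambda>u. Fx u t)) has_vector_derivative
       Fy c y + integral {c..s} (\<lambda>u. Fxy u y)) (at y)"
      by (intro has_vector_derivative_add C1_dy[OF F]) simp
    then have "((\<lambda>t. F s t) has_vector_derivative Fy c y + integral {c..s} (\<lambda>u. Fxy u y)) (at y)"
      by (simp flip: eq[OF that])
    then show ?thesis using C1_dy[OF F] vector_derivative_unique_at by blast
  qed
  have "((\<lambda>s. integral {c..s} (\<lambda>u. Fxy u y)) has_vector_derivative Fxy x y) (at x within {c..x + 1})"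
    by (rule integral_has_vector_derivative) (auto simp: c_def intro!: cont2_line(1)[OF cont2_C1(3)[OF Fx]])
  then have "((\<lambda>s. Fy c y + integral {c..s} (\<lambda>u. Fxy u y)) has_vector_derivative 0 + Fxy x y) (at x within {c..x + 1})"
    by (intro has_vector_derivative_add has_vector_derivative_const)
  then have "((\<lambda>s. Fy c y + integral {c..s} (\<lambda>u. Fxy u y)) has_vector_derivative Fxy x y) (at x)"
    by (subst (asm) at_within_interior) (auto simp: c_def)
  then show ?thesis
  proof (rule has_vector_derivative_transform_within_open[of _ _ _ "{c<..}"])
    show "Fy c y + integral {c..s} (\<lambda>u. Fxy u y) = Fy s y" if "s \<in> {c<..}" for s
      using eqy[of s] that by simp
  qed (auto simp: c_def)
qed

lemma has_real_derivative_inner: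
  assumes "(f has_vector_derivative f') (at x within S)" "(g has_vector_derivative g') (at x within S)"
  shows "((\<lambda>x. inner (f x) (g x)) has_real_derivative inner (f x) g' + inner f' (g x)) (at x within S)"
proof -
  have "(\<lambda>h. inner (f x) (h *\<^sub>R g') + inner (h *\<^sub>R f') (g x)) = times (inner (f x) g' + inner f' (g x))"
    by (simp add: fun_eq_iff algebra_simps)
  then show ?thesis
    using has_derivative_inner[OF assms[unfolded has_vector_derivative_def]]
    unfolding has_field_derivative_def by simp
qed

lemma has_vector_derivative_translate:
  assumes "(f has_vector_derivative f') (at (x + c))"
  shows "((\<lambda>s. f (s + c)) has_vector_derivative f') (at x)"
proof -
  have "((\<lambda>s. s + c) has_vector_derivative 1) (at x)" by (auto intro!: derivative_eq_intros)
  from vector_diff_chain_at[OF this assms] show ?thesis by (simp add: o_def)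
qed

text \<open>The lattice is sheared by \<open>a\<close>, but a circle mean does not depend on where
  the circle starts, so it has period \<open>b\<close> in \<open>y\<close>.\<close>

lemma xint_shift_periodic:
  fixes F :: "real \<Rightarrow> real \<Rightarrow> 'a::euclidean_space"
  assumes c: "cont2 F" and p1: "\<And>x y. F (x + 1) y = F x y" and p2: "\<And>x y. F (x + a) (y + b) = F x y"
  shows "xint F (y + b) = xint F y"
proof -
  have "xint F (y + b) = integral {0..1} (\<lambda>x. F (x - a) y)"
    unfolding xint_def using p2[of "_ - a" y] by simp
  also have "\<dots> = integral {- a..- a + 1} (\<lambda>x. F x y)"
    using integral_translate[of 0 "- a" 1 "\<lambda>x. F x y"] by (simp add: add.commute)
  also have "\<dots> = integral {0..1} (\<lambda>x. F x y)"
    by (rule periodic_integral_any) (auto intro!: cont2_line(1)[OF c] p1)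
  finally show ?thesis by (simp add: xint_def)
qed

text \<open>By Rolle's theorem the derivative of a periodic function vanishes within one period
  after every point. A lower bound on the second derivative therefore bounds the first derivative
  from above, and with it the oscillation.\<close>

lemma periodic_osc_bound:
  fixes W h h' :: "real \<Rightarrow> real"
  assumes b: "0 < b" and dW: "\<And>y. (W has_real_derivative h y) (at y)"
    and dh: "\<And>y. (h has_real_derivative h' y) (at y)"
    and C: "\<And>y. - C \<le> h' y" "0 \<le> C" and p: "\<And>y. W (y + b) = W y"
  shows "W y1 - W y0 \<le> C * b\<^sup>2"
proof -
  define n where "n = \<lceil>(y0 - y1) / b\<rceil>"
  define z where "z = y1 + of_int n * b"
  have "(y0 - y1) / b \<le> of_int n" "of_int n - 1 < (y0 - y1) / b" unfolding n_def by linarith+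
  then have "y0 - y1 \<le> of_int n * b" "(of_int n - 1) * b < y0 - y1"
    using b by (simp_all add: pos_divide_le_eq pos_less_divide_eq)
  then have z: "y0 \<le> z" "z \<le> y0 + b" by (auto simp: z_def left_diff_distrib)
  have Wz: "W z = W y1" unfolding z_def by (rule periodic_of_int) (rule p)
  show ?thesis
  proof (cases "z = y0")
    case True then show ?thesis using Wz C(2) by simp
  next
    case False
    then have "y0 < z" using z by simp
    then obtain u where u: "y0 < u" "u < z" "W z - W y0 = (z - y0) * h u"
      using MVT2[of y0 z W h] dW by auto
    obtain v where v: "u < v" "v < u + b" "W (u + b) - W u = (u + b - u) * h v"
      using MVT2[of u "u + b" W h] dW b by auto
    have hv: "h v = 0" using v b p by simp
    obtain w where w: "h v - h u = (v - u) * h' w"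
      using MVT2[of u v h h'] dh v by auto
    have "(v - u) * (- C) \<le> (v - u) * h' w" using v C by (intro mult_left_mono) auto
    then have "h u \<le> (v - u) * C" using w hv by simp
    also have "\<dots> \<le> b * C" using v C by (intro mult_right_mono) auto
    finally have hu: "h u \<le> b * C" .
    have "(z - y0) * h u \<le> (z - y0) * (b * C)" using z hu by (intro mult_left_mono) auto
    also have "\<dots> \<le> b * (b * C)" using z b C by (intro mult_right_mono) auto
    finally show ?thesis using u Wz by (simp add: power2_eq_square mult.commute mult.left_commute)
  qed
qed

lemma ln_one_plus_concave:
  fixes s t :: real
  assumes "0 \<le> t" "t \<le> 1" "0 \<le> s"
  shows "t * ln (1 + s) \<le> ln (1 + t * s)"
  using concave_onD[OF ln_concave, of t 1 "1 + s"] assms by (simp add: algebra_simps)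

lemma periodic_attains_inf:
  fixes f :: "real \<Rightarrow> real"
  assumes c: "continuous_on UNIV f" and p: "\<And>y. f (y + b) = f y" and b: "0 < b"
  obtains y0 where "\<And>y. f y0 \<le> f y"
proof -
  obtain y0 where y0: "\<And>y. y \<in> {0..b} \<Longrightarrow> f y0 \<le> f y"
    using continuous_attains_inf[OF compact_Icc _ continuous_on_subset[OF c subset_UNIV], of 0 b] b by force
  have "f y0 \<le> f y" for y
  proof -
    define n where "n = \<lfloor>y / b\<rfloor>"
    have "of_int n \<le> y / b" "y / b < of_int n + 1" unfolding n_def by linarith+
    then have "of_int n * b \<le> y" "y < (of_int n + 1) * b"
      using b by (simp_all add: pos_le_divide_eq pos_divide_less_eq)
    then have "f y0 \<le> f (y + of_int (- n) * b)" by (intro y0) (auto simp: distrib_right)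
    also have "f (y + of_int (- n) * b) = f y" by (rule periodic_of_int) (rule p)
    finally show ?thesis .
  qed
  then show ?thesis using that by blast
qed

text \<open>The \<open>arccos\<close> is the angle between the normalised vectors
  \<open>(\<psi>, sqrt e)\<close> and \<open>(- \<psi>, sqrt e)\<close> when
  \<open>n = |\<psi>|^2\<close>. It tends to \<pi> as \<open>e\<close> tends to 0, uniformly in
  \<open>n \<ge> d\<close>.\<close>

lemma pos_norm_arccos:
  assumes "0 < d" "A < pi" "0 \<le> A"
  obtains e where "0 < e" "\<And>n. n \<ge> d \<Longrightarrow> A \<le> arccos ((e - n) / (e + n))"
proof -
  define q where "q = cos A"
  have q: "q > -1" "q \<le> 1" using assms cos_monotone_0_pi[of A pi] by (auto simp: q_def)
  define e where "e = d * (1 + q) / 2"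
  have e: "0 < e" using assms q by (simp add: e_def)
  have "A \<le> arccos ((e - n) / (e + n))" if n: "n \<ge> d" for n
  proof -
    have "e - n \<le> q * (e + n)"
    proof -
      have "e * (1 - q) \<le> e * 2" using q e by (intro mult_left_mono) auto
      also have "\<dots> = d * (1 + q)" by (simp add: e_def)
      also have "\<dots> \<le> n * (1 + q)" using n q by (intro mult_right_mono) auto
      finally show ?thesis by (simp add: algebra_simps)
    qed
    then have "(e - n) / (e + n) \<le> q" using e n assms by (simp add: pos_divide_le_eq)
    moreover have "-1 \<le> (e - n) / (e + n)" using e n assms by (simp add: pos_le_divide_eq)
    ultimately have "arccos q \<le> arccos ((e - n) / (e + n))" using q by (intro arccos_le_arccos) auto
    then show ?thesis using assms by (simp add: q_def arccos_cos)
  qed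
  then show ?thesis using e that by blast
qed

lemma K_periodic_integral:
  fixes f :: "real \<Rightarrow> 'a::euclidean_space"
  assumes "continuous_on UNIV f" "\<And>x. f (x + 1 / K) = f x" "1 \<le> K"
  shows "integral {s..s + 1 / real K} f = (1 / K) *\<^sub>R integral {0..1} f"
proof -
  have "integral {0..real K * (1 / K)} f = real K *\<^sub>R integral {0..1 / K} f"
    by (rule periodic_integral_multiple) (use assms in auto)
  moreover have "integral {s..s + 1 / K} f = integral {0..1 / K} f"
    by (rule periodic_integral_any) (use assms in auto)
  ultimately show ?thesis using assms(3) by simp
qed

text \<open>Solutions of \<open>D \<psi> = Z \<psi>\<close> that change sign under a shift by
  \<open>1 / K\<close>; they are to be excluded when the circle norms of \<open>Z\<close> are small.
  Second derivatives are required of \<open>\<psi>x\<close> only, the remaining mixed one comes from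
  \<open>mixed_partial\<close>.\<close>

locale spin_kernel =
  fixes K :: nat and a b :: real and \<psi> \<psi>x \<psi>y \<psi>xx \<psi>xy :: "real \<Rightarrow> real \<Rightarrow> spin"
    and Z :: "real \<Rightarrow> real \<Rightarrow> real"
  assumes K: "1 \<le> K" and b: "0 < b"
    and C: "C1 \<psi> \<psi>x \<psi>y" and Cx: "C1 \<psi>x \<psi>xx \<psi>xy"
    and anti: "\<psi> (x + 1 / K) y = - \<psi> x y" and per: "\<psi> (x + a) (y + b) = \<psi> x y"
    and cZ: "cont2 Z" and Z0: "0 \<le> Z x y" and Zper: "Z (x + a) (y + b) = Z x y" "Z (x + 1) y = Z x y"
    and eq: "e1 (\<psi>x x y) + e2 (\<psi>y x y) = Z x y *\<^sub>R \<psi> x y"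
begin

lemmas c\<psi> = cont2_C1[OF C, unfolded cont2_def] cont2_C1[OF Cx, unfolded cont2_def] cZ[unfolded cont2_def]
lemmas dx\<psi> = C1_dx[OF C] and dy\<psi> = C1_dy[OF C] and dy\<psi>x = C1_dy[OF Cx] and dx\<psi>y = mixed_partial[OF C Cx]
lemmas dJ = bounded_linear.has_vector_derivative[OF bl_JJ]
lemmas cJ = bounded_linear.continuous_on[OF bl_JJ] bounded_linear.continuous_on[OF bl_e1] bounded_linear.continuous_on[OF bl_e2]

text \<open>Applying \<open>e2\<close> solves the equation for \<open>\<psi>y\<close>. As
  \<open>\<psi>\<close> is orthogonal to \<open>e2 \<psi>\<close>, the potential drops out of the
  \<open>y\<close>-derivative of \<open>|\<psi>|^2\<close>.\<close>

lemma \<psi>y_eq: "\<psi>y x y = JJ (\<psi>x x y) - Z x y *\<^sub>R e2 (\<psi> x y)"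
proof -
  have "e2 (e1 (\<psi>x x y) + e2 (\<psi>y x y)) = Z x y *\<^sub>R e2 (\<psi> x y)" unfolding eq by (simp add: e_lin)
  then show ?thesis by (simp add: e_lin e_alg algebra_simps)
qed

lemma anti': "\<psi>x (x + 1 / K) y = - \<psi>x x y"
proof -
  have "((\<lambda>s. \<psi> (s + 1 / K) y) has_vector_derivative \<psi>x (x + 1 / K) y) (at x)"
    by (rule has_vector_derivative_translate[of "\<lambda>s. \<psi> s y"]) (rule dx\<psi>)
  moreover have "((\<lambda>s. - \<psi> s y) has_vector_derivative - \<psi>x x y) (at x)"
    by (intro has_vector_derivative_minus dx\<psi>)
  ultimately show ?thesis unfolding anti using vector_derivative_unique_at by blast
qed

text \<open>\<open>wx\<close> and \<open>wy\<close> are the partial derivatives of \<open>log m / 2\<close>. In the circle mean of \<open>wy\<close>, the variable of the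
  differential inequality, \<open>t2\<close> is the dominant term of the derivative.\<close>

definition "m e x y = (norm (\<psi> x y))\<^sup>2 + e"
definition "wx e x y = inner (\<psi> x y) (\<psi>x x y) / m e x y"
definition "wy e x y = inner (\<psi> x y) (JJ (\<psi>x x y)) / m e x y"
definition "kap x y = inner (\<psi>x x y) (e1 (\<psi> x y))"
definition "t2 e x y = (norm (\<psi>x x y))\<^sup>2 / m e x y - (wx e x y)\<^sup>2 - (wy e x y)\<^sup>2"
definition "dd e x y = 2 * t2 e x y + 2 * (Z x y * kap x y / m e x y)"
definition "zh y = sqrt (xint (\<lambda>x y. (Z x y)\<^sup>2) y)"

text \<open>\<open>\<psi>\<close> may have zeros, so every quotient is regularised by
  \<open>e > 0\<close>.\<close>

lemma m_pos: "0 < e \<Longrightarrow> 0 < m e x y" by (simp add: m_def add_nonneg_pos)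

lemma cm: "continuous_on S (\<lambda>p. m e (fst p) (snd p))"
  unfolding m_def by (rule continuous_on_subset[OF _ subset_UNIV]) (intro continuous_intros c\<psi>)

lemma cs:
  assumes "0 < e"
  shows "cont2 (m e)" "cont2 (wx e)" "cont2 (wy e)" "cont2 kap" "cont2 (t2 e)" "cont2 (dd e)"
proof -
  have n: "m e (fst p) (snd p) \<noteq> 0" for p using m_pos[OF assms] by (metis less_irrefl)
  show "cont2 (m e)" "cont2 (wx e)" "cont2 (wy e)" "cont2 kap" "cont2 (t2 e)" "cont2 (dd e)"
    using n unfolding cont2_def dd_def t2_def wx_def wy_def kap_def
    by (auto intro!: continuous_intros c\<psi> cm cJ)
qed

lemma dm: "((\<lambda>s. m e s y) has_real_derivative 2 * inner (\<psi> x y) (\<psi>x x y)) (at x)"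
  "((\<lambda>t. m e x t) has_real_derivative 2 * inner (\<psi> x y) (JJ (\<psi>x x y))) (at y)"
proof -
  have "((\<lambda>s. inner (\<psi> s y) (\<psi> s y) + e) has_real_derivative (inner (\<psi> x y) (\<psi>x x y) + inner (\<psi>x x y) (\<psi> x y)) + 0) (at x)"
    by (intro DERIV_add has_real_derivative_inner dx\<psi> DERIV_const)
  then show "((\<lambda>s. m e s y) has_real_derivative 2 * inner (\<psi> x y) (\<psi>x x y)) (at x)"
    by (simp add: m_def[abs_def] power2_norm_eq_inner inner_commute)
  have "((\<lambda>s. inner (\<psi> x s) (\<psi> x s) + e) has_real_derivative (inner (\<psi> x y) (\<psi>y x y) + inner (\<psi>y x y) (\<psi> x y)) + 0) (at y)"
    by (intro DERIV_add has_real_derivative_inner dy\<psi> DERIV_const)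
  then show "((\<lambda>t. m e x t) has_real_derivative 2 * inner (\<psi> x y) (JJ (\<psi>x x y))) (at y)"
    by (simp add: m_def[abs_def] power2_norm_eq_inner inner_commute \<psi>y_eq inner_diff_right e_self inner_diff_left)
qed

text \<open>\<open>wx m\<close>, \<open>- wy m\<close> and \<open>kap\<close> are the inner products
  of \<open>\<psi>x\<close> with \<open>\<psi>\<close>, \<open>JJ \<psi>\<close> and
  \<open>e1 \<psi>\<close>. By \<open>frame_ineq\<close>, removing the first two from
  \<open>|\<psi>x|^2 m\<close> leaves at least the square of the third.\<close>

lemma kap_le:
  assumes "0 < e"
  shows "\<bar>kap x y / m e x y\<bar> \<le> sqrt (t2 e x y)" "0 \<le> t2 e x y"
proof -
  define N where "N = (norm (\<psi>x x y))\<^sup>2"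
  have m: "0 < m e x y" using m_pos[OF assms] .
  have "(inner (\<psi>x x y) (\<psi> x y))\<^sup>2 + (inner (\<psi>x x y) (JJ (\<psi> x y)))\<^sup>2 + (kap x y)\<^sup>2 \<le> N * (norm (\<psi> x y))\<^sup>2"
    unfolding kap_def N_def by (rule frame_ineq)
  also have "\<dots> \<le> N * m e x y" using assms by (intro mult_left_mono) (auto simp: m_def N_def)
  also have "inner (\<psi>x x y) (\<psi> x y) = wx e x y * m e x y" using m by (simp add: wx_def inner_commute)
  also have "inner (\<psi>x x y) (JJ (\<psi> x y)) = - (wy e x y * m e x y)"
    using m e_inner(6)[of "\<psi>x x y" "\<psi> x y"] by (simp add: wy_def inner_commute)
  finally have "(kap x y)\<^sup>2 \<le> N * m e x y - (wx e x y)\<^sup>2 * (m e x y)\<^sup>2 - (wy e x y)\<^sup>2 * (m e x y)\<^sup>2"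
    by (simp add: power_mult_distrib)
  also have "\<dots> = t2 e x y * (m e x y)\<^sup>2" using m by (simp add: t2_def N_def field_simps power2_eq_square)
  finally have *: "(kap x y / m e x y)\<^sup>2 \<le> t2 e x y" using m by (simp add: power_divide pos_divide_le_eq)
  then show "0 \<le> t2 e x y" using zero_le_power2 order_trans by blast
  from * show "\<bar>kap x y / m e x y\<bar> \<le> sqrt (t2 e x y)" using real_sqrt_le_mono by fastforce
qed

text \<open>The term with \<open>\<psi>xy\<close> is removed by integrating the \<open>x\<close>-derivative of \<open>- wx = \<langle>\<psi>, JJ \<psi>y\<rangle> / m\<close>.\<close>

lemma hh_deriv:
  assumes e: "0 < e"
  shows "(xint (wy e) has_real_derivative xint (dd e) y) (at y)"
proof -
  have n: "m e x y \<noteq> 0" for x y using m_pos[OF e] by (metis less_irrefl)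
  have n': "m e (fst p) (snd p) \<noteq> 0" for p using n .
  define B where "B x y = inner (\<psi> x y) (JJ (\<psi>y x y)) / m e x y" for x y
  have B: "B x y = - wx e x y" for x y
    by (simp add: B_def \<psi>y_eq e_lin e_alg inner_diff_right e_self wx_def)
  define Bx where "Bx x y = (inner (\<psi> x y) (JJ (\<psi>xy x y)) + inner (\<psi>x x y) (JJ (\<psi>y x y))) / m e x y
     + 2 * (wx e x y)\<^sup>2" for x y
  define G where "G x y = (inner (\<psi> x y) (JJ (\<psi>xy x y)) + inner (\<psi>y x y) (JJ (\<psi>x x y))) / m e x y
     - 2 * (wy e x y)\<^sup>2" for x y
  have dB: "((\<lambda>s. B s y) has_vector_derivative Bx x y) (at x)" for x y
  proof -
    have "((\<lambda>s. B s y) has_real_derivative ((inner (\<psi> x y) (JJ (\<psi>xy x y)) + inner (\<psi>x x y) (JJ (\<psi>y x y))) * m e x y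
       - inner (\<psi> x y) (JJ (\<psi>y x y)) * (2 * inner (\<psi> x y) (\<psi>x x y))) / (m e x y * m e x y)) (at x)"
      unfolding B_def by (intro DERIV_divide has_real_derivative_inner dx\<psi> dJ dx\<psi>y dm n)
    also have "inner (\<psi> x y) (JJ (\<psi>y x y)) = - inner (\<psi> x y) (\<psi>x x y)"
      using B[of x y] n[of x y] unfolding B_def wx_def by (metis divide_cancel_right minus_divide_left)
    also have "((inner (\<psi> x y) (JJ (\<psi>xy x y)) + inner (\<psi>x x y) (JJ (\<psi>y x y))) * m e x y
       - - inner (\<psi> x y) (\<psi>x x y) * (2 * inner (\<psi> x y) (\<psi>x x y))) / (m e x y * m e x y) = Bx x y"
      using n[of x y] by (simp add: Bx_def wx_def field_simps power2_eq_square)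
    finally show ?thesis by (simp add: has_real_derivative_iff_has_vector_derivative)
  qed
  have cBx: "cont2 Bx" unfolding cont2_def Bx_def
    using n' cs[OF e, unfolded cont2_def] by (auto intro!: continuous_intros c\<psi> cm cJ)
  have cG: "cont2 G" unfolding cont2_def G_def
    using n' cs[OF e, unfolded cont2_def] by (auto intro!: continuous_intros c\<psi> cm cJ)
  \<comment> \<open>All quantities involved are quadratic in \<open>\<psi>\<close>, so the sign
    \<open>(-1)^K\<close> picked up along the full circle cancels.\<close>
  have p1: "\<psi> (x + 1) y = \<psi> x y \<or> \<psi> (x + 1) y = - \<psi> x y" "\<psi>x (x + 1) y = \<psi>x x y \<and> \<psi> (x + 1) y = \<psi> x y \<or> \<psi>x (x + 1) y = - \<psi>x x y \<and> \<psi> (x + 1) y = - \<psi> x y" for x y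
  proof -
    have "\<psi> (x + real n * (1 / K)) y = (-1) ^ n *\<^sub>R \<psi> x y \<and> \<psi>x (x + real n * (1 / K)) y = (-1) ^ n *\<^sub>R \<psi>x x y" for n
    proof (induction n)
      case (Suc n)
      have "x + real (Suc n) * (1 / K) = x + real n * (1 / K) + 1 / K" by (simp add: add_divide_distrib)
      then show ?case using Suc by (simp only: anti anti') simp
    qed simp
    from this[of K] show "\<psi> (x + 1) y = \<psi> x y \<or> \<psi> (x + 1) y = - \<psi> x y" "\<psi>x (x + 1) y = \<psi>x x y \<and> \<psi> (x + 1) y = \<psi> x y \<or> \<psi>x (x + 1) y = - \<psi>x x y \<and> \<psi> (x + 1) y = - \<psi> x y"
      using K by (cases "even K", auto)+
  qed
  have "wx e 1 y = wx e 0 y" for y using p1(2)[of 0 y] by (auto simp: wx_def m_def)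
  then have Bx0: "xint Bx y = 0" for y using xint_ftc[of B y Bx] dB B by simp
  have dwy: "((\<lambda>t. wy e x t) has_vector_derivative G x y) (at y)" for x y
  proof -
    have "((\<lambda>t. wy e x t) has_real_derivative ((inner (\<psi> x y) (JJ (\<psi>xy x y)) + inner (\<psi>y x y) (JJ (\<psi>x x y))) * m e x y
       - inner (\<psi> x y) (JJ (\<psi>x x y)) * (2 * inner (\<psi> x y) (JJ (\<psi>x x y)))) / (m e x y * m e x y)) (at y)"
      unfolding wy_def by (intro DERIV_divide has_real_derivative_inner dy\<psi> dJ dy\<psi>x dm n)
    also have "((inner (\<psi> x y) (JJ (\<psi>xy x y)) + inner (\<psi>y x y) (JJ (\<psi>x x y))) * m e x y
       - inner (\<psi> x y) (JJ (\<psi>x x y)) * (2 * inner (\<psi> x y) (JJ (\<psi>x x y)))) / (m e x y * m e x y) = G x y"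
      using n[of x y] by (simp add: G_def wy_def field_simps power2_eq_square)
    finally show ?thesis by (simp add: has_real_derivative_iff_has_vector_derivative)
  qed
  \<comment> \<open>The terms with \<open>\<psi>xy\<close> in \<open>G\<close> and \<open>Bx\<close>
    coincide, and skewness of \<open>JJ\<close> makes the two remaining products opposite, so that
    their difference is twice one of them.\<close>
  have GB: "G x y = dd e x y + Bx x y" for x y
  proof -
    have 1: "inner (\<psi>x x y) (JJ (\<psi>y x y)) = - inner (\<psi>y x y) (JJ (\<psi>x x y))"
      using e_inner(6)[of "\<psi>x x y" "\<psi>y x y"] by (simp add: inner_commute)
    have 3: "inner (e2 (\<psi> x y)) (JJ (\<psi>x x y)) = - kap x y"
      by (simp add: e_inner(5) e_alg kap_def) (metis e_inner(4) inner_commute add.inverse_inverse)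
    have "inner (\<psi>y x y) (JJ (\<psi>x x y)) = (norm (\<psi>x x y))\<^sup>2 + Z x y * kap x y"
      by (simp add: \<psi>y_eq inner_diff_left 3 e_inner(3) power2_norm_eq_inner)
    then show ?thesis unfolding G_def Bx_def 1 dd_def t2_def using n[of x y]
      by (simp add: add_divide_distrib diff_divide_distrib)
  qed
  have "(xint (wy e) has_vector_derivative xint G y) (at y)"
    by (rule xint_deriv[OF cs(3)[OF e] cG dwy])
  also have "xint G y = xint (dd e) y"
    using xint_add[OF cs(6)[OF e] cBx] Bx0 by (simp add: GB[abs_def])
  finally show ?thesis by (simp add: has_real_derivative_iff_has_vector_derivative)
qed

text \<open>Pointwise \<open>dd \<ge> 2 t2 - 2 Z sqrt t2\<close> by \<open>kap_le\<close>;
  Cauchy-Schwarz on the circle then replaces \<open>Z\<close> by its norm. This is the differential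
  inequality in the form that \<open>ode_contra\<close> takes.\<close>

lemma xint_wy_diff_le:
  assumes e: "0 < e"
  shows "2 * xint (t2 e) y - 2 * zh y * sqrt (xint (t2 e) y) \<le> xint (dd e) y"
proof -
  have cst: "cont2 (\<lambda>x y. sqrt (t2 e x y))"
    using cs(5)[OF e] unfolding cont2_def by (rule continuous_on_real_sqrt)
  have cZs: "cont2 (\<lambda>x y. Z x y * sqrt (t2 e x y))"
    using cZ cst unfolding cont2_def by (rule continuous_on_mult)
  have c2: "cont2 (\<lambda>x y. 2 * t2 e x y)"
    using cs(5)[OF e] unfolding cont2_def by (intro continuous_intros)
  have c4: "cont2 (\<lambda>x y. 2 * (Z x y * sqrt (t2 e x y)))"
    using cZs unfolding cont2_def by (rule continuous_on_mult_left)
  have c3: "cont2 (\<lambda>x y. 2 * t2 e x y - 2 * (Z x y * sqrt (t2 e x y)))"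
    using c2 c4 unfolding cont2_def by (rule continuous_on_diff)
  have "(xint (\<lambda>x y. Z x y * sqrt (t2 e x y)) y)\<^sup>2 \<le> xint (\<lambda>x y. (Z x y)\<^sup>2) y * xint (\<lambda>x y. (sqrt (t2 e x y))\<^sup>2) y"
    by (rule CS_xint[OF cZ cst])
  also have "(\<lambda>x y. (sqrt (t2 e x y))\<^sup>2) = t2 e" using kap_le(2)[OF e] by auto
  finally have "\<bar>xint (\<lambda>x y. Z x y * sqrt (t2 e x y)) y\<bar> \<le> sqrt (xint (\<lambda>x y. (Z x y)\<^sup>2) y * xint (t2 e) y)"
    by (rule real_le_rsqrt[of "\<bar>_\<bar>", simplified])
  then have le: "xint (\<lambda>x y. Z x y * sqrt (t2 e x y)) y \<le> zh y * sqrt (xint (t2 e) y)"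
    by (simp add: zh_def real_sqrt_mult)
  have "2 * xint (t2 e) y - 2 * (zh y * sqrt (xint (t2 e) y)) \<le> 2 * xint (t2 e) y - 2 * xint (\<lambda>x y. Z x y * sqrt (t2 e x y)) y"
    using le by simp
  also have "\<dots> = xint (\<lambda>x y. 2 * t2 e x y - 2 * (Z x y * sqrt (t2 e x y))) y"
    using xint_diff[OF c2 c4]
      xint_cmult[of "\<lambda>_. 2" "t2 e"] xint_cmult[of "\<lambda>_. 2" "\<lambda>x y. Z x y * sqrt (t2 e x y)"]
    by simp
  also have "\<dots> \<le> xint (dd e) y"
  proof (rule xint_mono[OF c3 cs(6)[OF e]])
    fix x
    have "- (kap x y / m e x y) \<le> sqrt (t2 e x y)" using kap_le(1)[OF e, of x y] by linarith
    from mult_left_mono[OF this Z0[of x y]]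
    show "2 * t2 e x y - 2 * (Z x y * sqrt (t2 e x y)) \<le> dd e x y" by (simp add: dd_def)
  qed
  finally show ?thesis by (simp add: mult.assoc)
qed

lemma wy_per: "wy e (x + 1 / K) y = wy e x y" "t2 e (x + 1 / K) y = t2 e x y"
  by (simp_all add: wy_def t2_def wx_def m_def anti anti' linear_neg[OF lin_JJ])

lemma K_periodic_xint:
  fixes f :: "real \<Rightarrow> real"
  assumes "continuous_on UNIV f" "\<And>x. f (x + 1 / K) = f x"
  shows "integral {s..s + 1 / K} f = integral {0..1} f / K"
  using K_periodic_integral[OF assms K] by simp

text \<open>The length of the curve \<open>(rot \<sigma> \<psi>, \<surd>e) / \<surd>m\<close> on the unit sphere, over one period \<open>1/K\<close>.
  The gauge \<open>\<sigma>\<close> removes the part of \<open>wy\<close> with mean zero.\<close>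

lemma arc_bound:
  assumes e: "0 < e"
  shows "(real K * arccos ((e - (norm (\<psi> x0 y))\<^sup>2) / (e + (norm (\<psi> x0 y))\<^sup>2)))\<^sup>2
    \<le> xint (t2 e) y + (xint (wy e) y)\<^sup>2"
proof -
  define x1 where "x1 = x0 + 1 / K"
  have x01: "x0 < x1" using K by (simp add: x1_def)
  define hh where "hh = xint (wy e) y"
  define \<sigma> where "\<sigma> x = integral {x0..x} (\<lambda>x. wy e x y - hh)" for x
  have cw: "continuous_on S (\<lambda>x. wy e x y - hh)" for S
    by (intro continuous_intros cont2_line(1) cs(3) e)
  have d\<sigma>: "(\<sigma> has_vector_derivative wy e x y - hh) (at x within {x0..x1})" if "x \<in> {x0..x1}" for x
    unfolding \<sigma>_def by (rule integral_has_vector_derivative[OF cw that])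
  have \<sigma>0: "\<sigma> x0 = 0" by (simp add: \<sigma>_def)
  have "\<sigma> x1 = integral {0..1} (\<lambda>x. wy e x y - hh) / K"
    unfolding \<sigma>_def x1_def by (rule K_periodic_xint) (auto intro: cw simp: wy_per)
  also have "integral {0..1} (\<lambda>x. wy e x y - hh) = 0"
    using integral_diff[OF cont2_integrable[OF cs(3)[OF e]] integrable_const_ivl[of hh]]
    by (simp add: hh_def xint_def)
  finally have \<sigma>1: "\<sigma> x1 = 0" by simp
  \<comment> \<open>\<open>\<psi>\<close> turned by the angle \<open>\<sigma>\<close> in the plane
    of \<open>\<psi>\<close> and \<open>JJ \<psi>\<close>. As \<open>\<sigma>\<close> vanishes at
    both ends, the end points are still \<open>\<psi>\<close> and \<open>- \<psi>\<close>.\<close>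
  define u where "u x = cos (\<sigma> x) *\<^sub>R \<psi> x y + sin (\<sigma> x) *\<^sub>R JJ (\<psi> x y)" for x
  define v where "v x = cos (\<sigma> x) *\<^sub>R \<psi>x x y + sin (\<sigma> x) *\<^sub>R JJ (\<psi>x x y)" for x
  define ux where "ux x = v x + (wy e x y - hh) *\<^sub>R JJ (u x)" for x
  define r where "r x = inverse (sqrt (m e x y))" for x
  define G where "G x = r x *\<^sub>R (u x, sqrt e)" for x
  define Gx where "Gx x = r x *\<^sub>R (ux x, 0) - (wx e x y) *\<^sub>R G x" for x
  have du: "(u has_vector_derivative ux x) (at x within {x0..x1})" if x: "x \<in> {x0..x1}" for x
  proof -
    have s: "(\<sigma> has_real_derivative wy e x y - hh) (at x within {x0..x1})"
      using d\<sigma>[OF x] by (simp add: has_real_derivative_iff_has_vector_derivative)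
    have c: "((\<lambda>x. cos (\<sigma> x)) has_real_derivative - sin (\<sigma> x) * (wy e x y - hh)) (at x within {x0..x1})"
      "((\<lambda>x. sin (\<sigma> x)) has_real_derivative cos (\<sigma> x) * (wy e x y - hh)) (at x within {x0..x1})"
      by (auto intro!: derivative_eq_intros s)
    have "(u has_vector_derivative (cos (\<sigma> x) *\<^sub>R \<psi>x x y + (- sin (\<sigma> x) * (wy e x y - hh)) *\<^sub>R \<psi> x y) +
       (sin (\<sigma> x) *\<^sub>R JJ (\<psi>x x y) + (cos (\<sigma> x) * (wy e x y - hh)) *\<^sub>R JJ (\<psi> x y))) (at x within {x0..x1})"
      unfolding u_def by (intro has_vector_derivative_add has_vector_derivative_scaleR c dx\<psi> dJ)
    then show ?thesis
      by (simp add: ux_def v_def u_def e_lin e_alg algebra_simps)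
  qed
  have m0: "0 < m e x y" for x using m_pos[OF e] .
  have rr: "r x * r x = 1 / m e x y" for x using m0[of x] by (simp add: r_def divide_inverse flip: inverse_mult_distrib)
  have dr: "(r has_real_derivative - wx e x y * r x) (at x within {x0..x1})" for x
  proof -
    have "((\<lambda>s. sqrt (m e s y)) has_real_derivative inverse (sqrt (m e x y)) / 2 * (2 * inner (\<psi> x y) (\<psi>x x y))) (at x)"
      by (rule DERIV_chain2[OF DERIV_real_sqrt[OF m0] dm(1)])
    from DERIV_inverse'[OF this]
    have "(r has_real_derivative - (r x * (r x / 2 * (2 * inner (\<psi> x y) (\<psi>x x y))) * r x)) (at x)"
      using m0[of x] unfolding r_def[abs_def] by simp
    moreover have "- (r x * (r x / 2 * (2 * inner (\<psi> x y) (\<psi>x x y))) * r x) = - (r x * r x * inner (\<psi> x y) (\<psi>x x y)) * r x"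
      by simp
    ultimately have "(r has_real_derivative - wx e x y * r x) (at x)"
      unfolding rr wx_def by simp
    then show ?thesis by (rule has_field_derivative_at_within)
  qed
  have rot: "cos t * (cos t * X) + sin t * (sin t * X) = X" for t X :: real
  proof -
    have "cos t * (cos t * X) + sin t * (sin t * X) = ((cos t)\<^sup>2 + (sin t)\<^sup>2) * X" by algebra
    then show ?thesis by simp
  qed
  have nu: "inner (u x) (u x) = (norm (\<psi> x y))\<^sup>2" for x
    unfolding power2_norm_eq_inner by (simp add: u_def inner_add_left inner_add_right e_inner(3) e_self rot)
  have nv: "inner (v x) (v x) = (norm (\<psi>x x y))\<^sup>2" for x
    unfolding power2_norm_eq_inner by (simp add: v_def inner_add_left inner_add_right e_inner(3) e_self rot)
  have uv: "inner (u x) (v x) = wx e x y * m e x y" for x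
  proof -
    have "inner (u x) (v x) = inner (\<psi> x y) (\<psi>x x y)"
      using e_inner(6)[of "\<psi> x y" "\<psi>x x y"] rot[of "\<sigma> x" "inner (\<psi> x y) (\<psi>x x y)"]
      by (simp add: u_def v_def inner_add_left inner_add_right e_inner(3) algebra_simps)
    then show ?thesis using m0[of x] by (simp add: wx_def)
  qed
  have Juv: "inner (JJ (u x)) (v x) = - wy e x y * m e x y" for x
  proof -
    have "inner (JJ (u x)) (v x) = - inner (\<psi> x y) (JJ (\<psi>x x y))"
      using e_inner(6)[of "\<psi> x y" "\<psi>x x y"] rot[of "\<sigma> x" "inner (\<psi> x y) (JJ (\<psi>x x y))"]
      by (simp add: u_def v_def e_lin e_alg inner_add_left inner_add_right e_inner(3) algebra_simps)
    then show ?thesis using m0[of x] by (simp add: wy_def)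
  qed
  have GG: "inner (G x) (G x) = 1" for x
  proof -
    have "inner (G x) (G x) = r x * r x * m e x y"
      using e by (simp add: G_def nu m_def algebra_simps)
    then show ?thesis using rr[of x] m0[of x] by simp
  qed
  have uux: "inner (u x) (ux x) = wx e x y * m e x y" for x
    by (simp add: ux_def inner_add_right uv e_self)
  have Gux: "inner (G x) (r x *\<^sub>R (ux x, 0)) = wx e x y" for x
  proof -
    have "inner (G x) (r x *\<^sub>R (ux x, 0)) = r x * r x * (wx e x y * m e x y)"
      by (simp add: G_def uux)
    then show ?thesis using rr[of x] m0[of x] by simp
  qed
  have orth: "inner (G x) (Gx x) = 0" for x
    unfolding Gx_def inner_diff_right Gux by (simp add: GG)
  \<comment> \<open>With \<open>s = wy - hh\<close> the rotation turns \<open>wy^2\<close> into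
    \<open>(wy - s)^2 = hh^2\<close>. This is the purpose of the gauge: the mean \<open>hh\<close>
    is under control, \<open>wy\<close> is not.\<close>
  have nux: "inner (ux x) (ux x) / m e x y - (wx e x y)\<^sup>2 \<le> t2 e x y + hh\<^sup>2" for x
  proof -
    define s where "s = wy e x y - hh"
    have "inner (ux x) (ux x) = (norm (\<psi>x x y))\<^sup>2 - 2 * s * (wy e x y * m e x y) + s\<^sup>2 * (norm (\<psi> x y))\<^sup>2"
      using Juv[of x] by (simp add: ux_def s_def[symmetric] inner_add_left inner_add_right nv nu e_inner(3) power2_eq_square inner_commute[of "v x"] algebra_simps)
    also have "\<dots> \<le> (norm (\<psi>x x y))\<^sup>2 - 2 * s * (wy e x y * m e x y) + s\<^sup>2 * m e x y"
      using e by (intro add_left_mono mult_left_mono) (auto simp: m_def)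
    finally have "inner (ux x) (ux x) / m e x y - (wx e x y)\<^sup>2 \<le> ((norm (\<psi>x x y))\<^sup>2 - 2 * s * (wy e x y * m e x y) + s\<^sup>2 * m e x y) / m e x y - (wx e x y)\<^sup>2"
      using m0[of x] by (intro diff_right_mono divide_right_mono) auto
    also have "\<dots> = (norm (\<psi>x x y))\<^sup>2 / m e x y - 2 * s * wy e x y + s\<^sup>2 - (wx e x y)\<^sup>2"
      using m0[of x] by (simp add: add_divide_distrib diff_divide_distrib)
    also have "\<dots> = t2 e x y + hh\<^sup>2" by (simp add: t2_def s_def power2_eq_square algebra_simps)
    finally show ?thesis by simp
  qed
  have nGx: "norm (Gx x) \<le> sqrt (t2 e x y + hh\<^sup>2)" for x
  proof -
    have "inner (Gx x) (Gx x) = inner (r x *\<^sub>R (ux x, 0::real)) (r x *\<^sub>R (ux x, 0)) - (wx e x y)\<^sup>2"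
    proof -
      define q where "q = r x *\<^sub>R (ux x, 0::real)"
      have "inner (G x) q = wx e x y" unfolding q_def by (rule Gux)
      moreover have "inner q (G x) = wx e x y" using calculation by (simp add: inner_commute)
      ultimately show ?thesis unfolding Gx_def q_def[symmetric]
        by (simp add: inner_diff_left inner_diff_right GG power2_eq_square)
    qed
    also have "inner (r x *\<^sub>R (ux x, 0::real)) (r x *\<^sub>R (ux x, 0)) = r x * r x * inner (ux x) (ux x)" by simp
    also have "\<dots> = inner (ux x) (ux x) / m e x y" unfolding rr by simp
    finally show ?thesis using nux[of x] by (simp add: norm_eq_sqrt_inner)
  qed
  define s where "s x = sqrt (t2 e x y + hh\<^sup>2)" for x
  have css: "continuous_on S s" for S unfolding s_def
    by (intro continuous_intros cont2_line(1) cs(5) e)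
  have "arccos (inner (G x0) (G x1)) \<le> integral {x0..x1} s"
  proof (rule arc_length_ge_angle[where G' = Gx])
    show "(G has_vector_derivative Gx x) (at x within {x0..x1})" if x: "x \<in> {x0..x1}" for x
    proof -
      have "(G has_vector_derivative r x *\<^sub>R (ux x, 0) + (- wx e x y * r x) *\<^sub>R (u x, sqrt e)) (at x within {x0..x1})"
        unfolding G_def
        by (intro has_vector_derivative_scaleR dr has_vector_derivative_Pair du x has_vector_derivative_const)
      then show ?thesis by (simp add: Gx_def G_def mult.assoc)
    qed
  qed (use x01 GG nGx orth css in \<open>auto simp: norm_eq_sqrt_inner s_def\<close>)
  also have "inner (G x0) (G x1) = (e - (norm (\<psi> x0 y))\<^sup>2) / (e + (norm (\<psi> x0 y))\<^sup>2)"
  proof -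
    have "u x0 = \<psi> x0 y" "u x1 = - \<psi> x0 y" using \<sigma>0 \<sigma>1 anti[of x0 y] by (simp_all add: u_def x1_def)
    moreover have "r x1 = r x0" by (simp add: r_def m_def x1_def anti)
    ultimately have "inner (G x0) (G x1) = (r x0 * r x0) * (e - (norm (\<psi> x0 y))\<^sup>2)"
      using e by (simp add: G_def power2_norm_eq_inner algebra_simps)
    then show ?thesis unfolding rr by (simp add: m_def add.commute)
  qed
  finally have A: "arccos ((e - (norm (\<psi> x0 y))\<^sup>2) / (e + (norm (\<psi> x0 y))\<^sup>2)) \<le> integral {x0..x1} s" (is "?A \<le> _") .
  have A0: "0 \<le> ?A"
  proof (rule arccos_lbound)
    define n where "n = (norm (\<psi> x0 y))\<^sup>2"
    have "0 \<le> n" by (simp add: n_def)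
    then show "- 1 \<le> (e - n) / (e + n)" "(e - n) / (e + n) \<le> 1" using e by (simp_all add: field_simps)
  qed
  have "?A\<^sup>2 \<le> (integral {x0..x1} s)\<^sup>2" using A A0 by (intro power_mono)
  also have "\<dots> \<le> integral {x0..x1} (\<lambda>x. 1\<^sup>2) * integral {x0..x1} (\<lambda>x. (s x)\<^sup>2)"
    using CS_integral[of x0 x1 "\<lambda>x. 1" s] css by simp
  also have "integral {x0..x1} (\<lambda>x. (s x)\<^sup>2) = integral {0..1} (\<lambda>x. t2 e x y + hh\<^sup>2) / K"
  proof -
    have "(\<lambda>x. (s x)\<^sup>2) = (\<lambda>x. t2 e x y + hh\<^sup>2)" using kap_le(2)[OF e] by (simp add: s_def)
    moreover have "integral {x0..x1} (\<lambda>x. t2 e x y + hh\<^sup>2) = integral {0..1} (\<lambda>x. t2 e x y + hh\<^sup>2) / K"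
      unfolding x1_def by (rule K_periodic_xint)
        (simp_all add: wy_per continuous_on_add[OF cont2_line(1)[OF cs(5)[OF e]] continuous_on_const])
    ultimately show ?thesis by simp
  qed
  also have "integral {0..1} (\<lambda>x. t2 e x y + hh\<^sup>2) = xint (t2 e) y + hh\<^sup>2"
    using integral_add[OF cont2_integrable[OF cs(5)[OF e]] integrable_const_ivl[of "hh\<^sup>2"]]
    by (simp add: xint_def)
  also have "integral {x0..x1} (\<lambda>x. 1\<^sup>2) = 1 / K" using x01 by (simp add: x1_def)
  finally have "?A\<^sup>2 \<le> (xint (t2 e) y + hh\<^sup>2) / (real K)\<^sup>2" by (simp add: power2_eq_square)
  then show ?thesis using K by (simp add: hh_def power_mult_distrib pos_le_divide_eq mult.commute)
qed


definition "n2 x y = (norm (\<psi> x y))\<^sup>2"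

lemma psi_one: "\<psi> (x + 1) y = (-1) ^ K *\<^sub>R \<psi> x y \<and> \<psi>x (x + 1) y = (-1) ^ K *\<^sub>R \<psi>x x y"
proof -
  have "\<psi> (x + real n * (1 / K)) y = (-1) ^ n *\<^sub>R \<psi> x y \<and> \<psi>x (x + real n * (1 / K)) y = (-1) ^ n *\<^sub>R \<psi>x x y" for n
  proof (induction n)
    case (Suc n)
    have "x + real (Suc n) * (1 / K) = x + real n * (1 / K) + 1 / K" by (simp add: add_divide_distrib)
    then show ?case using Suc by (simp only: anti anti') simp
  qed simp
  from this[of K] show ?thesis using K by simp
qed

lemma n2: "cont2 n2" "n2 (x + 1) y = n2 x y" "n2 (x + a) (y + b) = n2 x y" "0 \<le> n2 x y"
  using psi_one[of x y] per unfolding cont2_def n2_def by (auto intro!: continuous_intros c\<psi>)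

lemma zh_cont: "continuous_on UNIV zh" and zh_nonneg: "0 \<le> zh y" and zh_per: "zh (y + b) = zh y"
proof -
  have c: "cont2 (\<lambda>x y. (Z x y)\<^sup>2)" using cZ unfolding cont2_def by (intro continuous_intros)
  have n: "0 \<le> xint (\<lambda>x y. (Z x y)\<^sup>2) y" for y by (rule xint_nonneg[OF c]) simp
  show "continuous_on UNIV zh" unfolding zh_def by (intro continuous_intros xint_cont c)
  show "0 \<le> zh y" using n by (simp add: zh_def)
  show "zh (y + b) = zh y" unfolding zh_def
    using xint_shift_periodic[OF c, of a b y] Zper by simp
qed

text \<open>Half the logarithm of \<open>m / e\<close>. The normalisation makes it nonnegative, and
  zero at the zeros of \<open>\<psi>\<close> for every \<open>e\<close>.\<close>

definition "lw e x y = ln (1 + n2 x y / e) / 2"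

lemma lw:
  assumes e: "0 < e"
  shows "(xint (lw e) has_real_derivative xint (wy e) y) (at y)" "xint (lw e) (y + b) = xint (lw e) y"
    "cont2 (lw e)"
proof -
  have p: "0 < 1 + n2 x y / e" for x y using e n2(4)[of x y] by (simp add: add_pos_nonneg)
  have p': "1 + n2 x y / e \<noteq> 0" for x y using p[of x y] by linarith
  show c: "cont2 (lw e)"
    using n2(1) e p unfolding cont2_def lw_def by (auto intro!: continuous_intros simp: p')
  show "xint (lw e) (y + b) = xint (lw e) y"
    by (rule xint_shift_periodic[OF c, of a b]) (simp_all add: lw_def n2)
  have eq: "1 + n2 x y / e = m e x y / e" for x y using e by (simp add: m_def n2_def field_simps)
  have "((\<lambda>t. lw e x t) has_vector_derivative wy e x y) (at y)" for x y
  proof -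
    have "((\<lambda>t. ln (m e x t / e)) has_real_derivative 1 / (m e x y / e) * (2 * inner (\<psi> x y) (JJ (\<psi>x x y)) / e)) (at y)"
      by (rule DERIV_chain2[OF DERIV_ln_divide DERIV_cdivide[OF dm(2)]]) (use m_pos[OF e] e in simp)
    from DERIV_cdivide[OF this, of 2] show ?thesis using e
      by (simp add: lw_def[abs_def] eq wy_def has_real_derivative_iff_has_vector_derivative)
  qed
  from xint_deriv[OF c cs(3)[OF e] this]
  show "(xint (lw e) has_real_derivative xint (wy e) y) (at y)"
    by (simp add: has_real_derivative_iff_has_vector_derivative)
qed

text \<open>A weak form of unique continuation. The circle mean of \<open>lw\<close> is periodic and
  its second derivative is at least \<open>- zh^2 / 2\<close>, so its oscillation is bounded
  independently of \<open>e\<close>. If \<open>\<psi>\<close> vanished on the circle at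
  \<open>y0\<close>, the mean would be 0 there, while at \<open>y1\<close> it grows without bound as
  \<open>e\<close> tends to 0.\<close>

lemma circle_nonzero:
  assumes y1: "0 < xint n2 y1"
  shows "0 < xint n2 y0"
proof (rule ccontr)
  assume "\<not> ?thesis"
  then have z: "xint n2 y0 = 0" using xint_nonneg[OF n2(1), of y0] n2(4) by force
  have n0: "n2 x y0 = 0" if "x \<in> {0..1}" for x
    using integral_eq_0_iff[OF cont2_line(1)[OF n2(1), of "{0..1}" y0]] z n2(4) that by (auto simp: xint_def)
  obtain yz where yz: "\<And>y. - (zh yz)\<^sup>2 \<le> - (zh y)\<^sup>2"
  proof (rule periodic_attains_inf[of "\<lambda>y. - (zh y)\<^sup>2" b])
    show "continuous_on UNIV (\<lambda>y. - (zh y)\<^sup>2)" by (intro continuous_intros zh_cont)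
  qed (use zh_per b in auto)
  define B where "B = (zh yz)\<^sup>2 / 2"
  have osc: "xint (lw e) y1 - xint (lw e) y0 \<le> B * b\<^sup>2" if e: "0 < e" for e
  proof (rule periodic_osc_bound[OF b lw(1)[OF e] hh_deriv[OF e]])
    fix y
    define T where "T = xint (t2 e) y"
    have T: "0 \<le> T" unfolding T_def by (rule xint_nonneg[OF cs(5)[OF e]]) (rule kap_le(2)[OF e])
    have "0 \<le> (2 * sqrt T - zh y)\<^sup>2" by simp
    then have "- ((zh y)\<^sup>2 / 2) \<le> 2 * T - 2 * zh y * sqrt T"
      using T by (simp add: power2_diff power_mult_distrib algebra_simps)
    also have "\<dots> \<le> xint (dd e) y" unfolding T_def by (rule xint_wy_diff_le[OF e])
    finally show "- B \<le> xint (dd e) y" using yz[of y] by (simp add: B_def)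
  qed (use lw(2)[OF e] in \<open>auto simp: B_def\<close>)
  obtain M where M: "\<And>x. x \<in> {0..1} \<Longrightarrow> n2 x y1 \<le> M" "0 < M"
  proof -
    obtain x0 where "\<And>x. x \<in> {0..1} \<Longrightarrow> n2 x y1 \<le> n2 x0 y1"
      using continuous_attains_sup[OF compact_Icc _ cont2_line(1)[OF n2(1), of "{0..1}" y1]] by force
    then show ?thesis using that[of "n2 x0 y1 + 1"] n2(4)[of x0 y1] by force
  qed
  define c where "c = B * b\<^sup>2 + 1"
  \<comment> \<open>Chosen so that \<open>ln (M / e) = 2 M c / xint n2 y1\<close>. By concavity
    \<open>lw\<close> is at least \<open>n2 / (2 M)\<close> times \<open>ln (1 + M / e)\<close>, and
    the mean at \<open>y1\<close> is then at least \<open>c\<close>.\<close>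
  define e where "e = M / exp (2 * M * c / xint n2 y1)"
  have e: "0 < e" using M by (simp add: e_def)
  have "xint (lw e) y0 = 0"
  proof -
    have "integral {0..1} (\<lambda>x. lw e x y0) = integral {0..1::real} (\<lambda>x. 0::real)"
      by (rule Henstock_Kurzweil_Integration.integral_cong) (simp add: lw_def n0)
    then show ?thesis by (simp add: xint_def)
  qed
  then have "xint (lw e) y1 \<le> c - 1" using osc[OF e] by (simp add: c_def)
  moreover have "c \<le> xint (lw e) y1"
  proof -
    have "2 * M * c / xint n2 y1 = ln (M / e)" using M by (simp add: e_def)
    also have "\<dots> \<le> ln (1 + M / e)" using M e by (intro ln_mono) (auto simp: add_pos_pos)
    finally have "c \<le> xint n2 y1 * (ln (1 + M / e) / (2 * M))" using M y1 by (simp add: field_simps)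
    also have "\<dots> = integral {0..1} (\<lambda>x. n2 x y1 * (ln (1 + M / e) / (2 * M)))"
      unfolding xint_def by simp
    also have "\<dots> \<le> integral {0..1} (\<lambda>x. lw e x y1)"
    proof (rule integral_le)
      show "(\<lambda>x. n2 x y1 * (ln (1 + M / e) / (2 * M))) integrable_on {0..1}"
        by (intro integrable_on_mult_left cont2_integrable n2)
      show "(\<lambda>x. lw e x y1) integrable_on {0..1}" by (intro cont2_integrable lw e)
      fix x :: real assume x: "x \<in> {0..1}"
      have "(n2 x y1 / M) * ln (1 + M / e) \<le> ln (1 + (n2 x y1 / M) * (M / e))"
        using M(1)[OF x] M(2) n2(4)[of x y1] e by (intro ln_one_plus_concave) auto
      then show "n2 x y1 * (ln (1 + M / e) / (2 * M)) \<le> lw e x y1"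
        using M by (simp add: lw_def field_simps)
    qed
    finally show ?thesis by (simp add: xint_def)
  qed
  ultimately show False by simp
qed

text \<open>\<open>2.42\<^sup>2 < \<pi>\<^sup>2 - 2\<^sup>2\<close> is the lower bound for the circle mean of \<open>t2\<close>, divided by \<open>K\<^sup>2\<close>, while the mean of
  \<open>wy\<close> is at most \<open>2 K\<close> in modulus.\<close>

theorem kernel_trivial:
  fixes E :: "real \<Rightarrow> real"
  defines "t0 \<equiv> 2.42 * real K"
  assumes nz: "\<psi> x1 y1 \<noteq> 0"
    and E: "continuous_on UNIV E" "\<And>y. 0 \<le> E y" "\<And>y. E (y + b) = E y"
      "\<And>y. zh y \<le> t0 \<or> (zh y)\<^sup>2 / 2 \<le> E y" "integral {0..b} E < 4 * real K"
    and slab: "2 * t0 * sqrt (b/2) * (t0 * sqrt (b/2) - sqrt (integral {0..b} (\<lambda>y. (zh y)\<^sup>2))) \<ge> 4 * real K"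
  shows False
proof -
  have K0: "0 < real K" using K by simp
  have "0 < xint n2 y1"
  proof (rule ccontr)
    assume "\<not> ?thesis"
    then have z: "xint n2 y1 = 0" using xint_nonneg[OF n2(1), of y1] n2(4) by force
    have n0: "n2 x y1 = 0" if "x \<in> {0..1}" for x
      using integral_eq_0_iff[OF cont2_line(1)[OF n2(1), of "{0..1}" y1]] z n2(4) that by (auto simp: xint_def)
    have "n2 (x1 + of_int (- \<lfloor>x1\<rfloor>) * 1) y1 = n2 x1 y1"
      by (rule periodic_of_int[of "\<lambda>x. n2 x y1"]) (rule n2(2))
    moreover have "n2 (x1 + of_int (- \<lfloor>x1\<rfloor>) * 1) y1 = 0" by (rule n0) (simp, linarith)
    ultimately show False using nz by (simp add: n2_def)
  qed
  note pos = circle_nonzero[OF this]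
  obtain ym where ym: "\<And>y. xint n2 ym \<le> xint n2 y"
    using periodic_attains_inf[OF xint_cont[OF n2(1)] _ b] xint_shift_periodic[OF n2(1), of a b] n2 by metis
  \<comment> \<open>Every circle contains a point with \<open>n2 \<ge> d\<close>, and
    \<open>arc_bound\<close> needs one starting point per circle; thus a single \<open>e\<close>
    serves all circles.\<close>
  define d where "d = xint n2 ym / 2"
  have d: "0 < d" using pos by (simp add: d_def)
  have ex: "\<exists>x. n2 x y \<ge> d" for y
  proof (rule ccontr)
    assume "\<not> ?thesis"
    then have "xint n2 y \<le> xint (\<lambda>_ _. d) y" by (intro xint_mono n2) (auto simp: cont2_def not_le less_imp_le)
    then show False using ym[of y] d by (simp add: d_def)
  qed
  \<comment> \<open>\<open>3.1395 < \<pi>\<close>, and \<open>3.1395^2 - 2^2\<close> exceeds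
    \<open>2.42^2\<close> by less than 0.0001.\<close>
  obtain e where e: "0 < e" "\<And>n. n \<ge> d \<Longrightarrow> 3.1395 \<le> arccos ((e - n) / (e + n))"
    using pos_norm_arccos[OF d, of "3.1395"] pi_approx(1) by auto
  have T0: "0 \<le> xint (t2 e) y" for y by (rule xint_nonneg[OF cs(5)[OF e(1)]]) (rule kap_le(2)[OF e(1)])
  show False
  proof (rule ode_contra[of b "2 * real K" t0 "xint (wy e)" "xint (dd e)" "xint (t2 e)" zh E])
    show "(xint (wy e) has_real_derivative xint (dd e) y) (at y)" for y by (rule hh_deriv[OF e(1)])
    show "continuous_on UNIV (xint (dd e))" by (rule xint_cont[OF cs(6)[OF e(1)]])
    show "xint (wy e) (y + b) = xint (wy e) y" for y
    proof -
      have "wy e (x + 1) y = wy e x y" for x y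
        using psi_one[of x y] by (simp add: wy_def m_def linear_scale[OF lin_JJ])
      moreover have "\<psi>x (x + a) (y + b) = \<psi>x x y" for x y
      proof -
        have "((\<lambda>s. \<psi> (s + a) (y + b)) has_vector_derivative \<psi>x (x + a) (y + b)) (at x)"
          by (rule has_vector_derivative_translate[of "\<lambda>s. \<psi> s (y + b)"]) (rule dx\<psi>)
        then show ?thesis unfolding per using dx\<psi> vector_derivative_unique_at by blast
      qed
      ultimately show ?thesis
        by (intro xint_shift_periodic[OF cs(3)[OF e(1)], of a b]) (simp_all add: wy_def m_def per)
    qed
    have "integral {0..b} (xint (wy e)) = xint (lw e) b - xint (lw e) 0"
      by (rule integral_deriv) (use b lw(1)[OF e(1)] in auto)
    then show "integral {0..b} (xint (wy e)) = 0" using lw(2)[OF e(1), of 0] by simp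
    show "2 * xint (t2 e) y - 2 * zh y * sqrt (xint (t2 e) y) \<le> xint (dd e) y" for y
      by (rule xint_wy_diff_le[OF e(1)])
    show "t0\<^sup>2 \<le> xint (t2 e) y" if h: "\<bar>xint (wy e) y\<bar> \<le> 2 * real K" for y
    proof -
      obtain x where x: "n2 x y \<ge> d" using ex by blast
      have "(real K * 3.1395)\<^sup>2 \<le> (real K * arccos ((e - n2 x y) / (e + n2 x y)))\<^sup>2"
        using e(2)[OF x] by (intro power_mono mult_left_mono) auto
      also have "\<dots> \<le> xint (t2 e) y + (xint (wy e) y)\<^sup>2" unfolding n2_def by (rule arc_bound[OF e(1)])
      also have "(xint (wy e) y)\<^sup>2 \<le> (2 * real K)\<^sup>2" using h by (metis abs_le_square_iff abs_of_nonneg of_nat_0_le_iff mult_nonneg_nonneg zero_le_numeral)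
      finally have "(real K)\<^sup>2 * (3.1395\<^sup>2 - 4) \<le> xint (t2 e) y" by (simp add: power2_eq_square algebra_simps)
      moreover have "(real K)\<^sup>2 * 2.42\<^sup>2 \<le> (real K)\<^sup>2 * (3.1395\<^sup>2 - 4)"
        by (intro mult_left_mono) (simp_all add: power2_eq_square)
      ultimately have "(real K)\<^sup>2 * 2.42\<^sup>2 \<le> xint (t2 e) y" by linarith
      then show ?thesis unfolding t0_def by (simp only: power_mult_distrib mult.commute)
    qed
  qed (use b K0 T0 zh_cont zh_nonneg zh_per E slab in \<open>auto simp: t0_def\<close>)
qed

end

section \<open>The top eigenvector of a compact form\<close>

text \<open>Complex scalars acting on spinors, which as pairs are only a real vector space.
  \<open>e1\<close> and \<open>e2\<close> commute with this action; the adjoint for the real inner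
  product is the action of the conjugate.\<close>

definition csc :: "complex \<Rightarrow> spin \<Rightarrow> spin" where "csc z p = (z * fst p, z * snd p)"

lemma csc_simps: "csc z (csc w p) = csc (z * w) p" "csc 1 p = p" "csc (of_real r) p = r *\<^sub>R p"
  "csc 0 p = 0" "csc z 0 = 0" "csc z (r *\<^sub>R p) = r *\<^sub>R csc z p"
  by (simp_all add: csc_def prod_eq_iff scaleR_conv_of_real)

lemma csc_lin: "csc (z + w) p = csc z p + csc w p" "csc z (p + q) = csc z p + csc z q"
  "csc z (p - q) = csc z p - csc z q" "csc z (- p) = - csc z p" "csc (- z) p = - csc z p" "csc (z - w) p = csc z p - csc w p"
  by (simp_all add: csc_def algebra_simps)

lemma csc_sum: "csc z (\<Sum>i\<in>I. f i) = (\<Sum>i\<in>I. csc z (f i))" "csc (\<Sum>i\<in>I. g i) p = (\<Sum>i\<in>I. csc (g i) p)"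
  by (induction I rule: infinite_finite_induct) (simp_all add: csc_simps csc_lin)

lemma norm_csc: "norm (csc z p) = norm z * norm p"
  by (simp add: csc_def norm_prod_def norm_mult power_mult_distrib real_sqrt_mult flip: distrib_left)

lemma inner_csc: "inner (csc z p) q = inner p (csc (cnj z) q)"
  by (simp add: csc_def inner_prod_def inner_complex_def algebra_simps)

lemma e_csc: "e1 (csc z p) = csc z (e1 p)" "e2 (csc z p) = csc z (e2 p)"
  by (simp_all add: e1_def e2_def csc_def)

lemma bounded_bilinear_csc: "bounded_bilinear csc"
  by (rule bounded_bilinear.intro) (simp_all add: csc_lin csc_simps norm_csc, simp add: csc_def prod_eq_iff, auto intro: exI[of _ 1])

section \<open>Square-summable families over the frequency lattice\<close>

definition ibox :: "nat \<Rightarrow> (int \<times> int) set" where "ibox n = {- int n..int n} \<times> {- int n..int n}"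

lemma finite_ibox [simp]: "finite (ibox n)" by (simp add: ibox_def)

lemma ibox_mono: "n \<le> m \<Longrightarrow> ibox n \<subseteq> ibox m" by (auto simp: ibox_def)

lemma finite_subset_ibox:
  assumes "finite F" obtains n where "F \<subseteq> ibox n"
  using assms
proof (induction F arbitrary: thesis)
  case (insert k F)
  then obtain n where "F \<subseteq> ibox n" by blast
  then have "insert k F \<subseteq> ibox (n + nat \<bar>fst k\<bar> + nat \<bar>snd k\<bar>)" by (force simp: ibox_def subset_iff)
  then show ?case using insert by blast
qed simp

text \<open>\<open>r\<close> is the squared radius. Bounding finite partial sums, instead of an
  infinite sum, presents the ball as an intersection of sets closed for pointwise
  convergence.\<close>

definition l2ball :: "real \<Rightarrow> (int \<times> int \<Rightarrow> spin) set" where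
  "l2ball r = {u. \<forall>F. finite F \<longrightarrow> (\<Sum>k\<in>F. (norm (u k))\<^sup>2) \<le> r}"

lemma l2ballD: "u \<in> l2ball r \<Longrightarrow> finite F \<Longrightarrow> (\<Sum>k\<in>F. (norm (u k))\<^sup>2) \<le> r"
  by (simp add: l2ball_def)

lemma l2ball_nonneg: "u \<in> l2ball r \<Longrightarrow> 0 \<le> r"
  using l2ballD[of u r "{}"] by simp

lemma compact_l2ball: "compact (l2ball r)"
proof (cases "0 \<le> r")
  case False
  then have "l2ball r = {}" using l2ball_nonneg by blast
  then show ?thesis by simp
next
  case True
  have "compactin (product_topology (\<lambda>_. euclidean) UNIV) (PiE (UNIV::(int\<times>int) set) (\<lambda>_. cball (0::spin) (sqrt r)))"
    unfolding compactin_PiE by simp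
  then have c: "compact (PiE (UNIV::(int\<times>int) set) (\<lambda>_. cball (0::spin) (sqrt r)))"
    by (simp add: euclidean_product_topology)
  have "closed (l2ball r)"
  proof -
    have "l2ball r = (\<Inter>F\<in>{F. finite F}. {u. (\<Sum>k\<in>F. (norm (u k))\<^sup>2) \<le> r})" by (auto simp: l2ball_def)
    also have "closed \<dots>"
      by (intro closed_INT ballI closed_Collect_le continuous_intros) auto
    finally show ?thesis .
  qed
  then have "compact (PiE UNIV (\<lambda>_. cball 0 (sqrt r)) \<inter> l2ball r)" by (rule compact_Int_closed[OF c])
  moreover have "PiE UNIV (\<lambda>_. cball 0 (sqrt r)) \<inter> l2ball r = l2ball r"
  proof -
    have "norm (u k) \<le> sqrt r" if "u \<in> l2ball r" for u k
      using l2ballD[OF that, of "{k}"] by (intro real_le_rsqrt) simp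
    then show ?thesis by (auto simp: PiE_def)
  qed
  ultimately show ?thesis by simp
qed

text \<open>\<open>G u\<close> is \<open>\<langle>A (q u), q u\<rangle>\<close> for the Fourier multiplier \<open>A\<close> and the trigonometric polynomial \<open>q\<close>. It is
  continuous for pointwise convergence on the \<open>\<ell>\<^sup>2\<close> ball, which is compact by Tychonoff.\<close>

locale ell2_op =
  fixes Q :: "(int \<times> int) set" and q :: "int \<times> int \<Rightarrow> complex"
    and A :: "int \<times> int \<Rightarrow> spin \<Rightarrow> spin" and \<delta> :: "nat \<Rightarrow> real"
  assumes finQ: "finite Q" and linA: "linear (A k)" and symA: "inner (A k s) t = inner s (A k t)"
    and bdA: "k \<notin> ibox n \<Longrightarrow> norm (A k s) \<le> \<delta> n * norm s" and \<delta>: "\<delta> \<longlonglongrightarrow> 0" "0 \<le> \<delta> n"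
begin

definition "conv u k = (\<Sum>j\<in>Q. csc (q j) (u (k - j)))" for u :: "int \<times> int \<Rightarrow> spin"
definition "GN n u = (\<Sum>k\<in>ibox n. inner (A k (conv u k)) (conv u k))"
definition "CC = card Q * (\<Sum>j\<in>Q. (norm (q j))\<^sup>2)"
definition "G u = lim (\<lambda>n. GN n u)"

lemma conv_l2ball:
  assumes u: "u \<in> l2ball r"
  shows "conv u \<in> l2ball (CC * r)"
  unfolding l2ball_def
proof safe
  fix F :: "(int \<times> int) set" assume F: "finite F"
  have "(norm (conv u k))\<^sup>2 \<le> card Q * (\<Sum>j\<in>Q. (norm (q j))\<^sup>2 * (norm (u (k - j)))\<^sup>2)" for k
  proof -
    have "norm (conv u k) \<le> (\<Sum>j\<in>Q. norm (q j) * norm (u (k - j)))"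
      unfolding conv_def by (rule order_trans[OF norm_sum]) (simp add: norm_csc)
    then have "(norm (conv u k))\<^sup>2 \<le> (\<Sum>j\<in>Q. norm (q j) * norm (u (k - j)))\<^sup>2" by (intro power_mono) auto
    also have "\<dots> \<le> card Q * (\<Sum>j\<in>Q. (norm (q j) * norm (u (k - j)))\<^sup>2)"
      by (rule sum_squared_le_sum_of_squares[of _ Q, simplified mult.commute])
    finally show ?thesis by (simp add: power_mult_distrib)
  qed
  then have "(\<Sum>k\<in>F. (norm (conv u k))\<^sup>2) \<le> (\<Sum>k\<in>F. card Q * (\<Sum>j\<in>Q. (norm (q j))\<^sup>2 * (norm (u (k - j)))\<^sup>2))"
    by (intro sum_mono)
  also have "\<dots> = card Q * (\<Sum>j\<in>Q. (norm (q j))\<^sup>2 * (\<Sum>k\<in>F. (norm (u (k - j)))\<^sup>2))"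
    by (subst sum_distrib_left[symmetric], subst sum.swap) (simp add: sum_distrib_left)
  also have "\<dots> \<le> card Q * (\<Sum>j\<in>Q. (norm (q j))\<^sup>2 * r)"
  proof (intro mult_left_mono sum_mono)
    fix j
    have "(\<Sum>k\<in>F. (norm (u (k - j)))\<^sup>2) = (\<Sum>k\<in>(\<lambda>k. k - j) ` F. (norm (u k))\<^sup>2)"
      by (subst sum.reindex) (auto simp: inj_on_def)
    also have "\<dots> \<le> r" using u F by (intro l2ballD) auto
    finally show "(\<Sum>k\<in>F. (norm (u (k - j)))\<^sup>2) \<le> r" .
  qed auto
  also have "\<dots> = CC * r" by (simp add: CC_def sum_distrib_right)
  finally show "(\<Sum>k\<in>F. (norm (conv u k))\<^sup>2) \<le> CC * r" .
qed

text \<open>The multiplier tends to 0 at infinity, so the tail is small uniformly on a ball, and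
  \<open>G\<close> is there a uniform limit of functions of finitely many coordinates.\<close>

lemma GN_diff:
  assumes u: "u \<in> l2ball r" and nm: "n \<le> m"
  shows "\<bar>GN m u - GN n u\<bar> \<le> \<delta> n * (CC * r)"
proof -
  have "GN m u - GN n u = (\<Sum>k\<in>ibox m - ibox n. inner (A k (conv u k)) (conv u k))"
    unfolding GN_def by (rule sum_diff[symmetric]) (auto simp: ibox_mono nm subset_iff dest: set_mp[OF ibox_mono[OF nm]])
  also have "\<bar>\<dots>\<bar> \<le> (\<Sum>k\<in>ibox m - ibox n. \<delta> n * (norm (conv u k))\<^sup>2)"
  proof (rule order_trans[OF sum_abs sum_mono])
    fix k assume "k \<in> ibox m - ibox n"
    then have "norm (A k (conv u k)) \<le> \<delta> n * norm (conv u k)" by (intro bdA) auto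
    then have "norm (A k (conv u k)) * norm (conv u k) \<le> \<delta> n * norm (conv u k) * norm (conv u k)"
      by (intro mult_right_mono) auto
    then show "\<bar>inner (A k (conv u k)) (conv u k)\<bar> \<le> \<delta> n * (norm (conv u k))\<^sup>2"
      using Cauchy_Schwarz_ineq2[of "A k (conv u k)" "conv u k"] by (simp add: power2_eq_square mult.assoc)
  qed
  also have "\<dots> = \<delta> n * (\<Sum>k\<in>ibox m - ibox n. (norm (conv u k))\<^sup>2)" by (simp add: sum_distrib_left)
  also have "\<dots> \<le> \<delta> n * (CC * r)"
    by (intro mult_left_mono l2ballD[OF conv_l2ball[OF u]] \<delta>) simp
  finally show ?thesis .
qed

lemma G_lim:
  assumes u: "u \<in> l2ball r"
  shows "(\<lambda>n. GN n u) \<longlonglongrightarrow> G u" "\<bar>G u - GN n u\<bar> \<le> \<delta> n * (CC * r)"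
proof -
  have "(\<lambda>n. \<delta> n * (CC * r)) \<longlonglongrightarrow> 0" by (rule tendsto_mult_left_zero[OF \<delta>(1)])
  have "Cauchy (\<lambda>n. GN n u)"
  proof (rule CauchyI')
    fix e :: real assume "0 < e"
    then obtain N where N: "\<And>n. n \<ge> N \<Longrightarrow> \<bar>\<delta> n * (CC * r)\<bar> < e"
      using LIMSEQ_D[OF \<open>(\<lambda>n. \<delta> n * (CC * r)) \<longlonglongrightarrow> 0\<close>] by auto
    have "dist (GN m u) (GN n u) < e" if "m \<ge> N" "n > m" for m n
      using GN_diff[OF u, of m n] N[of m] that by (simp add: dist_real_def abs_minus_commute)
    then show "\<exists>M. \<forall>m\<ge>M. \<forall>n>m. dist (GN m u) (GN n u) < e" by blast
  qed
  then show l: "(\<lambda>n. GN n u) \<longlonglongrightarrow> G u"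
    unfolding G_def by (simp add: Cauchy_convergent convergent_LIMSEQ_iff[symmetric])
  have "(\<lambda>m. \<bar>GN m u - GN n u\<bar>) \<longlonglongrightarrow> \<bar>G u - GN n u\<bar>" by (intro tendsto_intros l)
  then show "\<bar>G u - GN n u\<bar> \<le> \<delta> n * (CC * r)"
    by (rule LIMSEQ_le_const2) (use GN_diff[OF u] in auto)
qed

lemma G_cont: "continuous_on (l2ball r) G"
proof (rule uniform_limit_theorem[where F = sequentially])
  show "\<forall>\<^sub>F n in sequentially. continuous_on (l2ball r) (GN n)"
  proof (intro always_eventually allI)
    fix n
    have cc: "continuous_on S (\<lambda>u. conv u k)" for S k
      unfolding conv_def by (intro continuous_intros bounded_linear.continuous_on[OF bounded_bilinear.bounded_linear_right[OF bounded_bilinear_csc]])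
        (rule continuous_on_subset[OF continuous_on_product_coordinates subset_UNIV])
    show "continuous_on (l2ball r) (GN n)" unfolding GN_def
      by (intro continuous_intros cc bounded_linear.continuous_on[OF linear_conv_bounded_linear[THEN iffD1, OF linA]])
  qed
  show "uniform_limit (l2ball r) GN G sequentially"
    unfolding uniform_limit_iff
  proof safe
    fix e :: real assume "0 < e"
    have "(\<lambda>n. \<delta> n * (CC * r)) \<longlonglongrightarrow> 0" by (rule tendsto_mult_left_zero[OF \<delta>(1)])
    then have "\<forall>\<^sub>F n in sequentially. \<delta> n * (CC * r) < e" using \<open>0 < e\<close> by (rule order_tendstoD)
    then show "\<forall>\<^sub>F n in sequentially. \<forall>u\<in>l2ball r. dist (GN n u) (G u) < e"
    proof eventually_elim
      case (elim n)
      have "dist (GN n u) (G u) = \<bar>G u - GN n u\<bar>" for u by (simp add: dist_real_def abs_minus_commute)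
      then show ?case using le_less_trans[OF G_lim(2) elim] by simp
    qed
  qed
qed simp

lemma conv_scale: "conv (\<lambda>k. c *\<^sub>R u k) k = c *\<^sub>R conv u k"
  by (simp add: conv_def csc_simps scaleR_sum_right)

lemma G_scale:
  assumes u: "u \<in> l2ball r" and c: "c\<^sup>2 * r \<le> r'"
  shows "(\<lambda>k. c *\<^sub>R u k) \<in> l2ball r'" "G (\<lambda>k. c *\<^sub>R u k) = c\<^sup>2 * G u"
proof -
  have "(\<Sum>k\<in>F. (norm (c *\<^sub>R u k))\<^sup>2) \<le> r'" if "finite F" for F
  proof -
    have "(\<Sum>k\<in>F. (norm (c *\<^sub>R u k))\<^sup>2) = c\<^sup>2 * (\<Sum>k\<in>F. (norm (u k))\<^sup>2)"
      by (simp add: power_mult_distrib sum_distrib_left)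
    also have "\<dots> \<le> c\<^sup>2 * r" by (intro mult_left_mono l2ballD[OF u that]) simp
    finally show ?thesis using c by simp
  qed
  then show m: "(\<lambda>k. c *\<^sub>R u k) \<in> l2ball r'" by (simp add: l2ball_def)
  have "GN n (\<lambda>k. c *\<^sub>R u k) = c\<^sup>2 * GN n u" for n
    by (simp add: GN_def conv_scale linear_scale[OF linA] power2_eq_square sum_distrib_left mult.assoc)
  then have "(\<lambda>n. GN n (\<lambda>k. c *\<^sub>R u k)) \<longlonglongrightarrow> c\<^sup>2 * G u"
    using tendsto_mult_left[OF G_lim(1)[OF u]] by simp
  then show "G (\<lambda>k. c *\<^sub>R u k) = c\<^sup>2 * G u" using G_lim(1)[OF m] LIMSEQ_unique by blast
qed

text \<open>First variation of \<open>G\<close> in one coordinate. Only finitely many entries of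
  \<open>conv u\<close> change, so the dependence on \<open>t\<close> is exactly quadratic and
  \<open>G\<close> never has to be differentiated as a function on a sequence space.\<close>

lemma G_point_perturb:
  fixes k :: "int \<times> int" and s :: spin
  assumes u: "u \<in> l2ball 1"
  defines "w \<equiv> (\<lambda>t l. if l = k then u l + t *\<^sub>R s else u l)"
  shows "w t \<in> l2ball (1 + 2 * t * inner (u k) s + t\<^sup>2 * (norm s)\<^sup>2)"
    "\<exists>g. \<forall>t. G (w t) = G u + 2 * t * inner (\<Sum>j\<in>Q. csc (cnj (q j)) (A (k + j) (conv u (k + j)))) s + t\<^sup>2 * g"
proof -
  have nw: "(norm (w t k))\<^sup>2 = (norm (u k))\<^sup>2 + 2 * t * inner (u k) s + t\<^sup>2 * (norm s)\<^sup>2" for t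
    unfolding power2_norm_eq_inner w_def by (simp add: inner_add_left inner_add_right inner_commute power2_eq_square)
  show m: "w t \<in> l2ball (1 + 2 * t * inner (u k) s + t\<^sup>2 * (norm s)\<^sup>2)" for t
    unfolding l2ball_def
  proof safe
    fix F :: "(int \<times> int) set" assume F: "finite F"
    have "(\<Sum>l\<in>F. (norm (w t l))\<^sup>2) \<le> (\<Sum>l\<in>insert k F. (norm (w t l))\<^sup>2)" by (rule sum_mono2) (use F in auto)
    also have "\<dots> = (norm (w t k))\<^sup>2 + (\<Sum>l\<in>F - {k}. (norm (u l))\<^sup>2)"
      using F by (simp add: sum.insert_remove) (simp add: w_def)
    also have "\<dots> = 2 * t * inner (u k) s + t\<^sup>2 * (norm s)\<^sup>2 + (\<Sum>l\<in>insert k F. (norm (u l))\<^sup>2)"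
      using F by (simp add: nw sum.insert_remove)
    also have "\<dots> \<le> 2 * t * inner (u k) s + t\<^sup>2 * (norm s)\<^sup>2 + 1" using l2ballD[OF u, of "insert k F"] F by simp
    finally show "(\<Sum>l\<in>F. (norm (w t l))\<^sup>2) \<le> 1 + 2 * t * inner (u k) s + t\<^sup>2 * (norm s)\<^sup>2" by simp
  qed
  define p where "p l = (if l - k \<in> Q then csc (q (l - k)) s else 0)" for l
  have cw: "conv (w t) l = conv u l + t *\<^sub>R p l" for t l
  proof -
    have "conv (w t) l = (\<Sum>j\<in>Q. csc (q j) (u (l - j)) + (if j = l - k then t *\<^sub>R csc (q j) s else 0))"
      unfolding conv_def w_def by (intro sum.cong) (auto simp: csc_lin csc_simps)
    also have "\<dots> = conv u l + t *\<^sub>R p l"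
      using finQ by (simp add: sum.distrib conv_def p_def)
    finally show ?thesis .
  qed
  obtain N where N: "(\<lambda>j. k + j) ` Q \<subseteq> ibox N" using finite_subset_ibox finQ by (metis finite_imageI)
  define B where "B n = (\<Sum>l\<in>ibox n. inner (A l (conv u l)) (p l))" for n
  define g where "g n = (\<Sum>l\<in>ibox n. inner (A l (p l)) (p l))" for n
  have GNw: "GN n (w t) = GN n u + 2 * t * B n + t\<^sup>2 * g n" for n t
  proof -
    have "inner (A l (conv (w t) l)) (conv (w t) l) =
      inner (A l (conv u l)) (conv u l) + 2 * t * inner (A l (conv u l)) (p l) + t\<^sup>2 * inner (A l (p l)) (p l)" for l
      using symA[of l "p l" "conv u l"]
      by (simp add: cw linear_add[OF linA] linear_scale[OF linA] inner_add_left inner_add_right inner_commute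
         power2_eq_square algebra_simps)
    then show ?thesis by (simp add: GN_def B_def g_def sum.distrib sum_distrib_left)
  qed
  have supp: "(\<Sum>l\<in>ibox n. f l) = (\<Sum>j\<in>Q. f (k + j))" if "n \<ge> N" "\<And>l. l - k \<notin> Q \<Longrightarrow> f l = 0" for n and f :: "int \<times> int \<Rightarrow> real"
  proof -
    have "(\<Sum>l\<in>ibox n. f l) = (\<Sum>l\<in>(\<lambda>j. k + j) ` Q. f l)"
    proof (rule sum.mono_neutral_right)
      show "(\<lambda>j. k + j) ` Q \<subseteq> ibox n" using N ibox_mono[OF that(1)] by blast
      have "l \<in> (\<lambda>j. k + j) ` Q" if "l - k \<in> Q" for l by (rule image_eqI[OF _ that]) simp
      then show "\<forall>l\<in>ibox n - (\<lambda>j. k + j) ` Q. f l = 0" using that(2) by blast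
    qed simp
    also have "\<dots> = (\<Sum>j\<in>Q. f (k + j))" by (subst sum.reindex) (auto simp: inj_on_def)
    finally show ?thesis .
  qed
  have B: "B n = inner (\<Sum>j\<in>Q. csc (cnj (q j)) (A (k + j) (conv u (k + j)))) s" if "n \<ge> N" for n
  proof -
    have "B n = (\<Sum>j\<in>Q. inner (A (k + j) (conv u (k + j))) (p (k + j)))"
      unfolding B_def by (rule supp[OF that]) (simp add: p_def)
    also have "\<dots> = (\<Sum>j\<in>Q. inner (csc (cnj (q j)) (A (k + j) (conv u (k + j)))) s)"
      by (intro sum.cong) (simp_all add: p_def inner_csc)
    finally show ?thesis by (simp add: inner_sum_left)
  qed
  have s0: "inner (A l (p l)) (p l) = 0" if "l - k \<notin> Q" for l using that by (simp add: p_def)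
  have g: "g n = (\<Sum>j\<in>Q. inner (A (k + j) (p (k + j))) (p (k + j)))" if "n \<ge> N" for n
    unfolding g_def by (rule supp[OF that]) (rule s0)
  define g0 where "g0 = (\<Sum>j\<in>Q. inner (A (k + j) (p (k + j))) (p (k + j)))"
  have "G (w t) = G u + 2 * t * inner (\<Sum>j\<in>Q. csc (cnj (q j)) (A (k + j) (conv u (k + j)))) s + t\<^sup>2 * g0" (is "_ = ?R") for t
  proof -
    have "(\<lambda>n. GN n u + 2 * t * inner (\<Sum>j\<in>Q. csc (cnj (q j)) (A (k + j) (conv u (k + j)))) s + t\<^sup>2 * g0) \<longlonglongrightarrow> ?R"
      by (intro tendsto_intros G_lim[OF u])
    moreover have "\<forall>\<^sub>F n in sequentially. GN n u + 2 * t * inner (\<Sum>j\<in>Q. csc (cnj (q j)) (A (k + j) (conv u (k + j)))) s + t\<^sup>2 * g0 = GN n (w t)"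
      using eventually_ge_at_top[of N] by eventually_elim (simp add: GNw B g g0_def)
    ultimately have "(\<lambda>n. GN n (w t)) \<longlonglongrightarrow> ?R" by (rule Lim_transform_eventually)
    then show ?thesis using G_lim(1)[OF m] LIMSEQ_unique by blast
  qed
  then show "\<exists>g. \<forall>t. G (w t) = G u + 2 * t * inner (\<Sum>j\<in>Q. csc (cnj (q j)) (A (k + j) (conv u (k + j)))) s + t\<^sup>2 * g"
    by blast
qed

lemma linear_coeff_zero:
  fixes B g :: real
  assumes "\<And>t. 2 * t * B + t\<^sup>2 * g \<le> 0"
  shows "B = 0"
proof (rule ccontr)
  assume B: "B \<noteq> 0"
  define c where "c = \<bar>g\<bar> + 1"
  have c: "0 < c" "0 < 2 * c + g" by (auto simp: c_def)
  define t where "t = B / c"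
  have "2 * t * B + t\<^sup>2 * g = B\<^sup>2 / c\<^sup>2 * (2 * c + g)"
    using c(1) by (simp add: t_def field_simps power2_eq_square)
  moreover have "0 < B\<^sup>2 / c\<^sup>2 * (2 * c + g)" using B c by (intro mult_pos_pos) auto
  ultimately show False using assms[of t] by linarith
qed

text \<open>Compactness yields a maximiser \<open>u\<close> of \<open>G\<close> on the unit ball. By
  scaling, \<open>G w \<le> M r\<close> on the ball of squared radius \<open>r\<close>; this
  replaces a Lagrange multiplier rule when one coordinate of \<open>u\<close> is perturbed. The
  hypothesis \<open>big\<close> makes \<open>M\<close> larger than 1, so that division by
  \<open>M\<close> later lowers the potential.\<close>

theorem top_eigenvector:
  assumes fin: "finite {k. v k \<noteq> 0}" and big: "(\<Sum>k | v k \<noteq> 0. (norm (v k))\<^sup>2) < G v"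
  obtains M u where "1 < M" "u \<in> l2ball 1" "\<exists>k. u k \<noteq> 0"
    "\<And>k. M *\<^sub>R u k = (\<Sum>j\<in>Q. csc (cnj (q j)) (A (k + j) (conv u (k + j))))"
proof -
  have z: "(\<lambda>_. 0) \<in> l2ball r" if "0 \<le> r" for r using that by (simp add: l2ball_def)
  obtain u where u: "u \<in> l2ball 1" and mx: "\<And>w. w \<in> l2ball 1 \<Longrightarrow> G w \<le> G u"
    using continuous_attains_sup[OF compact_l2ball _ G_cont, of 1] z[of 1] by auto
  define M where "M = G u"
  define N where "N = (\<Sum>k | v k \<noteq> 0. (norm (v k))\<^sup>2)"
  have G0: "G (\<lambda>_. 0) = 0"
    using G_scale(2)[OF z[of 0], of 0 0] by simp
  have vN: "v \<in> l2ball N" unfolding l2ball_def N_def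
  proof safe
    fix F :: "(int \<times> int) set" assume F: "finite F"
    have "(\<Sum>k\<in>F. (norm (v k))\<^sup>2) = (\<Sum>k\<in>F \<inter> {k. v k \<noteq> 0}. (norm (v k))\<^sup>2)"
      by (rule sum.mono_neutral_right) (use F in auto)
    also have "\<dots> \<le> (\<Sum>k | v k \<noteq> 0. (norm (v k))\<^sup>2)" by (rule sum_mono2) (use fin in auto)
    finally show "(\<Sum>k\<in>F. (norm (v k))\<^sup>2) \<le> (\<Sum>k | v k \<noteq> 0. (norm (v k))\<^sup>2)" .
  qed
  have homog: "G w \<le> M * r" if w: "w \<in> l2ball r" for w r
  proof (cases "r = 0")
    case True
    have "w k = 0" for k using l2ballD[OF w, of "{k}"] True by simp
    then have "w = (\<lambda>_. 0)" by auto
    then show ?thesis using G0 True by simp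
  next
    case False
    then have r: "0 < r" using l2ball_nonneg[OF w] by simp
    have "(1 / sqrt r)\<^sup>2 * r \<le> 1" using r by (simp add: power_divide)
    from G_scale[OF w this] mx have "(1 / sqrt r)\<^sup>2 * G w \<le> M" unfolding M_def by metis
    then show ?thesis using r by (simp add: power_divide pos_divide_le_eq)
  qed
  have N0: "0 < N"
  proof (rule ccontr)
    assume "\<not> ?thesis"
    then have "N = 0" using l2ball_nonneg[OF vN] by simp
    then show False using homog[OF vN] big by (simp add: N_def)
  qed
  have M1: "1 < M"
  proof (rule ccontr)
    assume "\<not> ?thesis"
    then have "M * N \<le> 1 * N" using N0 by (intro mult_right_mono) auto
    then show False using homog[OF vN] big by (simp add: N_def)
  qed
  have eq: "M *\<^sub>R u k = (\<Sum>j\<in>Q. csc (cnj (q j)) (A (k + j) (conv u (k + j))))" (is "_ = ?T") for k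
  proof -
    \<comment> \<open>With the residual as direction of the perturbation, the linear coefficient
      becomes its squared norm.\<close>
    define s where "s = ?T - M *\<^sub>R u k"
    obtain g where g: "\<And>t. G (\<lambda>l. if l = k then u l + t *\<^sub>R s else u l) = G u + 2 * t * inner ?T s + t\<^sup>2 * g"
      using G_point_perturb(2)[OF u, of k s] by blast
    have "2 * t * inner s s + t\<^sup>2 * (g - M * (norm s)\<^sup>2) \<le> 0" for t
      using homog[OF G_point_perturb(1)[OF u, of k t s]] g[of t]
      by (simp add: M_def[symmetric] s_def inner_diff_left algebra_simps)
    then have "inner s s = 0" by (rule linear_coeff_zero)
    then show ?thesis by (simp add: s_def)
  qed
  have "\<exists>k. u k \<noteq> 0"
  proof (rule ccontr)
    assume "\<not> ?thesis"
    then have "u = (\<lambda>_. 0)" by auto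
    then show False using G0 M1 by (simp add: M_def)
  qed
  then show ?thesis using that M1 u eq by blast
qed

end

section \<open>Fourier modes\<close>

text \<open>For doubly periodic functions the rectangle of sides 1 and \<open>b\<close> gives the
  same integral as the fundamental parallelogram, see
  \<open>fundamental_domain_integral\<close>.\<close>

definition II :: "real \<Rightarrow> (real \<Rightarrow> real \<Rightarrow> real) \<Rightarrow> real" where
  "II b F = integral {0..b} (xint F)"

lemma II_add:
  assumes "cont2 F" "cont2 G"
  shows "II b (\<lambda>x y. F x y + G x y) = II b F + II b G"
proof -
  have "xint (\<lambda>x y. F x y + G x y) = (\<lambda>y. xint F y + xint G y)" by (rule ext) (rule xint_add[OF assms])
  then show ?thesis unfolding II_def
    by (simp add: integral_add integrable_continuous_interval xint_cont assms)
qed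

lemma II_diff:
  assumes "cont2 F" "cont2 G"
  shows "II b (\<lambda>x y. F x y - G x y) = II b F - II b G"
proof -
  have "xint (\<lambda>x y. F x y - G x y) = (\<lambda>y. xint F y - xint G y)" by (rule ext) (rule xint_diff[OF assms])
  then show ?thesis unfolding II_def
    by (simp add: integral_diff integrable_continuous_interval xint_cont assms)
qed

lemma II_cmult: "II b (\<lambda>x y. c * F x y) = c * II b F"
proof -
  have "xint (\<lambda>x y. c * F x y) = (\<lambda>y. c * xint F y)" by (rule ext) (simp add: xint_def)
  then show ?thesis unfolding II_def by simp
qed

lemma II_mono: "cont2 F \<Longrightarrow> cont2 G \<Longrightarrow> (\<And>x y. F x y \<le> G x y) \<Longrightarrow> II b F \<le> II b G"
  unfolding II_def by (intro integral_le integrable_continuous_interval xint_cont xint_mono)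

lemma II_nonneg: "cont2 F \<Longrightarrow> (\<And>x y. 0 \<le> F x y) \<Longrightarrow> 0 \<le> II b F"
  unfolding II_def by (intro integral_nonneg integrable_continuous_interval xint_cont xint_nonneg)

lemma II_const: "0 \<le> b \<Longrightarrow> II b (\<lambda>_ _. c) = b * c"
  by (simp add: II_def xint_def[abs_def])

lemma cont2_op:
  shows cont2_const: "cont2 (\<lambda>_ _. c)"
    and cont2_inner: "cont2 F \<Longrightarrow> cont2 G \<Longrightarrow> cont2 (\<lambda>x y. inner (F x y) (G x y :: 'a::real_inner))"
    and cont2_add: "cont2 H \<Longrightarrow> cont2 H' \<Longrightarrow> cont2 (\<lambda>x y. H x y + H' x y)"
    and cont2_diff: "cont2 H \<Longrightarrow> cont2 H' \<Longrightarrow> cont2 (\<lambda>x y. H x y - H' x y)"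
    and cont2_minus: "cont2 H \<Longrightarrow> cont2 (\<lambda>x y. - H x y)"
    and cont2_norm: "cont2 H \<Longrightarrow> cont2 (\<lambda>x y. norm (H x y))"
    and cont2_mult: "cont2 p \<Longrightarrow> cont2 q \<Longrightarrow> cont2 (\<lambda>x y. p x y * (q x y :: 'd::real_normed_algebra))"
    and cont2_power: "cont2 r \<Longrightarrow> cont2 (\<lambda>x y. (r x y :: 'e::real_normed_algebra_1) ^ n)"
    and cont2_divide: "cont2 u \<Longrightarrow> cont2 v \<Longrightarrow> (\<And>x y. v x y \<noteq> 0) \<Longrightarrow> cont2 (\<lambda>x y. u x y / (v x y :: 'f::real_normed_field))"
    and cont2_sqrt: "cont2 w \<Longrightarrow> cont2 (\<lambda>x y. sqrt (w x y))"
  unfolding cont2_def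
  by (auto intro!: continuous_intros)

lemma cont2_bl:
  assumes "cont2 H" "bounded_linear L"
  shows "cont2 (\<lambda>x y. L (H x y))"
  using assms(1) unfolding cont2_def by (rule bounded_linear.continuous_on[OF assms(2)])

lemmas cont2_e = cont2_bl[OF _ bl_e1] cont2_bl[OF _ bl_e2] cont2_bl[OF _ bl_JJ]

lemma cont2_bilinear:
  assumes "bounded_bilinear P" "cont2 f" "cont2 g"
  shows "cont2 (\<lambda>x y. P (f x y) (g x y))"
  using assms(2,3) unfolding cont2_def by (rule bounded_bilinear.continuous_on[OF assms(1)])

lemmas cont2_csc = cont2_bilinear[OF bounded_bilinear_csc]

lemma cont2_sum: "(\<And>i. i \<in> I \<Longrightarrow> cont2 (f i)) \<Longrightarrow> cont2 (\<lambda>x y. \<Sum>i\<in>I. f i x y :: 'a::real_normed_vector)"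
  unfolding cont2_def by (intro continuous_intros)

text \<open>Applied to products this is integration by parts on the sheared torus.\<close>

lemma II_deriv_zero:
  assumes C: "C1 F Fx Fy" and p1: "\<And>x y. F (x + 1) y = F x y" and p2: "\<And>x y. F (x + a) (y + b) = F x y" and b: "0 \<le> b"
  shows "II b Fx = 0" "II b Fy = 0"
proof -
  have "xint Fx y = 0" for y using xint_ftc[of F y Fx] C1_dx[OF C] p1[of 0 y] by simp
  then have "xint Fx = (\<lambda>_. 0)" by auto
  then show "II b Fx = 0" by (simp add: II_def)
  have "(xint F has_real_derivative xint Fy y) (at y)" for y
    using xint_deriv[OF cont2_C1(1,3)[OF C] C1_dy[OF C]] by (simp add: has_real_derivative_iff_has_vector_derivative)
  then have "II b Fy = xint F b - xint F 0" unfolding II_def by (intro integral_deriv b)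
  also have "xint F b = xint F 0" using xint_shift_periodic[OF cont2_C1(1)[OF C] p1 p2, of 0] by simp
  finally show "II b Fy = 0" by simp
qed

lemma C1_inner:
  assumes "C1 F Fx Fy" "C1 G Gx Gy"
  shows "C1 (\<lambda>x y. inner (F x y) (G x y)) (\<lambda>x y. inner (F x y) (Gx x y) + inner (Fx x y) (G x y))
    (\<lambda>x y. inner (F x y) (Gy x y) + inner (Fy x y) (G x y))"
  using assms unfolding C1_def
  by (auto intro!: cont2_inner cont2_add has_real_derivative_inner simp: has_real_derivative_iff_has_vector_derivative[symmetric])

lemma C1_linear:
  assumes "C1 F Fx Fy" "bounded_linear L"
  shows "C1 (\<lambda>x y. L (F x y)) (\<lambda>x y. L (Fx x y)) (\<lambda>x y. L (Fy x y))"
  using assms(1) unfolding C1_def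
  by (auto intro!: cont2_bl[OF _ assms(2)] bounded_linear.has_vector_derivative[OF assms(2)])

lemma C1_add:
  assumes "C1 F Fx Fy" "C1 G Gx Gy"
  shows "C1 (\<lambda>x y. F x y + G x y) (\<lambda>x y. Fx x y + Gx x y) (\<lambda>x y. Fy x y + Gy x y)"
  using assms unfolding C1_def by (auto intro!: cont2_add has_vector_derivative_add)

lemma C1_diff:
  assumes "C1 F Fx Fy" "C1 G Gx Gy"
  shows "C1 (\<lambda>x y. F x y - G x y) (\<lambda>x y. Fx x y - Gx x y) (\<lambda>x y. Fy x y - Gy x y)"
  using assms unfolding C1_def by (auto intro!: cont2_diff has_vector_derivative_diff)

lemma C1_zero: "C1 (\<lambda>_ _. 0) (\<lambda>_ _. 0) (\<lambda>_ _. 0)"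
  unfolding C1_def by (auto intro: cont2_const)

lemma C1_sum:
  assumes "\<And>i. i \<in> I \<Longrightarrow> C1 (F i) (Fx i) (Fy i)"
  shows "C1 (\<lambda>x y. \<Sum>i\<in>I. F i x y) (\<lambda>x y. \<Sum>i\<in>I. Fx i x y) (\<lambda>x y. \<Sum>i\<in>I. Fy i x y)"
  using assms
  by (induction I rule: infinite_finite_induct) (simp_all add: C1_zero C1_add)

text \<open>The flat Dirac operator as a function of the two partial derivatives.\<close>

definition dir :: "(real \<Rightarrow> real \<Rightarrow> spin) \<Rightarrow> (real \<Rightarrow> real \<Rightarrow> spin) \<Rightarrow> real \<Rightarrow> real \<Rightarrow> spin" where
  "dir \<xi>x \<xi>y x y = e1 (\<xi>x x y) + e2 (\<xi>y x y)"

lemma cont2_dir: "cont2 \<xi>x \<Longrightarrow> cont2 \<xi>y \<Longrightarrow> cont2 (dir \<xi>x \<xi>y)"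
  unfolding dir_def by (intro cont2_add cont2_e)

text \<open>Both integration by parts and \<open>e1\<close>, \<open>e2\<close> contribute a sign.
  The factor \<open>\<sigma>\<close> covers spinors of period 1 as well as those that change sign,
  since only products are integrated.\<close>

lemma dir_symmetric:
  assumes C: "C1 \<xi> \<xi>x \<xi>y" and D: "C1 \<zeta> \<zeta>x \<zeta>y"
    and p: "\<And>x y. \<xi> (x + 1) y = \<sigma> *\<^sub>R \<xi> x y" "\<And>x y. \<zeta> (x + 1) y = \<sigma> *\<^sub>R \<zeta> x y" "\<sigma> * \<sigma> = 1"
    and q: "\<And>x y. \<xi> (x + a) (y + b) = \<xi> x y" "\<And>x y. \<zeta> (x + a) (y + b) = \<zeta> x y" and b: "0 \<le> b"
  shows "II b (\<lambda>x y. inner (dir \<xi>x \<xi>y x y) (\<zeta> x y)) = II b (\<lambda>x y. inner (\<xi> x y) (dir \<zeta>x \<zeta>y x y))"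
proof -
  note c = cont2_C1[OF C] cont2_C1[OF D]
  have p': "\<sigma> * (\<sigma> * r) = r" for r using p(3) by (metis mult.assoc mult_1)
  have E: "C1 (\<lambda>x y. inner (e1 (\<xi> x y)) (\<zeta> x y)) (\<lambda>x y. inner (e1 (\<xi> x y)) (\<zeta>x x y) + inner (e1 (\<xi>x x y)) (\<zeta> x y))
    (\<lambda>x y. inner (e1 (\<xi> x y)) (\<zeta>y x y) + inner (e1 (\<xi>y x y)) (\<zeta> x y))"
    by (rule C1_inner[OF C1_linear[OF C bl_e1] D])
  have E': "C1 (\<lambda>x y. inner (e2 (\<xi> x y)) (\<zeta> x y)) (\<lambda>x y. inner (e2 (\<xi> x y)) (\<zeta>x x y) + inner (e2 (\<xi>x x y)) (\<zeta> x y))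
    (\<lambda>x y. inner (e2 (\<xi> x y)) (\<zeta>y x y) + inner (e2 (\<xi>y x y)) (\<zeta> x y))"
    by (rule C1_inner[OF C1_linear[OF C bl_e2] D])
  have 1: "II b (\<lambda>x y. inner (e1 (\<xi> x y)) (\<zeta>x x y) + inner (e1 (\<xi>x x y)) (\<zeta> x y)) = 0"
    by (rule II_deriv_zero(1)[OF E, where a = a]) (simp_all add: p p' q b e_lin)
  have 2: "II b (\<lambda>x y. inner (e2 (\<xi> x y)) (\<zeta>y x y) + inner (e2 (\<xi>y x y)) (\<zeta> x y)) = 0"
    by (rule II_deriv_zero(2)[OF E', where a = a]) (simp_all add: p p' q b e_lin)
  have pt: "inner (dir \<xi>x \<xi>y x y) (\<zeta> x y) - inner (\<xi> x y) (dir \<zeta>x \<zeta>y x y) =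
     (inner (e1 (\<xi> x y)) (\<zeta>x x y) + inner (e1 (\<xi>x x y)) (\<zeta> x y)) + (inner (e2 (\<xi> x y)) (\<zeta>y x y) + inner (e2 (\<xi>y x y)) (\<zeta> x y))" for x y
    by (simp add: dir_def inner_add_left inner_add_right e_inner(4)[of "\<xi> x y"] e_inner(5)[of "\<xi> x y"])
  have "II b (\<lambda>x y. inner (dir \<xi>x \<xi>y x y) (\<zeta> x y)) - II b (\<lambda>x y. inner (\<xi> x y) (dir \<zeta>x \<zeta>y x y)) =
     II b (\<lambda>x y. inner (dir \<xi>x \<xi>y x y) (\<zeta> x y) - inner (\<xi> x y) (dir \<zeta>x \<zeta>y x y))"
    by (rule II_diff[symmetric]) (intro cont2_inner cont2_dir c)+
  also have "\<dots> = 0"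
    unfolding pt by (subst II_add) (auto intro!: cont2_inner cont2_add cont2_e c simp: 1 2)
  finally show ?thesis by simp
qed

section \<open>Characters of the lattice spanned by \<open>(1 / K, 0)\<close> and
  \<open>(a, b)\<close>\<close>

locale modes =
  fixes K :: nat and a b :: real
  assumes K: "1 \<le> K" and b: "0 < b"
begin

text \<open>Dual frequencies: translation by \<open>(1 / K, 0)\<close> and by \<open>(a, b)\<close>
  multiplies \<open>E \<mu> \<nu>\<close> by \<open>cis (2 \<pi> \<mu>)\<close> and
  \<open>cis (2 \<pi> \<nu>)\<close>. Half-integral \<open>\<mu>\<close> with integral
  \<open>\<nu>\<close> therefore belongs to the spinors that change sign.\<close>

definition "al \<mu> = 2 * pi * real K * \<mu>"
definition "be \<mu> \<nu> = (2 * pi * \<nu> - al \<mu> * a) / b"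
definition "E \<mu> \<nu> x y = cis (al \<mu> * x + be \<mu> \<nu> * y)"

lemma E_mult: "E \<mu> \<nu> x y * E \<mu>' \<nu>' x y = E (\<mu> + \<mu>') (\<nu> + \<nu>') x y"
  by (simp add: E_def cis_mult al_def be_def algebra_simps add_divide_distrib diff_divide_distrib)

lemma E_cnj: "cnj (E \<mu> \<nu> x y) = E (- \<mu>) (- \<nu>) x y"
proof -
  have "al (- \<mu>) * x + be (- \<mu>) (- \<nu>) * y = - (al \<mu> * x + be \<mu> \<nu> * y)"
    by (simp add: al_def be_def algebra_simps diff_divide_distrib)
  then show ?thesis by (simp add: E_def cis_cnj)
qed

lemma norm_E [simp]: "norm (E \<mu> \<nu> x y) = 1" by (simp add: E_def)
lemma E_00 [simp]: "E 0 0 x y = 1" by (simp add: E_def al_def be_def)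

lemma E_shift: "E \<mu> \<nu> (x + 1 / K) y = cis (2 * pi * \<mu>) * E \<mu> \<nu> x y"
  "E \<mu> \<nu> (x + a) (y + b) = cis (2 * pi * \<nu>) * E \<mu> \<nu> x y"
proof -
  have "al \<mu> * (x + 1 / K) + be \<mu> \<nu> * y = 2 * pi * \<mu> + (al \<mu> * x + be \<mu> \<nu> * y)"
    using K by (simp add: al_def field_simps)
  then show "E \<mu> \<nu> (x + 1 / K) y = cis (2 * pi * \<mu>) * E \<mu> \<nu> x y" by (simp only: E_def cis_mult)
  have "al \<mu> * (x + a) + be \<mu> \<nu> * (y + b) = 2 * pi * \<nu> + (al \<mu> * x + be \<mu> \<nu> * y)"
    using b by (simp add: be_def field_simps)
  then show "E \<mu> \<nu> (x + a) (y + b) = cis (2 * pi * \<nu>) * E \<mu> \<nu> x y" by (simp only: E_def cis_mult)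
qed

lemma E_cont: "cont2 (E \<mu> \<nu>)"
  unfolding cont2_def E_def by (intro continuous_intros)

lemma C1_E: "C1 (\<lambda>x y. csc (E \<mu> \<nu> x y) s) (\<lambda>x y. csc (E \<mu> \<nu> x y) (csc (\<i> * al \<mu>) s))
   (\<lambda>x y. csc (E \<mu> \<nu> x y) (csc (\<i> * be \<mu> \<nu>) s))"
proof -
  have 1: "((\<lambda>t. csc (cis (c * t + d)) s) has_vector_derivative csc (cis (c * t + d)) (csc (\<i> * c) s)) (at t)" for c d t
  proof -
    have "((\<lambda>t. cis (c * t + d)) has_derivative (\<lambda>h. (c * h) *\<^sub>R (\<i> * cis (c * t + d)))) (at t)"
      by (auto intro!: derivative_eq_intros)
    moreover have "(\<lambda>h. (c * h) *\<^sub>R (\<i> * cis (c * t + d))) = (\<lambda>h. h *\<^sub>R (cis (c * t + d) * (\<i> * c)))"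
      by (auto simp: scaleR_conv_of_real algebra_simps)
    ultimately have "((\<lambda>t. cis (c * t + d)) has_vector_derivative cis (c * t + d) * (\<i> * c)) (at t)"
      by (simp add: has_vector_derivative_def)
    from bounded_linear.has_vector_derivative[OF bounded_bilinear.bounded_linear_left[OF bounded_bilinear_csc] this]
    show ?thesis by (simp add: csc_simps)
  qed
  have "((\<lambda>t. csc (E \<mu> \<nu> t y) s) has_vector_derivative csc (E \<mu> \<nu> x y) (csc (\<i> * al \<mu>) s)) (at x)" for x y
    unfolding E_def by (rule 1)
  moreover have "((\<lambda>t. csc (E \<mu> \<nu> x t) s) has_vector_derivative csc (E \<mu> \<nu> x y) (csc (\<i> * be \<mu> \<nu>) s)) (at y)" for x y
    using 1[of "be \<mu> \<nu>" "al \<mu> * x" y] unfolding E_def by (simp add: add.commute)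
  ultimately show ?thesis unfolding C1_def by (auto intro!: cont2_csc E_cont cont2_const)
qed

definition "Em \<mu>0 k x y = E (\<mu>0 + of_int (fst k)) (of_int (snd k)) x y"

text \<open>A nontrivial character is the \<open>x\<close>- or the \<open>y\<close>-derivative of a
  periodic function.\<close>

lemma II_mode:
  "II b (\<lambda>x y. inner p (csc (Em 0 j x y) q)) = (if j = 0 then b * inner p q else 0)"
proof (cases "j = 0")
  case True
  then show ?thesis using b by (simp add: Em_def csc_simps II_const)
next
  case False
  define \<mu> \<nu> where "\<mu> = real_of_int (fst j)" and "\<nu> = real_of_int (snd j)"
  have i: "\<mu> \<in> \<int>" "\<nu> \<in> \<int>" by (simp_all add: \<mu>_def \<nu>_def)
  have p1: "csc (E \<mu> \<nu> (x + 1) y) s = csc (E \<mu> \<nu> x y) s" for x y s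
  proof -
    have "E \<mu> \<nu> (x + of_int (int K) * (1 / K)) y = E \<mu> \<nu> x y"
      by (rule periodic_of_int[of "\<lambda>x. E \<mu> \<nu> x y"]) (simp add: E_shift i)
    then show ?thesis using K by simp
  qed
  have p2: "csc (E \<mu> \<nu> (x + a) (y + b)) s = csc (E \<mu> \<nu> x y) s" for x y s by (simp add: E_shift i)
  show ?thesis
  proof (cases "\<mu> = 0")
    case False
    then have al: "al \<mu> \<noteq> 0" using K by (simp add: al_def)
    define s where "s = csc (1 / (\<i> * al \<mu>)) q"
    have "II b (\<lambda>x y. inner p (csc (E \<mu> \<nu> x y) (csc (\<i> * al \<mu>) s))) = 0"
      by (rule II_deriv_zero(1)[OF C1_linear[OF C1_E bounded_linear_inner_right], where a = a]) (simp_all add: p1 p2 b less_imp_le)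
    moreover have "csc (\<i> * al \<mu>) s = q" using al by (simp add: s_def csc_simps)
    ultimately show ?thesis using \<open>j \<noteq> 0\<close> by (simp add: Em_def \<mu>_def \<nu>_def)
  next
    case True
    then have "\<nu> \<noteq> 0" using \<open>j \<noteq> 0\<close> by (auto simp: \<mu>_def \<nu>_def prod_eq_iff)
    then have be: "be \<mu> \<nu> \<noteq> 0" using b True by (simp add: be_def al_def)
    define s where "s = csc (1 / (\<i> * be \<mu> \<nu>)) q"
    have "II b (\<lambda>x y. inner p (csc (E \<mu> \<nu> x y) (csc (\<i> * be \<mu> \<nu>) s))) = 0"
      by (rule II_deriv_zero(2)[OF C1_linear[OF C1_E bounded_linear_inner_right], where a = a]) (simp_all add: p1 p2 b less_imp_le)
    moreover have "csc (\<i> * be \<mu> \<nu>) s = q" using be by (simp add: s_def csc_simps)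
    ultimately show ?thesis using \<open>j \<noteq> 0\<close> by (simp add: Em_def \<mu>_def \<nu>_def)
  qed
qed

definition "tp S u x y = (\<Sum>k\<in>S. csc (Em (1/2) k x y) (u k))"

lemma Em_shift: "Em (1/2) k (x + 1 / K) y = - Em (1/2) k x y" "Em \<mu>0 k (x + a) (y + b) = Em \<mu>0 k x y"
proof -
  have "cis (2 * pi * (1/2 + real_of_int (fst k))) = cis pi * cis (2 * pi * real_of_int (fst k))"
    unfolding cis_mult by (simp add: distrib_left)
  then show "Em (1/2) k (x + 1 / K) y = - Em (1/2) k x y" unfolding Em_def E_shift by simp
qed (simp add: Em_def E_shift)

lemma tp_shift: "tp S u (x + 1 / K) y = - tp S u x y" "tp S u (x + a) (y + b) = tp S u x y"
  by (simp_all add: tp_def Em_shift csc_lin sum_negf)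

lemma tp_cont: "cont2 (tp S u)"
  unfolding tp_def Em_def by (intro cont2_sum cont2_csc E_cont cont2_const)

lemma II_sum: "(\<And>i. i \<in> I \<Longrightarrow> cont2 (f i)) \<Longrightarrow> II b (\<lambda>x y. \<Sum>i\<in>I. f i x y) = (\<Sum>i\<in>I. II b (f i))"
proof (induction I rule: infinite_finite_induct)
  case (insert i I)
  then show ?case by (simp add: II_add cont2_sum)
qed (simp_all add: II_const b less_imp_le)

lemma parseval:
  assumes S: "finite S"
  shows "II b (\<lambda>x y. inner (tp S u x y) (tp S v x y)) = b * (\<Sum>k\<in>S. inner (u k) (v k))"
proof -
  have eq: "inner (csc (Em (1/2) k x y) p) (csc (Em (1/2) l x y) q) = inner p (csc (Em 0 (l - k) x y) q)" for k l x y p q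
    by (simp add: inner_csc csc_simps Em_def E_cnj E_mult)
  have "II b (\<lambda>x y. inner (tp S u x y) (tp S v x y)) =
    (\<Sum>l\<in>S. \<Sum>k\<in>S. II b (\<lambda>x y. inner (u k) (csc (Em 0 (l - k) x y) (v l))))"
    unfolding tp_def inner_sum_left inner_sum_right eq
    by (subst II_sum; (subst II_sum)?) (auto intro!: cont2_sum cont2_inner cont2_const cont2_csc E_cont simp: Em_def)
  also have "\<dots> = (\<Sum>l\<in>S. \<Sum>k\<in>S. if l = k then b * inner (u k) (v k) else 0)"
    by (intro sum.cong refl) (simp add: II_mode)
  also have "\<dots> = b * (\<Sum>k\<in>S. inner (u k) (v k))"
    using S by (simp add: sum_distrib_left)
  finally show ?thesis .
qed

section \<open>Trigonometric polynomials and their density\<close>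

inductive trig :: "(real \<Rightarrow> real \<Rightarrow> complex) \<Rightarrow> bool" where
  mode: "trig (\<lambda>x y. c * Em 0 j x y)"
| add: "trig f \<Longrightarrow> trig g \<Longrightarrow> trig (\<lambda>x y. f x y + g x y)"

lemma trig_mult: "trig f \<Longrightarrow> trig g \<Longrightarrow> trig (\<lambda>x y. f x y * g x y)"
proof (induction f rule: trig.induct)
  case (mode c j)
  show ?case using mode
  proof (induction g rule: trig.induct)
    case (mode d l)
    have "(\<lambda>x y. c * Em 0 j x y * (d * Em 0 l x y)) = (\<lambda>x y. (c * d) * Em 0 (j + l) x y)"
      by (simp add: fun_eq_iff Em_def E_mult[symmetric])
    then show ?case using trig.mode by simp
  next
    case (add f g)
    then show ?case using trig.add[OF add.IH] by (simp add: distrib_left)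
  qed
next
  case (add f g)
  then show ?case using trig.add by (simp add: distrib_right)
qed

lemma trig_const: "trig (\<lambda>_ _. c)"
  using trig.mode[of c 0] by (simp add: Em_def)

lemma trig_repr:
  assumes "trig f"
  obtains Q q where "finite Q" "\<And>j. j \<notin> Q \<Longrightarrow> q j = 0" "\<And>x y. f x y = (\<Sum>j\<in>Q. q j * Em 0 j x y)"
  using assms
proof (induction f arbitrary: thesis rule: trig.induct)
  case (mode c j)
  show ?case by (rule mode[of "{j}" "\<lambda>i. if i = j then c else 0"]) auto
next
  case (add f g)
  obtain Q q where f: "finite Q" "\<And>j. j \<notin> Q \<Longrightarrow> q j = 0" "\<And>x y. f x y = (\<Sum>j\<in>Q. q j * Em 0 j x y)" using add.IH(1) by blast
  obtain R r where g: "finite R" "\<And>j. j \<notin> R \<Longrightarrow> r j = 0" "\<And>x y. g x y = (\<Sum>j\<in>R. r j * Em 0 j x y)" using add.IH(2) by blast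
  have "f x y = (\<Sum>j\<in>Q \<union> R. q j * Em 0 j x y)" for x y unfolding f
    by (rule sum.mono_neutral_left) (use f g in auto)
  moreover have "g x y = (\<Sum>j\<in>Q \<union> R. r j * Em 0 j x y)" for x y unfolding g
    by (rule sum.mono_neutral_left) (use f g in auto)
  ultimately show ?case
    by (intro add.prems[of "Q \<union> R" "\<lambda>j. q j + r j"]) (use f g in \<open>auto simp: sum.distrib distrib_right\<close>)
qed

text \<open>Connects the real polynomials of the Stone-Weierstrass theorem with sums of characters:
  real and imaginary part of a character are combinations of it and its inverse.\<close>

lemma trig_polynomial:
  assumes "real_polynomial_function p"
  shows "trig (\<lambda>x y. of_real (p (E 1 0 x y, E 0 1 x y)))"
  using assms
proof (induction p rule: real_polynomial_function.induct)
  case (linear f)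
  have L: "linear f" by (rule bounded_linear.linear[OF linear])
  have fc: "f (z, w) = Re z * f (1, 0) + Im z * f (\<i>, 0) + Re w * f (0, 1) + Im w * f (0, \<i>)" for z w
  proof -
    have "(z, w) = Re z *\<^sub>R (1, 0) + Im z *\<^sub>R (\<i>, 0) + Re w *\<^sub>R (0, 1) + Im w *\<^sub>R (0, \<i>)"
      by (simp add: complex_eq_iff)
    then have "f (z, w) = f (Re z *\<^sub>R (1, 0) + Im z *\<^sub>R (\<i>, 0) + Re w *\<^sub>R (0, 1) + Im w *\<^sub>R (0, \<i>))" by simp
    then show ?thesis by (simp only: linear_add[OF L] linear_scale[OF L] real_scaleR_def)
  qed
  have re: "complex_of_real (Re z) = (z + cnj z) / 2" "complex_of_real (Im z) = (z - cnj z) * (- \<i> / 2)" for z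
    by (simp_all add: complex_eq_iff)
  have eq: "complex_of_real (f (E 1 0 x y, E 0 1 x y)) =
     ((f (1, 0) - \<i> * f (\<i>, 0)) / 2 * Em 0 (1, 0) x y + (f (1, 0) + \<i> * f (\<i>, 0)) / 2 * Em 0 (- 1, 0) x y) +
     ((f (0, 1) - \<i> * f (0, \<i>)) / 2 * Em 0 (0, 1) x y + (f (0, 1) + \<i> * f (0, \<i>)) / 2 * Em 0 (0, - 1) x y)" for x y
    by (subst fc, simp only: of_real_add of_real_mult re E_cnj) (simp add: Em_def field_simps)
  show ?case unfolding eq by (intro trig.add trig.mode)
next
  case (const c)
  then show ?case by (rule trig_const)
next
  case (add f g)
  then show ?case using trig.add by simp
next
  case (mult f g)
  then show ?case using trig_mult by simp
qed


lemma trig_dense_real: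
  fixes F :: "real \<Rightarrow> real \<Rightarrow> real"
  assumes c: "cont2 F" and p1: "\<And>x y. F (x + 1 / K) y = F x y" and p2: "\<And>x y. F (x + a) (y + b) = F x y" and e: "0 < e"
  shows "\<exists>p. trig p \<and> (\<forall>x y. norm (of_real (F x y) - p x y) < e)"
proof -
  define f where "f t = (cis (fst t), cis (snd t))" for t :: "real \<times> real"
  \<comment> \<open>\<open>F\<close> in the angles of the two generating characters; double
    periodicity of \<open>F\<close> becomes period \<open>2 \<pi>\<close> in each angle.\<close>
  define H where "H t = F (fst t / (2 * pi * K) + snd t / (2 * pi) * a) (snd t / (2 * pi) * b)" for t
  have pp: "F (x + of_int n * a) (y + of_int n * b) = F x y" for x y n
    using periodic_of_int[of "\<lambda>t. F (x + t * a) (y + t * b)" 1 0 n] p2[of "x + _ * a" "y + _ * b"]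
    by (simp add: distrib_right add.assoc)
  have pK: "F (x + of_int n * (1 / K)) y = F x y" for x y n
    by (rule periodic_of_int[of "\<lambda>x. F x y"]) (rule p1)
  have Hper: "H t = H s" if "f t = f s" for t s
  proof -
    have "cis (fst t) = cis (fst s)" "cis (snd t) = cis (snd s)" using that by (auto simp: f_def)
    then obtain m n :: int where mn: "fst t = fst s + 2 * pi * m" "snd t = snd s + 2 * pi * n"
      by (metis cis.simps(1,2) sin_cos_eq_iff)
    have "H t = F ((fst s / (2 * pi * K) + snd s / (2 * pi) * a + of_int m * (1 / K)) + of_int n * a) (snd s / (2 * pi) * b + of_int n * b)"
    proof -
      have "fst t / (2 * pi * K) = fst s / (2 * pi * K) + of_int m * (1 / K)"
        using K by (simp add: mn add_divide_distrib)
      moreover have "snd t / (2 * pi) = snd s / (2 * pi) + of_int n" by (simp add: mn add_divide_distrib)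
      ultimately show ?thesis unfolding H_def by (simp add: distrib_right add_ac)
    qed
    then show ?thesis unfolding pp pK by (simp add: H_def)
  qed
  have cH: "continuous_on S H" for S unfolding H_def
    by (intro cont2D[OF c] continuous_intros) (use K in auto)
  define T where "T = f ` ({- pi..pi} \<times> {- pi..pi})"
  have cf: "continuous_on S f" for S unfolding f_def by (intro continuous_intros)
  have fT: "f t \<in> T" for t
  proof -
    have "cis (Arg (cis s)) = cis s" for s by (simp add: cis_Arg)
    then have "f t = f (Arg (cis (fst t)), Arg (cis (snd t)))" by (simp add: f_def)
    moreover have "(Arg (cis (fst t)), Arg (cis (snd t))) \<in> {- pi..pi} \<times> {- pi..pi}"
      using Arg_bounded[of "cis (fst t)"] Arg_bounded[of "cis (snd t)"] by auto
    ultimately show ?thesis unfolding T_def by blast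
  qed
  have T: "compact T" unfolding T_def by (intro compact_continuous_image cf compact_Times compact_Icc)
  define g where "g p = H (SOME t. f t = p)" for p
  have gf: "g (f t) = H t" for t unfolding g_def by (rule Hper) (rule someI[of _ t], rule refl)
  \<comment> \<open>\<open>f\<close> maps a compact square onto \<open>T\<close>, so preimages of
    closed sets under \<open>g\<close> are images of compact sets. Continuity of \<open>g\<close>
    thus needs no continuous branch of the argument.\<close>
  have cg: "continuous_on T g"
    unfolding continuous_on_closed_vimage[OF compact_imp_closed[OF T]]
  proof safe
    fix B :: "real set" assume B: "closed B"
    have "g -` B \<inter> T = f ` (({- pi..pi} \<times> {- pi..pi}) \<inter> H -` B)"
      unfolding T_def by (auto simp: gf)
    also have "compact \<dots>"
    proof (intro compact_continuous_image cf compact_Int_closed compact_Times compact_Icc)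
      show "closed (H -` B)" by (rule closed_vimage[OF B cH])
    qed
    finally show "closed (g -` B \<inter> T)" by (rule compact_imp_closed)
  qed
  obtain p where p: "real_polynomial_function p" "\<And>z. z \<in> T \<Longrightarrow> \<bar>g z - p z\<bar> < e"
    using Stone_Weierstrass_real_polynomial_function[OF T cg e] by blast
  have "norm (of_real (F x y) - complex_of_real (p (E 1 0 x y, E 0 1 x y))) < e" for x y
  proof -
    define t where "t = (al 1 * x + be 1 0 * y, al 0 * x + be 0 1 * y)"
    have "H t = F x y"
      unfolding H_def t_def using K b by (simp add: al_def be_def field_simps)
    moreover have "f t = (E 1 0 x y, E 0 1 x y)" by (simp add: f_def t_def E_def)
    ultimately have "\<bar>F x y - p (E 1 0 x y, E 0 1 x y)\<bar> < e" using p(2)[OF fT, of t] gf[of t] by simp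
    then show ?thesis by (simp flip: of_real_diff)
  qed
  then show ?thesis using trig_polynomial[OF p(1)] by blast
qed

lemma trig_dense:
  fixes F :: "real \<Rightarrow> real \<Rightarrow> complex"
  assumes c: "cont2 F" and p1: "\<And>x y. F (x + 1 / K) y = F x y" and p2: "\<And>x y. F (x + a) (y + b) = F x y" and e: "0 < e"
  obtains p where "trig p" "\<And>x y. norm (F x y - p x y) < e"
proof -
  have "cont2 (\<lambda>x y. Re (F x y))" "cont2 (\<lambda>x y. Im (F x y))"
    using c unfolding cont2_def by (auto intro: continuous_intros)
  then obtain p q where p: "trig p" "\<And>x y. norm (of_real (Re (F x y)) - p x y) < e / 2"
    and q: "trig q" "\<And>x y. norm (of_real (Im (F x y)) - q x y) < e / 2"
    using trig_dense_real[of "\<lambda>x y. Re (F x y)" "e / 2"] trig_dense_real[of "\<lambda>x y. Im (F x y)" "e / 2"] p1 p2 e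
    by auto
  have "norm (F x y - (p x y + \<i> * q x y)) < e" for x y
  proof -
    have "F x y - (p x y + \<i> * q x y) = (of_real (Re (F x y)) - p x y) + \<i> * (of_real (Im (F x y)) - q x y)"
      by (subst complex_eq[of "F x y"]) (simp add: algebra_simps)
    also have "norm \<dots> \<le> norm (of_real (Re (F x y)) - p x y) + norm (of_real (Im (F x y)) - q x y)"
      by (rule order_trans[OF norm_triangle_ineq]) (simp add: norm_mult)
    also have "\<dots> < e" using p(2)[of x y] q(2)[of x y] by simp
    finally show ?thesis .
  qed
  then show ?thesis using that[of "\<lambda>x y. p x y + \<i> * q x y"] trig.add[OF p(1) trig_mult[OF trig_const q(1)]] by blast
qed

lemma tp_dense:
  fixes \<xi> :: "real \<Rightarrow> real \<Rightarrow> spin"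
  assumes c: "cont2 \<xi>" and p1: "\<And>x y. \<xi> (x + 1 / K) y = - \<xi> x y" and p2: "\<And>x y. \<xi> (x + a) (y + b) = \<xi> x y" and e: "0 < e"
  obtains S u where "finite S" "\<And>k. k \<notin> S \<Longrightarrow> u k = 0" "\<And>x y. norm (\<xi> x y - tp S u x y) < e"
proof -
  \<comment> \<open>Multiplication by the character of frequency \<open>- 1/2\<close> turns the
    change of sign into periodicity.\<close>
  define m where "m x y = E (- (1/2)) 0 x y" for x y
  have m: "cont2 m" "\<And>x y. m (x + 1 / K) y = - m x y" "\<And>x y. m (x + a) (y + b) = m x y"
    using E_cont by (auto simp: m_def[abs_def] E_shift complex_eq_iff)
  have e2: "0 < e / 2" using e by simp
  have c1: "cont2 (\<lambda>x y. m x y * fst (\<xi> x y))" and c2: "cont2 (\<lambda>x y. m x y * snd (\<xi> x y))"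
    using c m(1) unfolding cont2_def by (auto intro!: continuous_intros)
  have s: "m (x + 1 / K) y * fst (\<xi> (x + 1 / K) y) = m x y * fst (\<xi> x y)"
    "m (x + 1 / K) y * snd (\<xi> (x + 1 / K) y) = m x y * snd (\<xi> x y)" for x y
    by (simp_all only: m p1 fst_uminus snd_uminus minus_mult_minus)
  have t: "m (x + a) (y + b) * fst (\<xi> (x + a) (y + b)) = m x y * fst (\<xi> x y)"
    "m (x + a) (y + b) * snd (\<xi> (x + a) (y + b)) = m x y * snd (\<xi> x y)" for x y
    by (simp_all only: m p2)
  obtain p where p: "trig p" "\<And>x y. norm (m x y * fst (\<xi> x y) - p x y) < e / 2"
    using trig_dense[OF c1 s(1) t(1) e2] by blast
  obtain q where q: "trig q" "\<And>x y. norm (m x y * snd (\<xi> x y) - q x y) < e / 2"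
    using trig_dense[OF c2 s(2) t(2) e2] by blast
  obtain P c where P: "finite P" "\<And>j. j \<notin> P \<Longrightarrow> c j = 0" "\<And>x y. p x y = (\<Sum>j\<in>P. c j * Em 0 j x y)"
    using trig_repr[OF p(1)] by blast
  obtain R d where R: "finite R" "\<And>j. j \<notin> R \<Longrightarrow> d j = 0" "\<And>x y. q x y = (\<Sum>j\<in>R. d j * Em 0 j x y)"
    using trig_repr[OF q(1)] by blast
  have pP: "p x y = (\<Sum>j\<in>P \<union> R. c j * Em 0 j x y)" for x y unfolding P
    by (rule sum.mono_neutral_left) (use P R in auto)
  have qR: "q x y = (\<Sum>j\<in>P \<union> R. d j * Em 0 j x y)" for x y unfolding R
    by (rule sum.mono_neutral_left) (use P R in auto)
  have tpe: "tp (P \<union> R) (\<lambda>j. (c j, d j)) x y = csc (E (1/2) 0 x y) (p x y, q x y)" for x y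
  proof -
    have "Em (1/2) k x y = E (1/2) 0 x y * Em 0 k x y" for k by (simp add: Em_def E_mult)
    then show ?thesis
      by (simp add: tp_def pP qR csc_def sum_prod sum_distrib_left mult_ac)
  qed
  have "norm (\<xi> x y - tp (P \<union> R) (\<lambda>j. (c j, d j)) x y) < e" for x y
  proof -
    have "\<xi> x y = csc (E (1/2) 0 x y) (csc (m x y) (\<xi> x y))"
      by (simp add: csc_simps m_def E_mult)
    then have "\<xi> x y - tp (P \<union> R) (\<lambda>j. (c j, d j)) x y = csc (E (1/2) 0 x y) (csc (m x y) (\<xi> x y) - (p x y, q x y))"
      unfolding tpe by (simp add: csc_lin)
    then have "norm (\<xi> x y - tp (P \<union> R) (\<lambda>j. (c j, d j)) x y) = norm (m x y * fst (\<xi> x y) - p x y, m x y * snd (\<xi> x y) - q x y)"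
      by (simp add: norm_csc) (simp add: csc_def)
    also have "\<dots> \<le> norm (m x y * fst (\<xi> x y) - p x y) + norm (m x y * snd (\<xi> x y) - q x y)"
      by (rule norm_Pair_le)
    also have "\<dots> < e" using p(2)[of x y] q(2)[of x y] by simp
    finally show ?thesis .
  qed
  then show ?thesis using that[of "P \<union> R" "\<lambda>j. (c j, d j)"] P R by (simp add: zero_prod_def)
qed

end

section \<open>Construction of kernel spinors\<close>

lemma C1_uniform_limit:
  fixes F :: "nat \<Rightarrow> real \<Rightarrow> real \<Rightarrow> 'a::banach"
  assumes C: "\<And>n. C1 (F n) (Fx n) (Fy n)"
    and l: "uniform_limit UNIV (\<lambda>n p. F n (fst p) (snd p)) (\<lambda>p. f (fst p) (snd p)) sequentially"
    and lx: "uniform_limit UNIV (\<lambda>n p. Fx n (fst p) (snd p)) (\<lambda>p. fx (fst p) (snd p)) sequentially"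
    and ly: "uniform_limit UNIV (\<lambda>n p. Fy n (fst p) (snd p)) (\<lambda>p. fy (fst p) (snd p)) sequentially"
  shows "C1 f fx fy"
proof -
  have cont: "cont2 g" if "uniform_limit UNIV (\<lambda>n p. G n (fst p) (snd p)) (\<lambda>p. g (fst p) (snd p)) sequentially" "\<And>n. cont2 (G n)"
    for g :: "real \<Rightarrow> real \<Rightarrow> 'a" and G
    using that(2) unfolding cont2_def by (intro uniform_limit_theorem[OF _ that(1)]) auto
  have lim: "(\<lambda>n. F n x y) \<longlonglongrightarrow> f x y" for x y
    using tendsto_uniform_limitI[OF l, of "(x, y)"] by simp
  have der: "(h has_vector_derivative h' t) (at t)"
    if H: "\<And>n s. (H n has_vector_derivative H' n s) (at s)" and hl: "\<And>s. (\<lambda>n. H n s) \<longlonglongrightarrow> h s"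
      and u: "\<And>e. 0 < e \<Longrightarrow> \<forall>\<^sub>F n in sequentially. \<forall>s. norm (H' n s - h' s) < e" for h h' :: "real \<Rightarrow> 'a" and H H' t
  proof -
    have "\<exists>g. \<forall>x\<in>UNIV. (\<lambda>n. H n x) \<longlonglongrightarrow> g x \<and> (g has_derivative (\<lambda>k. k *\<^sub>R h' x)) (at x within UNIV)"
    proof (rule has_derivative_sequence)
      show "(H n has_derivative (\<lambda>k. k *\<^sub>R H' n x)) (at x within UNIV)" for n x
        using H by (simp add: has_vector_derivative_def)
      show "\<forall>\<^sub>F n in sequentially. \<forall>x\<in>UNIV. \<forall>k. norm (k *\<^sub>R H' n x - k *\<^sub>R h' x) \<le> e * norm k" if "0 < e" for e
        using u[OF that]
      proof eventually_elim
        case (elim n)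
        have "norm (k *\<^sub>R H' n x - k *\<^sub>R h' x) \<le> e * norm k" for x k
          using mult_left_mono[of "norm (H' n x - h' x)" e "\<bar>k\<bar>"] elim
          by (simp add: less_imp_le mult.commute flip: scaleR_diff_right)
        then show ?case by blast
      qed
    qed (use hl in auto)
    then obtain g where g: "\<And>x. (\<lambda>n. H n x) \<longlonglongrightarrow> g x" "\<And>x. (g has_vector_derivative h' x) (at x)"
      unfolding has_vector_derivative_def by auto
    have "g = h" using LIMSEQ_unique[OF g(1) hl] by auto
    then show ?thesis using g by simp
  qed
  have "((\<lambda>s. f s y) has_vector_derivative fx x y) (at x)" for x y
  proof (rule der[where H = "\<lambda>n s. F n s y" and H' = "\<lambda>n s. Fx n s y"])
    show "\<forall>\<^sub>F n in sequentially. \<forall>s. norm (Fx n s y - fx s y) < e" if "0 < e" for e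
      using uniform_limitD[OF lx that] by eventually_elim (auto simp: dist_norm)
  qed (use C1_dx[OF C] lim in auto)
  moreover have "((\<lambda>s. f x s) has_vector_derivative fy x y) (at y)" for x y
  proof (rule der[where H = "\<lambda>n s. F n x s" and H' = "\<lambda>n s. Fy n x s"])
    show "\<forall>\<^sub>F n in sequentially. \<forall>s. norm (Fy n x s - fy x s) < e" if "0 < e" for e
      using uniform_limitD[OF ly that] by eventually_elim (auto simp: dist_norm)
  qed (use C1_dy[OF C] lim in auto)
  ultimately show ?thesis unfolding C1_def
    using cont[OF l cont2_C1(1)[OF C]] cont[OF lx cont2_C1(2)[OF C]] cont[OF ly cont2_C1(3)[OF C]] by blast
qed

text \<open>At least 1 and submultiplicative, so that polynomial decay of coefficients survives
  convolution with finitely many modes.\<close>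

definition wt :: "int \<times> int \<Rightarrow> real" where "wt k = 1 + \<bar>of_int (fst k)\<bar> + \<bar>of_int (snd k)\<bar>"

lemma wt_ge1: "1 \<le> wt k" by (simp add: wt_def)

lemma wt_submult: "wt (k + l) \<le> wt k * wt l"
proof -
  have "wt (k + l) \<le> 1 + (\<bar>of_int (fst k)\<bar> + \<bar>of_int (snd k)\<bar>) + (\<bar>of_int (fst l)\<bar> + \<bar>of_int (snd l)\<bar>)"
    by (simp add: wt_def)
  also have "\<dots> \<le> wt k * wt l" by (simp add: wt_def algebra_simps)
  finally show ?thesis .
qed

lemma wt_summable: "(\<lambda>k. 1 / wt k ^ 4) summable_on UNIV"
proof (rule nonneg_bdd_above_summable_on)
  define g where "g m = 1 / (1 + \<bar>real_of_int m\<bar>)\<^sup>2" for m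
  \<comment> \<open>The bound telescopes because
    \<open>1 / (n + 2)^2 \<le> 1 / ((n + 1) (n + 2))\<close>.\<close>
  have g: "(\<Sum>m\<in>{- int n..int n}. g m) \<le> 3 - 2 / (real n + 1)" for n
  proof (induction n)
    case (Suc n)
    have "{- int (Suc n)..int (Suc n)} = insert (- int (Suc n)) (insert (int (Suc n)) {- int n..int n})" by auto
    then have "(\<Sum>m\<in>{- int (Suc n)..int (Suc n)}. g m) = 2 / (real n + 2)\<^sup>2 + (\<Sum>m\<in>{- int n..int n}. g m)"
      by (simp add: g_def add.commute)
    also have "\<dots> \<le> 2 / (real n + 2)\<^sup>2 + (3 - 2 / (real n + 1))" using Suc by simp
    also have "2 / (real n + 2)\<^sup>2 \<le> 2 / ((real n + 1) * (real n + 2))"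
      unfolding power2_eq_square by (intro divide_left_mono mult_right_mono) auto
    also have "\<dots> = 2 / (real n + 1) - 2 / (real n + 2)" by (simp add: field_simps)
    finally show ?case by (simp add: add.commute)
  qed (simp add: g_def)
  have le: "1 / wt k ^ 4 \<le> g (fst k) * g (snd k)" for k
  proof -
    define p q where "p = 1 + \<bar>real_of_int (fst k)\<bar>" and "q = 1 + \<bar>real_of_int (snd k)\<bar>"
    have pq: "1 \<le> p" "1 \<le> q" "p \<le> wt k" "q \<le> wt k" by (auto simp: p_def q_def wt_def)
    then have "p\<^sup>2 * q\<^sup>2 \<le> (wt k)\<^sup>2 * (wt k)\<^sup>2" by (intro mult_mono power_mono) auto
    also have "\<dots> = wt k ^ 4" by (simp flip: power_add)
    finally have "1 / wt k ^ 4 \<le> 1 / (p\<^sup>2 * q\<^sup>2)" using pq by (intro divide_left_mono mult_pos_pos) auto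
    then show ?thesis by (simp add: g_def p_def q_def)
  qed
  show "bdd_above (sum (\<lambda>k. 1 / wt k ^ 4) ` {F. F \<subseteq> UNIV \<and> finite F})"
  proof (rule bdd_aboveI2[where M = 9], safe)
    fix F :: "(int \<times> int) set" assume "finite F"
    then obtain n where n: "F \<subseteq> ibox n" using finite_subset_ibox by blast
    have "(\<Sum>k\<in>F. 1 / wt k ^ 4) \<le> (\<Sum>k\<in>ibox n. g (fst k) * g (snd k))"
      by (rule order_trans[OF sum_mono[OF le] sum_mono2]) (use n in \<open>auto simp: g_def\<close>)
    also have "\<dots> = (\<Sum>m\<in>{- int n..int n}. g m) * (\<Sum>m\<in>{- int n..int n}. g m)"
      by (simp add: ibox_def sum_product sum.cartesian_product split_beta)
    also have "\<dots> \<le> 3 * 3"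
      using g[of n] by (intro mult_mono sum_nonneg) (auto simp: g_def intro: order_trans)
    finally show "(\<Sum>k\<in>F. 1 / wt k ^ 4) \<le> 9" by simp
  qed
qed (simp add: wt_def)

lemma filterlim_ibox: "filterlim ibox (finite_subsets_at_top UNIV) sequentially"
  unfolding filterlim_finite_subsets_at_top
proof safe
  fix X :: "(int \<times> int) set" assume "finite X"
  then obtain n where "X \<subseteq> ibox n" using finite_subset_ibox by blast
  then have "X \<subseteq> ibox m" if "n \<le> m" for m using ibox_mono[OF that] by blast
  then show "\<forall>\<^sub>F m in sequentially. finite (ibox m) \<and> X \<subseteq> ibox m \<and> ibox m \<subseteq> UNIV"
    unfolding eventually_sequentially by auto
qed

lemma sum_wt_bound_summable:
  assumes "\<And>k. norm (d k) * wt k ^ (n + 4) \<le> C"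
  shows "(\<lambda>k. wt k ^ n * norm (d k)) summable_on UNIV"
proof (rule summable_on_comparison_test[of "\<lambda>k. C * (1 / wt k ^ 4)"])
  show "(\<lambda>k. C * (1 / wt k ^ 4)) summable_on UNIV" by (rule summable_on_cmult_right[OF wt_summable])
  show "wt k ^ n * norm (d k) \<le> C * (1 / wt k ^ 4)" for k
    using assms[of k] wt_ge1[of k] by (simp add: pos_le_divide_eq power_add mult_ac)
  show "0 \<le> wt k ^ n * norm (d k)" for k using wt_ge1[of k] by simp
qed

context modes begin

text \<open>\<open>\<i> nu k\<close> and \<open>\<i> eta k\<close> are the factors by which the
  partial derivatives act on the mode \<open>k\<close> of half-integral frequency. With
  \<open>om = eta + \<i> nu\<close> the Dirac operator acts there with eigenvalues of modulus
  \<open>norm (om k)\<close>.\<close>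

definition "nu k = al (1/2 + of_int (fst k))"
definition "eta k = be (1/2 + of_int (fst k)) (of_int (snd k))"
definition "om k = Complex (eta k) (nu k)"
definition "SF d x y = (\<Sum>\<^sub>\<infinity>k. csc (Em (1/2) k x y) (d k))"

text \<open>Half-integers stay away from 0, hence \<open>om\<close> never vanishes and grows
  linearly: on these spinors the inverse of the Dirac operator gains one power of
  \<open>wt\<close>.\<close>

lemma freq_bounds:
  obtains C where "0 < C" "\<And>k. \<bar>nu k\<bar> \<le> C * wt k" "\<And>k. \<bar>eta k\<bar> \<le> C * wt k" "\<And>k. wt k \<le> C * norm (om k)"
proof -
  have K0: "0 < real K" using K by simp
  define A where "A = 2 * pi * real K"
  have A: "0 < A" using K0 by (simp add: A_def)
  define B where "B = (2 * pi + A * \<bar>a\<bar>) / b"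
  have nu: "\<bar>nu k\<bar> \<le> A * wt k" for k
  proof -
    have "\<bar>nu k\<bar> = A * \<bar>1/2 + of_int (fst k)\<bar>" using A by (simp add: nu_def al_def A_def abs_mult)
    also have "\<dots> \<le> A * wt k" using A by (intro mult_left_mono) (auto simp: wt_def)
    finally show ?thesis .
  qed
  have eta: "\<bar>eta k\<bar> \<le> B * wt k" for k
  proof -
    have "\<bar>eta k\<bar> = \<bar>2 * pi * of_int (snd k) - nu k * a\<bar> / b"
      using b by (simp add: eta_def be_def nu_def)
    also have "\<dots> \<le> (2 * pi * wt k + A * wt k * \<bar>a\<bar>) / b"
    proof (rule divide_right_mono)
      have "\<bar>2 * pi * of_int (snd k) - nu k * a\<bar> \<le> 2 * pi * \<bar>of_int (snd k)\<bar> + \<bar>nu k\<bar> * \<bar>a\<bar>"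
        by (rule order_trans[OF abs_triangle_ineq4]) (simp add: abs_mult)
      also have "\<dots> \<le> 2 * pi * wt k + A * wt k * \<bar>a\<bar>"
        by (intro add_mono mult_left_mono mult_right_mono nu) (auto simp: wt_def)
      finally show "\<bar>2 * pi * of_int (snd k) - nu k * a\<bar> \<le> 2 * pi * wt k + A * wt k * \<bar>a\<bar>" .
    qed (use b in simp)
    also have "\<dots> = B * wt k" by (simp add: B_def field_simps)
    finally show ?thesis .
  qed
  define D where "D = 4 / A + (b + \<bar>a\<bar>) / (2 * pi)"
  have wtD: "wt k \<le> D * norm (om k)" for k
  proof -
    have n1: "\<bar>nu k\<bar> \<le> norm (om k)" using abs_Im_le_cmod[of "om k"] by (simp add: om_def)
    have n2: "\<bar>eta k\<bar> \<le> norm (om k)" using abs_Re_le_cmod[of "om k"] by (simp add: om_def)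
    \<comment> \<open>Equality holds at \<open>fst k = - 1\<close>, which determines the factor
      4.\<close>
    have "1 + \<bar>real_of_int (fst k)\<bar> \<le> 4 * \<bar>1/2 + of_int (fst k)\<bar>"
    proof (cases "fst k \<ge> 0")
      case False
      then have "real_of_int (fst k) \<le> -1" by linarith
      then show ?thesis by (simp add: abs_of_nonpos abs_of_neg)
    qed simp
    also have "\<dots> = 4 / A * \<bar>nu k\<bar>" using K0 by (simp add: nu_def al_def A_def abs_mult)
    also have "\<dots> \<le> 4 / A * norm (om k)" using n1 A by (intro mult_left_mono) auto
    finally have 1: "1 + \<bar>real_of_int (fst k)\<bar> \<le> 4 / A * norm (om k)" .
    have "2 * pi * of_int (snd k) = b * eta k + a * nu k"
      using b by (simp add: eta_def be_def nu_def)
    then have "2 * pi * \<bar>real_of_int (snd k)\<bar> = \<bar>b * eta k + a * nu k\<bar>"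
      by (metis abs_mult abs_of_pos pi_gt_zero mult_pos_pos zero_less_numeral)
    also have "\<dots> \<le> b * \<bar>eta k\<bar> + \<bar>a\<bar> * \<bar>nu k\<bar>" using b by (intro order_trans[OF abs_triangle_ineq]) (simp add: abs_mult)
    also have "\<dots> \<le> b * norm (om k) + \<bar>a\<bar> * norm (om k)" using n1 n2 b by (intro add_mono mult_left_mono) auto
    finally have "\<bar>real_of_int (snd k)\<bar> \<le> (b + \<bar>a\<bar>) / (2 * pi) * norm (om k)" by (simp add: field_simps)
    then show ?thesis using 1 by (simp add: wt_def D_def distrib_right)
  qed
  define C where "C = A + B + D"
  have B0: "0 \<le> B" "0 \<le> D" using A b by (auto simp: B_def D_def)
  show ?thesis
  proof (rule that[of C])
    show "0 < C" using A B0 by (simp add: C_def)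
    have w: "0 \<le> wt k" for k using wt_ge1[of k] by simp
    have AC: "A \<le> C" and BC: "B \<le> C" and DC: "D \<le> C" using A B0 by (auto simp: C_def)
    show "\<bar>nu k\<bar> \<le> C * wt k" for k using nu mult_right_mono[OF AC w] by (rule order_trans)
    show "\<bar>eta k\<bar> \<le> C * wt k" for k using eta mult_right_mono[OF BC w] by (rule order_trans)
    show "wt k \<le> C * norm (om k)" for k using wtD mult_right_mono[OF DC norm_ge_zero] by (rule order_trans)
  qed
qed

lemma norm_Em [simp]: "norm (Em \<mu>0 k x y) = 1" by (simp add: Em_def)

lemma SF_has_sum:
  assumes "(\<lambda>k. norm (d k)) summable_on UNIV"
  shows "((\<lambda>k. csc (Em (1/2) k x y) (d k)) has_sum SF d x y) UNIV"
  unfolding SF_def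
  by (rule has_sum_infsum, rule abs_summable_summable) (simp add: norm_csc assms)

lemma SF_uniform:
  assumes "(\<lambda>k. norm (d k)) summable_on UNIV"
  shows "uniform_limit UNIV (\<lambda>n p. tp (ibox n) d (fst p) (snd p)) (\<lambda>p. SF d (fst p) (snd p)) sequentially"
proof -
  have "uniform_limit UNIV (\<lambda>X p. \<Sum>k\<in>X. csc (Em (1/2) k (fst p) (snd p)) (d k))
     (\<lambda>p. \<Sum>\<^sub>\<infinity>k. csc (Em (1/2) k (fst p) (snd p)) (d k)) (finite_subsets_at_top UNIV)"
    by (rule Weierstrass_m_test_general[OF _ assms]) (simp add: norm_csc)
  from filterlim_compose[OF this filterlim_ibox] show ?thesis by (simp add: tp_def SF_def)
qed

lemma C1_tp: "C1 (tp S d) (tp S (\<lambda>k. csc (\<i> * nu k) (d k))) (tp S (\<lambda>k. csc (\<i> * eta k) (d k)))"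
  unfolding tp_def Em_def nu_def eta_def by (intro C1_sum C1_E)

lemma C1_SF:
  assumes d: "(\<lambda>k. wt k * norm (d k)) summable_on UNIV"
  shows "C1 (SF d) (SF (\<lambda>k. csc (\<i> * nu k) (d k))) (SF (\<lambda>k. csc (\<i> * eta k) (d k)))"
proof -
  obtain C where C: "0 < C" "\<And>k. \<bar>nu k\<bar> \<le> C * wt k" "\<And>k. \<bar>eta k\<bar> \<le> C * wt k" using freq_bounds by metis
  have dC: "(\<lambda>k. C * (wt k * norm (d k))) summable_on UNIV" by (rule summable_on_cmult_right[OF d])
  have "(\<lambda>k. norm (d k)) summable_on UNIV"
  proof (rule summable_on_comparison_test[OF d])
    show "norm (d k) \<le> wt k * norm (d k)" for k using mult_right_mono[OF wt_ge1 norm_ge_zero, of "d k" k] by simp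
  qed simp
  moreover have "(\<lambda>k. norm (csc (\<i> * nu k) (d k))) summable_on UNIV"
    by (rule summable_on_comparison_test[OF dC])
      (use mult_right_mono[OF C(2)] in \<open>auto simp: norm_csc norm_mult mult.assoc\<close>)
  moreover have "(\<lambda>k. norm (csc (\<i> * eta k) (d k))) summable_on UNIV"
    by (rule summable_on_comparison_test[OF dC])
      (use mult_right_mono[OF C(3)] in \<open>auto simp: norm_csc norm_mult mult.assoc\<close>)
  ultimately show ?thesis using C1_uniform_limit[OF C1_tp SF_uniform SF_uniform SF_uniform] by blast
qed

text \<open>Multiplying by a mode shifts the coefficients. This converts the equation for sequences
  into one for functions.\<close>

lemma SF_shift:
  assumes d: "(\<lambda>k. norm (d k)) summable_on UNIV"
  shows "((\<lambda>k. csc (Em (1/2) k x y) (csc z (d (k - j)))) has_sum csc (z * Em 0 j x y) (SF d x y)) UNIV"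
proof -
  have "bij_betw (\<lambda>k. k - j) UNIV UNIV"
    by (rule bij_betwI[of _ _ _ "\<lambda>k. k + j"]) auto
  from has_sum_reindex_bij_betw[OF this, of "\<lambda>k. csc (Em (1/2) k x y) (d k)"]
  have "((\<lambda>k. csc (Em (1/2) (k - j) x y) (d (k - j))) has_sum SF d x y) UNIV"
    using SF_has_sum[OF d] by blast
  from has_sum_bounded_linear[OF bounded_bilinear.bounded_linear_right[OF bounded_bilinear_csc, of "z * Em 0 j x y"] this]
  have "((\<lambda>k. csc (z * Em 0 j x y) (csc (Em (1/2) (k - j) x y) (d (k - j)))) has_sum csc (z * Em 0 j x y) (SF d x y)) UNIV" .
  moreover have "csc (z * Em 0 j x y) (csc (Em (1/2) (k - j) x y) (d (k - j))) = csc (Em (1/2) k x y) (csc z (d (k - j)))" for k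
  proof -
    have "Em 0 j x y * Em (1/2) (k - j) x y = Em (1/2) k x y" by (simp add: Em_def E_mult)
    then show ?thesis by (simp add: csc_simps mult_ac)
  qed
  ultimately show ?thesis by simp
qed

lemma has_sum_sum_finite:
  fixes f :: "'i \<Rightarrow> 'k \<Rightarrow> 'a::real_normed_vector"
  assumes "\<And>i. i \<in> I \<Longrightarrow> (f i has_sum s i) A"
  shows "((\<lambda>k. \<Sum>i\<in>I. f i k) has_sum (\<Sum>i\<in>I. s i)) A"
  using assms by (induction I rule: infinite_finite_induct) (simp_all add: has_sum_add)

text \<open>By Parseval's identity a partial sum containing \<open>k\<close> cannot be smaller than
  \<open>norm (d k)\<close> everywhere, and partial sums are uniformly close to the series.\<close>

lemma SF_nonzero:
  assumes d: "(\<lambda>k. norm (d k)) summable_on UNIV" and k: "d k \<noteq> 0"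
  shows "\<exists>x y. SF d x y \<noteq> 0"
proof (rule ccontr)
  assume "\<not> ?thesis"
  then have z: "SF d x y = 0" for x y by blast
  define e where "e = norm (d k) / 2"
  have e: "0 < e" using k by (simp add: e_def)
  have "\<forall>\<^sub>F n in sequentially. k \<in> ibox n"
    using filterlim_ibox unfolding filterlim_finite_subsets_at_top by (auto dest!: spec[of _ "{k}"] elim: eventually_mono)
  then have "\<forall>\<^sub>F n in sequentially. k \<in> ibox n \<and> (\<forall>p. dist (tp (ibox n) d (fst p) (snd p)) (SF d (fst p) (snd p)) < e)"
    using uniform_limitD[OF SF_uniform[OF d] e] by eventually_elim auto
  then obtain n where n: "k \<in> ibox n" "\<And>p. norm (tp (ibox n) d (fst p) (snd p)) < e"
    unfolding eventually_sequentially by (auto simp: z)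
  have le: "inner (tp (ibox n) d x y) (tp (ibox n) d x y) \<le> e\<^sup>2" for x y
    using n(2)[of "(x, y)"] by (simp add: power_mono flip: power2_norm_eq_inner)
  have "b * (norm (d k))\<^sup>2 \<le> b * (\<Sum>k\<in>ibox n. inner (d k) (d k))"
    using b n(1) member_le_sum[of k "ibox n" "\<lambda>k. inner (d k) (d k)"]
    by (intro mult_left_mono) (auto simp: power2_norm_eq_inner)
  also have "\<dots> = II b (\<lambda>x y. inner (tp (ibox n) d x y) (tp (ibox n) d x y))" by (simp add: parseval)
  also have "\<dots> \<le> II b (\<lambda>_ _. e\<^sup>2)" by (intro II_mono cont2_inner tp_cont cont2_const le)
  also have "\<dots> = b * e\<^sup>2" using b by (simp add: II_const)
  finally have "(norm (d k))\<^sup>2 \<le> e\<^sup>2" using b by simp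
  then have "norm (d k) \<le> e" using e by (simp add: power2_le_iff_abs_le)
  then show False using e by (simp add: e_def)
qed

end

text \<open>A point is brought into the rectangle by multiples of \<open>(a, b)\<close> and then by
  multiples of \<open>T\<close> along its circle.\<close>

lemma doubly_periodic_inf:
  fixes F :: "real \<Rightarrow> real \<Rightarrow> real"
  assumes c: "cont2 F" and p1: "\<And>x y. F (x + T) y = F x y" and p2: "\<And>x y. F (x + a) (y + b) = F x y"
    and T: "0 < T" and b: "0 < b"
  obtains x0 y0 where "\<And>x y. F x0 y0 \<le> F x y"
proof -
  have ct: "continuous_on ({0..T} \<times> {0..b}) (\<lambda>p. F (fst p) (snd p))"
    using c unfolding cont2_def by (rule continuous_on_subset) simp
  have "(0, 0) \<in> {0..T} \<times> {0..b}" using T b by simp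
  then have ne: "{0..T} \<times> {0..b} \<noteq> {}" by blast
  obtain z where z: "\<And>p. p \<in> {0..T} \<times> {0..b} \<Longrightarrow> F (fst z) (snd z) \<le> F (fst p) (snd p)"
    using continuous_attains_inf[OF compact_Times[OF compact_Icc compact_Icc] ne ct] by blast
  have "F (fst z) (snd z) \<le> F x y" for x y
  proof -
    define n where "n = \<lfloor>y / b\<rfloor>"
    have "of_int n \<le> y / b" "y / b < of_int n + 1" unfolding n_def by linarith+
    then have n: "of_int n * b \<le> y" "y < (of_int n + 1) * b"
      using b by (simp_all add: pos_le_divide_eq pos_divide_less_eq)
    define x' where "x' = x - of_int n * a"
    define m where "m = \<lfloor>x' / T\<rfloor>"
    have "of_int m \<le> x' / T" "x' / T < of_int m + 1" unfolding m_def by linarith+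
    then have m: "of_int m * T \<le> x'" "x' < (of_int m + 1) * T"
      using T by (simp_all add: pos_le_divide_eq pos_divide_less_eq)
    have "F (fst z) (snd z) \<le> F (x' + of_int (- m) * T) (y - of_int n * b)"
      using z[of "(x' + of_int (- m) * T, y - of_int n * b)"] m n by (auto simp: distrib_right)
    also have "\<dots> = F x' (y - of_int n * b)"
      by (rule periodic_of_int[of "\<lambda>x. F x (y - of_int n * b)"]) (rule p1)
    also have "\<dots> = F (x + of_int (- n) * a) (y + of_int (- n) * b)" by (simp add: x'_def)
    also have "\<dots> = F x y"
      using periodic_of_int[of "\<lambda>t. F (x + t * a) (y + t * b)" 1 0 "- n"] p2[of "x + _ * a" "y + _ * b"]
      by (simp add: distrib_right add.assoc)
    finally show ?thesis .
  qed
  then show ?thesis using that by blast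
qed

lemma doubly_periodic_bounded:
  fixes F :: "real \<Rightarrow> real \<Rightarrow> 'a::real_normed_vector"
  assumes c: "cont2 F" and p1: "\<And>x y. norm (F (x + T) y) = norm (F x y)" and p2: "\<And>x y. F (x + a) (y + b) = F x y"
    and T: "0 < T" and b: "0 < b"
  obtains B where "1 \<le> B" "\<And>x y. norm (F x y) \<le> B"
proof -
  obtain x0 y0 where "\<And>x y. - norm (F x0 y0) \<le> - norm (F x y)"
    using doubly_periodic_inf[of "\<lambda>x y. - norm (F x y)" T a b] assms by (metis cont2_minus cont2_norm)
  then show ?thesis using that[of "norm (F x0 y0) + 1"] by (simp add: add_increasing2)
qed

text \<open>The hypotheses of \<open>kernel_trivial\<close> for potentials with circle norms at most \<open>v\<close>.\<close>

definition crit :: "nat \<Rightarrow> real \<Rightarrow> (real \<Rightarrow> real) \<Rightarrow> bool" where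
  "crit K b v \<longleftrightarrow> continuous_on UNIV v \<and> (\<exists>E. continuous_on UNIV E \<and> (\<forall>y. 0 \<le> E y \<and> E (y + b) = E y) \<and>
     (\<forall>y. v y \<le> 2.42 * real K \<or> (v y)\<^sup>2 / 2 \<le> E y) \<and> integral {0..b} E < 4 * real K) \<and>
     2 * (2.42 * real K) * sqrt (b/2) * ((2.42 * real K) * sqrt (b/2) - sqrt (integral {0..b} (\<lambda>y. (v y)\<^sup>2))) \<ge> 4 * real K"

text \<open>The conditions on the circle norms are monotone, so an upper bound \<open>v\<close> may
  stand in for them.\<close>

lemma (in spin_kernel) kernel_trivial_crit:
  assumes nz: "\<psi> x1 y1 \<noteq> 0" and v: "\<And>y. zh y \<le> v y" and cr: "crit K b v"
  shows False
proof -
  obtain E where E: "continuous_on UNIV E" "\<And>y. 0 \<le> E y" "\<And>y. E (y + b) = E y"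
    "\<And>y. v y \<le> 2.42 * real K \<or> (v y)\<^sup>2 / 2 \<le> E y" "integral {0..b} E < 4 * real K"
    and cv: "continuous_on UNIV v"
    and sl: "2 * (2.42 * real K) * sqrt (b/2) * ((2.42 * real K) * sqrt (b/2) - sqrt (integral {0..b} (\<lambda>y. (v y)\<^sup>2))) \<ge> 4 * real K"
    using cr unfolding crit_def by blast
  have sq: "(zh y)\<^sup>2 \<le> (v y)\<^sup>2" for y using v zh_nonneg by (intro power_mono)
  show False
  proof (rule kernel_trivial[OF nz E(1,2,3) _ E(5)])
    show "zh y \<le> 2.42 * real K \<or> (zh y)\<^sup>2 / 2 \<le> E y" for y
      using E(4)[of y] v[of y] sq[of y] by linarith
    have "integral {0..b} (\<lambda>y. (zh y)\<^sup>2) \<le> integral {0..b} (\<lambda>y. (v y)\<^sup>2)"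
      using sq by (intro integral_le integrable_continuous_interval continuous_intros
          continuous_on_subset[OF zh_cont] continuous_on_subset[OF cv]) auto
    then have "2 * (2.42 * real K) * sqrt (b/2) * ((2.42 * real K) * sqrt (b/2) - sqrt (integral {0..b} (\<lambda>y. (v y)\<^sup>2)))
      \<le> 2 * (2.42 * real K) * sqrt (b/2) * ((2.42 * real K) * sqrt (b/2) - sqrt (integral {0..b} (\<lambda>y. (zh y)\<^sup>2)))"
      using b by (intro mult_left_mono diff_left_mono real_sqrt_le_mono) auto
    then show "4 * real K \<le> 2 * (2.42 * real K) * sqrt (b/2) * ((2.42 * real K) * sqrt (b/2) - sqrt (integral {0..b} (\<lambda>y. (zh y)\<^sup>2)))"
      using sl by linarith
  qed
qed

section \<open>The inverse of the Dirac operator on spinors that change sign\<close>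

context modes begin

text \<open>On the mode \<open>k\<close> the Dirac operator maps \<open>(p, q)\<close> to
  \<open>(om q, cnj om p)\<close>; this is the inverse map.\<close>

definition "Ak k s = (snd s / cnj (om k), fst s / om k)"

lemma om_nonzero: "om k \<noteq> 0"
proof -
  obtain C where "0 < C" "\<And>k. wt k \<le> C * norm (om k)" using freq_bounds by metis
  then show ?thesis using wt_ge1[of k] by (metis mult_zero_right norm_zero not_one_le_zero order_trans)
qed

lemma Ak_linear: "linear (Ak k)"
  by (rule linearI) (auto simp: Ak_def add_divide_distrib scaleR_conv_of_real)

lemma Ak_sym: "inner (Ak k s) t = inner s (Ak k t)"
proof -
  have "inner (z * w) u = inner z (u * cnj w)" for z w u :: complex
    by (simp add: inner_complex_def algebra_simps)
  then have "inner (z / w) u = inner z (u / cnj w)" for z w u :: complex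
    by (simp add: divide_inverse)
  then show ?thesis by (simp add: Ak_def inner_prod_def add.commute)
qed

lemma norm_Ak: "norm (Ak k s) = norm s / norm (om k)"
  by (simp add: Ak_def norm_prod_def norm_divide power_divide add.commute real_sqrt_divide flip: add_divide_distrib)

lemma Ak_inv: "e1 (csc (\<i> * nu k) (Ak k s)) + e2 (csc (\<i> * eta k) (Ak k s)) = s"
proof -
  have "e1 (csc (\<i> * nu k) p) + e2 (csc (\<i> * eta k) p) = (om k * snd p, cnj (om k) * fst p)" for p
    by (auto simp: e1_def e2_def csc_def prod_eq_iff om_def complex_eq_iff)
  then show ?thesis using om_nonzero[of k] by (simp add: Ak_def)
qed

lemma dir_tp:
  "dir (tp S (\<lambda>k. csc (\<i> * nu k) (Ak k (d k)))) (tp S (\<lambda>k. csc (\<i> * eta k) (Ak k (d k)))) = tp S d"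
proof (intro ext)
  fix x y
  have "dir (tp S (\<lambda>k. csc (\<i> * nu k) (Ak k (d k)))) (tp S (\<lambda>k. csc (\<i> * eta k) (Ak k (d k)))) x y
    = (\<Sum>k\<in>S. csc (Em (1/2) k x y) (e1 (csc (\<i> * nu k) (Ak k (d k))) + e2 (csc (\<i> * eta k) (Ak k (d k)))))"
    unfolding dir_def tp_def linear_sum[OF lin_e1] linear_sum[OF lin_e2] by (simp add: e_csc csc_lin sum.distrib)
  then show "dir (tp S (\<lambda>k. csc (\<i> * nu k) (Ak k (d k)))) (tp S (\<lambda>k. csc (\<i> * eta k) (Ak k (d k)))) x y = tp S d x y"
    by (simp add: Ak_inv tp_def)
qed

lemma ell2_Ak:
  assumes "finite Q"
  obtains \<delta> where "ell2_op Q Ak \<delta>"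
proof -
  obtain C where C: "0 < C" "\<And>k. wt k \<le> C * norm (om k)" using freq_bounds by metis
  have "ell2_op Q Ak (\<lambda>n. C / real (Suc n))"
  proof (rule ell2_op.intro)
    show "linear (Ak k)" for k by (rule Ak_linear)
    show "inner (Ak k s) t = inner s (Ak k t)" for k s t by (rule Ak_sym)
    show "norm (Ak k s) \<le> C / real (Suc n) * norm s" if "k \<notin> ibox n" for k n s
    proof -
      have "real n + 1 \<le> wt k"
      proof -
        have "int n < \<bar>fst k\<bar> \<or> int n < \<bar>snd k\<bar>" using that by (auto simp: ibox_def mem_Times_iff)
        then have "real n < \<bar>real_of_int (fst k)\<bar> \<or> real n < \<bar>real_of_int (snd k)\<bar>" by linarith
        then show ?thesis by (auto simp: wt_def)
      qed
      also have "\<dots> \<le> C * norm (om k)" by (rule C)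
      finally have "real (Suc n) \<le> C * norm (om k)" by simp
      then have "1 / norm (om k) \<le> C / real (Suc n)" using om_nonzero[of k] by (simp add: field_simps)
      then have "1 / norm (om k) * norm s \<le> C / real (Suc n) * norm s" by (intro mult_right_mono) auto
      then show ?thesis by (simp add: norm_Ak)
    qed
    show "(\<lambda>n. C / real (Suc n)) \<longlonglongrightarrow> 0" by (rule LIMSEQ_Suc[OF lim_const_over_n])
  qed (use assms C in auto)
  then show ?thesis using that by blast
qed

text \<open>The box must contain all shifted frequencies, otherwise truncation would destroy the
  product formula.\<close>

lemma trig_mult_tp:
  assumes S: "finite S" "\<And>k. k \<notin> S \<Longrightarrow> u k = 0" and n: "\<And>j k. j \<in> Q \<Longrightarrow> k \<in> S \<Longrightarrow> k + j \<in> ibox n"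
  shows "tp (ibox n) (\<lambda>l. \<Sum>j\<in>Q. csc (q j) (u (l - j))) x y = csc (\<Sum>j\<in>Q. q j * Em 0 j x y) (tp S u x y)"
proof -
  have "tp (ibox n) (\<lambda>l. \<Sum>j\<in>Q. csc (q j) (u (l - j))) x y =
     (\<Sum>j\<in>Q. \<Sum>l\<in>ibox n. csc (Em (1/2) l x y * q j) (u (l - j)))"
    unfolding tp_def csc_sum csc_simps by (rule sum.swap)
  also have "\<dots> = (\<Sum>j\<in>Q. \<Sum>k\<in>S. csc (q j * Em 0 j x y * Em (1/2) k x y) (u k))"
  proof (rule sum.cong[OF refl])
    fix j assume j: "j \<in> Q"
    have "(\<Sum>l\<in>ibox n. csc (Em (1/2) l x y * q j) (u (l - j))) = (\<Sum>l\<in>(\<lambda>k. k + j) ` S. csc (Em (1/2) l x y * q j) (u (l - j)))"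
    proof (rule sum.mono_neutral_right)
      show "(\<lambda>k. k + j) ` S \<subseteq> ibox n" using n[OF j] by auto
      have "u (l - j) = 0" if "l \<notin> (\<lambda>k. k + j) ` S" for l
        by (rule S(2)) (use that in \<open>force simp: image_iff\<close>)
      then show "\<forall>l\<in>ibox n - (\<lambda>k. k + j) ` S. csc (Em (1/2) l x y * q j) (u (l - j)) = 0" by (auto simp: csc_simps)
    qed simp
    also have "\<dots> = (\<Sum>k\<in>S. csc (Em (1/2) (k + j) x y * q j) (u k))"
      by (subst sum.reindex) (auto simp: inj_on_def)
    also have "\<dots> = (\<Sum>k\<in>S. csc (q j * Em 0 j x y * Em (1/2) k x y) (u k))"
    proof (rule sum.cong[OF refl])
      fix k
      have "Em (1/2) (k + j) x y = Em 0 j x y * Em (1/2) k x y" by (simp add: Em_def E_mult add_ac)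
      then show "csc (Em (1/2) (k + j) x y * q j) (u k) = csc (q j * Em 0 j x y * Em (1/2) k x y) (u k)" by (simp add: mult_ac)
    qed
    finally show "(\<Sum>l\<in>ibox n. csc (Em (1/2) l x y * q j) (u (l - j))) = (\<Sum>k\<in>S. csc (q j * Em 0 j x y * Em (1/2) k x y) (u k))" .
  qed
  also have "\<dots> = csc (\<Sum>j\<in>Q. q j * Em 0 j x y) (tp S u x y)"
    by (subst sum.swap) (simp add: tp_def csc_sum csc_simps sum_distrib_right)
  finally show ?thesis .
qed

text \<open>An eigenvector in \<open>\<ell>\<^sup>2\<close> has rapidly decreasing coefficients, since \<open>q\<close> has finitely many modes.\<close>

lemma kernel_exists:
  assumes el: "ell2_op Q Ak \<delta>" and M: "1 < M" and u: "u \<in> l2ball 1" "u k0 \<noteq> 0"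
    and eig: "\<And>k. M *\<^sub>R u k = (\<Sum>j\<in>Q. csc (cnj (q j)) (Ak (k + j) (ell2_op.conv Q q u (k + j))))"
  obtains \<psi> \<psi>x \<psi>y \<psi>xx \<psi>xy x1 y1 where "C1 \<psi> \<psi>x \<psi>y" "C1 \<psi>x \<psi>xx \<psi>xy" "\<psi> x1 y1 \<noteq> 0"
    "\<And>x y. \<psi> (x + 1 / K) y = - \<psi> x y" "\<And>x y. \<psi> (x + a) (y + b) = \<psi> x y"
    "\<And>x y. dir \<psi>x \<psi>y x y = ((norm (\<Sum>j\<in>Q. q j * Em 0 j x y))\<^sup>2 / M) *\<^sub>R \<psi> x y"
proof -
  interpret ell2_op Q q Ak \<delta> by (rule el)
  obtain C where C: "0 < C" "\<And>k. \<bar>nu k\<bar> \<le> C * wt k" "\<And>k. \<bar>eta k\<bar> \<le> C * wt k" "\<And>k. wt k \<le> C * norm (om k)"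
    using freq_bounds by metis
  have AkC: "norm (Ak k s) * wt k \<le> C * norm s" for k s
    using mult_left_mono[OF C(4), of "norm s" k] om_nonzero[of k] by (simp add: norm_Ak field_simps)
  \<comment> \<open>The spinor is built from \<open>c\<close>, the inverse Dirac operator applied to
    \<open>q u\<close>, and not from \<open>u\<close>. Then \<open>D \<psi>\<close> is
    \<open>q u\<close>, and \<open>u\<close> is \<open>cnj q c / M\<close>, which gives the
    potential \<open>|q|^2 / M\<close>.\<close>
  define c where "c k = Ak k (conv u k)" for k
  have uc: "u k = inverse M *\<^sub>R (\<Sum>j\<in>Q. csc (cnj (q j)) (c (k + j)))" for k
    using M arg_cong[OF eig[of k], of "\<lambda>s. inverse M *\<^sub>R s"] by (simp add: c_def)
  \<comment> \<open>Bootstrapping: one passage from \<open>c\<close> to \<open>u\<close> and back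
    costs constants, but the factor \<open>Ak\<close> gains a power of \<open>wt\<close>.\<close>
  have dec: "\<exists>D. \<forall>k. norm (c k) * wt k ^ n \<le> D" for n
  proof (induction n)
    case 0
    have "norm (c k) \<le> C * sqrt (CC * 1)" for k
    proof -
      have "norm (conv u k) \<le> sqrt (CC * 1)"
        using l2ballD[OF conv_l2ball[OF u(1)], of "{k}"] by (intro real_le_rsqrt) simp
      then have "C * norm (conv u k) \<le> C * sqrt (CC * 1)" using C by (intro mult_left_mono) auto
      moreover have "norm (c k) * 1 \<le> norm (c k) * wt k" by (intro mult_left_mono wt_ge1) auto
      ultimately show ?thesis using AkC[of k "conv u k"] by (simp add: c_def)
    qed
    then show ?case by auto
  next
    case (Suc n)
    then obtain D where D: "\<And>k. norm (c k) * wt k ^ n \<le> D" by blast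
    define L where "L i = (\<Sum>j\<in>Q. norm (q j) * (D * wt (i - j) ^ n))" for i
    have w0: "0 \<le> wt k" for k using wt_ge1[of k] by simp
    have uD: "norm (u (k - i)) * wt k ^ n \<le> L i" for k i
    proof -
      have "norm (u (k - i)) \<le> 1 * norm (\<Sum>j\<in>Q. csc (cnj (q j)) (c (k - i + j)))"
        unfolding uc norm_scaleR using M by (intro mult_right_mono) (auto simp: field_simps)
      also have "\<dots> \<le> (\<Sum>j\<in>Q. norm (q j) * norm (c (k - i + j)))"
        by (simp add: order_trans[OF norm_sum] norm_csc)
      finally have "norm (u (k - i)) * wt k ^ n \<le> (\<Sum>j\<in>Q. norm (q j) * norm (c (k - i + j))) * wt k ^ n"
        using w0 by (intro mult_right_mono) auto
      also have "\<dots> = (\<Sum>j\<in>Q. norm (q j) * (norm (c (k - i + j)) * wt k ^ n))" by (simp add: sum_distrib_right mult.assoc)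
      also have "\<dots> \<le> L i" unfolding L_def
      proof (intro sum_mono mult_left_mono)
        fix j
        have "wt k ^ n \<le> (wt (k - i + j) * wt (i - j)) ^ n"
          using wt_submult[of "k - i + j" "i - j"] w0 by (intro power_mono) auto
        then have "norm (c (k - i + j)) * wt k ^ n \<le> norm (c (k - i + j)) * (wt (k - i + j) ^ n * wt (i - j) ^ n)"
          by (intro mult_left_mono) (auto simp: power_mult_distrib)
        also have "\<dots> \<le> D * wt (i - j) ^ n"
          unfolding mult.assoc[symmetric] using w0 by (intro mult_right_mono D) auto
        finally show "norm (c (k - i + j)) * wt k ^ n \<le> D * wt (i - j) ^ n" .
      qed auto
      finally show ?thesis .
    qed
    have "norm (c k) * wt k ^ Suc n \<le> C * (\<Sum>i\<in>Q. norm (q i) * L i)" for k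
    proof -
      have "norm (c k) * wt k ^ Suc n = norm (c k) * wt k * wt k ^ n" by simp
      also have "\<dots> \<le> C * norm (conv u k) * wt k ^ n"
        unfolding c_def using w0 AkC by (intro mult_right_mono) auto
      also have "\<dots> \<le> C * (\<Sum>i\<in>Q. norm (q i) * norm (u (k - i))) * wt k ^ n"
        using C(1) w0 by (intro mult_left_mono mult_right_mono)
          (auto simp: conv_def intro!: order_trans[OF norm_sum] simp: norm_csc)
      also have "\<dots> = C * (\<Sum>i\<in>Q. norm (q i) * (norm (u (k - i)) * wt k ^ n))"
        by (simp add: sum_distrib_right mult.assoc)
      also have "\<dots> \<le> C * (\<Sum>i\<in>Q. norm (q i) * L i)"
        using C(1) uD by (intro mult_left_mono sum_mono) auto
      finally show ?thesis .
    qed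
    then show ?case by blast
  qed
  have sc: "(\<lambda>k. wt k ^ n * norm (c k)) summable_on UNIV" for n
    using dec[of "n + 4"] sum_wt_bound_summable by metis
  have sc0: "(\<lambda>k. norm (c k)) summable_on UNIV" using sc[of 0] by simp
  have sc1: "(\<lambda>k. wt k * norm (c k)) summable_on UNIV" using sc[of 1] by simp
  have sc2: "(\<lambda>k. wt k * norm (csc (\<i> * nu k) (c k))) summable_on UNIV"
  proof (rule summable_on_comparison_test[OF summable_on_cmult_right[OF sc[of 2], of C]])
    fix k
    have "\<bar>nu k\<bar> * (wt k * norm (c k)) \<le> C * wt k * (wt k * norm (c k))"
      using C(2)[of k] wt_ge1[of k] by (intro mult_right_mono) auto
    then show "wt k * norm (csc (\<i> * nu k) (c k)) \<le> C * (wt k ^ 2 * norm (c k))"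
      by (simp add: norm_csc norm_mult power2_eq_square mult_ac)
    show "0 \<le> wt k * norm (csc (\<i> * nu k) (c k))" using wt_ge1[of k] by simp
  qed
  have su: "(\<lambda>k. norm (u k)) summable_on UNIV"
  proof (rule summable_on_comparison_test)
    show "(\<lambda>k. \<Sum>j\<in>Q. norm (q j) * norm (c (k + j))) summable_on UNIV"
    proof (rule has_sum_imp_summable[OF has_sum_sum_finite[OF has_sum_infsum[OF summable_on_cmult_right]]])
      fix j :: "int \<times> int"
      have "bij_betw (\<lambda>k. k + j) UNIV UNIV" by (rule bij_betwI[of _ _ _ "\<lambda>k. k - j"]) auto
      from summable_on_reindex_bij_betw[OF this, of "\<lambda>k. norm (c k)"]
      show "(\<lambda>k. norm (c (k + j))) summable_on UNIV" using sc0 by blast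
    qed
    fix k
    have "norm (u k) \<le> 1 * norm (\<Sum>j\<in>Q. csc (cnj (q j)) (c (k + j)))"
      unfolding uc norm_scaleR using M by (intro mult_right_mono) (auto simp: field_simps)
    also have "\<dots> \<le> (\<Sum>j\<in>Q. norm (q j) * norm (c (k + j)))"
      by (simp add: order_trans[OF norm_sum] norm_csc)
    finally show "norm (u k) \<le> (\<Sum>j\<in>Q. norm (q j) * norm (c (k + j)))" .
  qed simp
  define qf where "qf x y = (\<Sum>j\<in>Q. q j * Em 0 j x y)" for x y
  note sums = SF_has_sum[OF sc0] SF_has_sum[OF su]
  have SFu: "SF u x y = inverse M *\<^sub>R csc (cnj (qf x y)) (SF c x y)" for x y
  proof -
    have "((\<lambda>k. \<Sum>j\<in>Q. csc (Em (1/2) k x y) (csc (cnj (q j)) (c (k - (- j))))) has_sum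
       (\<Sum>j\<in>Q. csc (cnj (q j) * Em 0 (- j) x y) (SF c x y))) UNIV"
      by (rule has_sum_sum_finite) (rule SF_shift[OF sc0])
    from has_sum_bounded_linear[OF bounded_linear_scaleR_right this, of "inverse M"]
    have "((\<lambda>k. csc (Em (1/2) k x y) (u k)) has_sum inverse M *\<^sub>R (\<Sum>j\<in>Q. csc (cnj (q j) * Em 0 (- j) x y) (SF c x y))) UNIV"
      by (simp add: uc csc_simps csc_sum)
    moreover have "(\<Sum>j\<in>Q. csc (cnj (q j) * Em 0 (- j) x y) (SF c x y)) = csc (cnj (qf x y)) (SF c x y)"
      by (simp add: qf_def csc_sum Em_def E_cnj)
    ultimately show ?thesis using has_sum_unique[OF sums(2)] by metis
  qed
  define \<psi> where "\<psi> = SF c"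
  define \<psi>x where "\<psi>x = SF (\<lambda>k. csc (\<i> * nu k) (c k))"
  define \<psi>y where "\<psi>y = SF (\<lambda>k. csc (\<i> * eta k) (c k))"
  have C1: "C1 \<psi> \<psi>x \<psi>y" unfolding \<psi>_def \<psi>x_def \<psi>y_def by (rule C1_SF[OF sc1])
  have C2: "C1 \<psi>x (SF (\<lambda>k. csc (\<i> * nu k) (csc (\<i> * nu k) (c k)))) (SF (\<lambda>k. csc (\<i> * eta k) (csc (\<i> * nu k) (c k))))"
    unfolding \<psi>x_def by (rule C1_SF[OF sc2])
  obtain k1 where k1: "c k1 \<noteq> 0"
  proof -
    have "\<exists>k. c k \<noteq> 0"
    proof (rule ccontr)
      assume "\<not> ?thesis"
      then have "c = (\<lambda>_. 0)" by auto
      then show False using u(2) uc[of k0] by (simp add: csc_simps)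
    qed
    then show ?thesis using that by blast
  qed
  obtain x1 y1 where nz: "\<psi> x1 y1 \<noteq> 0" unfolding \<psi>_def using SF_nonzero[OF sc0 k1] by blast
  have anti: "\<psi> (x + 1 / K) y = - \<psi> x y" and per: "\<psi> (x + a) (y + b) = \<psi> x y" for x y
    by (simp_all add: \<psi>_def SF_def Em_shift csc_lin infsum_uminus)
  have eq: "dir \<psi>x \<psi>y x y = ((norm (qf x y))\<^sup>2 / M) *\<^sub>R \<psi> x y" for x y
  proof -
    have s1: "(\<lambda>k. norm (csc (\<i> * nu k) (c k))) summable_on UNIV"
    proof (rule summable_on_comparison_test[OF sc2])
      show "norm (csc (\<i> * nu k) (c k)) \<le> wt k * norm (csc (\<i> * nu k) (c k))" for k
        using mult_right_mono[OF wt_ge1 norm_ge_zero, of "csc (\<i> * nu k) (c k)" k] by simp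
    qed simp
    have s2: "(\<lambda>k. norm (csc (\<i> * eta k) (c k))) summable_on UNIV"
    proof (rule summable_on_comparison_test[OF summable_on_cmult_right[OF sc1, of C]])
      show "norm (csc (\<i> * eta k) (c k)) \<le> C * (wt k * norm (c k))" for k
        using mult_right_mono[OF C(3) norm_ge_zero, of k "c k"] by (simp add: norm_csc norm_mult mult.assoc)
    qed simp
    have "((\<lambda>k. e1 (csc (Em (1/2) k x y) (csc (\<i> * nu k) (c k))) + e2 (csc (Em (1/2) k x y) (csc (\<i> * eta k) (c k)))) has_sum
       (e1 (\<psi>x x y) + e2 (\<psi>y x y))) UNIV"
      unfolding \<psi>x_def \<psi>y_def
      by (intro has_sum_add has_sum_bounded_linear[OF bl_e1] has_sum_bounded_linear[OF bl_e2] SF_has_sum s1 s2)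
    moreover have "e1 (csc (Em (1/2) k x y) (csc (\<i> * nu k) (c k))) + e2 (csc (Em (1/2) k x y) (csc (\<i> * eta k) (c k)))
       = (\<Sum>j\<in>Q. csc (Em (1/2) k x y) (csc (q j) (u (k - j))))" for k
    proof -
      have "e1 (csc (Em (1/2) k x y) (csc (\<i> * nu k) (c k))) + e2 (csc (Em (1/2) k x y) (csc (\<i> * eta k) (c k)))
        = csc (Em (1/2) k x y) (conv u k)"
        unfolding e_csc csc_lin(2)[symmetric] c_def using Ak_inv[of k "conv u k"] by (simp only: e_csc csc_lin)
      then show ?thesis by (simp add: conv_def csc_sum)
    qed
    ultimately have "((\<lambda>k. \<Sum>j\<in>Q. csc (Em (1/2) k x y) (csc (q j) (u (k - j)))) has_sum dir \<psi>x \<psi>y x y) UNIV"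
      by (simp add: dir_def)
    moreover have "((\<lambda>k. \<Sum>j\<in>Q. csc (Em (1/2) k x y) (csc (q j) (u (k - j)))) has_sum (\<Sum>j\<in>Q. csc (q j * Em 0 j x y) (SF u x y))) UNIV"
      by (rule has_sum_sum_finite) (rule SF_shift[OF su])
    ultimately have "dir \<psi>x \<psi>y x y = (\<Sum>j\<in>Q. csc (q j * Em 0 j x y) (SF u x y))" by (rule has_sum_unique)
    also have "\<dots> = csc (qf x y) (SF u x y)" by (simp add: qf_def csc_sum)
    also have "\<dots> = inverse M *\<^sub>R csc (qf x y * cnj (qf x y)) (\<psi> x y)"
      unfolding SFu \<psi>_def csc_simps(6) csc_simps(1) ..
    also have "\<dots> = ((norm (qf x y))\<^sup>2 / M) *\<^sub>R \<psi> x y"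
      unfolding complex_norm_square[symmetric] csc_simps(3) by (simp add: divide_inverse mult.commute)
    finally show ?thesis .
  qed
  show ?thesis by (rule that[OF C1 C2 nz anti per]) (use eq in \<open>simp add: qf_def\<close>)
qed


lemma one_period:
  assumes "\<And>x y. F (x + 1 / K) y = (\<sigma>::real) *\<^sub>R (F x y :: 'a::real_vector)"
  shows "F (x + 1) y = \<sigma> ^ K *\<^sub>R F x y"
proof -
  have "F (x + real n * (1 / K)) y = \<sigma> ^ n *\<^sub>R F x y" for n
  proof (induction n)
    case (Suc n)
    have "x + real (Suc n) * (1 / K) = x + real n * (1 / K) + 1 / K" by (simp add: add_divide_distrib)
    then show ?case using Suc by (simp only: assms) simp
  qed simp
  from this[of K] show ?thesis using K by simp
qed

lemma trig_cont: "trig f \<Longrightarrow> cont2 f"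
  by (induction f rule: trig.induct) (auto intro!: cont2_add cont2_mult cont2_const E_cont simp: Em_def)

text \<open>Let \<open>q\<close> be a trigonometric polynomial with
  \<open>Z \<le> |q|^2 \<le> r Z\<close> and \<open>\<phi> = D \<xi> / q\<close>. If the inequality
  fails, the form of \<open>ell2_op\<close> exceeds the squared norm at \<open>\<phi>\<close>, hence
  also at a nearby trigonometric polynomial. Its top eigenvalue \<open>M\<close> is then larger than
  1, and the eigenvector yields a nonzero solution of \<open>D \<psi> = Z' \<psi>\<close> with
  \<open>Z' = |q|^2 / M \<le> r Z\<close>, against \<open>kernel_trivial_crit\<close>.\<close>

theorem anti_bound:
  assumes cZ: "cont2 Z" and Z: "\<And>x y. 0 < Z x y" "\<And>x y. Z (x + 1 / K) y = Z x y" "\<And>x y. Z (x + a) (y + b) = Z x y"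
    and r: "1 < r" and v: "\<And>y. r * sqrt (xint (\<lambda>x y. (Z x y)\<^sup>2) y) \<le> v y" and cr: "crit K b v"
    and C: "C1 \<xi> \<xi>x \<xi>y" and anti: "\<And>x y. \<xi> (x + 1 / K) y = - \<xi> x y" and per: "\<And>x y. \<xi> (x + a) (y + b) = \<xi> x y"
  shows "II b (\<lambda>x y. inner (dir \<xi>x \<xi>y x y) (\<xi> x y)) \<le> II b (\<lambda>x y. (norm (dir \<xi>x \<xi>y x y))\<^sup>2 / Z x y)"
proof (rule ccontr)
  assume neg: "\<not> ?thesis"
  note c\<xi> = cont2_C1[OF C]
  define d where "d = dir \<xi>x \<xi>y"
  have cd: "cont2 d" unfolding d_def by (intro cont2_dir c\<xi>)
  have K0: "0 < real K" "0 < 1 / real K" using K by auto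
  have anti_d: "\<xi>x (x + 1 / K) y = - \<xi>x x y" "\<xi>y (x + 1 / K) y = - \<xi>y x y" for x y
  proof -
    have "((\<lambda>s. \<xi> (s + 1 / K) y) has_vector_derivative \<xi>x (x + 1 / K) y) (at x)"
      by (rule has_vector_derivative_translate[of "\<lambda>s. \<xi> s y"]) (rule C1_dx[OF C])
    moreover have "((\<lambda>s. - \<xi> s y) has_vector_derivative - \<xi>x x y) (at x)"
      by (intro has_vector_derivative_minus C1_dx[OF C])
    ultimately show "\<xi>x (x + 1 / K) y = - \<xi>x x y" unfolding anti using vector_derivative_unique_at by blast
    have "((\<lambda>s. \<xi> (x + 1 / K) s) has_vector_derivative \<xi>y (x + 1 / K) y) (at y)" by (rule C1_dy[OF C])
    moreover have "((\<lambda>s. - \<xi> x s) has_vector_derivative - \<xi>y x y) (at y)"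
      by (intro has_vector_derivative_minus C1_dy[OF C])
    ultimately show "\<xi>y (x + 1 / K) y = - \<xi>y x y" unfolding anti using vector_derivative_unique_at by blast
  qed
  have per_d: "\<xi>x (x + a) (y + b) = \<xi>x x y" "\<xi>y (x + a) (y + b) = \<xi>y x y" for x y
  proof -
    have "((\<lambda>s. \<xi> (s + a) (y + b)) has_vector_derivative \<xi>x (x + a) (y + b)) (at x)"
      by (rule has_vector_derivative_translate[of "\<lambda>s. \<xi> s (y + b)"]) (rule C1_dx[OF C])
    then show "\<xi>x (x + a) (y + b) = \<xi>x x y" unfolding per using C1_dx[OF C] vector_derivative_unique_at by blast
    have "((\<lambda>s. \<xi> (x + a) (s + b)) has_vector_derivative \<xi>y (x + a) (y + b)) (at y)"
      by (rule has_vector_derivative_translate[of "\<lambda>s. \<xi> (x + a) s"]) (rule C1_dy[OF C])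
    then show "\<xi>y (x + a) (y + b) = \<xi>y x y" unfolding per using C1_dy[OF C] vector_derivative_unique_at by blast
  qed
  have d_anti: "d (x + 1 / K) y = - d x y" and d_per: "d (x + a) (y + b) = d x y" for x y
    by (simp_all add: d_def dir_def anti_d per_d e_lin)
  obtain x0 y0 where zmin: "\<And>x y. Z x0 y0 \<le> Z x y"
    using doubly_periodic_inf[OF cZ Z(2,3) K0(2) b] by blast
  \<comment> \<open>Halfway between \<open>sqrt Z\<close> and \<open>sqrt (r Z)\<close>. As
    \<open>\<epsilon>\<close> is half the least distance between the two, an approximation within
    \<open>\<epsilon>\<close> has its modulus between them.\<close>
  define g where "g x y = complex_of_real (sqrt (Z x y) * (1 + sqrt r) / 2)" for x y
  define \<epsilon> where "\<epsilon> = sqrt (Z x0 y0) * (sqrt r - 1) / 2"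
  have \<epsilon>: "0 < \<epsilon>" using Z(1)[of x0 y0] r by (simp add: \<epsilon>_def)
  have "cont2 g" using cZ unfolding cont2_def g_def by (intro continuous_intros) auto
  moreover have "g (x + 1 / K) y = g x y" "g (x + a) (y + b) = g x y" for x y by (simp_all only: g_def Z)
  ultimately obtain qf where qf: "trig qf" "\<And>x y. norm (g x y - qf x y) < \<epsilon>" using trig_dense[OF _ _ _ \<epsilon>] by blast
  have Zq: "Z x y \<le> (norm (qf x y))\<^sup>2" "(norm (qf x y))\<^sup>2 \<le> r * Z x y" for x y
  proof -
    define s where "s = sqrt (Z x y)"
    have s: "0 < s" "Z x y = s\<^sup>2" "\<epsilon> \<le> s * (sqrt r - 1) / 2"
      using Z(1)[of x y] zmin[of x y] r by (auto simp: s_def \<epsilon>_def less_imp_le intro!: divide_right_mono mult_right_mono)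
    have ng: "norm (g x y) = s * (1 + sqrt r) / 2" unfolding g_def norm_of_real using s r by (simp add: s_def[symmetric])
    have "norm (g x y) - norm (qf x y) < \<epsilon>" "norm (qf x y) - norm (g x y) < \<epsilon>"
      using qf(2)[of x y] norm_triangle_ineq2[of "g x y" "qf x y"] norm_triangle_ineq2[of "qf x y" "g x y"]
      by (auto simp: norm_minus_commute)
    then have "s \<le> norm (qf x y)" "norm (qf x y) \<le> s * sqrt r"
      using s(3) ng by (auto simp: algebra_simps add_divide_distrib diff_divide_distrib)
    then have "s\<^sup>2 \<le> (norm (qf x y))\<^sup>2" "(norm (qf x y))\<^sup>2 \<le> (s * sqrt r)\<^sup>2"
      using s by (auto intro: power_mono)
    then show "Z x y \<le> (norm (qf x y))\<^sup>2" "(norm (qf x y))\<^sup>2 \<le> r * Z x y"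
      using r s by (auto simp: power_mult_distrib mult.commute)
  qed
  have qnz: "qf x y \<noteq> 0" for x y using Zq(1)[of x y] Z(1)[of x y] by auto
  obtain Q q where "finite Q" and "\<And>j. j \<notin> Q \<Longrightarrow> q j = 0"
    and "\<And>x y. qf x y = (\<Sum>j\<in>Q. q j * Em 0 j x y)"
    by (rule trig_repr[OF qf(1)]) blast
  note Q = this(1) this(3)
  have cq: "cont2 qf" using qf(1) by (rule trig_cont)
  have q_per: "qf (x + 1 / K) y = qf x y" "qf (x + a) (y + b) = qf x y" for x y
    by (simp_all add: Q(2) Em_def E_shift)
  define \<phi> where "\<phi> x y = csc (inverse (qf x y)) (d x y)" for x y
  have "cont2 (\<lambda>x y. inverse (qf x y))" using cq qnz unfolding cont2_def by (intro continuous_intros) auto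
  then have c\<phi>: "cont2 \<phi>" unfolding \<phi>_def by (intro cont2_csc cd)
  have \<phi>p: "\<phi> (x + 1 / K) y = - \<phi> x y" "\<phi> (x + a) (y + b) = \<phi> x y" for x y
    by (simp_all add: \<phi>_def q_per d_anti d_per csc_lin)
  have q\<phi>: "csc (qf x y) (\<phi> x y) = d x y" for x y using qnz[of x y] by (simp add: \<phi>_def csc_simps)
  have n\<phi>: "(norm (\<phi> x y))\<^sup>2 = (norm (d x y))\<^sup>2 / (norm (qf x y))\<^sup>2" for x y
    by (simp add: \<phi>_def norm_csc norm_inverse power_mult_distrib divide_inverse power_inverse)
  define \<gamma> where "\<gamma> = II b (\<lambda>x y. inner (d x y) (\<xi> x y)) - II b (\<lambda>x y. (norm (\<phi> x y))\<^sup>2)"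
  have \<gamma>: "0 < \<gamma>"
  proof -
    have "II b (\<lambda>x y. (norm (\<phi> x y))\<^sup>2) \<le> II b (\<lambda>x y. (norm (d x y))\<^sup>2 / Z x y)"
    proof (rule II_mono)
      show "cont2 (\<lambda>x y. (norm (d x y))\<^sup>2 / Z x y)"
        by (intro cont2_divide cont2_power cont2_norm cd cZ) (use Z(1) in \<open>metis less_irrefl\<close>)
      show "(norm (\<phi> x y))\<^sup>2 \<le> (norm (d x y))\<^sup>2 / Z x y" for x y
        unfolding n\<phi> using Zq(1)[of x y] Z(1)[of x y] by (intro divide_left_mono mult_pos_pos) auto
    qed (intro cont2_power cont2_norm c\<phi>)
    then show ?thesis using neg unfolding \<gamma>_def d_def by linarith
  qed
  obtain B1 where B1: "1 \<le> B1" "\<And>x y. norm (\<xi> x y) \<le> B1"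
    using doubly_periodic_bounded[of \<xi> "1 / K" a b] c\<xi>(1) anti per K0 b by auto
  obtain B2 where B2: "1 \<le> B2" "\<And>x y. norm (\<phi> x y) \<le> B2"
    using doubly_periodic_bounded[of \<phi> "1 / K" a b] c\<phi> \<phi>p K0 b by auto
  obtain B3 where B3: "1 \<le> B3" "\<And>x y. norm (d x y) \<le> B3"
    using doubly_periodic_bounded[of d "1 / K" a b] cd d_anti d_per K0 b by auto
  obtain B4 where B4: "1 \<le> B4" "\<And>x y. norm (qf x y) \<le> B4"
    using doubly_periodic_bounded[of qf "1 / K" a b] cq q_per K0 b by auto
  obtain Cf where Cf: "0 < Cf" "\<And>k. wt k \<le> Cf * norm (om k)" using freq_bounds by metis
  have AkC: "norm (Ak k s) \<le> Cf * norm s" for k s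
  proof -
    have "1 \<le> Cf * norm (om k)" using Cf(2)[of k] wt_ge1[of k] by linarith
    from mult_right_mono[OF this norm_ge_zero[of s]] show ?thesis
      using om_nonzero[of k] by (simp add: norm_Ak field_simps)
  qed
  \<comment> \<open>Collects the constants of \<open>est_p\<close> and \<open>est_G\<close>, so that
    the total error \<open>e D\<close> stays below the deficit \<open>\<gamma>\<close>.\<close>
  define D where "D = b * (2 * B2 + 1) + B4 * (b * (B1 + 1) + Cf\<^sup>2 * (b * (B3 + B4)\<^sup>2))"
  have D: "0 < D" unfolding D_def using B1(1) B2(1) B3(1) B4(1) b by (intro add_pos_nonneg mult_pos_pos mult_nonneg_nonneg add_nonneg_nonneg) auto
  define e where "e = min 1 (\<gamma> / (2 * D))"
  have e: "0 < e" "e \<le> 1" "e * D < \<gamma>"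
  proof -
    show "0 < e" "e \<le> 1" using \<gamma> D by (auto simp: e_def)
    have "e * D \<le> \<gamma> / (2 * D) * D" using D by (intro mult_right_mono) (auto simp: e_def)
    also have "\<dots> < \<gamma>" using \<gamma> D by simp
    finally show "e * D < \<gamma>" .
  qed
  obtain S u where S: "finite S" "\<And>k. k \<notin> S \<Longrightarrow> u k = 0" "\<And>x y. norm (\<phi> x y - tp S u x y) < e"
    using tp_dense[OF c\<phi> \<phi>p e(1)] by blast
  obtain n where n: "S \<union> (\<lambda>(j, k). k + j) ` (Q \<times> S) \<subseteq> ibox n"
    using finite_subset_ibox[of "S \<union> (\<lambda>(j, k). k + j) ` (Q \<times> S)"] S(1) Q(1) by blast
  obtain \<delta> where el: "ell2_op Q Ak \<delta>" using ell2_Ak[OF Q(1)] by blast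
  interpret ell2_op Q q Ak \<delta> by (rule el)
  define p where "p = tp S u"
  have pbox: "p = tp (ibox n) u"
  proof (intro ext)
    fix x y show "p x y = tp (ibox n) u x y" unfolding p_def tp_def
      by (rule sum.mono_neutral_left) (use n S in \<open>auto simp: csc_simps\<close>)
  qed
  have conv0: "conv u l = 0" if "l \<notin> ibox n" for l
  proof -
    have "u (l - j) = 0" if j: "j \<in> Q" for j
    proof (rule S(2), rule notI)
      assume "l - j \<in> S"
      moreover have "\<forall>k\<in>S. k + j \<in> ibox n" using n j by (auto simp: image_subset_iff)
      ultimately have "(l - j) + j \<in> ibox n" by blast
      then show False using \<open>l \<notin> ibox n\<close> by simp
    qed
    then show ?thesis by (simp add: conv_def csc_simps)
  qed
  have qp: "csc (qf x y) (p x y) = tp (ibox n) (conv u) x y" for x y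
    unfolding p_def Q(2) conv_def[abs_def] by (rule trig_mult_tp[symmetric]) (use S n in auto)
  define c where "c k = Ak k (conv u k)" for k
  define \<zeta> where "\<zeta> = tp (ibox n) c"
  define \<zeta>x where "\<zeta>x = tp (ibox n) (\<lambda>k. csc (\<i> * nu k) (c k))"
  define \<zeta>y where "\<zeta>y = tp (ibox n) (\<lambda>k. csc (\<i> * eta k) (c k))"
  have C\<zeta>: "C1 \<zeta> \<zeta>x \<zeta>y" unfolding \<zeta>_def \<zeta>x_def \<zeta>y_def by (rule C1_tp)
  have d\<zeta>: "dir \<zeta>x \<zeta>y x y = csc (qf x y) (p x y)" for x y
    unfolding qp \<zeta>x_def \<zeta>y_def c_def by (rule fun_cong[OF fun_cong[OF dir_tp]])
  have c\<zeta>: "cont2 \<zeta>" and cp: "cont2 p" unfolding \<zeta>_def p_def by (rule tp_cont)+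
  have cqp: "cont2 (\<lambda>x y. csc (qf x y) (p x y))" by (intro cont2_csc cq cp)
  have close: "norm (\<phi> x y - p x y) \<le> e" for x y using S(3)[of x y] by (simp add: p_def less_imp_le)
  have dqp: "norm (d x y - csc (qf x y) (p x y)) \<le> B4 * e" for x y
  proof -
    have "d x y - csc (qf x y) (p x y) = csc (qf x y) (\<phi> x y - p x y)" by (simp add: csc_lin q\<phi>)
    then have "norm (d x y - csc (qf x y) (p x y)) = norm (qf x y) * norm (\<phi> x y - p x y)" by (simp add: norm_csc)
    also have "\<dots> \<le> B4 * e" using B4 close by (intro mult_mono) auto
    finally show ?thesis .
  qed
  have est_p: "II b (\<lambda>x y. (norm (p x y))\<^sup>2) \<le> II b (\<lambda>x y. (norm (\<phi> x y))\<^sup>2) + e * (b * (2 * B2 + 1))"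
  proof -
    have "II b (\<lambda>x y. (norm (p x y))\<^sup>2) \<le> II b (\<lambda>x y. (norm (\<phi> x y))\<^sup>2 + e * (2 * B2 + 1))"
    proof (rule II_mono)
      fix x y
      have "norm (p x y) \<le> norm (\<phi> x y) + e"
        using close[of x y] norm_triangle_ineq2[of "p x y" "\<phi> x y"] by (simp add: norm_minus_commute)
      then have "(norm (p x y))\<^sup>2 \<le> (norm (\<phi> x y) + e)\<^sup>2" by (intro power_mono) auto
      also have "\<dots> = (norm (\<phi> x y))\<^sup>2 + e * (2 * norm (\<phi> x y) + e)" by (simp add: power2_eq_square algebra_simps)
      also have "\<dots> \<le> (norm (\<phi> x y))\<^sup>2 + e * (2 * B2 + 1)"
        using e B2(2)[of x y] by (intro add_left_mono mult_left_mono) auto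
      finally show "(norm (p x y))\<^sup>2 \<le> (norm (\<phi> x y))\<^sup>2 + e * (2 * B2 + 1)" .
    qed (intro cont2_power cont2_norm cont2_add cont2_const cp c\<phi>)+
    also have "\<dots> = II b (\<lambda>x y. (norm (\<phi> x y))\<^sup>2) + e * (b * (2 * B2 + 1))"
      using b by (subst II_add) (simp_all add: II_const cont2_const cont2_power cont2_norm c\<phi>)
    finally show ?thesis .
  qed
  have est_\<zeta>: "II b (\<lambda>x y. (norm (\<zeta> x y))\<^sup>2) \<le> Cf\<^sup>2 * (b * (B3 + B4)\<^sup>2)"
  proof -
    have "II b (\<lambda>x y. (norm (\<zeta> x y))\<^sup>2) = b * (\<Sum>k\<in>ibox n. (norm (c k))\<^sup>2)"
      unfolding power2_norm_eq_inner \<zeta>_def by (rule parseval) simp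
    also have "\<dots> \<le> b * (\<Sum>k\<in>ibox n. Cf\<^sup>2 * (norm (conv u k))\<^sup>2)"
    proof (intro mult_left_mono sum_mono)
      fix k
      have "(norm (c k))\<^sup>2 \<le> (Cf * norm (conv u k))\<^sup>2" unfolding c_def by (intro power_mono AkC) simp
      then show "(norm (c k))\<^sup>2 \<le> Cf\<^sup>2 * (norm (conv u k))\<^sup>2" by (simp add: power_mult_distrib)
    qed (use b in simp)
    also have "\<dots> = Cf\<^sup>2 * (b * (\<Sum>k\<in>ibox n. inner (conv u k) (conv u k)))"
      by (simp add: sum_distrib_left power2_norm_eq_inner mult_ac)
    also have "b * (\<Sum>k\<in>ibox n. inner (conv u k) (conv u k)) = II b (\<lambda>x y. (norm (csc (qf x y) (p x y)))\<^sup>2)"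
      unfolding qp power2_norm_eq_inner by (rule parseval[symmetric]) simp
    also have "Cf\<^sup>2 * \<dots> \<le> Cf\<^sup>2 * II b (\<lambda>_ _. (B3 + B4)\<^sup>2)"
    proof (intro mult_left_mono II_mono cont2_power cont2_norm cqp cont2_const power_mono)
      fix x y
      have "norm (csc (qf x y) (p x y)) \<le> norm (d x y) + norm (d x y - csc (qf x y) (p x y))"
        using norm_triangle_ineq4[of "d x y" "d x y - csc (qf x y) (p x y)"] by simp
      also have "\<dots> \<le> B3 + B4 * 1" using B3(2)[of x y] dqp[of x y] mult_left_mono[OF e(2), of B4] B4(1) by linarith
      finally show "norm (csc (qf x y) (p x y)) \<le> B3 + B4" by simp
    qed auto
    also have "\<dots> = Cf\<^sup>2 * (b * (B3 + B4)\<^sup>2)" using b by (simp add: II_const)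
    finally show ?thesis .
  qed
  have \<sigma>: "(-1) ^ K * (-1) ^ K = (1::real)" by (simp flip: power_mult_distrib)
  \<comment> \<open>\<open>\<zeta>\<close> solves \<open>D \<zeta> = q p\<close>. By symmetry the
    error in the form equals
    \<open>\<integral> \<langle>D \<xi> - q p, \<xi> + \<zeta>\<rangle>\<close>, which is small
    without a Fourier expansion of \<open>\<xi>\<close>.\<close>
  have sym: "II b (\<lambda>x y. inner (csc (qf x y) (p x y)) (\<xi> x y)) = II b (\<lambda>x y. inner (\<zeta> x y) (d x y))"
  proof -
    have "II b (\<lambda>x y. inner (dir \<zeta>x \<zeta>y x y) (\<xi> x y)) = II b (\<lambda>x y. inner (\<zeta> x y) (dir \<xi>x \<xi>y x y))"
    proof (rule dir_symmetric[OF C\<zeta> C _ _ \<sigma>])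
      show "\<zeta> (x + 1) y = (-1) ^ K *\<^sub>R \<zeta> x y" for x y by (rule one_period) (simp add: \<zeta>_def tp_shift)
      show "\<xi> (x + 1) y = (-1) ^ K *\<^sub>R \<xi> x y" for x y by (rule one_period) (simp add: anti)
      show "\<zeta> (x + a) (y + b) = \<zeta> x y" for x y by (simp add: \<zeta>_def tp_shift)
    qed (use per b in auto)
    then show ?thesis by (simp add: d\<zeta> d_def)
  qed
  have est_G: "II b (\<lambda>x y. inner (d x y) (\<xi> x y)) - II b (\<lambda>x y. inner (csc (qf x y) (p x y)) (\<zeta> x y))
     \<le> e * (B4 * (b * (B1 + 1) + Cf\<^sup>2 * (b * (B3 + B4)\<^sup>2)))"
  proof -
    define h where "h x y = d x y - csc (qf x y) (p x y)" for x y
    have ch: "cont2 h" unfolding h_def by (intro cont2_diff cd cqp)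
    have "II b (\<lambda>x y. inner (d x y) (\<xi> x y)) - II b (\<lambda>x y. inner (csc (qf x y) (p x y)) (\<zeta> x y))
      = (II b (\<lambda>x y. inner (d x y) (\<xi> x y)) - II b (\<lambda>x y. inner (csc (qf x y) (p x y)) (\<xi> x y))) +
        (II b (\<lambda>x y. inner (\<zeta> x y) (d x y)) - II b (\<lambda>x y. inner (csc (qf x y) (p x y)) (\<zeta> x y)))"
      using sym by simp
    also have "\<dots> = II b (\<lambda>x y. inner (d x y) (\<xi> x y) - inner (csc (qf x y) (p x y)) (\<xi> x y)) +
        II b (\<lambda>x y. inner (\<zeta> x y) (d x y) - inner (csc (qf x y) (p x y)) (\<zeta> x y))"
      by (subst (1 2) II_diff) (intro cont2_inner cd c\<xi> cqp c\<zeta> refl)+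
    also have "\<dots> = II b (\<lambda>x y. (inner (d x y) (\<xi> x y) - inner (csc (qf x y) (p x y)) (\<xi> x y)) +
        (inner (\<zeta> x y) (d x y) - inner (csc (qf x y) (p x y)) (\<zeta> x y)))"
      by (rule II_add[symmetric]) (intro cont2_diff cont2_inner cd c\<xi> cqp c\<zeta>)+
    also have "\<dots> = II b (\<lambda>x y. inner (h x y) (\<xi> x y + \<zeta> x y))"
    proof -
      have "(inner (d x y) (\<xi> x y) - inner (csc (qf x y) (p x y)) (\<xi> x y)) +
        (inner (\<zeta> x y) (d x y) - inner (csc (qf x y) (p x y)) (\<zeta> x y)) = inner (h x y) (\<xi> x y + \<zeta> x y)" for x y
        by (simp add: h_def inner_diff_left inner_add_right inner_commute[of "\<zeta> x y" "d x y"])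
      then show ?thesis by simp
    qed
    also have "\<dots> \<le> II b (\<lambda>x y. B4 * e * ((B1 + 1) + (norm (\<zeta> x y))\<^sup>2))"
    proof (rule II_mono)
      fix x y
      have "inner (h x y) (\<xi> x y + \<zeta> x y) \<le> norm (h x y) * norm (\<xi> x y + \<zeta> x y)" by (rule norm_cauchy_schwarz)
      also have "\<dots> \<le> B4 * e * ((B1 + 1) + (norm (\<zeta> x y))\<^sup>2)"
      proof (intro mult_mono)
        show "norm (h x y) \<le> B4 * e" unfolding h_def by (rule dqp)
        have "norm (\<zeta> x y) \<le> 1 + (norm (\<zeta> x y))\<^sup>2"
          using sum_power2_ge_zero[of "norm (\<zeta> x y) - 1" "norm (\<zeta> x y)"] by (simp add: power2_eq_square algebra_simps)
        then show "norm (\<xi> x y + \<zeta> x y) \<le> (B1 + 1) + (norm (\<zeta> x y))\<^sup>2"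
          using norm_triangle_ineq[of "\<xi> x y" "\<zeta> x y"] B1(2)[of x y] by linarith
      qed (use B4 e in auto)
      finally show "inner (h x y) (\<xi> x y + \<zeta> x y) \<le> B4 * e * ((B1 + 1) + (norm (\<zeta> x y))\<^sup>2)" .
    qed (intro cont2_inner cont2_add cont2_mult cont2_const cont2_power cont2_norm ch c\<xi> c\<zeta>)+
    also have "\<dots> = B4 * e * (b * (B1 + 1) + II b (\<lambda>x y. (norm (\<zeta> x y))\<^sup>2))"
      using b by (subst II_cmult, subst II_add) (simp_all add: II_const cont2_const cont2_power cont2_norm c\<zeta>)
    also have "\<dots> \<le> B4 * e * (b * (B1 + 1) + Cf\<^sup>2 * (b * (B3 + B4)\<^sup>2))"
      using est_\<zeta> B4 e by (intro mult_left_mono) auto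
    finally show ?thesis by (simp add: mult_ac)
  qed
  have "II b (\<lambda>x y. (norm (p x y))\<^sup>2) < II b (\<lambda>x y. inner (csc (qf x y) (p x y)) (\<zeta> x y))"
    using est_p est_G e(3) unfolding \<gamma>_def D_def by (simp add: distrib_left)
  also have "II b (\<lambda>x y. inner (csc (qf x y) (p x y)) (\<zeta> x y)) = b * GN n u"
    unfolding qp \<zeta>_def GN_def by (subst parseval) (simp_all add: c_def inner_commute)
  also have "II b (\<lambda>x y. (norm (p x y))\<^sup>2) = b * (\<Sum>k\<in>ibox n. (norm (u k))\<^sup>2)"
    unfolding pbox power2_norm_eq_inner by (rule parseval) simp
  finally have lt: "(\<Sum>k\<in>ibox n. (norm (u k))\<^sup>2) < GN n u" using b by simp
  have "{k. u k \<noteq> 0} \<subseteq> S" using S(2) by blast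
  then have fin: "finite {k. u k \<noteq> 0}" using S(1) by (rule finite_subset)
  have "GN m u = GN n u" if "n \<le> m" for m
    unfolding GN_def
  proof (rule sum.mono_neutral_right[OF _ ibox_mono[OF that]])
    show "\<forall>k\<in>ibox m - ibox n. inner (Ak k (conv u k)) (conv u k) = 0" using conv0 by simp
  qed simp
  then have "\<forall>\<^sub>F m in sequentially. GN m u = GN n u" unfolding eventually_sequentially by blast
  then have "(\<lambda>m. GN m u) \<longlonglongrightarrow> GN n u" by (rule tendsto_eventually)
  then have Gn: "G u = GN n u" unfolding G_def by (rule limI)
  have "(\<Sum>k | u k \<noteq> 0. (norm (u k))\<^sup>2) \<le> (\<Sum>k\<in>ibox n. (norm (u k))\<^sup>2)"
  proof (rule sum_mono2)
    show "{k. u k \<noteq> 0} \<subseteq> ibox n" using n \<open>{k. u k \<noteq> 0} \<subseteq> S\<close> by blast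
  qed simp_all
  then have "(\<Sum>k | u k \<noteq> 0. (norm (u k))\<^sup>2) < G u" using lt Gn by simp
  note big = this
  obtain M w where M: "1 < M" "w \<in> l2ball 1" "\<exists>k. w k \<noteq> 0"
    "\<And>k. M *\<^sub>R w k = (\<Sum>j\<in>Q. csc (cnj (q j)) (Ak (k + j) (conv w (k + j))))"
    by (rule top_eigenvector[OF fin big]) (rule that)
  obtain k0 where k0: "w k0 \<noteq> 0" using M(3) by blast
  obtain \<psi> \<psi>x \<psi>y \<psi>xx \<psi>xy x1 y1 where \<psi>: "C1 \<psi> \<psi>x \<psi>y" "C1 \<psi>x \<psi>xx \<psi>xy" "\<psi> x1 y1 \<noteq> 0"
    "\<And>x y. \<psi> (x + 1 / K) y = - \<psi> x y" "\<And>x y. \<psi> (x + a) (y + b) = \<psi> x y"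
    "\<And>x y. dir \<psi>x \<psi>y x y = ((norm (\<Sum>j\<in>Q. q j * Em 0 j x y))\<^sup>2 / M) *\<^sub>R \<psi> x y"
    by (rule kernel_exists[OF el M(1,2) k0 M(4)]) (rule that)
  define Z' where "Z' x y = (norm (qf x y))\<^sup>2 / M" for x y
  have cZ': "cont2 Z'" unfolding Z'_def using M(1) by (intro cont2_divide cont2_power cont2_norm cq cont2_const) auto
  interpret sk: spin_kernel K a b \<psi> \<psi>x \<psi>y \<psi>xx \<psi>xy Z'
  proof
    show "Z' (x + a) (y + b) = Z' x y" for x y by (simp only: Z'_def q_per)
    show "Z' (x + 1) y = Z' x y" for x y
      using one_period[of qf 1] by (simp add: Z'_def q_per)
  qed (use K b \<psi> cZ' M in \<open>auto simp: Z'_def q_per dir_def Q(2)\<close>)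
  have "sk.zh y \<le> v y" for y
  proof -
    have "xint (\<lambda>x y. (Z' x y)\<^sup>2) y \<le> xint (\<lambda>x y. (r * Z x y)\<^sup>2) y"
    proof (rule xint_mono[OF cont2_power[OF cZ'] cont2_power[OF cont2_mult[OF cont2_const cZ]]])
      fix x
      have "Z' x y \<le> (norm (qf x y))\<^sup>2 / 1" unfolding Z'_def using M(1) by (intro divide_left_mono) auto
      then have "Z' x y \<le> r * Z x y" using Zq(2)[of x y] by simp
      then show "(Z' x y)\<^sup>2 \<le> (r * Z x y)\<^sup>2" using M(1) by (intro power_mono) (auto simp: Z'_def)
    qed
    also have "\<dots> = r\<^sup>2 * xint (\<lambda>x y. (Z x y)\<^sup>2) y" by (simp add: power_mult_distrib xint_def)
    finally have "sk.zh y \<le> sqrt (r\<^sup>2 * xint (\<lambda>x y. (Z x y)\<^sup>2) y)" unfolding sk.zh_def by (rule real_sqrt_le_mono)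
    then show ?thesis using v[of y] r by (simp add: real_sqrt_mult)
  qed
  then show False by (rule sk.kernel_trivial_crit[OF \<psi>(3) _ cr])
qed

end

section \<open>Weights of small period\<close>

text \<open>A Riccati argument. \<open>\<theta>\<close> with \<open>\<theta>' = s\<close> stays
  inside \<open>(0, \<pi>)\<close>, and adding the derivative of
  \<open>(f - \<kappa>)^2 cot \<theta>\<close>, whose integral is 0, completes a square. In the
  variable \<open>\<integral> s\<close> this is the Dirichlet form of Wirtinger's inequality on an
  interval shorter than \<pi>.\<close>

lemma weighted_dirichlet:
  fixes f f' s :: "real \<Rightarrow> real"
  assumes pq: "p \<le> q" and df: "\<And>y. (f has_real_derivative f' y) (at y)" and cf': "continuous_on UNIV f'"
    and s: "continuous_on UNIV s" "\<And>y. 0 < s y" and m: "integral {p..q} s < pi" and eq: "f p = \<kappa>" "f q = \<kappa>"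
  shows "integral {p..q} (\<lambda>y. s y * (f y - \<kappa>)\<^sup>2) \<le> integral {p..q} (\<lambda>y. (f' y)\<^sup>2 / s y)"
proof -
  note cs = continuous_on_subset[OF _ subset_UNIV]
  have cf: "continuous_on S f" for S
    by (rule cs) (intro continuous_at_imp_continuous_on ballI DERIV_isCont, rule df)
  have s0: "s y \<noteq> 0" for y using s(2)[of y] by simp
  \<comment> \<open>Half of the missing length, left free at either end so that
    \<open>cot \<theta>\<close> remains finite.\<close>
  define \<eta> where "\<eta> = (pi - integral {p..q} s) / 2"
  define \<theta> where "\<theta> y = \<eta> + integral {p..y} s" for y
  have \<theta>: "0 < \<theta> y" "\<theta> y < pi" if "y \<in> {p..q}" for y
  proof -
    have "0 \<le> integral {p..y} s" by (intro integral_nonneg integrable_continuous_interval cs[OF s(1)]) (use s(2) in \<open>auto intro: less_imp_le\<close>)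
    moreover have "integral {p..y} s \<le> integral {p..q} s"
      by (rule integral_subset_le) (use that s(2) in \<open>auto intro!: integrable_continuous_interval cs[OF s(1)] intro: less_imp_le\<close>)
    ultimately show "0 < \<theta> y" "\<theta> y < pi" using m unfolding \<theta>_def \<eta>_def by (simp_all only: diff_divide_distrib)
  qed
  have d\<theta>: "(\<theta> has_real_derivative s y) (at y within {p..q})" if "y \<in> {p..q}" for y
    unfolding \<theta>_def has_real_derivative_iff_has_vector_derivative
    by (rule derivative_eq_intros integral_has_vector_derivative cs[OF s(1)] that refl)+ simp
  have c\<theta>: "continuous_on {p..q} \<theta>"
    unfolding continuous_on_eq_continuous_within by (blast intro: DERIV_continuous d\<theta>)
  have sin: "sin (\<theta> y) \<noteq> 0" if "y \<in> {p..q}" for y using sin_gt_zero[OF \<theta>[OF that]] by simp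
  define R where "R y = (f y - \<kappa>)\<^sup>2 * cot (\<theta> y)" for y
  define R' where "R' y = 2 * (f y - \<kappa>) * f' y * cot (\<theta> y) - (f y - \<kappa>)\<^sup>2 * (s y / (sin (\<theta> y))\<^sup>2)" for y
  have "(R has_real_derivative R' y) (at y within {p..q})" if y: "y \<in> {p..q}" for y
  proof -
    have "((\<lambda>y. cot (\<theta> y)) has_real_derivative - inverse ((sin (\<theta> y))\<^sup>2) * s y) (at y within {p..q})"
      by (rule DERIV_chain2[OF DERIV_cot[OF sin[OF y]] d\<theta>[OF y]])
    then show ?thesis unfolding R_def R'_def
      by (auto intro!: derivative_eq_intros has_field_derivative_at_within[OF df] simp: divide_inverse)
  qed
  then have "(R' has_integral (R q - R p)) {p..q}"
    by (intro fundamental_theorem_of_calculus pq) (simp flip: has_real_derivative_iff_has_vector_derivative)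
  then have R0: "integral {p..q} R' = 0" using eq by (simp add: R_def integral_unique)
  have ccot: "continuous_on {p..q} (\<lambda>y. cot (\<theta> y))" unfolding cot_def
    by (intro continuous_intros c\<theta>) (use sin in auto)
  have cR': "continuous_on {p..q} R'" unfolding R'_def
    by (intro continuous_intros ccot c\<theta> cf cs[OF cf'] cs[OF s(1)]) (use sin in auto)
  have c1: "continuous_on {p..q} (\<lambda>y. s y * (f y - \<kappa>)\<^sup>2)" "continuous_on {p..q} (\<lambda>y. (f' y)\<^sup>2 / s y)"
    by (intro continuous_intros cf cs[OF cf'] cs[OF s(1)] ballI s0)+
  have "integral {p..q} (\<lambda>y. s y * (f y - \<kappa>)\<^sup>2 + R' y) \<le> integral {p..q} (\<lambda>y. (f' y)\<^sup>2 / s y)"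
  proof (intro integral_le integrable_continuous_interval continuous_on_add c1 cR')
    fix y assume y: "y \<in> {p..q}"
    define u c where "u = f y - \<kappa>" and "c = cot (\<theta> y)"
    have "1 / (sin (\<theta> y))\<^sup>2 = 1 + c\<^sup>2"
      using sin[OF y] sin_cos_squared_add[of "\<theta> y"] by (simp add: c_def cot_def power_divide field_simps)
    then have R: "R' y = 2 * u * f' y * c - u\<^sup>2 * (s y * (1 + c\<^sup>2))"
      by (simp add: R'_def u_def c_def divide_inverse)
    have "0 \<le> (f' y - s y * u * c)\<^sup>2 / s y" using s(2)[of y] by simp
    also have "\<dots> = (f' y)\<^sup>2 / s y - (2 * u * f' y * c - s y * u\<^sup>2 * c\<^sup>2)"
      using s0[of y] by (simp add: power2_eq_square field_simps)
    finally show "s y * (f y - \<kappa>)\<^sup>2 + R' y \<le> (f' y)\<^sup>2 / s y" unfolding R by (simp add: u_def[symmetric] algebra_simps)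
  qed
  then show ?thesis using R0
    by (subst (asm) integral_add) (auto intro!: integrable_continuous_interval c1 cR')
qed

text \<open>Let \<open>T y\<close> be the point that lies half of the total mass of \<open>s\<close>
  after \<open>y\<close>. Then \<open>T (T 0) = b\<close>, so \<open>f (T y) - f y\<close> takes
  opposite values at \<open>0\<close> and at \<open>T 0\<close> and vanishes in between.\<close>

lemma halving_points:
  fixes f s :: "real \<Rightarrow> real"
  assumes b: "0 < b" and cf: "continuous_on UNIV f" and pf: "\<And>y. f (y + b) = f y"
    and s: "continuous_on UNIV s" "\<And>y. 0 < s y" "\<And>y. s (y + b) = s y"
  obtains p q where "p \<le> q" "q \<le> p + b" "f p = f q"
    "integral {p..q} s = integral {0..b} s / 2" "integral {q..p + b} s = integral {0..b} s / 2"
proof -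
  note cs = continuous_on_subset[OF _ subset_UNIV]
  have int: "s integrable_on {u..v}" for u v by (intro integrable_continuous_interval cs[OF s(1)])
  define L where "L = integral {0..b} s"
  \<comment> \<open>The base point -1 leaves room to the left of 0, so that \<open>S\<close> is
    continuous and invertible near every point used.\<close>
  define S where "S y = integral {-1..y} s" for y
  have Sdiff: "integral {u..v} s = S v - S u" if "-1 \<le> u" "u \<le> v" for u v
    using Henstock_Kurzweil_Integration.integral_combine[OF that int] by (simp add: S_def)
  have Spos: "S u < S v" if "-1 \<le> u" "u < v" for u v
  proof -
    have "0 \<le> integral {u..v} s" by (intro integral_nonneg int) (use s(2) in \<open>auto intro: less_imp_le\<close>)
    moreover have "integral {u..v} s \<noteq> 0"
      using integral_eq_0_iff[OF cs[OF s(1)], of u v] that s(2)[of u] by (auto simp: less_imp_le[OF s(2)])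
    ultimately show ?thesis using Sdiff[of u v] that by simp
  qed
  have inj: "inj_on S {-1<..}" 
  proof (rule linorder_inj_onI')
    fix i j :: real assume "i \<in> {-1<..}" "i < j"
    then show "S i \<noteq> S j" using Spos[of i j] by simp
  qed
  have cS: "isCont S y" if "-1 < y" for y
  proof -
    have "continuous_on {-1..y + 1} S" unfolding S_def by (rule indefinite_integral_continuous_1[OF int])
    then show ?thesis by (rule continuous_on_interior) (use that in auto)
  qed
  have Sb: "S (y + b) = S y + L" if "-1 \<le> y" for y
    using Sdiff[of y "y + b"] that b periodic_integral_any[OF s(1) s(3) b, of y] by (simp add: L_def)
  have L: "0 < L" using Sb[of 0] Spos[of 0 b] b by simp
  define g where "g = inv_into {-1<..} S"
  have g: "g (S z) = z" if "-1 < z" for z unfolding g_def by (rule inv_into_f_f[OF inj]) (use that in simp)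
  define T where "T y = g (S y + L / 2)" for y
  have T: "y \<le> T y" "T y \<le> y + b" "S (T y) = S y + L / 2" if y: "0 \<le> y" for y
  proof -
    have "\<exists>z\<ge>y. z \<le> y + b \<and> S z = S y + L / 2"
      by (rule IVT) (use y b L Sb[of y] cS in auto)
    then obtain z where z: "y \<le> z" "z \<le> y + b" "S z = S y + L / 2" by blast
    then have "T y = z" unfolding T_def z(3)[symmetric] using y by (intro g) auto
    then show "y \<le> T y" "T y \<le> y + b" "S (T y) = S y + L / 2" using z by auto
  qed
  have cT: "isCont T y" if y: "0 \<le> y" for y
  proof -
    have "isCont g (S (T y))"
    proof (rule isCont_inverse_function[where f = S and x = "T y" and d = "1/2"])
      fix z assume "\<bar>z - T y\<bar> \<le> 1/2"
      then have "-1 < z" using T(1)[OF y] y by linarith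
      then show "g (S z) = z" "isCont S z" by (simp_all add: g cS)
    qed simp
    then have "isCont g (S y + L / 2)" using T(3)[OF y] by simp
    moreover have "isCont (\<lambda>y. S y + L / 2) y" using cS[of y] y by simp
    ultimately show ?thesis unfolding T_def by (rule isCont_o2[rotated])
  qed
  have icf: "isCont f y" for y using cf by (simp add: continuous_on_eq_continuous_at)
  define h where "h y = f (T y) - f y" for y
  have ch: "isCont h y" if "0 \<le> y" for y
    unfolding h_def using isCont_o2[OF cT[OF that] icf] icf by simp
  have T0: "0 \<le> T 0" using T(1)[of 0] by simp
  have "T (T 0) = b"
  proof -
    have "S (T (T 0)) = S b" using T(3)[OF T0] T(3)[of 0] Sb[of 0] by simp
    moreover have "-1 < T (T 0)" using T(1)[OF T0] T0 by linarith
    ultimately show ?thesis using g[of b] g[of "T (T 0)"] b by simp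
  qed
  then have hT: "h (T 0) = - h 0" using pf[of 0] by (simp add: h_def)
  have "\<exists>p. 0 \<le> p \<and> p \<le> T 0 \<and> h p = 0"
  proof (cases "h 0 \<le> 0")
    case True
    then show ?thesis using IVT[of h 0 0 "T 0"] T0 hT ch by auto
  next
    case False
    then show ?thesis using IVT2[of h "T 0" 0 0] T0 hT ch by auto
  qed
  then obtain p where p: "0 \<le> p" "h p = 0" by blast
  show ?thesis
  proof (rule that[of p "T p"])
    show "integral {p..T p} s = integral {0..b} s / 2" using Sdiff[of p "T p"] T[OF p(1)] p by (simp add: L_def)
    show "integral {T p..p + b} s = integral {0..b} s / 2"
      using Sdiff[of "T p" "p + b"] T[OF p(1)] p Sb[of p] by (simp add: L_def field_simps)
  qed (use T[OF p(1)] p in \<open>auto simp: h_def\<close>)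
qed

text \<open>Wirtinger's inequality on a circle of length below \<open>2 \<pi>\<close> in the
  variable \<open>\<integral> s\<close>. With \<kappa> the common value of \<open>f\<close> at two
  points that halve the circle, it splits into two Dirichlet problems on arcs shorter than
  \<pi>.\<close>

lemma weighted_wirtinger:
  fixes f f' s :: "real \<Rightarrow> real"
  assumes b: "0 < b" and df: "\<And>y. (f has_real_derivative f' y) (at y)" and cf': "continuous_on UNIV f'"
    and pf: "\<And>y. f (y + b) = f y" and s: "continuous_on UNIV s" "\<And>y. 0 < s y" "\<And>y. s (y + b) = s y"
    and L: "integral {0..b} s < 2 * pi"
  shows "\<exists>\<kappa>. integral {0..b} (\<lambda>y. s y * (f y - \<kappa>)\<^sup>2) \<le> integral {0..b} (\<lambda>y. (f' y)\<^sup>2 / s y)"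
proof -
  have cf: "continuous_on UNIV f"
    by (intro continuous_at_imp_continuous_on ballI DERIV_isCont) (rule df)
  have s0: "s y \<noteq> 0" for y using s(2)[of y] by simp
  note cs = continuous_on_subset[OF _ subset_UNIV]
  obtain p q where pq: "p \<le> q" "q \<le> p + b" "f p = f q"
    "integral {p..q} s = integral {0..b} s / 2" "integral {q..p + b} s = integral {0..b} s / 2"
    using halving_points[OF b cf pf s] by metis
  define \<kappa> where "\<kappa> = f p"
  have pf': "f' (y + b) = f' y" for y
  proof -
    have "((\<lambda>t. f (t + b)) has_vector_derivative f' (y + b)) (at y)"
      by (rule has_vector_derivative_translate) (use df in \<open>simp add: has_real_derivative_iff_has_vector_derivative\<close>)
    moreover have "(f has_vector_derivative f' y) (at y)" using df by (simp add: has_real_derivative_iff_has_vector_derivative)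
    ultimately show ?thesis unfolding pf using vector_derivative_unique_at by metis
  qed
  have c1: "continuous_on UNIV (\<lambda>y. s y * (f y - \<kappa>)\<^sup>2)" and c2: "continuous_on UNIV (\<lambda>y. (f' y)\<^sup>2 / s y)"
    by (intro continuous_intros cf cf' s(1) ballI s0)+
  have split: "integral {0..b} g = integral {p..q} g + integral {q..p + b} g"
    if "continuous_on UNIV g" "\<And>y. g (y + b) = g y" for g :: "real \<Rightarrow> real"
    using Henstock_Kurzweil_Integration.integral_combine[OF pq(1,2) integrable_continuous_interval[OF cs[OF that(1)]]]
      periodic_integral_any[OF that b, of p] by simp
  have "integral {p..q} (\<lambda>y. s y * (f y - \<kappa>)\<^sup>2) \<le> integral {p..q} (\<lambda>y. (f' y)\<^sup>2 / s y)"
    by (rule weighted_dirichlet[OF pq(1) df cf' s(1,2)]) (use pq L in \<open>auto simp: \<kappa>_def\<close>)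
  moreover have "integral {q..p + b} (\<lambda>y. s y * (f y - \<kappa>)\<^sup>2) \<le> integral {q..p + b} (\<lambda>y. (f' y)\<^sup>2 / s y)"
    by (rule weighted_dirichlet[OF pq(2) df cf' s(1,2)]) (use pq L pf in \<open>auto simp: \<kappa>_def\<close>)
  ultimately have "integral {0..b} (\<lambda>y. s y * (f y - \<kappa>)\<^sup>2) \<le> integral {0..b} (\<lambda>y. (f' y)\<^sup>2 / s y)"
    unfolding split[OF c1, unfolded pf s, OF refl] split[OF c2, unfolded pf' s, OF refl] by simp
  then show ?thesis by blast
qed

text \<open>The halving points differ from component to component, but the constants still assemble
  into one vector.\<close>

lemma weighted_wirtinger_vector:
  fixes f f' :: "real \<Rightarrow> 'a::euclidean_space" and s :: "real \<Rightarrow> real"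
  assumes b: "0 < b" and df: "\<And>y. (f has_vector_derivative f' y) (at y)" and cf': "continuous_on UNIV f'"
    and pf: "\<And>y. f (y + b) = f y" and s: "continuous_on UNIV s" "\<And>y. 0 < s y" "\<And>y. s (y + b) = s y"
    and L: "integral {0..b} s < 2 * pi"
  shows "\<exists>\<kappa>. integral {0..b} (\<lambda>y. s y * (norm (f y - \<kappa>))\<^sup>2) \<le> integral {0..b} (\<lambda>y. (norm (f' y))\<^sup>2 / s y)"
proof -
  note cs = continuous_on_subset[OF _ subset_UNIV]
  have s0: "s y \<noteq> 0" for y using s(2)[of y] by simp
  have cf: "continuous_on UNIV f"
    by (intro continuous_at_imp_continuous_on ballI has_vector_derivative_continuous) (rule df)
  have "\<exists>\<kappa>. integral {0..b} (\<lambda>y. s y * (inner (f y) i - \<kappa>)\<^sup>2) \<le> integral {0..b} (\<lambda>y. (inner (f' y) i)\<^sup>2 / s y)" for i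
  proof (rule weighted_wirtinger[OF b _ _ _ s L])
    show "((\<lambda>y. inner (f y) i) has_real_derivative inner (f' y) i) (at y)" for y
      unfolding has_real_derivative_iff_has_vector_derivative
      by (rule bounded_linear.has_vector_derivative[OF bounded_linear_inner_left df])
  qed (auto intro!: continuous_intros cf' simp: pf)
  then have "\<forall>i. \<exists>\<kappa>. integral {0..b} (\<lambda>y. s y * (inner (f y) i - \<kappa>)\<^sup>2) \<le> integral {0..b} (\<lambda>y. (inner (f' y) i)\<^sup>2 / s y)"
    by (rule allI)
  from choice[OF this] obtain \<kappa> where \<kappa>: "\<forall>i. integral {0..b} (\<lambda>y. s y * (inner (f y) i - \<kappa> i)\<^sup>2) \<le> integral {0..b} (\<lambda>y. (inner (f' y) i)\<^sup>2 / s y)"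
    by (rule exE)
  define k where "k = (\<Sum>i\<in>Basis. \<kappa> i *\<^sub>R (i :: 'a))"
  have ki: "inner k i = \<kappa> i" if "i \<in> Basis" for i using that by (simp add: k_def)
  have nsq: "(norm v)\<^sup>2 = (\<Sum>i\<in>Basis. (inner v i)\<^sup>2)" for v :: 'a
    unfolding power2_norm_eq_inner by (subst euclidean_inner) (simp add: power2_eq_square)
  have "integral {0..b} (\<lambda>y. s y * (norm (f y - k))\<^sup>2) = (\<Sum>i\<in>Basis. integral {0..b} (\<lambda>y. s y * (inner (f y) i - \<kappa> i)\<^sup>2))"
    unfolding nsq sum_distrib_left
    by (subst integral_sum) (auto intro!: integrable_continuous_interval continuous_intros cs[OF cf] cs[OF s(1)] simp: inner_diff_left ki)
  also have "\<dots> \<le> (\<Sum>i\<in>Basis. integral {0..b} (\<lambda>y. (inner (f' y) i)\<^sup>2 / s y))" by (intro sum_mono) (simp add: \<kappa>)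
  also have "\<dots> = integral {0..b} (\<lambda>y. (norm (f' y))\<^sup>2 / s y)"
    unfolding nsq sum_divide_distrib
    by (subst integral_sum) (auto intro!: integrable_continuous_interval continuous_intros cs[OF cf'] cs[OF s(1)] simp: s0)
  finally show ?thesis by blast
qed

text \<open>The desired inequality for spinors that depend on \<open>y\<close> alone.
  \<open>e2 f'\<close> has integral 0, so a constant may be subtracted from \<open>f\<close>, and
  \<open>2 \<langle>e2 f', f - \<kappa>\<rangle> \<le> |f'|^2 / s + s |f - \<kappa>|^2\<close>. Mass
  exactly \<open>2 \<pi>\<close> is reached by scaling \<open>s\<close> with
  \<open>z < 1\<close>.\<close>

lemma circle_bound:
  fixes f f' :: "real \<Rightarrow> spin" and s :: "real \<Rightarrow> real"
  assumes b: "0 < b" and df: "\<And>y. (f has_vector_derivative f' y) (at y)" and cf': "continuous_on UNIV f'"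
    and pf: "\<And>y. f (y + b) = f y" and s: "continuous_on UNIV s" "\<And>y. 0 < s y" "\<And>y. s (y + b) = s y"
    and L: "integral {0..b} s \<le> 2 * pi"
  shows "integral {0..b} (\<lambda>y. inner (e2 (f' y)) (f y)) \<le> integral {0..b} (\<lambda>y. (norm (f' y))\<^sup>2 / s y)"
proof -
  note cs = continuous_on_subset[OF _ subset_UNIV]
  have cf: "continuous_on UNIV f"
    by (intro continuous_at_imp_continuous_on ballI has_vector_derivative_continuous) (rule df)
  have ce: "continuous_on S (\<lambda>y. e2 (f' y))" for S by (rule bounded_linear.continuous_on[OF bl_e2 cs[OF cf']])
  have strict: "integral {0..b} (\<lambda>y. inner (e2 (f' y)) (f y)) \<le> integral {0..b} (\<lambda>y. (norm (f' y))\<^sup>2 / r y)"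
    if r: "continuous_on UNIV r" "\<And>y. 0 < r y" "\<And>y. r (y + b) = r y" "integral {0..b} r < 2 * pi" for r :: "real \<Rightarrow> real"
  proof -
    have r0: "r y \<noteq> 0" for y using r(2)[of y] by simp
    obtain \<kappa> where \<kappa>: "integral {0..b} (\<lambda>y. r y * (norm (f y - \<kappa>))\<^sup>2) \<le> integral {0..b} (\<lambda>y. (norm (f' y))\<^sup>2 / r y)"
      using weighted_wirtinger_vector[OF b df cf' pf r] by blast
    have c1: "continuous_on {0..b} (\<lambda>y. r y * (norm (f y - \<kappa>))\<^sup>2)" "continuous_on {0..b} (\<lambda>y. (norm (f' y))\<^sup>2 / r y)"
      by (intro continuous_intros cs[OF cf] cs[OF cf'] cs[OF r(1)] ballI r0)+
    have "((\<lambda>y. inner (e2 (f' y)) \<kappa>) has_integral inner (e2 (f b)) \<kappa> - inner (e2 (f 0)) \<kappa>) {0..b}"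
      by (rule fundamental_theorem_of_calculus)
        (use b in \<open>auto intro!: bounded_linear.has_vector_derivative[OF bounded_linear_inner_left]
           bounded_linear.has_vector_derivative[OF bl_e2] has_vector_derivative_at_within[OF df]\<close>)
    then have z: "((\<lambda>y. inner (e2 (f' y)) \<kappa>) has_integral 0) {0..b}" using pf[of 0] by simp
    have "integral {0..b} (\<lambda>y. inner (e2 (f' y)) (f y)) = integral {0..b} (\<lambda>y. inner (e2 (f' y)) (f y - \<kappa>) + inner (e2 (f' y)) \<kappa>)"
      by (simp flip: inner_add_right)
    also have "\<dots> = integral {0..b} (\<lambda>y. inner (e2 (f' y)) (f y - \<kappa>))"
      using z by (subst integral_add) (auto intro!: integrable_continuous_interval continuous_intros ce cs[OF cf] simp: integral_unique)
    also have "\<dots> \<le> integral {0..b} (\<lambda>y. ((norm (f' y))\<^sup>2 / r y + r y * (norm (f y - \<kappa>))\<^sup>2) / 2)"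
    proof (intro integral_le integrable_continuous_interval)
      show "continuous_on {0..b} (\<lambda>y. inner (e2 (f' y)) (f y - \<kappa>))" by (intro continuous_intros ce cs[OF cf])
      show "continuous_on {0..b} (\<lambda>y. ((norm (f' y))\<^sup>2 / r y + r y * (norm (f y - \<kappa>))\<^sup>2) / 2)"
        by (rule continuous_on_divide[OF continuous_on_add[OF c1(2) c1(1)] continuous_on_const]) simp
      fix y
      define A B where "A = norm (f' y)" and "B = norm (f y - \<kappa>)"
      have "inner (e2 (f' y)) (f y - \<kappa>) \<le> A * B"
        using norm_cauchy_schwarz[of "e2 (f' y)" "f y - \<kappa>"] by (simp add: e_norm A_def B_def)
      also have "\<dots> \<le> (A\<^sup>2 / r y + r y * B\<^sup>2) / 2"
      proof -
        have "0 \<le> (A - r y * B)\<^sup>2 / r y" using r(2)[of y] by simp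
        also have "\<dots> = A\<^sup>2 / r y + r y * B\<^sup>2 - 2 * (A * B)" using r0[of y] by (simp add: power2_eq_square field_simps)
        finally show ?thesis by simp
      qed
      finally show "inner (e2 (f' y)) (f y - \<kappa>) \<le> ((norm (f' y))\<^sup>2 / r y + r y * (norm (f y - \<kappa>))\<^sup>2) / 2"
        by (simp add: A_def B_def)
    qed
    also have "\<dots> = (integral {0..b} (\<lambda>y. (norm (f' y))\<^sup>2 / r y) + integral {0..b} (\<lambda>y. r y * (norm (f y - \<kappa>))\<^sup>2)) / 2"
      using c1 by (simp add: integral_add integrable_continuous_interval)
    finally show ?thesis using \<kappa> by simp
  qed
  show ?thesis
  proof (rule field_le_mult_one_interval)
    fix z :: real assume z: "0 < z" "z < 1"
    have L0: "0 \<le> integral {0..b} s"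
      by (intro integral_nonneg integrable_continuous_interval cs[OF s(1)]) (use s(2) in \<open>auto intro: less_imp_le\<close>)
    have "z * integral {0..b} s < 2 * pi"
    proof (cases "integral {0..b} s = 0")
      case False
      then have "z * integral {0..b} s < 1 * integral {0..b} s" using z L0 by (intro mult_strict_right_mono) auto
      then show ?thesis using L by simp
    qed (use pi_gt_zero in simp)
    then have "integral {0..b} (\<lambda>y. inner (e2 (f' y)) (f y)) \<le> integral {0..b} (\<lambda>y. (norm (f' y))\<^sup>2 / (z * s y))"
      using z s by (intro strict) (auto intro!: continuous_intros)
    also have "\<dots> = (1 / z) * integral {0..b} (\<lambda>y. (norm (f' y))\<^sup>2 / s y)"
      by (subst integral_mult_right[symmetric]) (simp add: mult.commute)
    finally show "z * integral {0..b} (\<lambda>y. inner (e2 (f' y)) (f y)) \<le> integral {0..b} (\<lambda>y. (norm (f' y))\<^sup>2 / s y)"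
      using z by (simp add: field_simps)
  qed
qed

text \<open>The cross term is a null Lagrangian: the \<open>x\<close>-derivative of
  \<open>\<langle>\<zeta>, JJ \<zeta>y\<rangle>\<close> minus the \<open>y\<close>-derivative of
  \<open>\<langle>\<zeta>, JJ \<zeta>x\<rangle>\<close>.\<close>

lemma dirichlet_identity:
  assumes C: "C1 \<zeta> \<zeta>x \<zeta>y" and Cx: "C1 \<zeta>x \<zeta>xx \<zeta>xy"
    and p: "\<And>x y. \<zeta> (x + 1) y = \<zeta> x y" and q: "\<And>x y. \<zeta> (x + a) (y + b) = \<zeta> x y" and b: "0 \<le> b"
  shows "II b (\<lambda>x y. (norm (dir \<zeta>x \<zeta>y x y))\<^sup>2) = II b (\<lambda>x y. (norm (\<zeta>x x y))\<^sup>2) + II b (\<lambda>x y. (norm (\<zeta>y x y))\<^sup>2)"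
proof -
  note c = cont2_C1[OF C] cont2_C1[OF Cx]
  have px: "\<zeta>x (x + 1) y = \<zeta>x x y" "\<zeta>y (x + 1) y = \<zeta>y x y" for x y
  proof -
    have "((\<lambda>s. \<zeta> (s + 1) y) has_vector_derivative \<zeta>x (x + 1) y) (at x)"
      by (rule has_vector_derivative_translate[of "\<lambda>s. \<zeta> s y"]) (rule C1_dx[OF C])
    then show "\<zeta>x (x + 1) y = \<zeta>x x y" unfolding p using C1_dx[OF C] vector_derivative_unique_at by blast
    have "((\<lambda>s. \<zeta> (x + 1) s) has_vector_derivative \<zeta>y (x + 1) y) (at y)" by (rule C1_dy[OF C])
    then show "\<zeta>y (x + 1) y = \<zeta>y x y" unfolding p using C1_dy[OF C] vector_derivative_unique_at by blast
  qed
  have qx: "\<zeta>x (x + a) (y + b) = \<zeta>x x y" for x y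
  proof -
    have "((\<lambda>s. \<zeta> (s + a) (y + b)) has_vector_derivative \<zeta>x (x + a) (y + b)) (at x)"
      by (rule has_vector_derivative_translate[of "\<lambda>s. \<zeta> s (y + b)"]) (rule C1_dx[OF C])
    then show ?thesis unfolding q using C1_dx[OF C] vector_derivative_unique_at by blast
  qed
  define A where "A x y = inner (\<zeta> x y) (JJ (\<zeta>xy x y)) + inner (\<zeta>x x y) (JJ (\<zeta>y x y))" for x y
  have A: "II b A = 0"
  proof -
    have "((\<lambda>s. inner (\<zeta> s y) (JJ (\<zeta>y s y))) has_vector_derivative A x y) (at x)" for x y
      unfolding A_def has_real_derivative_iff_has_vector_derivative[symmetric]
      by (intro has_real_derivative_inner C1_dx[OF C] bounded_linear.has_vector_derivative[OF bl_JJ] mixed_partial[OF C Cx])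
    then have "xint A y = 0" for y
      using xint_ftc[of "\<lambda>s t. inner (\<zeta> s t) (JJ (\<zeta>y s t))" y A] p[of 0 y] px[of 0 y] by simp
    then have "xint A = (\<lambda>_. 0)" by auto
    then show ?thesis by (simp add: II_def)
  qed
  define B where "B x y = inner (\<zeta> x y) (JJ (\<zeta>xy x y)) + inner (\<zeta>y x y) (JJ (\<zeta>x x y))" for x y
  have B: "II b B = 0"
    unfolding B_def
    by (rule II_deriv_zero(2)[OF C1_inner[OF C C1_linear[OF Cx bl_JJ]], where a = a]) (simp_all add: p px q qx b)
  have pt: "(norm (dir \<zeta>x \<zeta>y x y))\<^sup>2 = ((norm (\<zeta>x x y))\<^sup>2 + (norm (\<zeta>y x y))\<^sup>2) + (A x y - B x y)" for x y
  proof -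
    have "inner (e1 (\<zeta>x x y)) (e2 (\<zeta>y x y)) = inner (\<zeta>x x y) (JJ (\<zeta>y x y))"
      by (simp add: e_inner(4) e_alg)
    moreover have "inner (\<zeta>y x y) (JJ (\<zeta>x x y)) = - inner (\<zeta>x x y) (JJ (\<zeta>y x y))"
      using e_inner(6)[of "\<zeta>x x y" "\<zeta>y x y"] by (simp add: inner_commute)
    ultimately show ?thesis
      unfolding power2_norm_eq_inner dir_def A_def B_def
      by (simp add: inner_add_left inner_add_right e_inner(1,2) inner_commute[of "e2 (\<zeta>y x y)"])
  qed
  have cA: "cont2 A" "cont2 B" unfolding A_def B_def by (intro cont2_add cont2_inner cont2_e c)+
  have cN: "cont2 (\<lambda>x y. (norm (\<zeta>x x y))\<^sup>2)" "cont2 (\<lambda>x y. (norm (\<zeta>y x y))\<^sup>2)"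
    by (intro cont2_power cont2_norm c)+
  show ?thesis unfolding pt
    by (subst II_add[OF cont2_add[OF cN] cont2_diff[OF cA]], subst II_add[OF cN], subst II_diff[OF cA]) (simp add: A B)
qed

text \<open>The tangent at \<open>v^2\<close> to \<open>u / (1 - u)\<close> as a function of
  \<open>u^2\<close>. The slope \<open>1 / (2 u (1 - u)^2)\<close> decreases exactly up to
  \<open>u = 1/3\<close>, which is the origin of the bound \<open>K / 3\<close> on the
  weights.\<close>

lemma mean_weight_bound:
  fixes u v :: real
  assumes "0 \<le> u" "0 < v" "u \<le> 1/3" "v \<le> 1/3"
  shows "u / (1 - u) \<le> v / (1 - v) + (u\<^sup>2 - v\<^sup>2) / (2 * v * (1 - v)\<^sup>2)"
proof -
  have p: "0 < 1 - u" "0 < 1 - v" "0 < 2 * v * (1 - v)\<^sup>2" using assms by auto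
  have "v / (1 - v) + (u\<^sup>2 - v\<^sup>2) / (2 * v * (1 - v)\<^sup>2) - u / (1 - u) =
     (u - v)\<^sup>2 * (1 - (u + 2 * v)) / (2 * v * (1 - v)\<^sup>2 * (1 - u))"
    using p assms(2) by (simp add: divide_simps) algebra
  also have "\<dots> \<ge> 0" using p assms by (intro divide_nonneg_nonneg mult_nonneg_nonneg) auto
  finally show ?thesis by simp
qed

text \<open>The hypotheses say that the symmetric matrix with diagonal \<open>E\<close> and
  off-diagonal \<open>D\<close> is at most \<open>diag (V, Z)\<close>; inversion reverses this
  order. Its eigenvalues \<open>E + D\<close> and \<open>E - D\<close> are the values of the weight
  at the two points of a pair. The inverse is handled through the dual bound
  \<open>2 \<langle>r, z\<rangle> - w |z|^2 \<le> |r|^2 / w\<close>.\<close>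

lemma pair_ineq:
  fixes p q :: "'a::real_inner"
  assumes W: "0 < E + D" "0 < E - D" and V: "E \<le> V" "E \<le> Z" and VZ: "D\<^sup>2 \<le> (V - E) * (Z - E)"
  shows "(norm p)\<^sup>2 / V + (norm q)\<^sup>2 / Z \<le> ((norm (p + q))\<^sup>2 / (E + D) + (norm (p - q))\<^sup>2 / (E - D)) / 2"
proof -
  have E: "0 < E" "0 < V" "0 < Z" using W V by linarith+
  define \<alpha> \<beta> where "\<alpha> = (1 / V) *\<^sub>R p" and "\<beta> = (1 / Z) *\<^sub>R q"
  have dual: "2 * inner r z - w * (norm z)\<^sup>2 \<le> (norm r)\<^sup>2 / w" if "0 < w" for r z :: 'a and w :: real
  proof -
    have "0 \<le> (norm (r - w *\<^sub>R z))\<^sup>2 / w" using that by simp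
    also have "\<dots> = (norm r)\<^sup>2 / w - (2 * inner r z - w * (norm z)\<^sup>2)"
      using that unfolding power2_norm_eq_inner
      by (simp add: inner_diff_left inner_diff_right inner_commute field_simps power2_eq_square)
    finally show ?thesis by simp
  qed
  have 1: "2 * inner (p + q) (\<alpha> + \<beta>) - (E + D) * (norm (\<alpha> + \<beta>))\<^sup>2 \<le> (norm (p + q))\<^sup>2 / (E + D)" by (rule dual[OF W(1)])
  have 2: "2 * inner (p - q) (\<alpha> - \<beta>) - (E - D) * (norm (\<alpha> - \<beta>))\<^sup>2 \<le> (norm (p - q))\<^sup>2 / (E - D)" by (rule dual[OF W(2)])
  have i: "inner p \<alpha> = (norm p)\<^sup>2 / V" "inner q \<beta> = (norm q)\<^sup>2 / Z"
    unfolding \<alpha>_def \<beta>_def power2_norm_eq_inner by simp_all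
  have n: "V * (norm \<alpha>)\<^sup>2 = (norm p)\<^sup>2 / V" "Z * (norm \<beta>)\<^sup>2 = (norm q)\<^sup>2 / Z"
    using E by (simp_all add: \<alpha>_def \<beta>_def power_divide power2_eq_square)
  have key: "2 * D * inner \<alpha> \<beta> \<le> (V - E) * (norm \<alpha>)\<^sup>2 + (Z - E) * (norm \<beta>)\<^sup>2"
  proof -
    define x y where "x = sqrt (V - E) * norm \<alpha>" and "y = sqrt (Z - E) * norm \<beta>"
    have "\<bar>D\<bar> \<le> sqrt ((V - E) * (Z - E))" using VZ by (simp add: real_le_rsqrt)
    then have "\<bar>D\<bar> * (norm \<alpha> * norm \<beta>) \<le> sqrt ((V - E) * (Z - E)) * (norm \<alpha> * norm \<beta>)" by (intro mult_right_mono) auto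
    also have "\<dots> = x * y" by (simp add: x_def y_def real_sqrt_mult)
    finally have "\<bar>D\<bar> * (norm \<alpha> * norm \<beta>) \<le> x * y" .
    moreover have "D * inner \<alpha> \<beta> \<le> \<bar>D\<bar> * (norm \<alpha> * norm \<beta>)"
      using mult_left_mono[OF Cauchy_Schwarz_ineq2[of \<alpha> \<beta>], of "\<bar>D\<bar>"] abs_ge_self[of "D * inner \<alpha> \<beta>"]
      by (simp add: abs_mult)
    moreover have "2 * (x * y) \<le> x\<^sup>2 + y\<^sup>2" using sum_squares_bound[of x y] by simp
    moreover have "x\<^sup>2 = (V - E) * (norm \<alpha>)\<^sup>2" "y\<^sup>2 = (Z - E) * (norm \<beta>)\<^sup>2"
      using V by (simp_all add: x_def y_def power_mult_distrib)
    ultimately show ?thesis by linarith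
  qed
  have "2 * ((norm p)\<^sup>2 / V + (norm q)\<^sup>2 / Z) \<le> (2 * inner (p + q) (\<alpha> + \<beta>) - (E + D) * (norm (\<alpha> + \<beta>))\<^sup>2) +
     (2 * inner (p - q) (\<alpha> - \<beta>) - (E - D) * (norm (\<alpha> - \<beta>))\<^sup>2)"
  proof -
    have "(2 * inner (p + q) (\<alpha> + \<beta>) - (E + D) * (norm (\<alpha> + \<beta>))\<^sup>2) +
     (2 * inner (p - q) (\<alpha> - \<beta>) - (E - D) * (norm (\<alpha> - \<beta>))\<^sup>2) =
      4 * inner p \<alpha> + 4 * inner q \<beta> - 2 * (E * (norm \<alpha>)\<^sup>2 + E * (norm \<beta>)\<^sup>2 + 2 * D * inner \<alpha> \<beta>)"
      unfolding power2_norm_eq_inner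
      by (simp add: inner_add_left inner_add_right inner_diff_left inner_diff_right inner_commute[of \<beta> \<alpha>] algebra_simps)
    also have "\<dots> \<ge> 4 * inner p \<alpha> + 4 * inner q \<beta> - 2 * (V * (norm \<alpha>)\<^sup>2 + Z * (norm \<beta>)\<^sup>2)"
      using key by (simp add: algebra_simps)
    finally show ?thesis unfolding i n by simp
  qed
  also have "\<dots> \<le> (norm (p + q))\<^sup>2 / (E + D) + (norm (p - q))\<^sup>2 / (E - D)" by (rule add_mono[OF 1 2])
  finally show ?thesis by (simp only: pos_le_divide_eq zero_less_numeral mult.commute[of _ 2])
qed

text \<open>For \<open>K = 1\<close> and \<open>W = \<kappa> \<rho>\<close>: the metric \<open>\<rho>\<^sup>2 (dx\<^sup>2 + dy\<^sup>2)\<close> has no eigenvalue in \<open>(0, \<kappa>)\<close>.\<close>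

definition specbd :: "nat \<Rightarrow> real \<Rightarrow> real \<Rightarrow> (real \<Rightarrow> real \<Rightarrow> real) \<Rightarrow> bool" where
  "specbd K a b W \<longleftrightarrow> (\<forall>\<xi> \<xi>x \<xi>y \<xi>xx \<xi>xy. C1 \<xi> \<xi>x \<xi>y \<longrightarrow> C1 \<xi>x \<xi>xx \<xi>xy \<longrightarrow>
     (\<forall>x y. \<xi> (x + 1 / K) y = \<xi> x y) \<longrightarrow> (\<forall>x y. \<xi> (x + a) (y + b) = \<xi> x y) \<longrightarrow>
     II b (\<lambda>x y. inner (dir \<xi>x \<xi>y x y) (\<xi> x y)) \<le> II b (\<lambda>x y. (norm (dir \<xi>x \<xi>y x y))\<^sup>2 / W x y))"

lemma cont2_of_line: "continuous_on UNIV g \<Longrightarrow> cont2 (\<lambda>x y. g y)"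
  unfolding cont2_def by (rule continuous_on_compose2[of UNIV g]) (auto intro: continuous_intros)

lemma xint_inner_left: "cont2 (F :: real \<Rightarrow> real \<Rightarrow> spin) \<Longrightarrow> xint (\<lambda>x y. inner (F x y) (g y)) y = inner (xint F y) (g y)"
  using integral_linear[OF cont2_integrable[where y = y and c = 0 and d = 1] bounded_linear_inner_left[of "g y"], of F] by (simp add: xint_def o_def)

lemma xint_bl: "cont2 (F :: real \<Rightarrow> real \<Rightarrow> spin) \<Longrightarrow> bounded_linear L \<Longrightarrow> xint (\<lambda>x y. L (F x y) :: spin) y = L (xint F y)"
  using integral_linear[OF cont2_integrable[where y = y and c = 0 and d = 1], of F L] by (simp add: xint_def o_def)

section \<open>Weights bounded by \<open>K / 3\<close>\<close>

context modes begin

text \<open>As \<open>g\<close> has mean zero over one period, \<open>g x\<close> is an average of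
  differences \<open>g x - g t\<close>. One factor \<open>1 / K\<close> comes from Cauchy-Schwarz
  over a period, the other from the share of a period in the unit circle.\<close>

lemma poincare:
  fixes g g' :: "real \<Rightarrow> spin"
  assumes d: "\<And>x. (g has_vector_derivative g' x) (at x)" and c: "continuous_on UNIV g'"
    and p: "\<And>x. g (x + 1 / K) = g x" "\<And>x. g' (x + 1 / K) = g' x" and z: "integral {0..1} g = 0"
  shows "(norm (g x))\<^sup>2 \<le> (1 / real K)\<^sup>2 * integral {0..1} (\<lambda>x. (norm (g' x))\<^sup>2)"
proof -
  note cs = continuous_on_subset[OF _ subset_UNIV]
  define k where "k = 1 / real K"
  have k: "0 < k" using K by (simp add: k_def)
  have cg: "continuous_on UNIV g"
    by (intro continuous_at_imp_continuous_on ballI has_vector_derivative_continuous) (rule d)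
  define I where "I = integral {x..x + k} (\<lambda>t. norm (g' t))"
  have ig: "g integrable_on {u..v}" for u v by (intro integrable_continuous_interval cs[OF cg])
  have gt: "norm (g x - g t) \<le> I" if t: "t \<in> {x..x + k}" for t
  proof -
    have "(g' has_integral g t - g x) {x..t}"
      by (rule fundamental_theorem_of_calculus) (use t has_vector_derivative_at_within[OF d] in auto)
    then have "norm (g t - g x) \<le> integral {x..t} (\<lambda>t. norm (g' t))"
      using integral_norm_bound_integral[of g' "{x..t}" "\<lambda>t. norm (g' t)"] cs[OF c]
      by (auto simp: integral_unique intro!: integrable_continuous_interval continuous_intros)
    also have "\<dots> \<le> I" unfolding I_def
      by (rule integral_subset_le) (use t in \<open>auto intro!: integrable_continuous_interval continuous_intros cs[OF c]\<close>)
    finally show ?thesis by (simp add: norm_minus_commute)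
  qed
  have "integral {x..x + k} g = 0"
    using K_periodic_integral[OF cg p(1) K, of x] z by (simp add: k_def)
  then have "k *\<^sub>R g x = integral {x..x + k} (\<lambda>t. g x - g t)"
    using k by (subst integral_diff) (auto simp: ig)
  also have "norm \<dots> \<le> integral {x..x + k} (\<lambda>t. I)"
    by (rule integral_norm_bound_integral) (use gt in \<open>auto intro!: integrable_continuous_interval continuous_intros cs[OF cg]\<close>)
  finally have "k * norm (g x) \<le> k * I" using k by simp
  then have gI: "norm (g x) \<le> I" using k by simp
  have "(norm (g x))\<^sup>2 \<le> I\<^sup>2" using gI by (intro power_mono) auto
  also have "\<dots> \<le> integral {x..x + k} (\<lambda>t. 1\<^sup>2) * integral {x..x + k} (\<lambda>t. (norm (g' t))\<^sup>2)"
    unfolding I_def using CS_integral[of x "x + k" "\<lambda>_. 1" "\<lambda>t. norm (g' t)"] continuous_on_norm[OF cs[OF c]]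
    by simp
  also have "integral {x..x + k} (\<lambda>t. (norm (g' t))\<^sup>2) = k *\<^sub>R integral {0..1} (\<lambda>t. (norm (g' t))\<^sup>2)"
    unfolding k_def by (rule K_periodic_integral[OF _ _ K]) (auto intro!: continuous_intros c simp: p)
  finally show ?thesis using k by (simp add: k_def power2_eq_square)
qed

text \<open>Split \<open>\<xi>\<close> into its circle means \<open>f\<close> and a rest
  \<open>\<zeta>\<close> of mean zero. By \<open>poincare\<close> the rest contributes at most
  \<open>\<integral> |D \<zeta>|^2 / K\<close>, and \<open>circle_bound\<close> treats the means
  with \<open>s\<close> the circle norm of \<open>W\<close>. That the right-hand side pays for both
  at once is \<open>lower\<close>, Cauchy-Schwarz with the weight \<open>1 / W - 1 / K\<close>,
  positive by \<open>small\<close>.\<close>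

theorem small_period_bound:
  assumes cW: "cont2 W" and W: "\<And>x y. 0 < W x y" "\<And>x y. W (x + 1 / K) y = W x y" "\<And>x y. W (x + a) (y + b) = W x y"
    and small: "\<And>x y. W x y \<le> K / 3"
    and L: "integral {0..b} (\<lambda>y. sqrt (xint (\<lambda>x y. (W x y)\<^sup>2) y)) \<le> 2 * pi"
  shows "specbd K a b W"
  unfolding specbd_def
proof (intro allI impI)
  fix \<xi> \<xi>x \<xi>y \<xi>xx \<xi>xy :: "real \<Rightarrow> real \<Rightarrow> spin"
  assume C: "C1 \<xi> \<xi>x \<xi>y" and Cx: "C1 \<xi>x \<xi>xx \<xi>xy"
    and per': "\<forall>x y. \<xi> (x + 1 / K) y = \<xi> x y" "\<forall>x y. \<xi> (x + a) (y + b) = \<xi> x y"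
  note per = per'[rule_format]
  note cx = cont2_C1[OF C]
  define c where "c = 1 / real K"
  have c: "0 < c" using K by (simp add: c_def)
  define s where "s y = sqrt (xint (\<lambda>x y. (W x y)\<^sup>2) y)" for y
  have cW2: "cont2 (\<lambda>x y. (W x y)\<^sup>2)" by (rule cont2_power[OF cW])
  have s: "continuous_on UNIV s" "0 < s y" "s (y + b) = s y" "s y \<le> K / 3" "(s y)\<^sup>2 = xint (\<lambda>x y. (W x y)\<^sup>2) y" for y
  proof -
    show "continuous_on UNIV s" unfolding s_def by (intro continuous_intros xint_cont cW2)
    have nn: "0 \<le> xint (\<lambda>x y. (W x y)\<^sup>2) y" by (rule xint_nonneg[OF cW2]) simp
    have "xint (\<lambda>x y. (W x y)\<^sup>2) y \<noteq> 0"
      unfolding xint_def using integral_eq_0_iff[OF cont2_line(1)[OF cW2], of 0 1 y] W(1)[of 0 y] by auto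
    then show "0 < s y" using nn by (simp add: s_def)
    show "(s y)\<^sup>2 = xint (\<lambda>x y. (W x y)\<^sup>2) y" using nn by (simp add: s_def)
    have W1: "W (x + 1) y = W x y" for x y using one_period[of W 1 x y] W(2) by simp
    show "s (y + b) = s y" unfolding s_def
      using xint_shift_periodic[OF cW2, of a b y] W1 W(3) by simp
    have "xint (\<lambda>x y. (W x y)\<^sup>2) y \<le> xint (\<lambda>x y. (K / 3)\<^sup>2) y"
      by (intro xint_mono cW2 cont2_const power_mono small) (use W(1) in \<open>auto intro: less_imp_le\<close>)
    then have "xint (\<lambda>x y. (W x y)\<^sup>2) y \<le> (K / 3)\<^sup>2" by simp
    then have "s y \<le> sqrt ((K / 3)\<^sup>2)" unfolding s_def by (rule real_sqrt_le_mono)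
    then show "s y \<le> K / 3" by simp
  qed
  have per1: "\<xi> (x + 1) y = \<xi> x y" for x y using one_period[of \<xi> 1 x y] per(1) by simp
  have perx: "\<xi>x (x + 1 / K) y = \<xi>x x y" for x y
  proof -
    have "((\<lambda>s. \<xi> (s + 1 / K) y) has_vector_derivative \<xi>x (x + 1 / K) y) (at x)"
      by (rule has_vector_derivative_translate[of "\<lambda>s. \<xi> s y"]) (rule C1_dx[OF C])
    then show ?thesis unfolding per using C1_dx[OF C] vector_derivative_unique_at by blast
  qed
  define f where "f = xint \<xi>"
  define f' where "f' = xint \<xi>y"
  have df: "(f has_vector_derivative f' y) (at y)" for y
    unfolding f_def f'_def by (rule xint_deriv[OF cx(1,3) C1_dy[OF C]])
  have cf': "continuous_on UNIV f'" unfolding f'_def by (rule xint_cont[OF cx(3)])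
  have cf: "continuous_on UNIV f" unfolding f_def by (rule xint_cont[OF cx(1)])
  have pf: "f (y + b) = f y" for y unfolding f_def by (rule xint_shift_periodic[OF cx(1) per1 per(2)])
  define d where "d = dir \<xi>x \<xi>y"
  have cd: "cont2 d" unfolding d_def by (intro cont2_dir cx)
  have xd: "xint d y = e2 (f' y)" for y
  proof -
    have "xint d y = xint (\<lambda>x y. e1 (\<xi>x x y)) y + xint (\<lambda>x y. e2 (\<xi>y x y)) y"
      unfolding d_def dir_def by (rule xint_add) (intro cont2_e cx)+
    also have "\<dots> = e1 (xint \<xi>x y) + e2 (xint \<xi>y y)" by (simp add: xint_bl[OF cx(2) bl_e1] xint_bl[OF cx(3) bl_e2])
    also have "xint \<xi>x y = 0" using xint_ftc[of \<xi> y \<xi>x] C1_dx[OF C] per1[of 0 y] by simp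
    finally show ?thesis by (simp add: f'_def e_lin)
  qed
  define \<zeta> where "\<zeta> x y = \<xi> x y - f y" for x y
  define \<zeta>y where "\<zeta>y x y = \<xi>y x y - f' y" for x y
  have C\<zeta>: "C1 \<zeta> \<xi>x \<zeta>y"
    unfolding C1_def \<zeta>_def \<zeta>y_def
  proof (intro conjI allI cont2_diff cx cont2_of_line cf cf')
    show "((\<lambda>s. \<xi> s y - f y) has_vector_derivative \<xi>x x y) (at x)" for x y
      using has_vector_derivative_diff[OF C1_dx[OF C] has_vector_derivative_const] by simp
    show "((\<lambda>t. \<xi> x t - f t) has_vector_derivative \<xi>y x y - f' y) (at y)" for x y
      by (rule has_vector_derivative_diff[OF C1_dy[OF C] df])
  qed
  have \<zeta>p: "\<zeta> (x + 1 / K) y = \<zeta> x y" "\<zeta> (x + 1) y = \<zeta> x y" "\<zeta> (x + a) (y + b) = \<zeta> x y" for x y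
    by (simp_all only: \<zeta>_def per per1 pf)
  define d' where "d' = dir \<xi>x \<zeta>y"
  have cd': "cont2 d'" unfolding d'_def by (intro cont2_dir cx cont2_C1[OF C\<zeta>])
  have d': "d' x y = d x y - e2 (f' y)" for x y by (simp add: d'_def d_def dir_def \<zeta>y_def e_lin)
  have ce: "continuous_on S (\<lambda>y. e2 (f' y))" for S
    by (rule bounded_linear.continuous_on[OF bl_e2 continuous_on_subset[OF cf' subset_UNIV]])
  have z\<zeta>: "xint \<zeta> y = 0" for y
    unfolding \<zeta>_def using xint_diff[OF cx(1) cont2_of_line[OF cf], of y] by (simp add: f_def)
  have split: "xint (\<lambda>x y. inner (d x y) (\<xi> x y)) y = xint (\<lambda>x y. inner (d' x y) (\<zeta> x y)) y + inner (e2 (f' y)) (f y)" for y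
  proof -
    have "inner (d x y) (\<xi> x y) = (inner (d' x y) (\<zeta> x y) + inner (\<zeta> x y) (e2 (f' y))) + inner (d x y) (f y)" for x y
      by (simp add: d' \<zeta>_def inner_diff_left inner_diff_right inner_commute)
    then have "xint (\<lambda>x y. inner (d x y) (\<xi> x y)) y =
       xint (\<lambda>x y. (inner (d' x y) (\<zeta> x y) + inner (\<zeta> x y) (e2 (f' y))) + inner (d x y) (f y)) y" by simp
    also have "\<dots> = (xint (\<lambda>x y. inner (d' x y) (\<zeta> x y)) y + xint (\<lambda>x y. inner (\<zeta> x y) (e2 (f' y))) y) + xint (\<lambda>x y. inner (d x y) (f y)) y"
      by (subst xint_add; (subst xint_add)?) (intro cont2_add cont2_inner cd' cd cont2_C1[OF C\<zeta>] cont2_of_line cf ce refl)+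
    finally show ?thesis
      by (simp add: xint_inner_left[OF cont2_C1(1)[OF C\<zeta>]] xint_inner_left[OF cd] z\<zeta> xd)
  qed
  have cdz: "cont2 (\<lambda>x y. inner (d' x y) (\<zeta> x y))" by (intro cont2_inner cd' cont2_C1[OF C\<zeta>])
  have I1: "II b (\<lambda>x y. inner (d x y) (\<xi> x y)) = II b (\<lambda>x y. inner (d' x y) (\<zeta> x y)) + integral {0..b} (\<lambda>y. inner (e2 (f' y)) (f y))"
    unfolding II_def split[abs_def]
    by (rule integral_add) (intro integrable_continuous_interval xint_cont cdz continuous_on_inner ce continuous_on_subset[OF cf subset_UNIV])+
  have cN: "cont2 (\<lambda>x y. (norm (d' x y))\<^sup>2)" "cont2 (\<lambda>x y. (norm (\<zeta> x y))\<^sup>2)" "cont2 (\<lambda>x y. (norm (\<xi>x x y))\<^sup>2)"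
    by (intro cont2_power cont2_norm cd' cont2_C1[OF C\<zeta>] cx)+
  have small': "II b (\<lambda>x y. inner (d' x y) (\<zeta> x y)) \<le> c * II b (\<lambda>x y. (norm (d' x y))\<^sup>2)"
  proof -
    have "II b (\<lambda>x y. (norm (\<zeta> x y))\<^sup>2) \<le> II b (\<lambda>x y. c\<^sup>2 * xint (\<lambda>x y. (norm (\<xi>x x y))\<^sup>2) y)"
    proof (rule II_mono[OF cN(2)])
      show "cont2 (\<lambda>x y. c\<^sup>2 * xint (\<lambda>x y. (norm (\<xi>x x y))\<^sup>2) y)"
        by (intro cont2_mult cont2_const cont2_of_line xint_cont cN)
      show "(norm (\<zeta> x y))\<^sup>2 \<le> c\<^sup>2 * xint (\<lambda>x y. (norm (\<xi>x x y))\<^sup>2) y" for x y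
        unfolding c_def xint_def
        by (rule poincare[of "\<lambda>x. \<zeta> x y"])
          (use C1_dx[OF C\<zeta>] cont2_line(1)[OF cx(2)] \<zeta>p perx z\<zeta>[of y] in \<open>auto simp: xint_def\<close>)
    qed
    also have "\<dots> = c\<^sup>2 * II b (\<lambda>x y. (norm (\<xi>x x y))\<^sup>2)"
    proof -
      have "xint (\<lambda>x y. c\<^sup>2 * xint (\<lambda>x y. (norm (\<xi>x x y))\<^sup>2) y) = (\<lambda>y. c\<^sup>2 * xint (\<lambda>x y. (norm (\<xi>x x y))\<^sup>2) y)"
        by (rule ext) (rule xint_const)
      then show ?thesis unfolding II_def by simp
    qed
    also have "\<dots> \<le> c\<^sup>2 * II b (\<lambda>x y. (norm (d' x y))\<^sup>2)"
    proof (rule mult_left_mono)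
      have "II b (\<lambda>x y. (norm (d' x y))\<^sup>2) = II b (\<lambda>x y. (norm (\<xi>x x y))\<^sup>2) + II b (\<lambda>x y. (norm (\<zeta>y x y))\<^sup>2)"
        unfolding d'_def by (rule dirichlet_identity[OF C\<zeta> Cx \<zeta>p(2,3)]) (use b in simp)
      moreover have "0 \<le> II b (\<lambda>x y. (norm (\<zeta>y x y))\<^sup>2)"
        by (rule II_nonneg) (auto intro!: cont2_power cont2_norm cont2_C1[OF C\<zeta>])
      ultimately show "II b (\<lambda>x y. (norm (\<xi>x x y))\<^sup>2) \<le> II b (\<lambda>x y. (norm (d' x y))\<^sup>2)" by simp
    qed simp
    finally have zd: "II b (\<lambda>x y. (norm (\<zeta> x y))\<^sup>2) \<le> c\<^sup>2 * II b (\<lambda>x y. (norm (d' x y))\<^sup>2)" .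
    have "II b (\<lambda>x y. inner (d' x y) (\<zeta> x y)) \<le> II b (\<lambda>x y. (c / 2) * (norm (d' x y))\<^sup>2 + (1 / (2 * c)) * (norm (\<zeta> x y))\<^sup>2)"
    proof (rule II_mono[OF cdz])
      show "cont2 (\<lambda>x y. (c / 2) * (norm (d' x y))\<^sup>2 + (1 / (2 * c)) * (norm (\<zeta> x y))\<^sup>2)"
        by (intro cont2_add cont2_mult cont2_const cN)
      fix x y
      define A B where "A = norm (d' x y)" and "B = norm (\<zeta> x y)"
      have "inner (d' x y) (\<zeta> x y) \<le> A * B" unfolding A_def B_def by (rule norm_cauchy_schwarz)
      also have "\<dots> \<le> (c / 2) * A\<^sup>2 + (1 / (2 * c)) * B\<^sup>2"
      proof -
        have "0 \<le> (c * A - B)\<^sup>2 / (2 * c)" using c by simp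
        also have "\<dots> = (c / 2) * A\<^sup>2 + (1 / (2 * c)) * B\<^sup>2 - A * B" using c by (simp add: power2_eq_square field_simps)
        finally show ?thesis by simp
      qed
      finally show "inner (d' x y) (\<zeta> x y) \<le> (c / 2) * (norm (d' x y))\<^sup>2 + (1 / (2 * c)) * (norm (\<zeta> x y))\<^sup>2"
        by (simp add: A_def B_def)
    qed
    also have "\<dots> = (c / 2) * II b (\<lambda>x y. (norm (d' x y))\<^sup>2) + (1 / (2 * c)) * II b (\<lambda>x y. (norm (\<zeta> x y))\<^sup>2)"
      by (subst II_add) (intro cont2_mult cont2_const cN, simp_all only: II_cmult, intro cont2_mult cont2_const cN)
    also have "\<dots> \<le> (c / 2) * II b (\<lambda>x y. (norm (d' x y))\<^sup>2) + (1 / (2 * c)) * (c\<^sup>2 * II b (\<lambda>x y. (norm (d' x y))\<^sup>2))"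
      using zd c by (intro add_left_mono mult_left_mono) auto
    also have "\<dots> = c * II b (\<lambda>x y. (norm (d' x y))\<^sup>2)" using c by (simp add: power2_eq_square)
    finally show ?thesis .
  qed
  have W0: "W x y \<noteq> 0" for x y using W(1)[of x y] by simp
  have cdW: "cont2 (\<lambda>x y. (norm (d x y))\<^sup>2 / W x y)" by (intro cont2_divide cont2_power cont2_norm cd cW W0)
  have lower: "(norm (f' y))\<^sup>2 / s y + c * xint (\<lambda>x y. (norm (d' x y))\<^sup>2) y \<le> xint (\<lambda>x y. (norm (d x y))\<^sup>2 / W x y) y" for y
  proof -
    \<comment> \<open>What is left of \<open>1 / W\<close> after reserving \<open>c |d|^2\<close>
      for the part without mean.\<close>
    define w where "w x y = 1 / W x y - c" for x y
    have cW3: "c * W x y \<le> 1/3" for x y using small[of x y] K by (simp add: c_def field_simps)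
    have wpos: "0 < w x y" for x y
      using cW3[of x y] W(1)[of x y] c by (simp add: w_def field_simps)
    have w0: "w x y \<noteq> 0" for x y using wpos[of x y] by simp
    have cw: "cont2 w" unfolding w_def by (intro cont2_diff cont2_divide cont2_const cW W0)
    have sq0: "sqrt (w x y) \<noteq> 0" for x y using wpos[of x y] by simp
    have cs1: "cont2 (\<lambda>x y. norm (d x y) * sqrt (w x y))" "cont2 (\<lambda>x y. 1 / sqrt (w x y))"
      by (intro cont2_mult cont2_norm cd cont2_sqrt cw cont2_divide cont2_const sq0)+
    have dw: "(norm (d x y) * sqrt (w x y))\<^sup>2 = (norm (d x y))\<^sup>2 / W x y - c * (norm (d x y))\<^sup>2" for x y
      using wpos[of x y] by (simp add: power_mult_distrib less_imp_le) (simp add: w_def right_diff_distrib)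
    have cdd: "cont2 (\<lambda>x y. (norm (d x y))\<^sup>2)" by (intro cont2_power cont2_norm cd)
    have x1: "xint (\<lambda>x y. (norm (d x y) * sqrt (w x y))\<^sup>2) y = xint (\<lambda>x y. (norm (d x y))\<^sup>2 / W x y) y - c * xint (\<lambda>x y. (norm (d x y))\<^sup>2) y"
      unfolding dw using xint_diff[OF cdW cont2_mult[OF cont2_const[of c] cdd], of y] xint_cmult[of "\<lambda>_. c"] by simp
    define \<mu> where "\<mu> = s y / (1 - c * s y)"
    have cs3: "c * s y \<le> 1/3" using s(4)[of y] K by (simp add: c_def field_simps)
    have \<mu>: "0 < \<mu>" "1 / \<mu> = 1 / s y - c" using s(2)[of y] cs3 by (auto simp: \<mu>_def field_simps)
    \<comment> \<open>\<open>1 / w = W / (1 - c W)\<close> is linearised in \<open>W^2\<close> at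
      \<open>s^2\<close>; the linear term has mean 0 because \<open>s^2\<close> is the mean of
      \<open>W^2\<close>.\<close>
    have x2: "xint (\<lambda>x y. (1 / sqrt (w x y))\<^sup>2) y \<le> \<mu>"
    proof -
      define T where "T = 1 / (2 * s y * (1 - c * s y)\<^sup>2)"
      have cW2T: "cont2 (\<lambda>x t. \<mu> + ((W x t)\<^sup>2 - (s y)\<^sup>2) * T)"
        by (intro cont2_add cont2_const cont2_mult cont2_diff cW2)
      have "xint (\<lambda>x y. (1 / sqrt (w x y))\<^sup>2) y \<le> xint (\<lambda>x t. \<mu> + ((W x t)\<^sup>2 - (s y)\<^sup>2) * T) y"
      proof (rule xint_mono[OF cont2_power[OF cs1(2)] cW2T])
        fix x
        define u v where "u = c * W x y" and "v = c * s y"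
        have uv: "0 \<le> u" "0 < v" "u \<le> 1/3" "v \<le> 1/3" using W(1)[of x y] s(2)[of y] c cW3[of x y] cs3 by (auto simp: u_def v_def)
        have "(1 / sqrt (w x y))\<^sup>2 = 1 / w x y" using wpos[of x y] by (simp add: power_divide)
        also have "\<dots> = W x y / (1 - u)"
          using W(1)[of x y] uv(3) by (simp add: w_def u_def field_simps)
        also have "\<dots> = (1 / c) * (u / (1 - u))" using c by (simp add: u_def)
        also have "\<dots> \<le> (1 / c) * (v / (1 - v) + (u\<^sup>2 - v\<^sup>2) / (2 * v * (1 - v)\<^sup>2))"
          using c by (intro mult_left_mono mean_weight_bound uv) auto
        also have "\<dots> = \<mu> + ((W x y)\<^sup>2 - (s y)\<^sup>2) * T"
        proof -
          have "(1 / c) * (v / (1 - v)) = \<mu>" using c by (simp add: v_def \<mu>_def)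
          moreover have "(1 / c) * ((u\<^sup>2 - v\<^sup>2) / (2 * v * (1 - v)\<^sup>2)) = ((W x y)\<^sup>2 - (s y)\<^sup>2) * T"
          proof -
            have "u\<^sup>2 - v\<^sup>2 = c * c * ((W x y)\<^sup>2 - (s y)\<^sup>2)" by (simp add: u_def v_def power_mult_distrib power2_eq_square right_diff_distrib mult_ac)
            then show ?thesis using c by (simp add: T_def v_def)
          qed
          ultimately show ?thesis by (simp add: distrib_left)
        qed
        finally show "(1 / sqrt (w x y))\<^sup>2 \<le> \<mu> + ((W x y)\<^sup>2 - (s y)\<^sup>2) * T" .
      qed
      also have "\<dots> = \<mu>"
      proof -
        have i: "(\<lambda>x. (W x y)\<^sup>2) integrable_on {0..1}" by (rule cont2_integrable[OF cW2])
        have "((\<lambda>x. \<mu> + ((W x y)\<^sup>2 - (s y)\<^sup>2) * T) has_integral (\<mu> * 1 + (integral {0..1} (\<lambda>x. (W x y)\<^sup>2) - (s y)\<^sup>2 * 1) * T)) {0..1}"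
          by (intro has_integral_add has_integral_mult_left has_integral_diff integrable_integral i)
            (use has_integral_const_real[of _ 0 1] in auto)
        from integral_unique[OF this] show ?thesis by (simp add: xint_def s(5))
      qed
      finally show ?thesis .
    qed
    have "norm (e2 (f' y)) \<le> xint (\<lambda>x y. norm (d x y)) y"
      unfolding xd[symmetric] xint_def
      by (rule integral_norm_bound_integral) (use cont2_integrable[OF cd] cont2_integrable[OF cont2_norm[OF cd]] in simp_all)
    then have "(norm (f' y))\<^sup>2 \<le> (xint (\<lambda>x y. norm (d x y)) y)\<^sup>2" by (intro power_mono) (simp_all add: e_norm)
    also have "(\<lambda>x y. norm (d x y)) = (\<lambda>x y. norm (d x y) * sqrt (w x y) * (1 / sqrt (w x y)))" using sq0 by auto
    also have "(xint \<dots> y)\<^sup>2 \<le> xint (\<lambda>x y. (norm (d x y) * sqrt (w x y))\<^sup>2) y * xint (\<lambda>x y. (1 / sqrt (w x y))\<^sup>2) y"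
      by (rule CS_xint[OF cs1])
    also have "\<dots> \<le> xint (\<lambda>x y. (norm (d x y) * sqrt (w x y))\<^sup>2) y * \<mu>"
      by (intro mult_left_mono x2 xint_nonneg cont2_power cs1) simp
    finally have "(norm (f' y))\<^sup>2 / \<mu> \<le> xint (\<lambda>x y. (norm (d x y))\<^sup>2 / W x y) y - c * xint (\<lambda>x y. (norm (d x y))\<^sup>2) y"
      using \<mu>(1) by (simp add: pos_divide_le_eq x1)
    moreover have "(norm (f' y))\<^sup>2 / \<mu> = (norm (f' y))\<^sup>2 / s y - c * (norm (f' y))\<^sup>2"
    proof -
      have "(norm (f' y))\<^sup>2 / \<mu> = (norm (f' y))\<^sup>2 * (1 / \<mu>)" by simp
      also have "\<dots> = (norm (f' y))\<^sup>2 / s y - c * (norm (f' y))\<^sup>2" unfolding \<mu>(2) by (simp add: right_diff_distrib)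
      finally show ?thesis .
    qed
    moreover have "xint (\<lambda>x y. (norm (d x y))\<^sup>2) y = (norm (f' y))\<^sup>2 + xint (\<lambda>x y. (norm (d' x y))\<^sup>2) y"
    proof -
      have "(norm (d x y))\<^sup>2 = ((norm (d' x y))\<^sup>2 + 2 * inner (d x y) (e2 (f' y))) - (norm (f' y))\<^sup>2" for x y
        unfolding power2_norm_eq_inner d' by (simp add: inner_diff_left inner_diff_right inner_commute e_inner(2))
      then have "xint (\<lambda>x y. (norm (d x y))\<^sup>2) y = xint (\<lambda>x y. ((norm (d' x y))\<^sup>2 + 2 * inner (d x y) (e2 (f' y))) - (norm (f' y))\<^sup>2) y" by simp
      also have "\<dots> = (xint (\<lambda>x y. (norm (d' x y))\<^sup>2) y + xint (\<lambda>x y. 2 * inner (d x y) (e2 (f' y))) y) - (norm (f' y))\<^sup>2"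
      proof -
        have c2: "cont2 (\<lambda>x y. 2 * inner (d x y) (e2 (f' y)))" by (intro cont2_mult cont2_const cont2_inner cd cont2_of_line ce)
        have c3: "cont2 (\<lambda>x y. (norm (f' y))\<^sup>2)" by (intro cont2_power cont2_norm cont2_of_line cf')
        show ?thesis using xint_diff[OF cont2_add[OF cN(1) c2] c3, of y] xint_add[OF cN(1) c2, of y] by simp
      qed
      also have "xint (\<lambda>x y. 2 * inner (d x y) (e2 (f' y))) y = 2 * (norm (f' y))\<^sup>2"
        using xint_cmult[of "\<lambda>_. 2" "\<lambda>x y. inner (d x y) (e2 (f' y))" y] xint_inner_left[OF cd, of "\<lambda>y. e2 (f' y)" y]
        by (simp add: xd e_inner(2) power2_norm_eq_inner)
      finally show ?thesis by simp
    qed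
    ultimately show ?thesis by (simp add: distrib_left)
  qed
  have s0: "s y \<noteq> 0" for y using s(2)[of y] by simp
  have cfs: "continuous_on {0..b} (\<lambda>y. (norm (f' y))\<^sup>2 / s y)"
    by (intro continuous_intros continuous_on_subset[OF cf' subset_UNIV] continuous_on_subset[OF s(1) subset_UNIV] ballI s0)
  have "II b (\<lambda>x y. inner (d x y) (\<xi> x y)) \<le> c * II b (\<lambda>x y. (norm (d' x y))\<^sup>2) + integral {0..b} (\<lambda>y. (norm (f' y))\<^sup>2 / s y)"
    unfolding I1 using small' circle_bound[OF b df cf' pf s(1-3)] L by (simp add: s_def add_mono)
  also have "\<dots> = integral {0..b} (\<lambda>y. (norm (f' y))\<^sup>2 / s y + c * xint (\<lambda>x y. (norm (d' x y))\<^sup>2) y)"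
    unfolding II_def
    by (subst integral_add) (auto intro!: integrable_continuous_interval cfs continuous_intros xint_cont cN)
  also have "\<dots> \<le> II b (\<lambda>x y. (norm (d x y))\<^sup>2 / W x y)"
    unfolding II_def
    by (intro integral_le integrable_continuous_interval continuous_on_add cfs continuous_on_mult_left xint_cont cN cdW lower)
  finally show "II b (\<lambda>x y. inner (dir \<xi>x \<xi>y x y) (\<xi> x y)) \<le> II b (\<lambda>x y. (norm (dir \<xi>x \<xi>y x y))\<^sup>2 / W x y)"
    by (simp add: d_def)
qed

end

section \<open>Halving the period\<close>

lemma cont2_shift:
  assumes "cont2 F" shows "cont2 (\<lambda>x y. F (x + h) y)"
  unfolding cont2_def by (rule cont2D[OF assms]) (intro continuous_intros)+

lemma C1_shift: "C1 F Fx Fy \<Longrightarrow> C1 (\<lambda>x y. F (x + h) y) (\<lambda>x y. Fx (x + h) y) (\<lambda>x y. Fy (x + h) y)"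
  unfolding C1_def
  by (auto intro: cont2_shift has_vector_derivative_translate[of "\<lambda>s. F s _"])

lemma xint_shift_x:
  fixes F :: "real \<Rightarrow> real \<Rightarrow> 'a::euclidean_space"
  assumes "cont2 F" "\<And>x y. F (x + 1) y = F x y"
  shows "xint (\<lambda>x y. F (x + h) y) y = xint F y"
proof -
  have "xint (\<lambda>x y. F (x + h) y) y = integral {h..h + 1} (\<lambda>x. F x y)"
    using integral_translate[of 0 h 1 "\<lambda>x. F x y"] by (simp add: xint_def add.commute)
  also have "\<dots> = integral {0..1} (\<lambda>x. F x y)"
    by (rule periodic_integral_any) (auto intro: cont2_line(1)[OF assms(1)] assms(2))
  finally show ?thesis by (simp add: xint_def)
qed

lemma II_shift_x:
  assumes "cont2 F" "\<And>x y. F (x + 1) y = F x y"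
  shows "II b (\<lambda>x y. F (x + h) y) = II b F"
proof -
  have "xint (\<lambda>x y. F (x + h) y) = xint F" by (rule ext) (rule xint_shift_x[OF assms])
  then show ?thesis by (simp add: II_def)
qed

text \<open>Even and odd parts under the shift by \<open>1 / K\<close> do not interact after
  integration, and \<open>pair_ineq\<close> compares the quotients at the points \<open>x\<close>
  and \<open>x + 1 / K\<close>. The inequality for odd spinors stays a hypothesis, to be supplied by
  \<open>anti_bound\<close>.\<close>

theorem (in modes) halving:
  assumes KK: "K = 2 * K'"
    and cW: "cont2 W" and W: "\<And>x y. 0 < W x y" "\<And>x y. W (x + 1 / K') y = W x y"
    and cV: "cont2 V" "cont2 Z"
    and VZ: "\<And>x y. (W x y + W (x + 1 / K) y) / 2 \<le> V x y" "\<And>x y. (W x y + W (x + 1 / K) y) / 2 \<le> Z x y"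
      "\<And>x y. ((W x y - W (x + 1 / K) y) / 2)\<^sup>2 \<le>
        (V x y - (W x y + W (x + 1 / K) y) / 2) * (Z x y - (W x y + W (x + 1 / K) y) / 2)"
    and M: "specbd K a b V"
    and odd: "\<And>\<xi> \<xi>x \<xi>y. C1 \<xi> \<xi>x \<xi>y \<Longrightarrow> (\<And>x y. \<xi> (x + 1 / K) y = - \<xi> x y) \<Longrightarrow> (\<And>x y. \<xi> (x + a) (y + b) = \<xi> x y) \<Longrightarrow>
      II b (\<lambda>x y. inner (dir \<xi>x \<xi>y x y) (\<xi> x y)) \<le> II b (\<lambda>x y. (norm (dir \<xi>x \<xi>y x y))\<^sup>2 / Z x y)"
  shows "specbd K' a b W"
  unfolding specbd_def
proof (intro allI impI)
  fix \<xi> \<xi>x \<xi>y \<xi>xx \<xi>xy :: "real \<Rightarrow> real \<Rightarrow> spin"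
  assume C: "C1 \<xi> \<xi>x \<xi>y" and Cx: "C1 \<xi>x \<xi>xx \<xi>xy"
    and per': "\<forall>x y. \<xi> (x + 1 / K') y = \<xi> x y" "\<forall>x y. \<xi> (x + a) (y + b) = \<xi> x y"
  note per = per'[rule_format]
  note cx = cont2_C1[OF C]
  define h where "h = 1 / real K"
  have K0: "1 \<le> K'" using K KK by simp
  have hh: "x + h + h = x + 1 / K'" for x using KK K0 by (simp add: h_def field_simps)
  have perx: "\<xi>x (x + 1 / K') y = \<xi>x x y" "\<xi>y (x + 1 / K') y = \<xi>y x y" for x y
  proof -
    have "((\<lambda>s. \<xi> (s + 1 / K') y) has_vector_derivative \<xi>x (x + 1 / K') y) (at x)"
      by (rule has_vector_derivative_translate[of "\<lambda>s. \<xi> s y"]) (rule C1_dx[OF C])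
    then show "\<xi>x (x + 1 / K') y = \<xi>x x y" unfolding per using C1_dx[OF C] vector_derivative_unique_at by blast
    have "((\<lambda>s. \<xi> (x + 1 / K') s) has_vector_derivative \<xi>y (x + 1 / K') y) (at y)" by (rule C1_dy[OF C])
    then show "\<xi>y (x + 1 / K') y = \<xi>y x y" unfolding per using C1_dy[OF C] vector_derivative_unique_at by blast
  qed
  define av where "av F x y = (1/2) *\<^sub>R (F x y + F (x + h) y)" for F :: "real \<Rightarrow> real \<Rightarrow> spin" and x y
  define di where "di F x y = (1/2) *\<^sub>R (F x y - F (x + h) y)" for F :: "real \<Rightarrow> real \<Rightarrow> spin" and x y
  have Cav: "C1 (av F) (av Fx) (av Fy)" "C1 (di F) (di Fx) (di Fy)" if "C1 F Fx Fy" for F Fx Fy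
    using C1_linear[OF C1_add[OF that C1_shift[OF that, of h]] bounded_linear_scaleR_right[of "1/2"]]
      C1_linear[OF C1_diff[OF that C1_shift[OF that, of h]] bounded_linear_scaleR_right[of "1/2"]]
    by (simp_all add: av_def[abs_def] di_def[abs_def])
  have avp: "av \<xi> (x + h) y = av \<xi> x y" "di \<xi> (x + h) y = - di \<xi> x y" for x y
    unfolding av_def di_def hh per by (simp_all add: add.commute flip: scaleR_minus_right)
  have avq: "av \<xi> (x + a) (y + b) = av \<xi> x y" "di \<xi> (x + a) (y + b) = di \<xi> x y" for x y
    using per(2)[of "x + h" y] per(2)[of x y] by (simp_all add: av_def di_def add_ac)
  define d where "d = dir \<xi>x \<xi>y"
  have cd: "cont2 d" unfolding d_def by (intro cont2_dir cx)
  have dper: "d (x + h + h) y = d x y" for x y by (simp add: d_def dir_def hh perx)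
  have dav: "dir (av \<xi>x) (av \<xi>y) = av d" "dir (di \<xi>x) (di \<xi>y) = di d"
    by (simp_all add: fun_eq_iff dir_def av_def di_def d_def e_lin algebra_simps)
  have cav: "cont2 (av d)" "cont2 (di d)"
    unfolding dav[symmetric] using Cav[OF C] by (auto intro!: cont2_dir dest: cont2_C1)
  have sum: "av F x y + di F x y = F x y" "av F x y - di F x y = F (x + h) y" for F x y
    by (simp_all add: av_def di_def scaleR_add_right scaleR_diff_right) (simp_all flip: scaleR_add_left)
  have one: "F (x + 1) y = F x y" if "\<And>x y. F (x + h + h) y = F x y" for F :: "real \<Rightarrow> real \<Rightarrow> 'c" and x y
  proof -
    have "F (x + of_int (int K') * (h + h)) y = F x y"
      by (rule periodic_of_int[of "\<lambda>x. F x y"]) (use that in \<open>simp add: add.assoc\<close>)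
    moreover have "real K' * (h + h) = 1" using KK K0 by (simp add: h_def field_simps)
    ultimately show ?thesis by simp
  qed
  have e: "II b (\<lambda>x y. inner (av d x y) (av \<xi> x y)) \<le> II b (\<lambda>x y. (norm (av d x y))\<^sup>2 / V x y)"
    using M[unfolded specbd_def, rule_format, OF Cav(1)[OF C] Cav(1)[OF Cx]] avp(1) avq(1)
    by (simp add: dav h_def)
  have o: "II b (\<lambda>x y. inner (di d x y) (di \<xi> x y)) \<le> II b (\<lambda>x y. (norm (di d x y))\<^sup>2 / Z x y)"
    using odd[OF Cav(2)[OF C]] avp(2) avq(2) by (simp add: dav h_def)
  define A where "A x y = inner (av d x y) (av \<xi> x y) + inner (di d x y) (di \<xi> x y)" for x y
  define B where "B x y = inner (av d x y) (di \<xi> x y) + inner (di d x y) (av \<xi> x y)" for x y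
  have c\<xi>: "cont2 (av \<xi>)" "cont2 (di \<xi>)" using Cav[OF C] by (auto dest: cont2_C1)
  have cA: "cont2 A" "cont2 B" unfolding A_def B_def by (intro cont2_add cont2_inner cav c\<xi>)+
  \<comment> \<open>The products of an even with an odd factor change sign under the shift.\<close>
  have "II b B = 0"
  proof -
    have avd: "av d (x + h) y = av d x y" "di d (x + h) y = - di d x y" for x y
      unfolding av_def di_def dper by (simp_all add: add.commute flip: scaleR_minus_right)
    have Bh: "B (x + h) y = - B x y" for x y by (simp add: B_def avd avp)
    have "II b B = II b (\<lambda>x y. B (x + h) y)"
      by (rule II_shift_x[OF cA(2), symmetric]) (rule one, simp only: Bh minus_minus)
    also have "\<dots> = - II b B" unfolding Bh using II_cmult[of b "-1" B] by simp
    finally show ?thesis by simp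
  qed
  moreover have "inner (d x y) (\<xi> x y) = A x y + B x y" for x y
    by (subst (1 2) sum(1)[symmetric]) (simp add: A_def B_def inner_add_left inner_add_right)
  ultimately have "II b (\<lambda>x y. inner (d x y) (\<xi> x y)) = II b A" using II_add[OF cA] by simp
  also have "\<dots> = II b (\<lambda>x y. inner (av d x y) (av \<xi> x y)) + II b (\<lambda>x y. inner (di d x y) (di \<xi> x y))"
    unfolding A_def by (rule II_add) (intro cont2_inner cav c\<xi>)+
  also have "\<dots> \<le> II b (\<lambda>x y. (norm (av d x y))\<^sup>2 / V x y) + II b (\<lambda>x y. (norm (di d x y))\<^sup>2 / Z x y)"
    using e o by simp
  finally have 1: "II b (\<lambda>x y. inner (d x y) (\<xi> x y)) \<le> \<dots>" .
  have Wpos: "0 < (W x y + W (x + h) y) / 2" for x y using W(1)[of x y] W(1)[of "x + h" y] by simp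
  have nz: "V x y \<noteq> 0" "Z x y \<noteq> 0" "W x y \<noteq> 0" for x y
    using Wpos[of x y] VZ(1,2)[of x y] W(1)[of x y] unfolding h_def by linarith+
  have cq: "cont2 (\<lambda>x y. (norm (av d x y))\<^sup>2 / V x y)" "cont2 (\<lambda>x y. (norm (di d x y))\<^sup>2 / Z x y)"
    "cont2 (\<lambda>x y. (norm (d x y))\<^sup>2 / W x y)"
    by (intro cont2_divide cont2_power cont2_norm cav cV cd cW nz)+
  note cqs = cont2_shift[OF cq(3), of h]
  have "II b (\<lambda>x y. (norm (av d x y))\<^sup>2 / V x y) + II b (\<lambda>x y. (norm (di d x y))\<^sup>2 / Z x y)
     = II b (\<lambda>x y. (norm (av d x y))\<^sup>2 / V x y + (norm (di d x y))\<^sup>2 / Z x y)"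
    by (rule II_add[OF cq(1,2), symmetric])
  also have "\<dots> \<le> II b (\<lambda>x y. (1/2) * ((norm (d x y))\<^sup>2 / W x y + (norm (d (x + h) y))\<^sup>2 / W (x + h) y))"
  proof (rule II_mono)
    fix x y
    have "(norm (av d x y))\<^sup>2 / V x y + (norm (di d x y))\<^sup>2 / Z x y \<le>
      ((norm (av d x y + di d x y))\<^sup>2 / ((W x y + W (x + h) y) / 2 + (W x y - W (x + h) y) / 2) +
       (norm (av d x y - di d x y))\<^sup>2 / ((W x y + W (x + h) y) / 2 - (W x y - W (x + h) y) / 2)) / 2"
      using VZ[of x y] W(1)[of x y] W(1)[of "x + h" y] unfolding h_def by (intro pair_ineq) (simp_all add: field_simps)
    also have "(W x y + W (x + h) y) / 2 + (W x y - W (x + h) y) / 2 = W x y" by (simp add: field_simps)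
    also have "(W x y + W (x + h) y) / 2 - (W x y - W (x + h) y) / 2 = W (x + h) y" by (simp add: field_simps)
    finally show "(norm (av d x y))\<^sup>2 / V x y + (norm (di d x y))\<^sup>2 / Z x y \<le>
      (1/2) * ((norm (d x y))\<^sup>2 / W x y + (norm (d (x + h) y))\<^sup>2 / W (x + h) y)" by (simp add: sum)
  qed (intro cont2_add cont2_mult cont2_const cq cqs)+
  also have "\<dots> = (1/2) * (II b (\<lambda>x y. (norm (d x y))\<^sup>2 / W x y) + II b (\<lambda>x y. (norm (d (x + h) y))\<^sup>2 / W (x + h) y))"
    unfolding II_cmult II_add[OF cq(3) cqs] ..
  also have "II b (\<lambda>x y. (norm (d (x + h) y))\<^sup>2 / W (x + h) y) = II b (\<lambda>x y. (norm (d x y))\<^sup>2 / W x y)"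
  proof (rule II_shift_x[OF cq(3)])
    have Wh: "W (x + h + h) y = W x y" for x y unfolding hh by (rule W(2))
    show "(norm (d (x + 1) y))\<^sup>2 / W (x + 1) y = (norm (d x y))\<^sup>2 / W x y" for x y
      by (rule one[of "\<lambda>x y. (norm (d x y))\<^sup>2 / W x y"]) (simp only: dper Wh)
  qed
  finally show "II b (\<lambda>x y. inner (dir \<xi>x \<xi>y x y) (\<xi> x y)) \<le> II b (\<lambda>x y. (norm (dir \<xi>x \<xi>y x y))\<^sup>2 / W x y)"
    using 1 by (simp add: d_def)
qed

text \<open>Quantified over all weights with given circle norms, because each step replaces the
  weight while its norms remain controlled. The bound \<open>S\<close> determines how short the
  period must become before \<open>small_period_bound\<close> applies.\<close>

definition good :: "nat \<Rightarrow> real \<Rightarrow> real \<Rightarrow> real \<Rightarrow> (real \<Rightarrow> real) \<Rightarrow> bool" where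
  "good K a b S u \<longleftrightarrow> (\<forall>W. cont2 W \<longrightarrow>
     (\<forall>x y. 0 < W x y \<and> W x y \<le> S \<and> W (x + 1 / K) y = W x y \<and> W (x + a) (y + b) = W x y) \<longrightarrow>
     (\<forall>y. sqrt (xint (\<lambda>x y. (W x y)\<^sup>2) y) \<le> u y) \<longrightarrow> specbd K a b W)"

text \<open>\<open>bV\<close> and \<open>bZ\<close> interpolate between two pairs with \<open>(V - E) (Z - E) = D\<^sup>2\<close>: the first keeps \<open>V \<le> R\<close>, the
  second makes \<open>Z\<close> smaller at the expense of \<open>V\<close>. Their bounds relative to \<open>R\<close> are \<open>mu\<close> and \<open>ze\<close>.\<close>

definition "bV E D l t = (1 - l) * (E + D\<^sup>2 / (2 * sqrt (E\<^sup>2 + D\<^sup>2))) + l * (E + \<bar>D\<bar> / t)" for E D l t :: real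
definition "bZ E D l t = (1 - l) * (E + 2 * sqrt (E\<^sup>2 + D\<^sup>2)) + l * (E + t * \<bar>D\<bar>)" for E D l t :: real
definition "mu l t = (1 - l) + l * sqrt (1 + 1 / t\<^sup>2)" for l t :: real
definition "ze l t = (1 - l) * 3 + l * ((1 + t) / sqrt 2)" for l t :: real

text \<open>Both choices satisfy \<open>(V - E) (Z - E) = D^2\<close>, and the arithmetic-geometric
  mean inequality preserves the lower bound under interpolation. \<open>E + |D| / t\<close> is
  estimated by Cauchy-Schwarz; \<open>E + t |D|\<close> relative to \<open>R\<close> is largest at
  \<open>|D| = E\<close>, which gives \<open>(1 + t) / sqrt 2\<close>.\<close>

lemma blend_bounds:
  fixes E D l t :: real
  assumes ED: "\<bar>D\<bar> < E" and l: "0 \<le> l" "l \<le> 1" and t: "1 \<le> t"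
  shows "E \<le> bV E D l t" "E \<le> bZ E D l t" "D\<^sup>2 \<le> (bV E D l t - E) * (bZ E D l t - E)"
    "bV E D l t \<le> mu l t * sqrt (E\<^sup>2 + D\<^sup>2)" "bZ E D l t \<le> ze l t * sqrt (E\<^sup>2 + D\<^sup>2)"
proof -
  define R where "R = sqrt (E\<^sup>2 + D\<^sup>2)"
  have E: "0 < E" using ED by linarith
  have R2: "R * R = E\<^sup>2 + D\<^sup>2" by (simp add: R_def)
  have ER: "E \<le> R" unfolding R_def by (rule real_le_rsqrt) simp
  have R: "0 < R" using E ER by linarith
  define \<alpha>1 \<alpha>2 \<beta>1 \<beta>2 where "\<alpha>1 = D\<^sup>2 / (2 * R)" and "\<alpha>2 = \<bar>D\<bar> / t" and "\<beta>1 = 2 * R" and "\<beta>2 = t * \<bar>D\<bar>"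
  have nn: "0 \<le> \<alpha>1" "0 \<le> \<alpha>2" "0 \<le> \<beta>1" "0 \<le> \<beta>2" using R t by (auto simp: \<alpha>1_def \<alpha>2_def \<beta>1_def \<beta>2_def)
  have V: "bV E D l t = E + ((1 - l) * \<alpha>1 + l * \<alpha>2)" and Z: "bZ E D l t = E + ((1 - l) * \<beta>1 + l * \<beta>2)"
    by (simp_all add: bV_def bZ_def \<alpha>1_def \<alpha>2_def \<beta>1_def \<beta>2_def R_def algebra_simps)
  have nV: "0 \<le> (1 - l) * \<alpha>1 + l * \<alpha>2" "0 \<le> (1 - l) * \<beta>1 + l * \<beta>2" using nn l by (auto intro!: add_nonneg_nonneg mult_nonneg_nonneg)
  show "E \<le> bV E D l t" "E \<le> bZ E D l t" unfolding V Z using nV by auto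
  show "D\<^sup>2 \<le> (bV E D l t - E) * (bZ E D l t - E)"
  proof -
    have p: "\<alpha>1 * \<beta>1 = D\<^sup>2" "\<alpha>2 * \<beta>2 = D\<^sup>2" using R t by (auto simp: \<alpha>1_def \<alpha>2_def \<beta>1_def \<beta>2_def power2_eq_square)
    have cross: "2 * D\<^sup>2 \<le> \<alpha>1 * \<beta>2 + \<alpha>2 * \<beta>1"
    proof -
      have "(2 * D\<^sup>2)\<^sup>2 = 4 * (\<alpha>1 * \<beta>2) * (\<alpha>2 * \<beta>1)" using p by (simp add: power2_eq_square) algebra
      also have "\<dots> \<le> (\<alpha>1 * \<beta>2 + \<alpha>2 * \<beta>1)\<^sup>2"
        using zero_le_power2[of "\<alpha>1 * \<beta>2 - \<alpha>2 * \<beta>1"] by (simp add: power2_eq_square algebra_simps)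
      finally show ?thesis by (rule power2_le_imp_le) (use nn in auto)
    qed
    have "D\<^sup>2 = (1 - l)\<^sup>2 * D\<^sup>2 + l\<^sup>2 * D\<^sup>2 + (1 - l) * l * (2 * D\<^sup>2)" by algebra
    also have "\<dots> \<le> (1 - l)\<^sup>2 * D\<^sup>2 + l\<^sup>2 * D\<^sup>2 + (1 - l) * l * (\<alpha>1 * \<beta>2 + \<alpha>2 * \<beta>1)"
      using l by (intro add_left_mono mult_left_mono cross) auto
    also have "\<dots> = (1 - l)\<^sup>2 * (\<alpha>1 * \<beta>1) + l\<^sup>2 * (\<alpha>2 * \<beta>2) + (1 - l) * l * (\<alpha>1 * \<beta>2 + \<alpha>2 * \<beta>1)"
      unfolding p ..
    also have "\<dots> = (bV E D l t - E) * (bZ E D l t - E)" unfolding V Z by (simp add: power2_eq_square algebra_simps)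
    finally show ?thesis .
  qed
  \<comment> \<open>With \<open>D^2 = R^2 - E^2\<close> this is
    \<open>(R - E)^2 \<ge> 0\<close>.\<close>
  have VA: "E + \<alpha>1 \<le> R"
  proof -
    have "0 \<le> (R - E)\<^sup>2" by simp
    then have "2 * R * E + D\<^sup>2 \<le> 2 * (R * R)" unfolding power2_diff using R2 by (simp add: power2_eq_square)
    then show ?thesis using R by (simp add: \<alpha>1_def field_simps)
  qed
  have Vt: "E + \<alpha>2 \<le> sqrt (1 + 1 / t\<^sup>2) * R"
  proof -
    have "(E + \<alpha>2)\<^sup>2 \<le> (1 + 1 / t\<^sup>2) * (E\<^sup>2 + D\<^sup>2)"
    proof -
      have "0 \<le> (E / t - \<bar>D\<bar>)\<^sup>2" by simp
      also have "\<dots> = (1 + 1 / t\<^sup>2) * (E\<^sup>2 + D\<^sup>2) - (E + \<alpha>2)\<^sup>2"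
        using t by (simp add: \<alpha>2_def power2_diff power2_sum power_divide field_simps)
      finally show ?thesis by simp
    qed
    then have "E + \<alpha>2 \<le> sqrt ((1 + 1 / t\<^sup>2) * (E\<^sup>2 + D\<^sup>2))" by (rule real_le_rsqrt)
    then show ?thesis by (simp add: real_sqrt_mult R_def)
  qed
  have Zt: "E + \<beta>2 \<le> (1 + t) / sqrt 2 * R"
  proof -
    define s q where "s = E - \<bar>D\<bar>" and "q = \<bar>D\<bar>"
    have sq: "0 \<le> s" "0 \<le> q" "E = q + s" "D\<^sup>2 = q\<^sup>2" using ED by (auto simp: s_def q_def)
    have "(1 + t)\<^sup>2 / 2 * (E\<^sup>2 + D\<^sup>2) - (E + \<beta>2)\<^sup>2 = (t\<^sup>2 - 1) * (q * s) + ((t + 1)\<^sup>2 - 2) * s\<^sup>2 / 2"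
      unfolding \<beta>2_def q_def[symmetric] sq(3,4) by (simp add: power2_eq_square field_simps)
    also have "\<dots> \<ge> 0"
    proof -
      have "1\<^sup>2 \<le> t\<^sup>2" "2\<^sup>2 \<le> (t + 1)\<^sup>2" using t by (intro power_mono; simp)+
      then show ?thesis using sq(1,2) by (intro add_nonneg_nonneg mult_nonneg_nonneg divide_nonneg_nonneg) auto
    qed
    finally have "(E + \<beta>2)\<^sup>2 \<le> (1 + t)\<^sup>2 / 2 * (E\<^sup>2 + D\<^sup>2)" by simp
    then have "E + \<beta>2 \<le> sqrt ((1 + t)\<^sup>2 / 2 * (E\<^sup>2 + D\<^sup>2))" by (rule real_le_rsqrt)
    also have "\<dots> = (1 + t) / sqrt 2 * R" using t by (simp add: real_sqrt_mult real_sqrt_divide R_def)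
    finally show ?thesis .
  qed
  have "bV E D l t = (1 - l) * (E + \<alpha>1) + l * (E + \<alpha>2)" unfolding V by (simp add: algebra_simps)
  also have "\<dots> \<le> (1 - l) * R + l * (sqrt (1 + 1 / t\<^sup>2) * R)" using l by (intro add_mono mult_left_mono VA Vt) auto
  also have "\<dots> = mu l t * R" by (simp add: mu_def algebra_simps)
  finally show "bV E D l t \<le> mu l t * sqrt (E\<^sup>2 + D\<^sup>2)" by (simp add: R_def)
  have "bZ E D l t = (1 - l) * (E + \<beta>1) + l * (E + \<beta>2)" unfolding Z by (simp add: algebra_simps)
  also have "\<dots> \<le> (1 - l) * (3 * R) + l * ((1 + t) / sqrt 2 * R)"
    using l ER by (intro add_mono mult_left_mono Zt) (auto simp: \<beta>1_def)
  also have "\<dots> = ze l t * R" by (simp add: ze_def algebra_simps)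
  finally show "bZ E D l t \<le> ze l t * sqrt (E\<^sup>2 + D\<^sup>2)" by (simp add: R_def)
qed

text \<open>\<open>E^2 + D^2\<close> is the average of \<open>W^2\<close> over the pair of points,
  hence \<open>R\<close> has the same circle norms as \<open>W\<close>.\<close>

lemma even_odd_parts:
  fixes W :: "real \<Rightarrow> real \<Rightarrow> real"
  assumes cW: "cont2 W" and W: "\<And>x y. 0 < W x y" "\<And>x y. W (x + h + h) y = W x y" "\<And>x y. W (x + 1) y = W x y"
    "\<And>x y. W (x + a) (y + b) = W x y"
  defines "E \<equiv> \<lambda>x y. (W x y + W (x + h) y) / 2" and "D \<equiv> \<lambda>x y. (W x y - W (x + h) y) / 2"
  shows "cont2 E" "cont2 D" "\<And>x y. \<bar>D x y\<bar> < E x y" "\<And>x y. E (x + h) y = E x y" "\<And>x y. D (x + h) y = - D x y"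
    "\<And>x y. E (x + a) (y + b) = E x y" "\<And>x y. D (x + a) (y + b) = D x y"
    "\<And>y. xint (\<lambda>x y. (E x y)\<^sup>2 + (D x y)\<^sup>2) y = xint (\<lambda>x y. (W x y)\<^sup>2) y"
proof -
  have cs: "cont2 (\<lambda>x y. W (x + h) y)" by (rule cont2_shift[OF cW])
  show "cont2 E" "cont2 D" unfolding E_def D_def by (intro cont2_divide cont2_add cont2_diff cont2_const cW cs, simp)+
  show "\<bar>D x y\<bar> < E x y" for x y using W(1)[of x y] W(1)[of "x + h" y] unfolding E_def D_def by (simp add: abs_less_iff)
  show "E (x + h) y = E x y" "D (x + h) y = - D x y" for x y unfolding E_def D_def W(2) by (simp_all add: field_simps)
  have "W (x + a + h) (y + b) = W (x + h) y" for x y using W(4)[of "x + h" y] by (simp add: add_ac)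
  then show "E (x + a) (y + b) = E x y" "D (x + a) (y + b) = D x y" for x y unfolding E_def D_def W(4) by simp_all
  show "xint (\<lambda>x y. (E x y)\<^sup>2 + (D x y)\<^sup>2) y = xint (\<lambda>x y. (W x y)\<^sup>2) y" for y
  proof -
    have c2: "cont2 (\<lambda>x y. (W x y)\<^sup>2)" by (rule cont2_power[OF cW])
    have "(\<lambda>x y. (E x y)\<^sup>2 + (D x y)\<^sup>2) = (\<lambda>x y. (1/2) * ((W x y)\<^sup>2 + (W (x + h) y)\<^sup>2))"
      by (simp add: fun_eq_iff E_def D_def power2_eq_square field_simps)
    moreover have "xint (\<lambda>x y. (1/2) * ((W x y)\<^sup>2 + (W (x + h) y)\<^sup>2)) y = (1/2) * (xint (\<lambda>x y. (W x y)\<^sup>2) y + xint (\<lambda>x y. (W (x + h) y)\<^sup>2) y)"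
      using xint_cmult[of "\<lambda>_. 1/2" "\<lambda>x y. (W x y)\<^sup>2 + (W (x + h) y)\<^sup>2" y] xint_add[OF c2 cont2_power[OF cs], of 2 y] by simp
    moreover have "xint (\<lambda>x y. (W (x + h) y)\<^sup>2) y = xint (\<lambda>x y. (W x y)\<^sup>2) y"
      by (rule xint_shift_x[OF c2]) (simp add: W(3))
    ultimately show ?thesis by simp
  qed
qed

lemma l2_norm_le:
  assumes "cont2 V" "cont2 R2" "\<And>x. 0 \<le> V x y" "\<And>x. 0 \<le> R2 x y" "\<And>x. V x y \<le> m * sqrt (R2 x y)" "0 \<le> m"
  shows "sqrt (xint (\<lambda>x y. (V x y)\<^sup>2) y) \<le> m * sqrt (xint R2 y)"
proof -
  have "xint (\<lambda>x y. (V x y)\<^sup>2) y \<le> xint (\<lambda>x y. m\<^sup>2 * R2 x y) y"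
  proof (rule xint_mono)
    fix x
    have "(V x y)\<^sup>2 \<le> (m * sqrt (R2 x y))\<^sup>2" using assms by (intro power_mono) auto
    then show "(V x y)\<^sup>2 \<le> m\<^sup>2 * R2 x y" using assms(4) by (simp add: power_mult_distrib)
  qed (intro cont2_power cont2_mult cont2_const assms)+
  also have "\<dots> = m\<^sup>2 * xint R2 y" by (simp add: xint_def)
  finally have "sqrt (xint (\<lambda>x y. (V x y)\<^sup>2) y) \<le> sqrt (m\<^sup>2 * xint R2 y)" by (rule real_sqrt_le_mono)
  then show ?thesis using assms(6) by (simp add: real_sqrt_mult)
qed

text \<open>One halving of the period: circle norms grow at most by \<open>mu\<close> from
  \<open>W\<close> to \<open>V\<close> and at most by \<open>ze\<close> from \<open>W\<close> to
  \<open>Z\<close>. The factor \<open>r > 1\<close> is the room for approximation that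
  \<open>anti_bound\<close> asks for.\<close>

lemma good_step:
  assumes b: "0 < b" and K: "1 \<le> K" and r: "1 < r"
    and l: "continuous_on UNIV l" "\<And>y. 0 \<le> l y" "\<And>y. l y \<le> 1" "\<And>y. l (y + b) = l y"
    and t: "continuous_on UNIV t" "\<And>y. 1 \<le> t y" "\<And>y. t (y + b) = t y"
    and S: "\<And>y. mu (l y) (t y) * S \<le> S'"
    and u': "\<And>y. mu (l y) (t y) * u y \<le> u' y"
    and z: "\<And>y. r * (ze (l y) (t y) * u y) \<le> z y" and cr: "crit (2 * K) b z"
    and g: "good (2 * K) a b S' u'"
  shows "good K a b S u"
  unfolding good_def
proof (intro allI impI)
  fix W
  assume cW: "cont2 W" and W': "\<forall>x y. 0 < W x y \<and> W x y \<le> S \<and> W (x + 1 / K) y = W x y \<and> W (x + a) (y + b) = W x y"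
    and u: "\<forall>y. sqrt (xint (\<lambda>x y. (W x y)\<^sup>2) y) \<le> u y"
  interpret modes "2 * K" a b by unfold_locales (use K b in auto)
  define h where "h = 1 / real (2 * K)"
  have hh: "x + h + h = x + 1 / K" for x using K by (simp add: h_def field_simps)
  have W: "0 < W x y" "W x y \<le> S" "W (x + h + h) y = W x y" "W (x + a) (y + b) = W x y" for x y
    using W' unfolding hh by auto
  have W1: "W (x + 1) y = W x y" for x y
  proof -
    have "W (x + of_int (int K) * (1 / K)) y = W x y"
      by (rule periodic_of_int[of "\<lambda>x. W x y"]) (use W' in simp)
    then show ?thesis using K by simp
  qed
  define E where "E x y = (W x y + W (x + h) y) / 2" for x y
  define D where "D x y = (W x y - W (x + h) y) / 2" for x y
  note eo = even_odd_parts[OF cW W(1,3) W1 W(4), folded E_def D_def]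
  have cR2: "cont2 (\<lambda>x y. (E x y)\<^sup>2 + (D x y)\<^sup>2)" by (intro cont2_add cont2_power eo(1,2))
  have R0: "0 < (E x y)\<^sup>2 + (D x y)\<^sup>2" for x y using eo(3)[of x y] by (intro add_pos_nonneg) auto
  have RS: "sqrt ((E x y)\<^sup>2 + (D x y)\<^sup>2) \<le> S" for x y
  proof -
    have "(W x y)\<^sup>2 \<le> S\<^sup>2" "(W (x + h) y)\<^sup>2 \<le> S\<^sup>2" by (intro power_mono W(2) less_imp_le[OF W(1)])+
    then have "(E x y)\<^sup>2 + (D x y)\<^sup>2 \<le> S\<^sup>2"
      by (simp add: E_def D_def power2_eq_square field_simps)
    moreover have "0 \<le> S" using W(1,2)[of x y] by simp
    ultimately show ?thesis using real_sqrt_le_mono by fastforce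
  qed
  define V where "V x y = bV (E x y) (D x y) (l y) (t y)" for x y
  define Z where "Z x y = bZ (E x y) (D x y) (l y) (t y)" for x y
  have bb: "E x y \<le> V x y" "E x y \<le> Z x y" "(D x y)\<^sup>2 \<le> (V x y - E x y) * (Z x y - E x y)"
    "V x y \<le> mu (l y) (t y) * sqrt ((E x y)\<^sup>2 + (D x y)\<^sup>2)" "Z x y \<le> ze (l y) (t y) * sqrt ((E x y)\<^sup>2 + (D x y)\<^sup>2)" for x y
    unfolding V_def Z_def by (rule blend_bounds[OF eo(3) l(2,3) t(2)])+
  have t0: "t y \<noteq> 0" for y using t(2)[of y] by simp
  have sR: "2 * sqrt ((E x y)\<^sup>2 + (D x y)\<^sup>2) \<noteq> 0" for x y
  proof -
    have "0 < sqrt ((E x y)\<^sup>2 + (D x y)\<^sup>2)" by (rule real_sqrt_gt_zero[OF R0])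
    then show ?thesis by linarith
  qed
  have cabs: "cont2 (\<lambda>x y. \<bar>D x y\<bar>)" using cont2_norm[OF eo(2)] by simp
  note cl = cont2_of_line[OF l(1)] and ct = cont2_of_line[OF t(1)]
  have cV: "cont2 V" unfolding V_def bV_def
    by (intro cont2_add cont2_mult cont2_diff cont2_const cont2_divide cont2_power cont2_sqrt cl ct cabs eo(1,2) cR2 sR t0)
  have cZ: "cont2 Z" unfolding Z_def bZ_def
    by (intro cont2_add cont2_mult cont2_diff cont2_const cont2_power cont2_sqrt cl ct cabs eo(1,2) cR2)
  have E0: "0 < E x y" for x y using eo(3)[of x y] by linarith
  have VZ0: "0 < V x y" "0 < Z x y" for x y using bb(1,2)[of x y] E0[of x y] by linarith+
  have Vh: "V (x + h) y = V x y" "Z (x + h) y = Z x y" for x y by (simp_all add: V_def Z_def bV_def bZ_def eo)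
  have Vab: "V (x + a) (y + b) = V x y" "Z (x + a) (y + b) = Z x y" for x y by (simp_all only: V_def Z_def eo l t)
  have mu0: "0 \<le> mu (l y) (t y)" "0 \<le> ze (l y) (t y)" for y
    unfolding mu_def ze_def using l(2,3)[of y] t(2)[of y] by (auto intro!: add_nonneg_nonneg mult_nonneg_nonneg)
  have VS: "V x y \<le> S'" for x y
    using order_trans[OF bb(4)[of x y] mult_left_mono[OF RS mu0(1)]] S[of y] by (rule order_trans)
  have nV: "sqrt (xint (\<lambda>x y. (V x y)\<^sup>2) y) \<le> u' y" for y
  proof -
    have "sqrt (xint (\<lambda>x y. (V x y)\<^sup>2) y) \<le> mu (l y) (t y) * sqrt (xint (\<lambda>x y. (E x y)\<^sup>2 + (D x y)\<^sup>2) y)"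
      by (rule l2_norm_le[OF cV cR2]) (use VZ0 R0 bb(4) mu0 in \<open>auto intro: less_imp_le\<close>)
    also have "\<dots> \<le> mu (l y) (t y) * u y" unfolding eo(8) using u mu0 by (intro mult_left_mono) auto
    finally show ?thesis using u'[of y] by linarith
  qed
  have nZ: "r * sqrt (xint (\<lambda>x y. (Z x y)\<^sup>2) y) \<le> z y" for y
  proof -
    have "sqrt (xint (\<lambda>x y. (Z x y)\<^sup>2) y) \<le> ze (l y) (t y) * sqrt (xint (\<lambda>x y. (E x y)\<^sup>2 + (D x y)\<^sup>2) y)"
      by (rule l2_norm_le[OF cZ cR2]) (use VZ0 R0 bb(5) mu0 in \<open>auto intro: less_imp_le\<close>)
    also have "\<dots> \<le> ze (l y) (t y) * u y" unfolding eo(8) using u mu0 by (intro mult_left_mono) auto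
    finally have "r * sqrt (xint (\<lambda>x y. (Z x y)\<^sup>2) y) \<le> r * (ze (l y) (t y) * u y)" using r by (intro mult_left_mono) auto
    then show ?thesis using z[of y] by linarith
  qed
  have MV: "specbd (2 * K) a b V"
    using g[unfolded good_def, rule_format, OF cV _ nV] VZ0 VS Vh Vab by (simp add: h_def)
  show "specbd K a b W"
  proof (rule halving[of K W V Z])
    show "W (x + 1 / K) y = W x y" for x y using W(3)[of x y] unfolding hh .
    show "(W x y + W (x + 1 / real (2 * K)) y) / 2 \<le> V x y" "(W x y + W (x + 1 / real (2 * K)) y) / 2 \<le> Z x y" for x y
      using bb(1,2)[of x y] by (simp_all add: E_def h_def)
    show "((W x y - W (x + 1 / real (2 * K)) y) / 2)\<^sup>2 \<le>
        (V x y - (W x y + W (x + 1 / real (2 * K)) y) / 2) * (Z x y - (W x y + W (x + 1 / real (2 * K)) y) / 2)" for x y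
      using bb(3)[of x y] by (simp add: E_def D_def h_def)
    fix \<xi> \<xi>x \<xi>y :: "real \<Rightarrow> real \<Rightarrow> spin" assume "C1 \<xi> \<xi>x \<xi>y" "\<And>x y. \<xi> (x + 1 / real (2 * K)) y = - \<xi> x y" "\<And>x y. \<xi> (x + a) (y + b) = \<xi> x y"
    then show "II b (\<lambda>x y. inner (dir \<xi>x \<xi>y x y) (\<xi> x y)) \<le> II b (\<lambda>x y. (norm (dir \<xi>x \<xi>y x y))\<^sup>2 / Z x y)"
      using Vh(2) by (intro anti_bound[OF cZ VZ0(2) _ Vab(2) r nZ cr]) (simp_all add: h_def)
  qed (use cW W(1) cV cZ MV in auto)
qed

lemma good_base:
  assumes b: "0 < b" and K: "1 \<le> K" and S: "S \<le> real K / 3" and u: "continuous_on UNIV u" "integral {0..b} u \<le> 2 * pi"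
  shows "good K a b S u"
  unfolding good_def
proof (intro allI impI)
  fix W
  assume cW: "cont2 W" and W': "\<forall>x y. 0 < W x y \<and> W x y \<le> S \<and> W (x + 1 / K) y = W x y \<and> W (x + a) (y + b) = W x y"
    and le: "\<forall>y. sqrt (xint (\<lambda>x y. (W x y)\<^sup>2) y) \<le> u y"
  interpret modes K a b by unfold_locales (use K b in auto)
  show "specbd K a b W"
  proof (rule small_period_bound[OF cW])
    show "W x y \<le> real K / 3" for x y using W' S by (meson order_trans)
    have "integral {0..b} (\<lambda>y. sqrt (xint (\<lambda>x y. (W x y)\<^sup>2) y)) \<le> integral {0..b} u"
      using le by (intro integral_le integrable_continuous_interval continuous_on_real_sqrt xint_cont cont2_power[OF cW]
          continuous_on_subset[OF u(1)]) auto
    then show "integral {0..b} (\<lambda>y. sqrt (xint (\<lambda>x y. (W x y)\<^sup>2) y)) \<le> 2 * pi" using u(2) by linarith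
  qed (use W' in auto)
qed

text \<open>With \<open>l = 0\<close> the factors are \<open>mu = 1\<close> and
  \<open>ze = 3\<close>: neither circle norms nor supremum grow, so the step can be repeated until
  the period is short compared with \<open>1 / S\<close>. The induction runs back from that
  period.\<close>

lemma good_stable:
  assumes b: "0 < b" and r: "1 < r" and u: "continuous_on UNIV u" "integral {0..b} u \<le> 2 * pi"
    and cr: "\<And>j. n \<le> j \<Longrightarrow> crit (2 * 2 ^ j) b (\<lambda>y. r * (3 * u y))"
  shows "good (2 ^ n) a b S u"
proof -
  obtain N :: nat where N: "3 * S \<le> 2 ^ N" using real_arch_pow[of 2 "3 * S"] by (auto intro: less_imp_le)
  have "good (2 ^ (n + N - k)) a b S u" if "k \<le> N" for k
    using that
  proof (induction k)
    case 0
    have "(2::real) ^ N \<le> 2 ^ (n + N)" by (rule power_increasing) auto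
    then have "3 * S \<le> 2 ^ (n + N)" using N by linarith
    then show ?case by (intro good_base[OF b _ _ u]) auto
  next
    case (Suc k)
    define j where "j = n + N - Suc k"
    have j: "n \<le> j" "n + N - k = Suc j" using Suc.prems by (auto simp: j_def)
    have "good (2 * 2 ^ j) a b S u" using Suc j by simp
    then have "good (2 ^ j) a b S u"
      by (intro good_step[OF b _ r, of "2 ^ j" "\<lambda>_. 0" "\<lambda>_. 1" S S u u "\<lambda>y. r * (3 * u y)"] cr j)
        (auto simp: mu_def ze_def intro: continuous_intros)
    then show ?case by (simp add: j_def)
  qed
  from this[of N] show ?thesis by simp
qed

section \<open>Weights of bounded area\<close>

text \<open>Numerical form of \<open>crit\<close>. From \<open>b \<ge> 2 \<pi>\<close> follows
  \<open>sqrt (b / 2) \<ge> 1.772\<close>, and 2.42 times 1.772 exceeds 4.288. With an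
  \<open>L^2\<close> norm of at most \<open>4.03 K\<close> the slab term is at least 2 times 4.288
  times 0.258 times \<open>K^2\<close>, more than \<open>4 K\<close> from \<open>K = 2\<close>
  on.\<close>

lemma crit_intro:
  assumes b: "2 * pi \<le> b" and K: "2 \<le> K" and z: "continuous_on UNIV z"
    and E: "continuous_on UNIV E" "\<And>y. 0 \<le> E y" "\<And>y. E (y + b) = E y"
      "\<And>y. z y \<le> 2.42 * real K \<or> (z y)\<^sup>2 / 2 \<le> E y" "integral {0..b} E < 4 * real K"
    and z2: "integral {0..b} (\<lambda>y. (z y)\<^sup>2) \<le> (4.03 * real K)\<^sup>2"
  shows "crit K b z"
proof -
  define T where "T = 2.42 * real K * sqrt (b / 2)"
  define t where "t = sqrt (integral {0..b} (\<lambda>y. (z y)\<^sup>2))"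
  have "1.772\<^sup>2 \<le> b / 2" using b pi_approx(1) by (simp add: power2_eq_square)
  then have "1.772 \<le> sqrt (b / 2)" by (rule real_le_rsqrt)
  then have "2.42 * real K * 1.772 \<le> T" unfolding T_def by (intro mult_left_mono) auto
  then have T: "4.288 * real K \<le> T" by simp
  have "t \<le> sqrt ((4.03 * real K)\<^sup>2)" unfolding t_def by (rule real_sqrt_le_mono[OF z2])
  then have t: "t \<le> 4.03 * real K" by (simp add: real_sqrt_mult)
  have "2 * (4.288 * real K) * (0.258 * real K) \<le> 2 * T * (T - t)"
    using T t K by (intro mult_mono) auto
  moreover have "4 * real K \<le> 2 * (4.288 * real K) * (0.258 * real K)"
  proof -
    have "real K * 2 \<le> real K * real K" using K by (intro mult_left_mono) auto
    moreover have "2 * (4.288 * real K) * (0.258 * real K) = 2.212608 * (real K * real K)" by simp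
    ultimately show ?thesis by simp
  qed
  ultimately have sl: "4 * real K \<le> 2 * T * (T - t)" by linarith
  show ?thesis unfolding crit_def
  proof (intro conjI exI[of _ E])
    show "4 * real K \<le> 2 * (2.42 * real K) * sqrt (b/2) * ((2.42 * real K) * sqrt (b/2) - sqrt (integral {0..b} (\<lambda>y. (z y)\<^sup>2)))"
      using sl unfolding T_def t_def by (simp only: mult.assoc)
  qed (use z E in auto)
qed

definition ramp :: "real \<Rightarrow> real \<Rightarrow> real \<Rightarrow> real" where
  "ramp l h v = min 1 (max 0 ((v - l) / (h - l)))"

lemma ramp:
  assumes "l < h"
  shows "0 \<le> ramp l h v" "ramp l h v \<le> 1" "v \<le> l \<Longrightarrow> ramp l h v = 0" "h \<le> v \<Longrightarrow> ramp l h v = 1"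
  using assms unfolding ramp_def by (auto simp: divide_le_0_iff le_divide_eq max_def min_def)

lemma ramp_continuous: "l < h \<Longrightarrow> continuous_on UNIV u \<Longrightarrow> continuous_on UNIV (\<lambda>y. ramp l h (u y))"
  unfolding ramp_def by (intro continuous_on_min continuous_on_max continuous_intros) auto

text \<open>One halving whose interpolation depends on the size of \<open>u\<close>. Up to
  \<open>l\<close> the norms are preserved and \<open>Z \<le> 3 R\<close>. Above \<open>h\<close>,
  where \<open>3 u\<close> may pass the threshold 2.42 times \<open>2 K\<close>, the factor for
  \<open>Z\<close> is lowered to \<open>(1 + t) / sqrt 2\<close>, and in exchange the norm of
  \<open>V\<close> may grow by \<open>sqrt (1 + 1 / t^2)\<close>. Above \<open>h2\<close>, where
  \<open>\<theta>a\<close> may no longer suffice, \<open>t = \<theta>b\<close> and the excess is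
  charged to the budget of \<open>crit\<close>.\<close>

lemma level:
  fixes u :: "real \<Rightarrow> real"
  assumes b: "2 * pi \<le> b" and K: "1 \<le> K" and u: "continuous_on UNIV u" "\<And>y. 0 \<le> u y" "\<And>y. u (y + b) = u y"
    and lh: "l < h" "l2 < h2" and th: "1 \<le> \<theta>b" "\<theta>b \<le> \<theta>a" "(1 + \<theta>a) / sqrt 2 \<le> 3" and r: "1 < r"
    and z1: "r * (3 * h) \<le> 2.42 * (2 * real K)" and z2: "r * ((1 + \<theta>a) / sqrt 2 * h2) \<le> 2.42 * (2 * real K)"
    and E: "(r * (1 + \<theta>b))\<^sup>2 / 4 * integral {0..b} (\<lambda>y. (u y)\<^sup>2) < 4 * (2 * real K)"
    and sl: "9 * r\<^sup>2 * integral {0..b} (\<lambda>y. (u y)\<^sup>2) \<le> (4.03 * (2 * real K))\<^sup>2"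
  obtains u' where "continuous_on UNIV u'" "\<And>y. u y \<le> u' y" "\<And>y. u' (y + b) = u' y"
    "\<And>y. u' y \<le> sqrt (1 + 1 / \<theta>b\<^sup>2) * u y" "\<And>y. u y \<le> l \<Longrightarrow> u' y = u y"
    "\<And>y. u y \<le> l2 \<Longrightarrow> u' y \<le> sqrt (1 + 1 / \<theta>a\<^sup>2) * u y"
    "\<And>S. 0 \<le> S \<Longrightarrow> good (2 * K) a b (2 * S) u' \<Longrightarrow> good K a b S u"
proof -
  define L where "L y = ramp l h (u y)" for y
  define t where "t y = \<theta>a - ramp l2 h2 (u y) * (\<theta>a - \<theta>b)" for y
  have L: "continuous_on UNIV L" "0 \<le> L y" "L y \<le> 1" "L (y + b) = L y" for y
    unfolding L_def using ramp[OF lh(1)] ramp_continuous[OF lh(1) u(1)] u(3) by auto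
  have tb: "\<theta>b \<le> t y" "t y \<le> \<theta>a" for y
  proof -
    have "ramp l2 h2 (u y) * (\<theta>a - \<theta>b) \<le> 1 * (\<theta>a - \<theta>b)" "0 \<le> ramp l2 h2 (u y) * (\<theta>a - \<theta>b)"
      using ramp(1,2)[OF lh(2)] th by (intro mult_right_mono mult_nonneg_nonneg; simp)+
    then show "\<theta>b \<le> t y" "t y \<le> \<theta>a" by (auto simp: t_def)
  qed
  have t: "continuous_on UNIV t" "1 \<le> t y" "t (y + b) = t y" for y
    using tb[of y] th u(3) by (auto simp: t_def[abs_def] intro!: continuous_intros ramp_continuous[OF lh(2) u(1)])
  have t0: "t y \<noteq> 0" for y using t(2)[of y] by simp
  define m where "m y = mu (L y) (t y)" for y
  define e where "e y = ze (L y) (t y)" for y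
  have sq: "sqrt (1 + 1 / (t y)\<^sup>2) \<le> sqrt (1 + 1 / \<theta>b\<^sup>2)" for y
    using tb[of y] th by (intro real_sqrt_le_mono add_left_mono divide_left_mono power_mono) auto
  have sb1: "1 \<le> sqrt (1 + 1 / x\<^sup>2)" for x :: real by simp
  have m1: "1 \<le> m y" for y
  proof -
    have "L y * 1 \<le> L y * sqrt (1 + 1 / (t y)\<^sup>2)" by (intro mult_left_mono sb1 L)
    then show ?thesis by (simp add: m_def mu_def)
  qed
  have mb: "m y \<le> sqrt (1 + 1 / \<theta>b\<^sup>2)" for y
  proof -
    have "(1 - L y) * 1 + L y * sqrt (1 + 1 / (t y)\<^sup>2) \<le> (1 - L y) * sqrt (1 + 1 / \<theta>b\<^sup>2) + L y * sqrt (1 + 1 / \<theta>b\<^sup>2)"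
      using L(2,3)[of y] by (intro add_mono mult_left_mono sb1 sq) auto
    then show ?thesis by (simp add: m_def mu_def algebra_simps)
  qed
  have ma: "m y \<le> sqrt (1 + 1 / \<theta>a\<^sup>2)" if "u y \<le> l2" for y
  proof -
    have ty: "t y = \<theta>a" using ramp(3)[OF lh(2) that] by (simp add: t_def)
    have "(1 - L y) * 1 + L y * sqrt (1 + 1 / \<theta>a\<^sup>2) \<le> (1 - L y) * sqrt (1 + 1 / \<theta>a\<^sup>2) + L y * sqrt (1 + 1 / \<theta>a\<^sup>2)"
      using L(2,3)[of y] by (intro add_right_mono mult_left_mono sb1) auto
    then show ?thesis by (simp add: m_def mu_def ty algebra_simps)
  qed
  have tz: "(1 + t y) / sqrt 2 \<le> (1 + \<theta>a) / sqrt 2" for y using tb[of y] by (intro divide_right_mono) auto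
  have e3: "e y \<le> 3" for y
  proof -
    have "(1 - L y) * 3 + L y * ((1 + t y) / sqrt 2) \<le> (1 - L y) * 3 + L y * 3"
      using L(2,3)[of y] tz[of y] th(3) by (intro add_left_mono mult_left_mono) auto
    then show ?thesis by (simp add: e_def ze_def)
  qed
  have e0: "0 \<le> e y" for y unfolding e_def ze_def using L(2,3)[of y] t(2)[of y] by (intro add_nonneg_nonneg mult_nonneg_nonneg) auto
  define u' where "u' y = m y * u y" for y
  define z where "z y = r * (e y * u y)" for y
  have cm: "continuous_on UNIV m" unfolding m_def mu_def by (intro continuous_intros L t ballI) (use t0 in auto)
  have ce: "continuous_on UNIV e" unfolding e_def ze_def by (intro continuous_intros L t) auto
  have cz: "continuous_on UNIV z" unfolding z_def by (intro continuous_intros ce u)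
  note cs = continuous_on_subset[OF _ subset_UNIV]
  have cr: "crit (2 * K) b z"
  proof (rule crit_intro[OF b _ cz, where E = "\<lambda>y. (r * (1 + \<theta>b))\<^sup>2 / 4 * (u y)\<^sup>2"])
    show "z y \<le> 2.42 * real (2 * K) \<or> (z y)\<^sup>2 / 2 \<le> (r * (1 + \<theta>b))\<^sup>2 / 4 * (u y)\<^sup>2" for y
    proof (cases "u y \<le> h")
      case True
      have "e y * u y \<le> 3 * h" using e3 u(2) True e0 by (intro mult_mono) auto
      then have "z y \<le> r * (3 * h)" unfolding z_def using r by (intro mult_left_mono) auto
      then show ?thesis using z1 by simp
    next
      case False
      then have "L y = 1" unfolding L_def using ramp(4)[OF lh(1)] by simp
      then have ey: "e y = (1 + t y) / sqrt 2" by (simp add: e_def ze_def)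
      show ?thesis
      proof (cases "u y \<le> h2")
        case True
        have "e y * u y \<le> (1 + \<theta>a) / sqrt 2 * h2" unfolding ey using tz[of y] u(2) True t(2)[of y] th by (intro mult_mono) auto
        then have "z y \<le> r * ((1 + \<theta>a) / sqrt 2 * h2)" unfolding z_def using r by (intro mult_left_mono) auto
        also have "\<dots> \<le> 2.42 * real (2 * K)" using z2 by (simp only: of_nat_mult of_nat_numeral)
        finally show ?thesis ..
      next
        case False
        then have "t y = \<theta>b" unfolding t_def using ramp(4)[OF lh(2)] by simp
        then have "(z y)\<^sup>2 / 2 = (r * (1 + \<theta>b))\<^sup>2 / 4 * (u y)\<^sup>2"
          unfolding z_def ey by (simp add: power_mult_distrib power_divide)
        then show ?thesis by simp
      qed
    qed
    show "integral {0..b} (\<lambda>y. (r * (1 + \<theta>b))\<^sup>2 / 4 * (u y)\<^sup>2) < 4 * real (2 * K)" using E by simp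
    have "integral {0..b} (\<lambda>y. (z y)\<^sup>2) \<le> integral {0..b} (\<lambda>y. 9 * r\<^sup>2 * (u y)\<^sup>2)"
    proof (rule integral_le)
      show "(\<lambda>y. (z y)\<^sup>2) integrable_on {0..b}" "(\<lambda>y. 9 * r\<^sup>2 * (u y)\<^sup>2) integrable_on {0..b}"
        by (intro integrable_continuous_interval continuous_intros cs[OF cz] cs[OF u(1)])+
      fix y
      have "(e y)\<^sup>2 \<le> 3\<^sup>2" using e0 e3 by (intro power_mono) auto
      then have "(e y)\<^sup>2 * (r\<^sup>2 * (u y)\<^sup>2) \<le> 9 * (r\<^sup>2 * (u y)\<^sup>2)" by (intro mult_right_mono) auto
      then show "(z y)\<^sup>2 \<le> 9 * r\<^sup>2 * (u y)\<^sup>2" by (simp add: z_def power_mult_distrib mult_ac)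
    qed
    also have "\<dots> = 9 * r\<^sup>2 * integral {0..b} (\<lambda>y. (u y)\<^sup>2)" by simp
    finally show "integral {0..b} (\<lambda>y. (z y)\<^sup>2) \<le> (4.03 * real (2 * K))\<^sup>2" using sl by simp
  qed (use K u in \<open>auto intro!: continuous_intros\<close>)
  have b0: "0 < b" using b pi_gt_zero by linarith
  have good: "good K a b S u" if "0 \<le> S" "good (2 * K) a b (2 * S) u'" for S
  proof (rule good_step[OF b0 K r L t _ _ _ cr that(2)])
    have "1\<^sup>2 \<le> \<theta>b\<^sup>2" using th by (intro power_mono) auto
    then have "1 / \<theta>b\<^sup>2 \<le> 1" by (simp add: divide_le_eq_1)
    then have "sqrt (1 + 1 / \<theta>b\<^sup>2) \<le> sqrt 4" by (intro real_sqrt_le_mono) simp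
    then have "m y \<le> 2" for y using mb[of y] by simp
    then show "mu (L y) (t y) * S \<le> 2 * S" for y using that(1) unfolding m_def by (intro mult_right_mono) auto
  qed (simp_all add: u'_def m_def z_def e_def)
  show ?thesis
  proof (rule that[of u'])
    show "continuous_on UNIV u'" unfolding u'_def by (intro continuous_intros cm u)
    show "u y \<le> u' y" for y using mult_right_mono[OF m1 u(2)] by (simp add: u'_def)
    show "u' (y + b) = u' y" for y by (simp add: u'_def m_def L t u)
    show "u' y \<le> sqrt (1 + 1 / \<theta>b\<^sup>2) * u y" for y unfolding u'_def by (intro mult_right_mono mb u)
    show "u' y = u y" if "u y \<le> l" for y
      using ramp(3)[OF lh(1) that] by (simp add: u'_def m_def mu_def L_def)
    show "u' y \<le> sqrt (1 + 1 / \<theta>a\<^sup>2) * u y" if "u y \<le> l2" for y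
      unfolding u'_def by (intro mult_right_mono ma that u)
  qed (rule good)
qed

text \<open>\<open>(u^2 + 1) / 2 - m u\<close> increases for \<open>u \<ge> m\<close>, so only the
  left end \<open>u0\<close> has to be checked.\<close>

lemma half_sq_bound:
  fixes m u0 u :: real
  assumes "u0 \<le> u" "m \<le> u0" "2 * m * u0 \<le> u0\<^sup>2 + 1"
  shows "m * u \<le> (u\<^sup>2 + 1) / 2"
proof -
  have "(2 * m) * (u - u0) \<le> (u + u0) * (u - u0)" using assms by (intro mult_right_mono) auto
  then show ?thesis using assms(3) by (simp add: power2_eq_square algebra_simps)
qed

lemma integral_sq_le:
  fixes u v :: "real \<Rightarrow> real"
  assumes "continuous_on UNIV u" "continuous_on UNIV v" "\<And>y. (0::real) \<le> v y" "\<And>y. v y \<le> sqrt c * u y"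
    and that: "0 \<le> c"
  shows "integral {0..b} (\<lambda>y. (v y)\<^sup>2) \<le> c * integral {0..b} (\<lambda>y. (u y)\<^sup>2)"
proof -
  have "integral {0..b} (\<lambda>y. (v y)\<^sup>2) \<le> integral {0..b} (\<lambda>y. c * (u y)\<^sup>2)"
  proof (rule integral_le)
    show "(\<lambda>y. (v y)\<^sup>2) integrable_on {0..b}" "(\<lambda>y. c * (u y)\<^sup>2) integrable_on {0..b}"
      by (intro integrable_continuous_interval continuous_intros continuous_on_subset[OF assms(1)]
        continuous_on_subset[OF assms(2)] subset_UNIV)+
    fix y
    have "(v y)\<^sup>2 \<le> (sqrt c * u y)\<^sup>2" using assms by (intro power_mono)
    then show "(v y)\<^sup>2 \<le> c * (u y)\<^sup>2" using that by (simp add: power_mult_distrib)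
  qed
  then show ?thesis by simp
qed

text \<open>Four steps with numerically tuned interpolation reach a period for which the norm-preserving choice
  satisfies \<open>crit\<close> at all further steps.\<close>

theorem good_one:
  fixes u p :: "real \<Rightarrow> real"
  assumes b: "2 * pi \<le> b" and u: "continuous_on UNIV u" "\<And>y. 0 \<le> u y" "\<And>y. u (y + b) = u y"
    and p: "continuous_on UNIV p" "\<And>y. u y \<le> p y" "\<And>y. 1.59 < u y \<Longrightarrow> ((u y)\<^sup>2 + 1) / 2 \<le> p y"
      "integral {0..b} p \<le> 2 * pi"
    and u2: "integral {0..b} (\<lambda>y. (u y)\<^sup>2) \<le> 6.3" and S: "0 \<le> S"
  shows "good 1 a b S u"
proof -
  define r :: real where "r = 1.0002"
  have s2: "x / sqrt 2 \<le> 0.70711 * x" if "0 \<le> x" for x :: real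
  proof -
    have "1 \<le> 0.70711 * sqrt (2::real)"
    proof -
      have "1 / 0.70711 \<le> sqrt 2" by (rule real_le_rsqrt) (simp add: power2_eq_square)
      then show ?thesis by simp
    qed
    then have "x * 1 \<le> x * (0.70711 * sqrt 2)" using that by (intro mult_left_mono)
    then show ?thesis by (simp add: pos_divide_le_eq mult_ac)
  qed
  have sq: "sqrt (1 + 1 / x\<^sup>2) \<le> y" if "0 < x" "0 \<le> y" "1 + x\<^sup>2 \<le> y\<^sup>2 * x\<^sup>2" for x y :: real
  proof (rule real_le_lsqrt)
    show "1 + 1 / x\<^sup>2 \<le> y\<^sup>2" using that by (simp add: field_simps)
  qed (use that in auto)
  \<comment> \<open>At each level \<open>h\<close> lies just below \<open>4.84 K / 3\<close>, and
    \<open>\<theta>b\<close> is limited by the budget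
    \<open>(1 + \<theta>b)^2 / 4 \<integral> u^2 < 8 K\<close>. At the first two levels
    \<open>h2\<close> lies just below \<open>4.84 K sqrt 2 / (1 + \<theta>a)\<close>; at the last
    two \<open>\<theta>a = \<theta>b\<close>, and \<open>l2 = 0\<close>, \<open>h2 = 1\<close> are
    placeholders.\<close>
  obtain u1 where u1: "continuous_on UNIV u1" "\<And>y. u y \<le> u1 y" "\<And>y. u1 (y + b) = u1 y"
    "\<And>y. u1 y \<le> sqrt (1 + 1 / 1.2\<^sup>2) * u y" "\<And>y. u y \<le> 1.595 \<Longrightarrow> u1 y = u y"
    "\<And>y. u y \<le> 2.19 \<Longrightarrow> u1 y \<le> sqrt (1 + 1 / 2.1\<^sup>2) * u y"
    "\<And>S. 0 \<le> S \<Longrightarrow> good (2 * 1) a b (2 * S) u1 \<Longrightarrow> good 1 a b S u"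
  proof (rule level[OF b order_refl u, of "1.595" "1.61" "2.19" "2.207" "1.2" "2.1" r a])
    have "(1 + 2.1) / sqrt 2 \<le> 0.70711 * (1 + 2.1)" by (rule s2) simp
    then show "(1 + 2.1) / sqrt 2 \<le> (3::real)" "r * ((1 + 2.1) / sqrt 2 * 2.207) \<le> 2.42 * (2 * real 1)"
      by (simp_all add: r_def)
    show "(r * (1 + 1.2))\<^sup>2 / 4 * integral {0..b} (\<lambda>y. (u y)\<^sup>2) < 4 * (2 * real 1)"
      "9 * r\<^sup>2 * integral {0..b} (\<lambda>y. (u y)\<^sup>2) \<le> (4.03 * (2 * real 1))\<^sup>2"
      using u2 by (simp_all add: r_def power2_eq_square)
  qed (auto simp: r_def)
  have u1n: "0 \<le> u1 y" for y using u(2) u1(2) order_trans by blast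
  have "integral {0..b} (\<lambda>y. (u1 y)\<^sup>2) \<le> (1 + 1 / 1.2\<^sup>2) * integral {0..b} (\<lambda>y. (u y)\<^sup>2)"
    by (rule integral_sq_le[OF u(1) u1(1) u1n u1(4)]) simp
  then have u12: "integral {0..b} (\<lambda>y. (u1 y)\<^sup>2) \<le> 10.676" using u2 by (simp add: power2_eq_square)
  obtain u2 where u2: "continuous_on UNIV u2" "\<And>y. u1 y \<le> u2 y" "\<And>y. u2 (y + b) = u2 y"
    "\<And>y. u2 y \<le> sqrt (1 + 1 / 1.4\<^sup>2) * u1 y" "\<And>y. u1 y \<le> 3.2 \<Longrightarrow> u2 y = u1 y"
    "\<And>y. u1 y \<le> 4.13 \<Longrightarrow> u2 y \<le> sqrt (1 + 1 / 2.3\<^sup>2) * u1 y"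
    "\<And>S. 0 \<le> S \<Longrightarrow> good (2 * 2) a b (2 * S) u2 \<Longrightarrow> good 2 a b S u1"
  proof (rule level[OF b _ u1(1) u1n u1(3), of "2" "3.2" "3.22" "4.13" "4.145" "1.4" "2.3" r a])
    have "(1 + 2.3) / sqrt 2 \<le> 0.70711 * (1 + 2.3)" by (rule s2) simp
    then show "(1 + 2.3) / sqrt 2 \<le> (3::real)" "r * ((1 + 2.3) / sqrt 2 * 4.145) \<le> 2.42 * (2 * real 2)"
      by (simp_all add: r_def)
    show "(r * (1 + 1.4))\<^sup>2 / 4 * integral {0..b} (\<lambda>y. (u1 y)\<^sup>2) < 4 * (2 * real 2)"
      "9 * r\<^sup>2 * integral {0..b} (\<lambda>y. (u1 y)\<^sup>2) \<le> (4.03 * (2 * real 2))\<^sup>2"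
      using u12 by (simp_all add: r_def power2_eq_square)
  qed (auto simp: r_def)
  have u2n: "0 \<le> u2 y" for y using u1n u2(2) order_trans by blast
  have "integral {0..b} (\<lambda>y. (u2 y)\<^sup>2) \<le> (1 + 1 / 1.4\<^sup>2) * integral {0..b} (\<lambda>y. (u1 y)\<^sup>2)"
    by (rule integral_sq_le[OF u1(1) u2(1) u2n u2(4)]) simp
  then have u22: "integral {0..b} (\<lambda>y. (u2 y)\<^sup>2) \<le> 16.124" using u12 by (simp add: power2_eq_square)
  obtain u3 where u3: "continuous_on UNIV u3" "\<And>y. u2 y \<le> u3 y" "\<And>y. u3 (y + b) = u3 y"
    "\<And>y. u3 y \<le> sqrt (1 + 1 / 1.8\<^sup>2) * u2 y" "\<And>y. u2 y \<le> 6.4 \<Longrightarrow> u3 y = u2 y"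
    "\<And>y. u2 y \<le> 0 \<Longrightarrow> u3 y \<le> sqrt (1 + 1 / 1.8\<^sup>2) * u2 y"
    "\<And>S. 0 \<le> S \<Longrightarrow> good (2 * 4) a b (2 * S) u3 \<Longrightarrow> good 4 a b S u2"
  proof (rule level[OF b _ u2(1) u2n u2(3), of "4" "6.4" "6.45" "0" "1" "1.8" "1.8" r a])
    have "(1 + 1.8) / sqrt 2 \<le> 0.70711 * (1 + 1.8)" by (rule s2) simp
    then show "(1 + 1.8) / sqrt 2 \<le> (3::real)" "r * ((1 + 1.8) / sqrt 2 * 1) \<le> 2.42 * (2 * real 4)"
      by (simp_all add: r_def)
    show "(r * (1 + 1.8))\<^sup>2 / 4 * integral {0..b} (\<lambda>y. (u2 y)\<^sup>2) < 4 * (2 * real 4)"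
      "9 * r\<^sup>2 * integral {0..b} (\<lambda>y. (u2 y)\<^sup>2) \<le> (4.03 * (2 * real 4))\<^sup>2"
      using u22 by (simp_all add: r_def power2_eq_square)
  qed (auto simp: r_def)
  have u3n: "0 \<le> u3 y" for y using u2n u3(2) order_trans by blast
  have "integral {0..b} (\<lambda>y. (u3 y)\<^sup>2) \<le> (1 + 1 / 1.8\<^sup>2) * integral {0..b} (\<lambda>y. (u2 y)\<^sup>2)"
    by (rule integral_sq_le[OF u2(1) u3(1) u3n u3(4)]) simp
  then have u32: "integral {0..b} (\<lambda>y. (u3 y)\<^sup>2) \<le> 21.11" using u22 by (simp add: power2_eq_square)
  obtain u4 where u4: "continuous_on UNIV u4" "\<And>y. u3 y \<le> u4 y" "\<And>y. u4 (y + b) = u4 y"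
    "\<And>y. u4 y \<le> sqrt (1 + 1 / 2.4\<^sup>2) * u3 y" "\<And>y. u3 y \<le> 12.8 \<Longrightarrow> u4 y = u3 y"
    "\<And>y. u3 y \<le> 0 \<Longrightarrow> u4 y \<le> sqrt (1 + 1 / 2.4\<^sup>2) * u3 y"
    "\<And>S. 0 \<le> S \<Longrightarrow> good (2 * 8) a b (2 * S) u4 \<Longrightarrow> good 8 a b S u3"
  proof (rule level[OF b _ u3(1) u3n u3(3), of "8" "12.8" "12.9" "0" "1" "2.4" "2.4" r a])
    have "(1 + 2.4) / sqrt 2 \<le> 0.70711 * (1 + 2.4)" by (rule s2) simp
    then show "(1 + 2.4) / sqrt 2 \<le> (3::real)" "r * ((1 + 2.4) / sqrt 2 * 1) \<le> 2.42 * (2 * real 8)"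
      by (simp_all add: r_def)
    show "(r * (1 + 2.4))\<^sup>2 / 4 * integral {0..b} (\<lambda>y. (u3 y)\<^sup>2) < 4 * (2 * real 8)"
      "9 * r\<^sup>2 * integral {0..b} (\<lambda>y. (u3 y)\<^sup>2) \<le> (4.03 * (2 * real 8))\<^sup>2"
      using u32 by (simp_all add: r_def power2_eq_square)
  qed (auto simp: r_def)
  have u4n: "0 \<le> u4 y" for y using u3n u4(2) order_trans by blast
  have "integral {0..b} (\<lambda>y. (u4 y)\<^sup>2) \<le> (1 + 1 / 2.4\<^sup>2) * integral {0..b} (\<lambda>y. (u3 y)\<^sup>2)"
    by (rule integral_sq_le[OF u3(1) u4(1) u4n u4(4)]) simp
  then have u42: "integral {0..b} (\<lambda>y. (u4 y)\<^sup>2) \<le> 24.78" using u32 by (simp add: power2_eq_square)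
  \<comment> \<open>Rational upper bounds for the growth factors of the norms at the four
    levels.\<close>
  have mults: "sqrt (1 + 1 / 1.2\<^sup>2) \<le> (1.3018::real)" "sqrt (1 + 1 / 2.1\<^sup>2) \<le> (1.1077::real)"
    "sqrt (1 + 1 / 1.4\<^sup>2) \<le> (1.22893::real)" "sqrt (1 + 1 / 2.3\<^sup>2) \<le> (1.09045::real)"
    "sqrt (1 + 1 / 1.8\<^sup>2) \<le> (1.144::real)" "sqrt (1 + 1 / 2.4\<^sup>2) \<le> (1.0834::real)"
    by (rule sq; simp add: power2_eq_square)+
  \<comment> \<open>In every case the factor in front of \<open>u\<close> bounds the product of the
    growth factors that can have acted, and the left end is a lower bound for \<open>u\<close> in
    that case, such as 2.458 below \<open>3.2 / 1.3018\<close>. The growth is absorbed by the gap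
    between \<open>u\<close> and \<open>(u^2 + 1) / 2\<close>.\<close>
  have u4p: "u4 y \<le> p y" for y
  proof -
    have a1: "u1 y \<le> 1.3018 * u y" using u1(4)[of y] mult_right_mono[OF mults(1) u(2)[of y]] by linarith
    consider (1) "u y \<le> 1.595" | (2) "1.595 < u y" "u y \<le> 2.19" | (3) "2.19 < u y" "u1 y \<le> 3.2"
      | (4) "2.19 < u y" "3.2 < u1 y" "u1 y \<le> 4.13" | (5) "2.19 < u y" "4.13 < u1 y" "u2 y \<le> 6.4"
      | (6) "2.19 < u y" "4.13 < u1 y" "6.4 < u2 y" by linarith
    then show ?thesis
    proof cases
      case 1
      then have "u1 y = u y" by (rule u1(5))
      moreover from this 1 have "u2 y = u1 y" by (intro u2(5)) simp
      moreover from calculation 1 have "u3 y = u2 y" by (intro u3(5)) simp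
      moreover from calculation 1 have "u4 y = u3 y" by (intro u4(5)) simp
      ultimately show ?thesis using p(2)[of y] by simp
    next
      case 2
      have "u1 y \<le> 1.1077 * u y" using u1(6)[OF 2(2)] mult_right_mono[OF mults(2) u(2)[of y]] by linarith
      moreover from this 2 have "u2 y = u1 y" by (intro u2(5)) simp
      moreover from calculation 2 have "u3 y = u2 y" by (intro u3(5)) simp
      moreover from calculation 2 have "u4 y = u3 y" by (intro u4(5)) simp
      moreover have "1.1077 * u y \<le> ((u y)\<^sup>2 + 1) / 2"
        by (rule half_sq_bound[of "1.595"]) (use 2 in \<open>auto simp: power2_eq_square\<close>)
      ultimately show ?thesis using p(3)[of y] 2 by simp
    next
      case 3
      have "u2 y = u1 y" using 3 by (intro u2(5)) simp
      moreover from this 3 have "u3 y = u2 y" by (intro u3(5)) simp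
      moreover from calculation 3 have "u4 y = u3 y" by (intro u4(5)) simp
      moreover have "1.3018 * u y \<le> ((u y)\<^sup>2 + 1) / 2"
        by (rule half_sq_bound[of "2.19"]) (use 3 in \<open>auto simp: power2_eq_square\<close>)
      ultimately show ?thesis using p(3)[of y] 3 a1 by simp
    next
      case 4
      have "u2 y \<le> 1.09045 * u1 y" using u2(6)[OF 4(3)] mult_right_mono[OF mults(4) u1n[of y]] by linarith
      moreover from this 4 have "u3 y = u2 y" by (intro u3(5)) simp
      moreover from calculation 4 have "u4 y = u3 y" by (intro u4(5)) simp
      ultimately have "u4 y \<le> 1.41955 * u y" using a1 u(2)[of y] by simp
      moreover have "1.41955 * u y \<le> ((u y)\<^sup>2 + 1) / 2"
        by (rule half_sq_bound[of "2.458"]) (use 4 a1 in \<open>auto simp: power2_eq_square\<close>)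
      ultimately show ?thesis using p(3)[of y] 4 by simp
    next
      case 5
      have "u2 y \<le> 1.22893 * u1 y" using u2(4)[of y] mult_right_mono[OF mults(3) u1n[of y]] by linarith
      moreover have "u3 y = u2 y" using 5 by (intro u3(5)) simp
      moreover from this 5 have "u4 y = u3 y" by (intro u4(5)) simp
      ultimately have "u4 y \<le> 1.6 * u y" using a1 u(2)[of y] by simp
      moreover have "1.6 * u y \<le> ((u y)\<^sup>2 + 1) / 2"
        by (rule half_sq_bound[of "3.17"]) (use 5 a1 in \<open>auto simp: power2_eq_square\<close>)
      ultimately show ?thesis using p(3)[of y] 5 by simp
    next
      case 6
      have 7: "u2 y \<le> 1.22893 * u1 y" using u2(4)[of y] mult_right_mono[OF mults(3) u1n[of y]] by linarith
      have "u3 y \<le> 1.144 * u2 y" using u3(4)[of y] mult_right_mono[OF mults(5) u2n[of y]] by linarith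
      moreover have "u4 y \<le> 1.0834 * u3 y" using u4(4)[of y] mult_right_mono[OF mults(6) u3n[of y]] by linarith
      ultimately have "u4 y \<le> 1.984 * u y" using a1 7 u(2)[of y] by simp
      moreover have "1.984 * u y \<le> ((u y)\<^sup>2 + 1) / 2"
        by (rule half_sq_bound[of "4"]) (use 6 7 a1 in \<open>auto simp: power2_eq_square\<close>)
      ultimately show ?thesis using p(3)[of y] 6 by simp
    qed
  qed
  note cs = continuous_on_subset[OF _ subset_UNIV]
  have i4: "integral {0..b} u4 \<le> 2 * pi"
  proof -
    have "integral {0..b} u4 \<le> integral {0..b} p"
      by (intro integral_le integrable_continuous_interval cs[OF u4(1)] cs[OF p(1)] u4p)
    then show ?thesis using p(4) by simp
  qed
  have b0: "0 < b" using b pi_gt_zero by linarith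
  \<comment> \<open>From here on all of \<open>z^2 / 2\<close> can be charged to the budget: its
    integral is at most 112, and the budget is at least 4 times 32.\<close>
  have g4: "good (2 ^ 4) a b T u4" for T
  proof (rule good_stable[OF b0 _ u4(1) i4, of r])
    fix j :: nat assume "4 \<le> j"
    then have "(2::real) ^ 4 \<le> 2 ^ j" by (rule power_increasing) simp
    then have j: "32 \<le> real (2 * 2 ^ j)" by simp
    have i: "integral {0..b} (\<lambda>y. (r * (3 * u4 y))\<^sup>2) = (9 * r\<^sup>2) * integral {0..b} (\<lambda>y. (u4 y)\<^sup>2)"
      by (simp add: power_mult_distrib)
    have i': "(9 * r\<^sup>2) * integral {0..b} (\<lambda>y. (u4 y)\<^sup>2) \<le> 224" using u42 by (simp add: r_def power2_eq_square)
    show "crit (2 * 2 ^ j) b (\<lambda>y. r * (3 * u4 y))"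
    proof (rule crit_intro[OF b, where E = "\<lambda>y. (r * (3 * u4 y))\<^sup>2 / 2"])
      show "integral {0..b} (\<lambda>y. (r * (3 * u4 y))\<^sup>2 / 2) < 4 * real (2 * 2 ^ j)" using i i' j by simp
      have "(4.03 * 32)\<^sup>2 \<le> (4.03 * real (2 * 2 ^ j))\<^sup>2" using j by (intro power_mono mult_left_mono) auto
      then show "integral {0..b} (\<lambda>y. (r * (3 * u4 y))\<^sup>2) \<le> (4.03 * real (2 * 2 ^ j))\<^sup>2"
      proof -
        have "(224::real) \<le> (4.03 * 32)\<^sup>2" by (simp add: power2_eq_square)
        then show ?thesis using i i' \<open>(4.03 * 32)\<^sup>2 \<le> _\<close> by linarith
      qed
    qed (auto intro!: continuous_intros u4(1) simp: u4(3))
  qed (simp add: r_def)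
  have "good 8 a b (2 * (2 * (2 * S))) u3" by (rule u4(7)) (use S g4 in auto)
  then have "good 4 a b (2 * (2 * S)) u2" using S by (intro u3(7)) auto
  then have "good 2 a b (2 * S) u1" using S by (intro u2(7)) auto
  then show ?thesis using S by (intro u1(7)) auto
qed

text \<open>No circle passes the threshold 4.84, so nothing is charged to the budget; 64.9 is just
  below \<open>8.06^2\<close>, the square of 4.03 times 2.\<close>

lemma crit_small:
  assumes b: "2 * pi \<le> b" and K: "2 \<le> K" and z: "continuous_on UNIV z" "\<And>y. z y \<le> 4.84"
    and z2: "integral {0..b} (\<lambda>y. (z y)\<^sup>2) \<le> 64.9"
  shows "crit K b z"
proof (rule crit_intro[OF b K z(1), where E = "\<lambda>_. 0"])
  have K2: "2 \<le> real K" using K by simp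
  show "z y \<le> 2.42 * real K \<or> (z y)\<^sup>2 / 2 \<le> 0" for y using z(2)[of y] K2 by simp
  have "(4.03 * 2)\<^sup>2 \<le> (4.03 * real K)\<^sup>2" using K2 by (intro power_mono mult_left_mono) auto
  then show "integral {0..b} (\<lambda>y. (z y)\<^sup>2) \<le> (4.03 * real K)\<^sup>2" using z2 by (simp add: power2_eq_square)
qed (use K in auto)

text \<open>\<open>U\<close> stands for \<open>\<kappa> sqrt \<phi>\<close> with
  \<open>\<kappa> = 2 \<pi> / sqrt (b A)\<close>, where \<open>A\<close> is the area; the total
  \<open>4 \<pi>^2 / b\<close> is then the same for every conformal factor
  \<open>\<phi>\<close>.\<close>

locale weight =
  fixes a b :: real and U :: "real \<Rightarrow> real \<Rightarrow> real"
  assumes b: "2 * pi \<le> b" and cU: "cont2 U" and U: "0 < U x y" "U (x + 1) y = U x y" "U (x + a) (y + b) = U x y"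
    and total: "integral {0..b} (xint (\<lambda>x y. (U x y)\<^sup>2)) = 4 * pi\<^sup>2 / b"
begin

text \<open>The value of \<open>U\<close> for a constant conformal factor, and the root mean square
  of \<open>u\<close> in general.\<close>

definition "c = 2 * pi / b"
definition "u y = sqrt (xint (\<lambda>x y. (U x y)\<^sup>2) y)"

lemma b0: "0 < b" using b pi_gt_zero by linarith
lemma c: "0 < c" "c \<le> 1" "c * b = 2 * pi" using b b0 by (simp_all add: c_def)

lemma cU2: "cont2 (\<lambda>x y. (U x y)\<^sup>2)" by (rule cont2_power[OF cU])

lemma u: "continuous_on UNIV u" "0 \<le> u y" "u (y + b) = u y" "(u y)\<^sup>2 = xint (\<lambda>x y. (U x y)\<^sup>2) y"
proof -
  have nn: "0 \<le> xint (\<lambda>x y. (U x y)\<^sup>2) y" for y by (rule xint_nonneg[OF cU2]) simp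
  show "continuous_on UNIV u" unfolding u_def by (intro continuous_intros xint_cont cU2)
  show "0 \<le> u y" "(u y)\<^sup>2 = xint (\<lambda>x y. (U x y)\<^sup>2) y" using nn by (simp_all add: u_def)
  show "u (y + b) = u y" unfolding u_def using xint_shift_periodic[OF cU2, of a b y] U by simp
qed

lemma u_total: "integral {0..b} (\<lambda>y. (u y)\<^sup>2) = 4 * pi\<^sup>2 / b" "4 * pi\<^sup>2 / b = c * c * b" "4 * pi\<^sup>2 / b \<le> 2 * pi"
proof -
  show "integral {0..b} (\<lambda>y. (u y)\<^sup>2) = 4 * pi\<^sup>2 / b" unfolding u(4) by (rule total)
  show e: "4 * pi\<^sup>2 / b = c * c * b" using b0 by (simp add: c_def power2_eq_square)
  have "c * (c * b) \<le> 1 * (c * b)" using c b0 by (intro mult_right_mono) auto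
  then show "4 * pi\<^sup>2 / b \<le> 2 * pi" unfolding e using c(3) by (simp add: mult.assoc)
qed

lemma bounded:
  obtains S where "0 \<le> S" "\<And>x y. U x y \<le> S"
proof -
  obtain B where "1 \<le> B" "\<And>x y. norm (U x y) \<le> B"
    using doubly_periodic_bounded[of U 1 a b] cU U b0 by auto
  then show ?thesis using that[of B] U(1) by (auto simp: abs_le_iff)
qed

text \<open>The majorant \<open>p\<close> of \<open>v = t u\<close> is
  \<open>(v^2 / c + c) / 2\<close> where \<open>v \<ge> c\<close>, and \<open>v\<close> itself where
  \<open>v < c\<close>. The first expression has integral \<open>\<pi> (t^2 + 1)\<close>; the saving
  from the second pays for \<open>t > 1\<close> exactly under \<open>J\<close>. For
  \<open>v > 1.59\<close>, \<open>c \<le> 1\<close> gives the bound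
  \<open>(v^2 + 1) / 2 \<le> p\<close> that \<open>good_one\<close> requires. Up to
  \<open>t = 1.001\<close>, \<open>2 \<pi> t^2\<close> stays below 6.3.\<close>

lemma specbd_scaled:
  assumes t: "1 \<le> t" "t \<le> 1.001"
    and J: "2 * c * (pi * (t\<^sup>2 - 1)) \<le> integral {0..b} (\<lambda>y. (max 0 (c - t * u y))\<^sup>2)"
  shows "specbd 1 a b (\<lambda>x y. t * U x y)"
proof -
  note cs = continuous_on_subset[OF _ subset_UNIV]
  define p where "p y = ((t * u y)\<^sup>2 / c + c) / 2 - (max 0 (c - t * u y))\<^sup>2 / (2 * c)" for y
  have t2: "t\<^sup>2 \<le> 1.001\<^sup>2" using t by (intro power_mono) auto
  have cmax: "continuous_on UNIV (\<lambda>y. max 0 (c - t * u y))" by (intro continuous_on_max continuous_intros u)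
  have cp: "continuous_on UNIV p" unfolding p_def by (intro continuous_intros u cmax) (use c in auto)
  have ip: "integral {0..b} p \<le> 2 * pi"
  proof -
    have i1: "((\<lambda>y. (u y)\<^sup>2) has_integral (c * c * b)) {0..b}"
    proof -
      have "(\<lambda>y. (u y)\<^sup>2) integrable_on {0..b}"
        by (intro integrable_continuous_interval continuous_intros cs[OF u(1)])
      from integrable_integral[OF this] show ?thesis using u_total by simp
    qed
    have i2: "((\<lambda>y. (max 0 (c - t * u y))\<^sup>2) has_integral integral {0..b} (\<lambda>y. (max 0 (c - t * u y))\<^sup>2)) {0..b}"
      by (intro integrable_integral integrable_continuous_interval continuous_intros cs[OF cmax])
    have i3: "((\<lambda>y. c) has_integral c * b) {0..b}" using has_integral_const_real[of c 0 b] b0 by (simp add: mult.commute)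
    have "((\<lambda>y. t\<^sup>2 / (2 * c) * (u y)\<^sup>2 + 1 / 2 * c - 1 / (2 * c) * (max 0 (c - t * u y))\<^sup>2) has_integral
       t\<^sup>2 / (2 * c) * (c * c * b) + 1 / 2 * (c * b) - 1 / (2 * c) * integral {0..b} (\<lambda>y. (max 0 (c - t * u y))\<^sup>2)) {0..b}"
      by (intro has_integral_add has_integral_diff has_integral_mult_right i1 i2 i3)
    also have "(\<lambda>y. t\<^sup>2 / (2 * c) * (u y)\<^sup>2 + 1 / 2 * c - 1 / (2 * c) * (max 0 (c - t * u y))\<^sup>2) = p"
      using c(1) by (simp add: fun_eq_iff p_def power_mult_distrib add_divide_distrib)
    finally have "integral {0..b} p = t\<^sup>2 / (2 * c) * (c * c * b) + 1 / 2 * (c * b) - 1 / (2 * c) * integral {0..b} (\<lambda>y. (max 0 (c - t * u y))\<^sup>2)"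
      by (rule integral_unique)
    also have "t\<^sup>2 / (2 * c) * (c * c * b) = t\<^sup>2 * pi" using c by (simp add: mult.assoc)
    also have "1 / 2 * (c * b) = pi" using c by simp
    finally have "integral {0..b} p = t\<^sup>2 * pi + pi - 1 / (2 * c) * integral {0..b} (\<lambda>y. (max 0 (c - t * u y))\<^sup>2)" .
    moreover have "pi * (t\<^sup>2 - 1) \<le> 1 / (2 * c) * integral {0..b} (\<lambda>y. (max 0 (c - t * u y))\<^sup>2)"
      using J c(1) by (simp add: field_simps)
    ultimately show ?thesis by (simp add: algebra_simps)
  qed
  have up: "t * u y \<le> p y" for y
  proof -
    define v where "v = t * u y"
    have "(max 0 (c - v))\<^sup>2 \<le> (v - c)\<^sup>2" by (auto simp: max_def power2_commute)
    then have "2 * c * v \<le> v\<^sup>2 + c\<^sup>2 - (max 0 (c - v))\<^sup>2" by (simp add: power2_eq_square algebra_simps)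
    then have "v \<le> (v\<^sup>2 + c\<^sup>2 - (max 0 (c - v))\<^sup>2) / (2 * c)" using c(1) by (simp add: pos_le_divide_eq mult_ac)
    also have "\<dots> = p y" using c(1) by (simp add: p_def v_def[symmetric] field_simps power2_eq_square)
    finally show ?thesis by (simp add: v_def)
  qed
  have up2: "((t * u y)\<^sup>2 + 1) / 2 \<le> p y" if "1.59 < t * u y" for y
  proof -
    define v where "v = t * u y"
    have "1 * c \<le> v * v" using that c unfolding v_def[symmetric] by (intro mult_mono) auto
    then have "0 \<le> (1 - c) * (v\<^sup>2 / c - 1)" using c by (intro mult_nonneg_nonneg) (auto simp: power2_eq_square pos_le_divide_eq)
    also have "\<dots> = (v\<^sup>2 / c + c) - (v\<^sup>2 + 1)" using c(1) by (simp add: field_simps)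
    finally have "v\<^sup>2 + 1 \<le> v\<^sup>2 / c + c" by simp
    from divide_right_mono[OF this, of 2] have "(v\<^sup>2 + 1) / 2 \<le> (v\<^sup>2 / c + c) / 2" by simp
    moreover have "max 0 (c - v) = 0" using that c unfolding v_def[symmetric] by simp
    ultimately show ?thesis by (simp add: p_def v_def)
  qed
  obtain S where S: "0 \<le> S" "\<And>x y. U x y \<le> S" using bounded by blast
  have "good 1 a b (t * S) (\<lambda>y. t * u y)"
  proof (rule good_one[OF b _ _ _ cp up up2 ip])
    have "integral {0..b} (\<lambda>y. (t * u y)\<^sup>2) = t\<^sup>2 * (4 * pi\<^sup>2 / b)" using u_total(1) by (simp add: power_mult_distrib)
    also have "\<dots> \<le> 1.001\<^sup>2 * (2 * pi)" using t2 u_total(3) b0 by (intro mult_mono) auto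
    also have "\<dots> \<le> 6.3" using pi_approx(2) by (simp add: power2_eq_square)
    finally show "integral {0..b} (\<lambda>y. (t * u y)\<^sup>2) \<le> 6.3" .
  qed (use t S u in \<open>auto intro!: continuous_intros\<close>)
  then show ?thesis
  proof (rule good_def[THEN iffD1, rule_format])
    show "cont2 (\<lambda>x y. t * U x y)" by (intro cont2_mult cont2_const cU)
    show "0 < t * U x y \<and> t * U x y \<le> t * S \<and> t * U (x + 1 / real 1) y = t * U x y \<and> t * U (x + a) (y + b) = t * U x y" for x y
      using t S U by (auto intro: mult_left_mono)
    have "xint (\<lambda>x y. (t * U x y)\<^sup>2) y = t\<^sup>2 * xint (\<lambda>x y. (U x y)\<^sup>2) y" for y by (simp add: xint_def power_mult_distrib)
    then show "sqrt (xint (\<lambda>x y. (t * U x y)\<^sup>2) y) \<le> t * u y" for y using t by (simp add: real_sqrt_mult u_def)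
  qed
qed

theorem specbd_weight: "specbd 1 a b U"
  using specbd_scaled[of 1] by (simp add: integral_nonneg integrable_continuous_interval continuous_intros continuous_on_subset[OF u(1)])

text \<open>The mean square of \<open>u\<close> is \<open>c^2\<close>, so a nonconstant
  \<open>u\<close> falls below \<open>c\<close> somewhere; there the majorant of
  \<open>specbd_scaled\<close> saves enough for some \<open>t > 1\<close>.\<close>

lemma gap_y:
  assumes y: "u y1 \<noteq> c"
  shows "\<exists>t>1. specbd 1 a b (\<lambda>x y. t * U x y)"
proof -
  note cs = continuous_on_subset[OF _ subset_UNIV]
  define I where "I = integral {0..b} (\<lambda>y. (max 0 (c - u y))\<^sup>2)"
  have cmax: "continuous_on S (\<lambda>y. max 0 (c - t * u y))" for t S by (intro continuous_on_max continuous_intros cs[OF u(1)])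
  have int: "(\<lambda>y. (max 0 (c - t * u y))\<^sup>2) integrable_on {0..b}" for t
    by (intro integrable_continuous_interval continuous_intros cmax)
  have intu: "(\<lambda>y. (u y)\<^sup>2) integrable_on {0..b}" "u integrable_on {0..b}"
    by (intro integrable_continuous_interval continuous_intros cs[OF u(1)])+
  have "I \<noteq> 0"
  proof
    assume "I = 0"
    then have le: "c \<le> u y" if "y \<in> {0..b}" for y
    proof -
      have "\<forall>y\<in>{0..b}. (max 0 (c - 1 * u y))\<^sup>2 = 0"
        using integral_eq_0_iff[OF continuous_on_power[OF cmax[of "{0..b}" 1]], of 2] b0 \<open>I = 0\<close> by (simp add: I_def)
      then have "(max 0 (c - 1 * u y))\<^sup>2 = 0" using that by blast
      then show ?thesis by (simp add: max_def split: if_splits)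
    qed
    have "integral {0..b} (\<lambda>y. (u y)\<^sup>2 - c\<^sup>2) = 0"
      using u_total b0 by (subst integral_diff[OF intu(1) integrable_const_ivl]) (simp add: power2_eq_square)
    then have "(u y)\<^sup>2 - c\<^sup>2 = 0" if "y \<in> {0..b}" for y
    proof -
      have "continuous_on {0..b} (\<lambda>y. (u y)\<^sup>2 - c\<^sup>2)" by (intro continuous_intros cs[OF u(1)])
      moreover have "0 \<le> (u y)\<^sup>2 - c\<^sup>2" if "y \<in> {0..b}" for y using power_mono[OF le[OF that], of 2] c(1) by simp
      ultimately have "\<forall>y\<in>{0..b}. (u y)\<^sup>2 - c\<^sup>2 = 0" using integral_eq_0_iff[of 0 b "\<lambda>y. (u y)\<^sup>2 - c\<^sup>2"] b0 \<open>integral {0..b} (\<lambda>y. (u y)\<^sup>2 - c\<^sup>2) = 0\<close> by blast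
      then show ?thesis using that by blast
    qed
    then have sq: "(u y)\<^sup>2 = c\<^sup>2" if "y \<in> {0..b}" for y using that by fastforce
    have uc: "u y = c" if "y \<in> {0..b}" for y by (rule power2_eq_imp_eq[OF sq[OF that] u(2) less_imp_le[OF c(1)]])
    define n where "n = \<lfloor>y1 / b\<rfloor>"
    have "of_int n \<le> y1 / b" "y1 / b < of_int n + 1" unfolding n_def by linarith+
    then have "of_int n * b \<le> y1" "y1 < (of_int n + 1) * b" using b0 by (simp_all add: pos_le_divide_eq pos_divide_less_eq)
    then have "u (y1 + of_int (- n) * b) = c" by (intro uc) (auto simp: distrib_right)
    moreover have "u (y1 + of_int (- n) * b) = u y1" by (rule periodic_of_int[of u]) (rule u(3))
    ultimately show False using y by simp
  qed
  moreover have "0 \<le> I" unfolding I_def using int[of 1] by (intro integral_nonneg) auto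
  ultimately have I: "0 < I" by simp
  \<comment> \<open>With \<open>t = 1 + \<delta>\<close> the saving is at least
    \<open>I - 4 \<pi> c \<delta>\<close> and the cost at most \<open>6 \<pi> c \<delta>\<close>,
    whence the factor 10.\<close>
  define \<delta> where "\<delta> = min 0.001 (I / (10 * pi * c))"
  have \<delta>: "0 < \<delta>" "\<delta> \<le> 0.001" "10 * pi * c * \<delta> \<le> I"
  proof -
    show "0 < \<delta>" "\<delta> \<le> 0.001" using I c by (auto simp: \<delta>_def)
    have "10 * pi * c * \<delta> \<le> 10 * pi * c * (I / (10 * pi * c))" using c by (intro mult_left_mono) (auto simp: \<delta>_def)
    then show "10 * pi * c * \<delta> \<le> I" using c by simp
  qed
  define t where "t = 1 + \<delta>"
  have iu: "integral {0..b} u \<le> 2 * pi"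
  proof -
    have "integral {0..b} u \<le> integral {0..b} (\<lambda>y. ((u y)\<^sup>2 / c + c) / 2)"
    proof (rule integral_le[OF intu(2)])
      show "(\<lambda>y. ((u y)\<^sup>2 / c + c) / 2) integrable_on {0..b}"
        by (intro integrable_continuous_interval continuous_intros cs[OF u(1)]) (use c in auto)
      show "u y \<le> ((u y)\<^sup>2 / c + c) / 2" for y
        using sum_squares_bound[of "u y" c] c(1) by (simp add: field_simps power2_eq_square)
    qed
    also have "\<dots> = (integral {0..b} (\<lambda>y. (u y)\<^sup>2) / c + c * b) / 2"
      using b0 integral_add[OF integrable_on_divide[OF intu(1), of c] integrable_const_ivl[of c 0 b]] by (simp add: mult.commute)
    also have "\<dots> = 2 * pi" using u_total c by (simp add: mult.assoc)
    finally show ?thesis .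
  qed
  have "I - 2 * c * \<delta> * integral {0..b} u = integral {0..b} (\<lambda>y. (max 0 (c - u y))\<^sup>2 - 2 * c * \<delta> * u y)"
    unfolding I_def using int[of 1] intu(2) by (subst integral_diff) (auto intro: integrable_on_mult_right)
  also have "\<dots> \<le> integral {0..b} (\<lambda>y. (max 0 (c - t * u y))\<^sup>2)"
  proof (rule integral_le[OF _ int])
    show "(\<lambda>y. (max 0 (c - u y))\<^sup>2 - 2 * c * \<delta> * u y) integrable_on {0..b}"
      using int[of 1] intu(2) by (intro integrable_diff integrable_on_mult_right) auto
    fix y
    define A B where "A = max 0 (c - u y)" and "B = max 0 (c - t * u y)"
    have "0 \<le> \<delta> * u y" using u(2)[of y] \<delta>(1) by simp
    moreover have "t * u y = u y + \<delta> * u y" by (simp add: t_def distrib_right)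
    ultimately have "A - B \<le> \<delta> * u y" "B \<le> A" "0 \<le> B" "A \<le> c"
      using u(2)[of y] c(1) unfolding A_def B_def by linarith+
    then have "(A - B) * (A + B) \<le> (\<delta> * u y) * (2 * c)" using \<delta>(1) u(2)[of y] by (intro mult_mono) auto
    then show "(max 0 (c - u y))\<^sup>2 - 2 * c * \<delta> * u y \<le> (max 0 (c - t * u y))\<^sup>2"
      unfolding A_def[symmetric] B_def[symmetric] by (simp add: power2_eq_square algebra_simps)
  qed
  finally have low: "I - 2 * c * \<delta> * integral {0..b} u \<le> integral {0..b} (\<lambda>y. (max 0 (c - t * u y))\<^sup>2)" .
  have "2 * c * \<delta> * integral {0..b} u \<le> 2 * c * \<delta> * (2 * pi)" using iu c \<delta> by (intro mult_left_mono) auto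
  moreover have "2 * c * (pi * (t\<^sup>2 - 1)) \<le> 6 * pi * c * \<delta>"
  proof -
    have "\<delta> * \<delta> \<le> \<delta> * 1" using \<delta> by (intro mult_left_mono) auto
    then have "t\<^sup>2 - 1 \<le> 3 * \<delta>" by (simp add: t_def power2_eq_square algebra_simps)
    then have "2 * c * pi * (t\<^sup>2 - 1) \<le> 2 * c * pi * (3 * \<delta>)" using c by (intro mult_left_mono) auto
    then show ?thesis by (simp add: mult_ac)
  qed
  ultimately have "2 * c * (pi * (t\<^sup>2 - 1)) \<le> integral {0..b} (\<lambda>y. (max 0 (c - t * u y))\<^sup>2)"
    using low \<delta>(3) by (simp add: algebra_simps)
  then have "specbd 1 a b (\<lambda>x y. t * U x y)" using \<delta> by (intro specbd_scaled) (auto simp: t_def)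
  then show ?thesis using \<delta>(1) by (intro exI[of _ t]) (simp add: t_def)
qed

text \<open>\<open>x\<close> is the limit of dyadic rationals, at each of which \<open>U\<close> has
  the same value as at 0.\<close>

lemma dyadic_constant:
  assumes "\<And>n x y. U (x + 1 / 2 ^ n) y = U x y"
  shows "U x y = U 0 y"
proof -
  have fl: "(\<lambda>n. of_int \<lfloor>x * 2 ^ n\<rfloor> * (1 / 2 ^ n)) \<longlonglongrightarrow> x"
  proof (rule LIMSEQ_I)
    fix e :: real assume "0 < e"
    then obtain N where N: "(1 / 2) ^ N < e" using real_arch_pow_inv[of e "1/2"] by auto
    have "norm (of_int \<lfloor>x * 2 ^ n\<rfloor> * (1 / 2 ^ n) - x) < e" if "N \<le> n" for n
    proof -
      have "of_int \<lfloor>x * 2 ^ n\<rfloor> \<le> x * 2 ^ n" "x * 2 ^ n < of_int \<lfloor>x * 2 ^ n\<rfloor> + 1" by linarith+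
      then have "\<bar>of_int \<lfloor>x * 2 ^ n\<rfloor> - x * 2 ^ n\<bar> \<le> 1" by linarith
      then have "\<bar>of_int \<lfloor>x * 2 ^ n\<rfloor> - x * 2 ^ n\<bar> * (1 / 2 ^ n) \<le> 1 * (1 / 2 ^ n)" by (intro mult_right_mono) auto
      also have "\<dots> \<le> (1/2) ^ N" using that by (simp add: power_one_over[symmetric] power_decreasing)
      finally have "\<bar>of_int \<lfloor>x * 2 ^ n\<rfloor> - x * 2 ^ n\<bar> * (1 / 2 ^ n) < e" using N by linarith
      moreover have "of_int \<lfloor>x * 2 ^ n\<rfloor> * (1 / 2 ^ n) - x = (of_int \<lfloor>x * 2 ^ n\<rfloor> - x * 2 ^ n) * (1 / 2 ^ n)"
        by (simp add: diff_divide_distrib)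
      ultimately show ?thesis by (simp add: abs_mult)
    qed
    then show "\<exists>no. \<forall>n\<ge>no. norm (of_int \<lfloor>x * 2 ^ n\<rfloor> * (1 / 2 ^ n) - x) < e" by blast
  qed
  have "isCont (\<lambda>x. U x y) x" using cont2_line(1)[OF cU, of UNIV y] by (simp add: continuous_on_eq_continuous_at)
  then have "(\<lambda>n. U (of_int \<lfloor>x * 2 ^ n\<rfloor> * (1 / 2 ^ n)) y) \<longlonglongrightarrow> U x y" using fl by (rule isCont_tendsto_compose)
  moreover have "U (of_int \<lfloor>x * 2 ^ n\<rfloor> * (1 / 2 ^ n)) y = U 0 y" for n
    using periodic_of_int[of "\<lambda>x. U x y" "1 / 2 ^ n" 0 "\<lfloor>x * 2 ^ n\<rfloor>"] assms by simp
  ultimately show ?thesis by (simp add: LIMSEQ_const_iff)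
qed

text \<open>Where \<open>U\<close> already has the shorter period its odd part vanishes, and
  \<open>V = U\<close>, \<open>Z = 3 U\<close> are admissible; the factor \<open>t\<close> passes
  through the step unchanged.\<close>

lemma specbd_halve:
  assumes K: "1 \<le> K" and t: "0 < t" and per: "\<And>x y. U (x + 1 / real (2 * K)) y = U x y"
    and z: "\<And>y. 1.0002 * (3 * (t * u y)) \<le> v y" and cr: "crit (2 * K) b v" and sp: "specbd (2 * K) a b (\<lambda>x y. t * U x y)"
  shows "specbd K a b (\<lambda>x y. t * U x y)"
proof -
  interpret modes "2 * K" a b by unfold_locales (use K b0 in auto)
  have cZ: "cont2 (\<lambda>x y. 3 * (t * U x y))" and ct: "cont2 (\<lambda>x y. t * U x y)" by (intro cont2_mult cont2_const cU)+
  have Z0: "0 < 3 * (t * U x y)" for x y using t U(1)[of x y] by simp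
  have Zn: "1.0002 * sqrt (xint (\<lambda>x y. (3 * (t * U x y))\<^sup>2) y) \<le> v y" for y
  proof -
    have "xint (\<lambda>x y. (3 * (t * U x y))\<^sup>2) y = (3 * t)\<^sup>2 * xint (\<lambda>x y. (U x y)\<^sup>2) y" by (simp add: xint_def power_mult_distrib)
    then have "sqrt (xint (\<lambda>x y. (3 * (t * U x y))\<^sup>2) y) = 3 * (t * u y)" using t by (simp add: real_sqrt_mult u_def)
    then show ?thesis using z[of y] by simp
  qed
  show ?thesis
  proof (rule halving[of K "\<lambda>x y. t * U x y" "\<lambda>x y. t * U x y" "\<lambda>x y. 3 * (t * U x y)"])
    show "t * U (x + 1 / real K) y = t * U x y" for x y
    proof -
      have "x + 1 / real K = x + 1 / real (2 * K) + 1 / real (2 * K)" using K by (simp add: field_simps)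
      then show ?thesis using per by metis
    qed
    fix \<xi> \<xi>x \<xi>y :: "real \<Rightarrow> real \<Rightarrow> spin" assume "C1 \<xi> \<xi>x \<xi>y" "\<And>x y. \<xi> (x + 1 / real (2 * K)) y = - \<xi> x y" "\<And>x y. \<xi> (x + a) (y + b) = \<xi> x y"
    then show "II b (\<lambda>x y. inner (dir \<xi>x \<xi>y x y) (\<xi> x y)) \<le> II b (\<lambda>x y. (norm (dir \<xi>x \<xi>y x y))\<^sup>2 / (3 * (t * U x y)))"
      by (intro anti_bound[OF cZ Z0 _ _ _ Zn cr]) (simp_all only: per U(3), simp)
  next
    show "(t * U x y + t * U (x + 1 / real (2 * K)) y) / 2 \<le> 3 * (t * U x y)" for x y
      unfolding per using t U(1)[of x y] by simp
  qed (use ct cZ sp Z0 t U(1) in \<open>simp_all add: per del: of_nat_mult\<close>)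
qed


text \<open>At the first step with a nonzero odd part, \<open>V\<close> is taken strictly below \<open>R\<close> where that part does not vanish,
  at the cost of a slightly larger \<open>Z\<close>.\<close>

lemma gap_x:
  assumes uc: "\<And>y. u y = c" and nc: "U x1 y1 \<noteq> U 0 y1"
  shows "\<exists>t>1. specbd 1 a b (\<lambda>x y. t * U x y)"
proof -
  note cs = continuous_on_subset[OF _ subset_UNIV]
  note b_ge = b
  define P where "P n \<longleftrightarrow> (\<forall>x y. U (x + 1 / 2 ^ n) y = U x y)" for n :: nat
  have "\<exists>n. \<not> P n" using dyadic_constant nc unfolding P_def by blast
  \<comment> \<open>The first dyadic shift that does not preserve \<open>U\<close>; the steps before
    it are those of \<open>specbd_halve\<close>.\<close>
  define N where "N = (LEAST n. \<not> P n)"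
  have N: "\<not> P N" unfolding N_def using \<open>\<exists>n. \<not> P n\<close> by (rule LeastI_ex)
  have low: "P j" if "j < N" for j using not_less_Least[of j "\<lambda>n. \<not> P n"] that by (auto simp: N_def)
  have "P 0" using U(2) by (simp add: P_def)
  then have "N \<noteq> 0" using N by metis
  then obtain m where m: "N = Suc m" using not0_implies_Suc by blast
  define K :: nat where "K = 2 ^ m"
  have K: "1 \<le> K" by (simp add: K_def)
  interpret modes "2 * K" a b by unfold_locales (use K b0 in auto)
  define h where "h = 1 / real (2 * K)"
  have h: "h = 1 / 2 ^ N" by (simp add: h_def K_def m)
  have hh: "x + h + h = x + 1 / real K" for x using K by (simp add: h_def field_simps)
  have perK: "U (x + 1 / real K) y = U x y" for x y using low[of m] by (simp add: P_def K_def m)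
  define E where "E x y = (U x y + U (x + h) y) / 2" for x y
  define D where "D x y = (U x y - U (x + h) y) / 2" for x y
  have Uhh: "U (x + h + h) y = U x y" for x y unfolding hh by (rule perK)
  note eo = even_odd_parts[OF cU U(1) Uhh U(2,3), folded E_def D_def]
  obtain x0 y0 where "U (x0 + h) y0 \<noteq> U x0 y0" using N unfolding P_def h[symmetric] by blast
  then have D0: "D x0 y0 \<noteq> 0" by (simp add: D_def)
  define R2 where "R2 x y = (E x y)\<^sup>2 + (D x y)\<^sup>2" for x y
  define R where "R x y = sqrt (R2 x y)" for x y
  have cR2: "cont2 R2" unfolding R2_def by (intro cont2_add cont2_power eo(1,2))
  have cR: "cont2 R" unfolding R_def by (intro cont2_sqrt cR2)
  have E0: "0 < E x y" for x y using eo(3)[of x y] by linarith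
  have R20: "0 < R2 x y" for x y unfolding R2_def using E0[of x y] by (intro add_pos_nonneg) auto
  have R0: "0 < R x y" for x y unfolding R_def by (rule real_sqrt_gt_zero[OF R20])
  have RR: "R x y * R x y = R2 x y" for x y using R20[of x y] by (simp add: R_def)
  have ER: "E x y \<le> R x y" for x y unfolding R_def R2_def by (rule real_le_rsqrt) simp
  have xR: "xint R2 y = c\<^sup>2" for y using eo(8)[of y] u(4)[of y] uc[of y] by (simp add: R2_def[abs_def])
  \<comment> \<open>The factor 2.2 in place of 2 keeps \<open>(V - E) (Z - E) = D^2\<close> and
    gives \<open>Z \<le> 3.2 R\<close>. As the circle norms equal \<open>c \<le> 1\<close>,
    \<open>crit_small\<close> still applies: \<open>3.2^2\<close> times \<open>2 \<pi>\<close> is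
    about 64.3.\<close>
  define V where "V x y = E x y + (D x y)\<^sup>2 / (2.2 * R x y)" for x y
  define Z where "Z x y = E x y + 2.2 * R x y" for x y
  have R22: "2.2 * R x y \<noteq> 0" for x y using R0[of x y] by simp
  have cV: "cont2 V" unfolding V_def by (intro cont2_add cont2_divide cont2_power cont2_mult cont2_const cR R22 eo(1,2))
  have cZ: "cont2 Z" unfolding Z_def by (intro cont2_add cont2_mult cont2_const cR eo(1,2))
  have EV: "E x y \<le> V x y" "E x y \<le> Z x y" for x y using R0[of x y] by (simp_all add: V_def Z_def)
  have V0: "0 < V x y" "0 < Z x y" for x y using EV[of x y] E0[of x y] by linarith+
  have VR: "V x y \<le> R x y" "D x y \<noteq> 0 \<Longrightarrow> V x y < R x y" for x y
  proof -
    have "0 \<le> (R x y - E x y)\<^sup>2" by simp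
    then have "2 * (R x y * E x y) + (D x y)\<^sup>2 \<le> 2 * (R x y * R x y)"
      using RR[of x y] by (simp add: R2_def power2_eq_square algebra_simps)
    then have A: "E x y + (D x y)\<^sup>2 / (2 * R x y) \<le> R x y" using R0[of x y] by (simp add: field_simps)
    have B: "(D x y)\<^sup>2 / (2.2 * R x y) \<le> (D x y)\<^sup>2 / (2 * R x y)" using R0[of x y] by (intro divide_left_mono) auto
    show "V x y \<le> R x y" using A B by (simp add: V_def)
    assume "D x y \<noteq> 0"
    then have "(D x y)\<^sup>2 / (2.2 * R x y) < (D x y)\<^sup>2 / (2 * R x y)" using R0[of x y] by (intro divide_strict_left_mono) auto
    then show "V x y < R x y" using A by (simp add: V_def)
  qed
  have VZh: "V (x + h) y = V x y" "Z (x + h) y = Z x y" "R2 (x + h) y = R2 x y" for x y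
    by (simp_all add: V_def Z_def R_def R2_def eo)
  have VZab: "V (x + a) (y + b) = V x y" "Z (x + a) (y + b) = Z x y" for x y
    by (simp_all only: V_def Z_def R_def R2_def eo)
  have V1: "V (x + 1) y = V x y" "R2 (x + 1) y = R2 x y" for x y
    using one_period[of V 1 x y] one_period[of R2 1 x y] VZh by (simp_all add: h_def)
  define nv where "nv y = sqrt (xint (\<lambda>x y. (V x y)\<^sup>2) y)" for y
  have cV2: "cont2 (\<lambda>x y. (V x y)\<^sup>2)" by (rule cont2_power[OF cV])
  have cnv: "continuous_on UNIV nv" unfolding nv_def by (intro continuous_intros xint_cont cV2)
  have VR2: "(V x y)\<^sup>2 \<le> R2 x y" for x y
    using power_mono[OF VR(1)[of x y], of 2] V0(1)[of x y] RR[of x y] by (simp add: power2_eq_square)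
  have xV: "0 \<le> xint (\<lambda>x y. (V x y)\<^sup>2) y" for y by (rule xint_nonneg[OF cV2]) simp
  have nv0: "0 \<le> nv y" for y using xV by (simp add: nv_def)
  have nvc: "nv y \<le> c" for y
  proof -
    have "xint (\<lambda>x y. (V x y)\<^sup>2) y \<le> c\<^sup>2" unfolding xR[of y, symmetric] by (rule xint_mono[OF cV2 cR2 VR2])
    then have "nv y \<le> sqrt (c\<^sup>2)" unfolding nv_def by (rule real_sqrt_le_mono)
    then show ?thesis using c(1) by simp
  qed
  have nvb: "nv (y + b) = nv y" for y unfolding nv_def using xint_shift_periodic[OF cV2, of a b y] V1 VZab by simp
  have nvlt: "nv y0 \<noteq> c"
  proof
    assume "nv y0 = c"
    then have "xint (\<lambda>x y. (V x y)\<^sup>2) y0 = c\<^sup>2" using real_sqrt_pow2[OF xV[of y0]] by (simp only: nv_def)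
    then have "xint (\<lambda>x y. R2 x y - (V x y)\<^sup>2) y0 = 0" using xint_diff[OF cR2 cV2, of y0] xR by simp
    then have "\<forall>x\<in>{0..1}. R2 x y0 - (V x y0)\<^sup>2 = 0"
      unfolding xint_def using integral_eq_0_iff[OF cont2_line(1)[OF cont2_diff[OF cR2 cV2]], of 0 1 y0] VR2 by simp
    moreover define x where "x = x0 + of_int (- \<lfloor>x0\<rfloor>) * 1"
    moreover have "x \<in> {0..1}" unfolding x_def by (simp, linarith)
    ultimately have "R2 x y0 = (V x y0)\<^sup>2" by simp
    moreover have "R2 x y0 = R2 x0 y0" unfolding x_def by (rule periodic_of_int[of "\<lambda>x. R2 x y0"]) (rule V1)
    moreover have "V x y0 = V x0 y0" unfolding x_def by (rule periodic_of_int[of "\<lambda>x. V x y0"]) (rule V1)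
    ultimately have "R x0 y0 * R x0 y0 = V x0 y0 * V x0 y0" by (simp add: RR power2_eq_square)
    moreover have "V x0 y0 * V x0 y0 < R x0 y0 * R x0 y0"
      using VR(2)[OF D0] V0(1)[of x0 y0] by (intro mult_strict_mono) auto
    ultimately show False by simp
  qed
  have lt: "integral {0..b} nv < 2 * pi"
  proof -
    have int: "nv integrable_on {0..b}" by (intro integrable_continuous_interval cs[OF cnv])
    have e: "integral {0..b} (\<lambda>y. c - nv y) = 2 * pi - integral {0..b} nv"
      using b0 c(3) by (subst integral_diff) (auto simp: int mult.commute)
    have "integral {0..b} (\<lambda>y. c - nv y) \<noteq> 0"
    proof
      assume "integral {0..b} (\<lambda>y. c - nv y) = 0"
      then have *: "\<forall>y\<in>{0..b}. c - nv y = 0"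
        using integral_eq_0_iff[OF continuous_on_diff[OF continuous_on_const cs[OF cnv]], of 0 b c] b0 nvc by simp
      define n where "n = \<lfloor>y0 / b\<rfloor>"
      have "of_int n \<le> y0 / b" "y0 / b < of_int n + 1" unfolding n_def by linarith+
      then have "of_int n * b \<le> y0" "y0 < (of_int n + 1) * b" using b0 by (simp_all add: pos_le_divide_eq pos_divide_less_eq)
      then have "nv (y0 + of_int (- n) * b) = c" using *[rule_format, of "y0 + of_int (- n) * b"] by (auto simp: distrib_right)
      moreover have "nv (y0 + of_int (- n) * b) = nv y0" by (rule periodic_of_int[of nv]) (rule nvb)
      ultimately show False using nvlt by simp
    qed
    moreover have "0 \<le> integral {0..b} (\<lambda>y. c - nv y)"
      by (intro integral_nonneg integrable_continuous_interval continuous_intros cs[OF cnv]) (simp add: nvc)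
    ultimately show ?thesis using e by simp
  qed
  define J where "J = integral {0..b} nv"
  have J: "0 \<le> J" "J < 2 * pi" unfolding J_def using lt
    by (auto intro!: integral_nonneg integrable_continuous_interval cs[OF cnv] nv0)
  \<comment> \<open>With \<open>x = (2 \<pi> - J) / (2 \<pi>)\<close> one has
    \<open>J = 2 \<pi> (1 - x)\<close>, and \<open>(1 + x) (1 - x) \<le> 1\<close> leaves the
    integral of \<open>t nv\<close> at most \<open>2 \<pi>\<close>.\<close>
  define t where "t = 1 + min 0.001 ((2 * pi - J) / (2 * pi))"
  have t: "1 < t" "t \<le> 1.001" "t * J \<le> 2 * pi"
  proof -
    have "0 < (2 * pi - J) / (2 * pi)" using J(2) by simp
    moreover have "1 < 1 + min 0.001 d" "1 + min 0.001 d \<le> 1.001" if "0 < d" for d :: real using that by (auto simp: min_def)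
    ultimately show "1 < t" "t \<le> 1.001" unfolding t_def by blast+
    have "t * J \<le> (1 + (2 * pi - J) / (2 * pi)) * J" using J by (intro mult_right_mono) (auto simp: t_def)
    also have "\<dots> = 2 * pi - (2 * pi - J)\<^sup>2 / (2 * pi)" by (simp add: field_simps power2_eq_square)
    also have "\<dots> \<le> 2 * pi" by simp
    finally show "t * J \<le> 2 * pi" .
  qed
  have cc: "c * c * b \<le> 2 * pi" using u_total(2,3) by simp
  have small: "crit M b z" if M: "2 \<le> M" and cz: "continuous_on UNIV z" and z: "\<And>y. 0 \<le> z y" "\<And>y. z y \<le> 1.0002 * (3.2 * (t * c))" for M z
  proof (rule crit_small[OF b_ge M cz])
    have tc: "t * c \<le> 1.001 * 1" using t c by (intro mult_mono) auto
    show "z y \<le> 4.84" for y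
    proof -
      have "z y \<le> 1.0002 * (3.2 * (1.001 * 1))" using z(2) by (rule order_trans) (intro mult_left_mono tc, auto)
      then show ?thesis by simp
    qed
    have "integral {0..b} (\<lambda>y. (z y)\<^sup>2) \<le> integral {0..b} (\<lambda>y. (1.0002 * (3.2 * (t * c)))\<^sup>2)"
    proof (rule integral_le)
      show "(\<lambda>y. (z y)\<^sup>2) integrable_on {0..b}" by (intro integrable_continuous_interval continuous_intros cs[OF cz])
      show "(z y)\<^sup>2 \<le> (1.0002 * (3.2 * (t * c)))\<^sup>2" for y using z by (intro power_mono)
    qed (rule integrable_const_ivl)
    also have "\<dots> = (1.0002 * 3.2)\<^sup>2 * t\<^sup>2 * (c * c * b)" using b0 by (simp add: power2_eq_square)
    also have "\<dots> \<le> (1.0002 * 3.2)\<^sup>2 * 1.001\<^sup>2 * (2 * pi)" 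
    proof (rule mult_mono[OF mult_left_mono cc])
      show "t\<^sup>2 \<le> 1.001\<^sup>2" using t by (intro power_mono) auto
    qed (use c b0 in auto)
    also have "\<dots> \<le> 64.9" using pi_approx(2) by (simp add: power2_eq_square)
    finally show "integral {0..b} (\<lambda>y. (z y)\<^sup>2) \<le> 64.9" .
  qed
  obtain S where S: "0 \<le> S" "\<And>x y. U x y \<le> S" using bounded by blast
  have RS: "R x y \<le> S" for x y
  proof -
    have "(U x y)\<^sup>2 \<le> S\<^sup>2" "(U (x + h) y)\<^sup>2 \<le> S\<^sup>2" by (intro power_mono S(2) less_imp_le[OF U(1)])+
    then have "R2 x y \<le> S\<^sup>2" by (simp add: R2_def E_def D_def power2_eq_square field_simps)
    then have "R x y \<le> sqrt (S\<^sup>2)" unfolding R_def by (rule real_sqrt_le_mono)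
    then show ?thesis using S(1) by simp
  qed
  \<comment> \<open>All circle norms are small, so the norm-preserving steps of
    \<open>good_stable\<close> suffice from this level on.\<close>
  have gV: "good (2 ^ N) a b (t * S) (\<lambda>y. t * nv y)"
  proof (rule good_stable[OF b0, of "1.0002"])
    show "continuous_on UNIV (\<lambda>y. t * nv y)" by (intro continuous_intros cnv)
    show "integral {0..b} (\<lambda>y. t * nv y) \<le> 2 * pi" using t(3) by (simp add: J_def)
    show "crit (2 * 2 ^ j) b (\<lambda>y. 1.0002 * (3 * (t * nv y)))" for j :: nat
    proof (rule small)
      show "0 \<le> 1.0002 * (3 * (t * nv y))" for y using nv0[of y] t(1) by simp
      have "t * nv y \<le> t * c" for y using nvc t(1) by (intro mult_left_mono) auto
      moreover have "0 \<le> t * c" using t c by simp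
      moreover have "1.0002 * (3 * p) \<le> 1.0002 * (3.2 * q)" if "p \<le> q" "0 \<le> q" for p q :: real using that by simp
      ultimately show "1.0002 * (3 * (t * nv y)) \<le> 1.0002 * (3.2 * (t * c))" for y by blast
    qed (auto intro!: continuous_intros cnv)
  qed simp
  have spV: "specbd (2 * K) a b (\<lambda>x y. t * V x y)"
  proof -
    have "specbd (2 ^ N) a b (\<lambda>x y. t * V x y)"
    proof (rule gV[unfolded good_def, rule_format])
      show "cont2 (\<lambda>x y. t * V x y)" by (intro cont2_mult cont2_const cV)
      have "V x y \<le> S" for x y using VR(1) RS by (rule order_trans)
      then show "0 < t * V x y \<and> t * V x y \<le> t * S \<and> t * V (x + 1 / real (2 ^ N)) y = t * V x y \<and> t * V (x + a) (y + b) = t * V x y" for x y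
        using t V0 VZh(1)[of x y] VZab by (auto simp: h intro: mult_left_mono)
      have "xint (\<lambda>x y. (t * V x y)\<^sup>2) y = t\<^sup>2 * xint (\<lambda>x y. (V x y)\<^sup>2) y" for y by (simp add: xint_def power_mult_distrib)
      then show "sqrt (xint (\<lambda>x y. (t * V x y)\<^sup>2) y) \<le> t * nv y" for y using t by (simp add: real_sqrt_mult nv_def)
    qed
    then show ?thesis by (simp add: K_def m)
  qed
  have spK: "specbd K a b (\<lambda>x y. t * U x y)"
  proof (rule halving[of K "\<lambda>x y. t * U x y" "\<lambda>x y. t * V x y" "\<lambda>x y. t * Z x y"])
    have e: "(t * U x y + t * U (x + 1 / real (2 * K)) y) / 2 = t * E x y" "(t * U x y - t * U (x + 1 / real (2 * K)) y) / 2 = t * D x y" for x y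
      unfolding h_def[symmetric] by (simp_all add: E_def D_def algebra_simps)
    show "(t * U x y + t * U (x + 1 / real (2 * K)) y) / 2 \<le> t * V x y" "(t * U x y + t * U (x + 1 / real (2 * K)) y) / 2 \<le> t * Z x y" for x y
      unfolding e using EV t(1) by (auto intro: mult_left_mono)
    show "((t * U x y - t * U (x + 1 / real (2 * K)) y) / 2)\<^sup>2 \<le> (t * V x y - (t * U x y + t * U (x + 1 / real (2 * K)) y) / 2) * (t * Z x y - (t * U x y + t * U (x + 1 / real (2 * K)) y) / 2)" for x y
      unfolding e using R0[of x y] by (simp add: V_def Z_def algebra_simps power2_eq_square)
    fix \<xi> \<xi>x \<xi>y :: "real \<Rightarrow> real \<Rightarrow> spin" assume \<xi>: "C1 \<xi> \<xi>x \<xi>y" "\<And>x y. \<xi> (x + 1 / real (2 * K)) y = - \<xi> x y" "\<And>x y. \<xi> (x + a) (y + b) = \<xi> x y"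
    have ctZ: "cont2 (\<lambda>x y. t * Z x y)" by (intro cont2_mult cont2_const cZ)
    have nZ: "1.0002 * sqrt (xint (\<lambda>x y. (t * Z x y)\<^sup>2) y) \<le> 1.0002 * (3.2 * (t * c))" for y
    proof -
      have "sqrt (xint (\<lambda>x y. (t * Z x y)\<^sup>2) y) \<le> (t * 3.2) * sqrt (xint R2 y)"
      proof (rule l2_norm_le[OF ctZ cR2])
        show "t * Z x y \<le> (t * 3.2) * sqrt (R2 x y)" for x
          using mult_left_mono[of "Z x y" "3.2 * R x y" t] ER[of x y] t(1) by (simp add: Z_def R_def mult.assoc)
      qed (use t V0 R20 in \<open>auto intro!: less_imp_le mult_pos_pos\<close>)
      also have "\<dots> = 3.2 * (t * c)" using c(1) by (simp add: xR)
      finally show ?thesis by simp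
    qed
    show "II b (\<lambda>x y. inner (dir \<xi>x \<xi>y x y) (\<xi> x y)) \<le> II b (\<lambda>x y. (norm (dir \<xi>x \<xi>y x y))\<^sup>2 / (t * Z x y))"
    proof (rule anti_bound[OF ctZ _ _ _ _ nZ small \<xi>])
      show "t * Z (x + 1 / real (2 * K)) y = t * Z x y" for x y unfolding h_def[symmetric] VZh ..
      show "t * Z (x + a) (y + b) = t * Z x y" for x y unfolding VZab ..
    qed (use t V0 K c in auto)
  qed (use t U(1) spV perK cU cV cZ in \<open>auto intro: cont2_mult cont2_const\<close>)
  have "specbd (2 ^ (m - k)) a b (\<lambda>x y. t * U x y)" if "k \<le> m" for k
    using that
  proof (induction k)
    case 0
    then show ?case using spK by (simp add: K_def)
  next
    case (Suc k)
    define j where "j = m - Suc k"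
    have j: "m - k = Suc j" "Suc j < N" using Suc.prems by (auto simp: j_def m)
    have "specbd (2 ^ j) a b (\<lambda>x y. t * U x y)"
    proof (rule specbd_halve[where v = "\<lambda>_. 1.0002 * (3 * (t * c))"])
      show "U (x + 1 / real (2 * 2 ^ j)) y = U x y" for x y using low[OF j(2)] by (simp add: P_def)
      show "specbd (2 * 2 ^ j) a b (\<lambda>x y. t * U x y)" using Suc j by simp
      show "crit (2 * 2 ^ j) b (\<lambda>_. 1.0002 * (3 * (t * c)))" using t c by (intro small) auto
    qed (use t uc in auto)
    then show ?case by (simp add: j_def)
  qed
  from this[of m] show ?thesis using t(1) by (intro exI[of _ t]) simp
qed

text \<open>A nonconstant weight either has circle norms different from \<open>c\<close> or varies
  along some circle; strictness has a different source in the two cases.\<close>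

theorem spectral_gap:
  assumes "U x1 y1 \<noteq> U 0 0"
  shows "\<exists>t>1. specbd 1 a b (\<lambda>x y. t * U x y)"
proof (cases "(\<forall>y. u y = c) \<and> (\<forall>x y. U x y = U 0 y)")
  case True
  then have ux: "u y = c" "U x y = U 0 y" for x y by auto
  have "U x y = c" for x y
  proof -
    have "(u y)\<^sup>2 = (U 0 y)\<^sup>2"
    proof -
      have "(\<lambda>x. (U x y)\<^sup>2) = (\<lambda>x. (U 0 y)\<^sup>2)" by (rule ext, subst ux(2), rule refl)
      then show ?thesis unfolding u(4) by (simp add: xint_def)
    qed
    then have "u y = U 0 y" using u(2)[of y] U(1)[of 0 y] by (simp add: power2_eq_iff_nonneg less_imp_le)
    then show ?thesis using ux by metis
  qed
  then show ?thesis using assms by simp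
next
  case False
  then show ?thesis using gap_y gap_x by blast
qed

end

section \<open>Metrics conformal to the flat torus\<close>

lemma C1_of_Ck:
  fixes f :: "complex \<Rightarrow> 'v::real_normed_vector"
  assumes "Ck 1 f"
  shows "C1 (\<lambda>x y. f (Complex x y)) (\<lambda>x y. frechet_derivative f (at (Complex x y)) 1)
    (\<lambda>x y. frechet_derivative f (at (Complex x y)) \<i>)"
proof -
  have d: "(f has_derivative frechet_derivative f (at z)) (at z)" for z
    using assms by (simp add: frechet_derivative_works[symmetric])
  have c: "cont2 (\<lambda>x y. h (Complex x y))" if "continuous_on UNIV h" for h :: "complex \<Rightarrow> 'v"
    unfolding cont2_def using that
    by (rule continuous_on_compose2) (auto simp: Complex_eq intro!: continuous_intros)
  have "continuous_on UNIV f"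
    by (intro continuous_at_imp_continuous_on ballI has_derivative_continuous[OF d])
  moreover have "continuous_on UNIV (\<lambda>z. frechet_derivative f (at z) v)" for v using assms by simp
  moreover have "((\<lambda>s. f (Complex s y)) has_vector_derivative frechet_derivative f (at (Complex x y)) 1) (at x)" for x y
  proof -
    have "((\<lambda>s. Complex s y) has_derivative (\<lambda>h. h *\<^sub>R 1)) (at x)"
      unfolding Complex_eq by (auto intro!: derivative_eq_intros simp: scaleR_conv_of_real)
    from has_derivative_compose[OF this d] show ?thesis
      unfolding has_vector_derivative_def linear_scale[OF has_derivative_linear[OF d]] .
  qed
  moreover have "((\<lambda>t. f (Complex x t)) has_vector_derivative frechet_derivative f (at (Complex x y)) \<i>) (at y)" for x y
  proof -
    have "((\<lambda>t. Complex x t) has_derivative (\<lambda>h. h *\<^sub>R \<i>)) (at y)"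
      unfolding Complex_eq by (auto intro!: derivative_eq_intros simp: scaleR_conv_of_real mult.commute)
    from has_derivative_compose[OF this d] show ?thesis
      unfolding has_vector_derivative_def linear_scale[OF has_derivative_linear[OF d]] .
  qed
  ultimately show ?thesis using c unfolding C1_def by blast
qed

lemma C1_Pair:
  assumes "C1 F Fx Fy" "C1 G Gx Gy"
  shows "C1 (\<lambda>x y. (F x y, G x y)) (\<lambda>x y. (Fx x y, Gx x y)) (\<lambda>x y. (Fy x y, Gy x y))"
  using assms unfolding C1_def cont2_def
  by (auto intro!: continuous_on_Pair has_vector_derivative_Pair)

lemma periodic_shift:
  assumes "periodic a b f"
  shows "f (Complex (x + 1) y) = f (Complex x y)" "f (Complex (x + a) (y + b)) = f (Complex x y)"
proof -
  have "(1::complex) \<in> lattice a b" unfolding lattice_def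
    by (rule CollectI, rule exI[of _ 1], rule exI[of _ 0]) simp
  moreover have "Complex a b \<in> lattice a b" unfolding lattice_def
    by (rule CollectI, rule exI[of _ 0], rule exI[of _ 1]) simp
  moreover have "Complex (x + 1) y = Complex x y + 1" "Complex (x + a) (y + b) = Complex x y + Complex a b"
    by (simp_all add: complex_eq_iff)
  ultimately show "f (Complex (x + 1) y) = f (Complex x y)" "f (Complex (x + a) (y + b)) = f (Complex x y)"
    using assms unfolding periodic_def by metis+
qed

lemma II_pos:
  assumes b: "0 < b" and F: "cont2 F" "\<And>x y. 0 \<le> F x y" and p: "\<And>x y. F (x + 1) y = F x y" "\<And>x y. F (x + a) (y + b) = F x y"
    and F0: "F x0 y0 \<noteq> 0"
  shows "0 < II b F"
proof (rule ccontr)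
  assume "\<not> 0 < II b F"
  then have "integral {0..b} (xint F) = 0" using II_nonneg[OF F, of b] by (simp add: II_def)
  then have y: "xint F y = 0" if "y \<in> {0..b}" for y
    using integral_eq_0_iff[OF xint_cont[OF F(1)], of 0 b] xint_nonneg[OF F] b that by blast
  have z: "F x y = 0" if "x \<in> {0..1}" "y \<in> {0..b}" for x y
    using integral_eq_0_iff[OF cont2_line(1)[OF F(1)], of 0 1 y] F(2) y[OF that(2)] that(1) by (simp add: xint_def)
  define n where "n = \<lfloor>y0 / b\<rfloor>"
  define x1 y1 where "x1 = x0 + of_int (- n) * a" and "y1 = y0 + of_int (- n) * b"
  have "F (x0 + (0 + of_int (- n) * 1) * a) (y0 + (0 + of_int (- n) * 1) * b) = F (x0 + 0 * a) (y0 + 0 * b)"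
    by (rule periodic_of_int[of "\<lambda>s. F (x0 + s * a) (y0 + s * b)"]) (simp add: distrib_right p add.assoc[symmetric])
  then have "F x1 y1 = F x0 y0" by (simp add: x1_def y1_def)
  moreover have "F (x1 + of_int (- \<lfloor>x1\<rfloor>) * 1) y1 = F x1 y1" by (rule periodic_of_int[of "\<lambda>x. F x y1"]) (rule p)
  moreover have "x1 + of_int (- \<lfloor>x1\<rfloor>) * 1 \<in> {0..1}" by (simp, linarith)
  moreover have "y1 \<in> {0..b}"
  proof -
    have "of_int n \<le> y0 / b" "y0 / b < of_int n + 1" unfolding n_def by linarith+
    then have "of_int n * b \<le> y0" "y0 < (of_int n + 1) * b" using b by (simp_all add: pos_le_divide_eq pos_divide_less_eq)
    then show ?thesis by (simp add: y1_def distrib_right)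
  qed
  ultimately show False using z F0 by metis
qed

text \<open>The inequality for \<open>\<kappa> \<rho>\<close> is tested with the eigenspinor:
  \<open>D \<xi> = l \<rho> \<xi>\<close> turns it into \<open>l N \<le> (l^2 / \<kappa>) N\<close>,
  where \<open>N\<close>, the integral of \<open>\<rho> |\<xi>|^2\<close>, is positive.\<close>

lemma eigenvalue_ge:
  assumes b: "0 < b" and \<phi>: "continuous_on UNIV \<phi>" "\<And>p. 0 < \<phi> p" and \<phi>p: "periodic a b \<phi>" and \<kappa>: "0 < \<kappa>" and l: "0 < l"
    and sp: "specbd 1 a b (\<lambda>x y. \<kappa> * sqrt (\<phi> (Complex x y)))"
    and ev: "dirac_eigenvalue a b (\<lambda>p u v. \<phi> p * flat_metric p u v) l"
  shows "\<kappa> \<le> l"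
proof -
  let ?g = "\<lambda>p u v. \<phi> p * flat_metric p u v"
  obtain \<psi> where sm: "smooth_spinor a b \<psi>" and nz: "\<psi> \<noteq> ((\<lambda>_. 0), (\<lambda>_. 0))"
    and eq: "dirac ?g \<psi> = ((\<lambda>z. of_real l * fst \<psi> z), (\<lambda>z. of_real l * snd \<psi> z))"
    using ev unfolding dirac_eigenvalue_def by blast
  obtain f h where fh: "\<psi> = (f, h)" by fastforce
  define \<rho> where "\<rho> x y = sqrt (\<phi> (Complex x y))" for x y
  have \<rho>0: "0 < \<rho> x y" for x y by (simp add: \<rho>_def \<phi>(2))
  have c\<rho>: "cont2 \<rho>" unfolding \<rho>_def cont2_def Complex_eq
    by (intro continuous_on_real_sqrt continuous_on_compose2[OF \<phi>(1)] continuous_intros) auto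
  have Ck: "Ck k f" "Ck k h" for k using sm by (auto simp: smooth_spinor_def smooth_def fh)
  have Ck': "Ck k (\<lambda>z. frechet_derivative f (at z) v)" "Ck k (\<lambda>z. frechet_derivative h (at z) v)" for k v
    using Ck[of "Suc k"] by simp_all
  define \<xi> where "\<xi> x y = (f (Complex x y), h (Complex x y))" for x y
  define \<xi>x where "\<xi>x x y = (frechet_derivative f (at (Complex x y)) 1, frechet_derivative h (at (Complex x y)) 1)" for x y
  define \<xi>y where "\<xi>y x y = (frechet_derivative f (at (Complex x y)) \<i>, frechet_derivative h (at (Complex x y)) \<i>)" for x y
  have C: "C1 \<xi> \<xi>x \<xi>y" unfolding \<xi>_def \<xi>x_def \<xi>y_def by (intro C1_Pair C1_of_Ck Ck)
  have C': "\<exists>\<xi>xx \<xi>xy. C1 \<xi>x \<xi>xx \<xi>xy" unfolding \<xi>x_def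
    using C1_Pair[OF C1_of_Ck[OF Ck'(1)] C1_of_Ck[OF Ck'(2)]] by blast
  have per: "\<xi> (x + 1) y = \<xi> x y" "\<xi> (x + a) (y + b) = \<xi> x y" for x y
    using sm by (simp_all add: smooth_spinor_def fh \<xi>_def periodic_shift[of a b])
  have D: "dir \<xi>x \<xi>y x y = (l * \<rho> x y) *\<^sub>R \<xi> x y" for x y
  proof -
    define z where "z = Complex x y"
    have s: "s0_norm_sq ?g z = 1 / \<rho> x y" by (simp add: s0_norm_sq_def flat_metric_def \<rho>_def z_def)
    have "2 * (of_real (1 / \<rho> x y) * d_z h z) = of_real l * f z" "2 * - (of_real (1 / \<rho> x y) * d_zbar f z) = of_real l * h z"
      using fun_cong[OF arg_cong[OF eq, of fst], of z] fun_cong[OF arg_cong[OF eq, of snd], of z]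
      unfolding dirac_def s[symmetric] by (simp_all add: fh)
    then have "2 * d_z h z = of_real (l * \<rho> x y) * f z" "- 2 * d_zbar f z = of_real (l * \<rho> x y) * h z"
      using \<rho>0[of x y] by (simp_all add: field_simps)
    moreover have "dir \<xi>x \<xi>y x y = (2 * d_z h z, - 2 * d_zbar f z)"
      by (simp add: dir_def e1_def e2_def \<xi>x_def \<xi>y_def z_def d_z_def d_zbar_def)
    ultimately show ?thesis by (simp add: \<xi>_def z_def scaleR_conv_of_real)
  qed
  define N where "N = II b (\<lambda>x y. \<rho> x y * (norm (\<xi> x y))\<^sup>2)"
  have cN: "cont2 (\<lambda>x y. \<rho> x y * (norm (\<xi> x y))\<^sup>2)"
    unfolding power2_norm_eq_inner by (intro cont2_mult c\<rho> cont2_inner cont2_C1(1)[OF C])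
  have "\<exists>z. f z \<noteq> 0 \<or> h z \<noteq> 0" using nz fh by (auto simp: fun_eq_iff)
  then obtain z where "f z \<noteq> 0 \<or> h z \<noteq> 0" by blast
  then have "\<xi> (Re z) (Im z) \<noteq> 0" by (auto simp: \<xi>_def zero_prod_def)
  moreover have "\<rho> (x + 1) y = \<rho> x y" "\<rho> (x + a) (y + b) = \<rho> x y" for x y
    by (simp_all add: \<rho>_def periodic_shift[OF \<phi>p])
  ultimately have "0 < N" unfolding N_def
    by (intro II_pos[OF b cN, of a "Re z" "Im z"]) (use \<rho>0 per in \<open>auto simp: less_imp_le less_imp_neq[THEN not_sym]\<close>)
  have "II b (\<lambda>x y. inner (dir \<xi>x \<xi>y x y) (\<xi> x y)) \<le> II b (\<lambda>x y. (norm (dir \<xi>x \<xi>y x y))\<^sup>2 / (\<kappa> * \<rho> x y))"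
    using sp C C' per unfolding specbd_def \<rho>_def[symmetric] by simp
  also have "(\<lambda>x y. inner (dir \<xi>x \<xi>y x y) (\<xi> x y)) = (\<lambda>x y. l * (\<rho> x y * (norm (\<xi> x y))\<^sup>2))"
    unfolding D by (simp add: power2_norm_eq_inner mult.assoc)
  also have "(\<lambda>x y. (norm (dir \<xi>x \<xi>y x y))\<^sup>2 / (\<kappa> * \<rho> x y)) = (\<lambda>x y. (l * l / \<kappa>) * (\<rho> x y * (norm (\<xi> x y))\<^sup>2))"
  proof (intro ext)
    show "(norm (dir \<xi>x \<xi>y x y))\<^sup>2 / (\<kappa> * \<rho> x y) = (l * l / \<kappa>) * (\<rho> x y * (norm (\<xi> x y))\<^sup>2)" for x y
      using \<rho>0[of x y] unfolding D power2_norm_eq_inner inner_scaleR_left inner_scaleR_right by simp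
  qed
  finally have "l * N \<le> (l * l / \<kappa>) * N" unfolding II_cmult N_def .
  then have "l \<le> l * l / \<kappa>" using \<open>0 < N\<close> mult_le_cancel_right_pos by blast
  then show ?thesis using l \<kappa> by (simp add: pos_le_divide_eq)
qed

section \<open>The area as an iterated integral\<close>

lemma measurable_Complex_pair: "(\<lambda>p. Complex (fst p) (snd p)) \<in> measurable lborel borel"
proof -
  have "continuous_on UNIV (\<lambda>p. Complex (fst p) (snd p))" unfolding Complex_eq by (intro continuous_intros)
  then show ?thesis using borel_measurable_continuous_onI by simp
qed

text \<open>Transfers integrals over the complex plane to the product measure, to which Fubini's
  theorem applies.\<close>

lemma lborel_complex: "(lborel :: complex measure) = distr (lborel :: (real \<times> real) measure) borel (\<lambda>p. Complex (fst p) (snd p))"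
proof (rule lborel_eqI)
  fix l u :: complex assume lu': "\<And>b. b \<in> Basis \<Longrightarrow> l \<bullet> b \<le> u \<bullet> b"
  have lu: "Re l \<le> Re u" "Im l \<le> Im u"
    using lu'[of 1] lu'[of \<i>] by (simp_all add: Basis_complex_def inner_complex_def)
  have "(\<lambda>p. Complex (fst p) (snd p)) -` box l u = box (Re l, Im l) (Re u, Im u)"
    by (auto simp: box_def Basis_complex_def Basis_prod_def inner_complex_def)
  then have "emeasure (distr (lborel :: (real \<times> real) measure) borel (\<lambda>p. Complex (fst p) (snd p))) (box l u) =
      emeasure lborel (box (Re l, Im l) (Re u, Im u))"
    using measurable_Complex_pair by (simp add: emeasure_distr)
  also have "\<dots> = ennreal ((Re u - Re l) * (Im u - Im l))"
    using lu by (subst emeasure_lborel_box) (auto simp: Basis_prod_def)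
  finally show "emeasure (distr (lborel :: (real \<times> real) measure) borel (\<lambda>p. Complex (fst p) (snd p))) (box l u) =
      ennreal (\<Prod>b\<in>Basis. (u - l) \<bullet> b)"
    by (simp add: Basis_complex_def inner_complex_def)
qed simp

text \<open>The parallelogram as a family of unit intervals over the heights from 0 to
  \<open>b\<close>, displaced by the shear.\<close>

lemma fundamental_domain_eq:
  assumes b: "0 < b"
  shows "fundamental_domain a b = {z. Im z \<in> {0..<b} \<and> Re z \<in> {Im z / b * a..<Im z / b * a + 1}}"
proof (intro set_eqI iffI)
  fix z assume "z \<in> fundamental_domain a b"
  then obtain s t where z: "z = of_real s + of_real t * Complex a b" and st: "s \<in> {0..<1}" "t \<in> {0..<1}"
    unfolding fundamental_domain_def by blast
  have "t * b < 1 * b" using st(2) b by (intro mult_strict_right_mono) auto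
  then show "z \<in> {z. Im z \<in> {0..<b} \<and> Re z \<in> {Im z / b * a..<Im z / b * a + 1}}"
    using z st b by simp
next
  fix z assume z: "z \<in> {z. Im z \<in> {0..<b} \<and> Re z \<in> {Im z / b * a..<Im z / b * a + 1}}"
  then have "z = of_real (Re z - Im z / b * a) + of_real (Im z / b) * Complex a b"
    "Re z - Im z / b * a \<in> {0..<1}" "Im z / b \<in> {0..<1}"
    using b by (auto simp: complex_eq_iff)
  then show "z \<in> fundamental_domain a b" unfolding fundamental_domain_def by blast
qed

lemma sets_strip:
  fixes f g :: "'a::topological_space \<Rightarrow> real"
  assumes "continuous_on UNIV f" "continuous_on UNIV g"
  shows "{z. g z \<in> {0..<b} \<and> f z \<in> {g z / b * a..<g z / b * a + 1}} \<in> sets borel"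
proof -
  have "{z. g z \<in> {0..<b} \<and> f z \<in> {g z / b * a..<g z / b * a + 1}} =
      ({z. 0 \<le> g z} \<inter> {z. g z < b}) \<inter> ({z. g z * (1 / b) * a \<le> f z} \<inter> {z. f z < g z * (1 / b) * a + 1})"
    by auto
  also have "\<dots> \<in> sets borel"
    by (intro sets.Int borel_closed borel_open closed_Collect_le open_Collect_less continuous_intros assms)
  finally show ?thesis .
qed

lemma integral_half_open:
  fixes f :: "real \<Rightarrow> real"
  assumes "continuous_on {s..t} f"
  shows "(LINT x:{s..<t}|lborel. f x) = integral {s..t} f"
proof -
  have i: "set_integrable lborel {s..t} f" unfolding set_integrable_def by (rule borel_integrable_compact) (use assms in auto)
  have "(LINT x:{s..<t}|lborel. f x) = (LINT x:{s..t}|lborel. f x)"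
    unfolding set_lebesgue_integral_def
  proof (rule integral_cong_AE)
    show "(\<lambda>x. indicat_real {s..<t} x *\<^sub>R f x) \<in> borel_measurable lborel"
      using set_integrable_subset[OF i, of "{s..<t}"] by (auto simp: set_integrable_def subset_eq)
    show "(\<lambda>x. indicat_real {s..t} x *\<^sub>R f x) \<in> borel_measurable lborel"
      using i by (auto simp: set_integrable_def)
    show "AE x in lborel. indicat_real {s..<t} x *\<^sub>R f x = indicat_real {s..t} x *\<^sub>R f x"
      using AE_lborel_singleton[of t] by eventually_elim (auto simp: indicator_def)
  qed
  also have "\<dots> = integral {s..t} f" by (rule set_borel_integral_eq_integral(2)[OF i])
  finally show ?thesis .
qed

lemma lborel_pair_iterated:
  fixes H :: "real \<Rightarrow> real \<Rightarrow> real"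
  assumes "integrable lborel (\<lambda>p. H (fst p) (snd p))"
  shows "(\<integral>p. H (fst p) (snd p) \<partial>lborel) = (\<integral>y. (\<integral>x. H x y \<partial>lborel) \<partial>lborel)"
  using lborel_pair.integral_snd[of H] assms by (simp add: lborel_prod split_beta')

text \<open>Each horizontal slice of the parallelogram is one full period of its circle, so the
  shear does not change the inner integral.\<close>

lemma fundamental_domain_integral:
  fixes \<phi> :: "complex \<Rightarrow> real"
  assumes b: "0 < b" and \<phi>: "continuous_on UNIV \<phi>" and p: "\<And>x y. \<phi> (Complex (x + 1) y) = \<phi> (Complex x y)"
  shows "(LINT p:fundamental_domain a b|lborel. \<phi> p) = integral {0..b} (xint (\<lambda>x y. \<phi> (Complex x y)))"
proof -
  let ?D = "{p. snd p \<in> {0..<b} \<and> fst p \<in> {snd p / b * a..<snd p / b * a + 1}} :: (real \<times> real) set"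
  let ?F = "\<lambda>x y. \<phi> (Complex x y)"
  have c: "cont2 ?F" unfolding cont2_def Complex_eq
    by (intro continuous_on_compose2[OF \<phi>] continuous_intros) auto
  have mD: "?D \<in> sets borel" by (intro sets_strip continuous_intros)
  have fdm: "fundamental_domain a b \<in> sets borel" unfolding fundamental_domain_eq[OF b] by (intro sets_strip continuous_intros)
  have int: "integrable lborel (\<lambda>p. indicat_real ?D p *\<^sub>R ?F (fst p) (snd p))"
  proof -
    let ?K = "cbox (- \<bar>a\<bar>, 0) (\<bar>a\<bar> + 1, b) :: (real \<times> real) set"
    have "?D \<subseteq> ?K"
    proof
      fix p assume "p \<in> ?D"
      then have p: "0 \<le> snd p" "snd p < b" "snd p / b * a \<le> fst p" "fst p < snd p / b * a + 1" by auto
      have "\<bar>snd p / b * a\<bar> \<le> 1 * \<bar>a\<bar>" unfolding abs_mult using p b by (intro mult_right_mono) auto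
      then have "- \<bar>a\<bar> \<le> fst p" "fst p \<le> \<bar>a\<bar> + 1" using p by linarith+
      then show "p \<in> ?K" using p by (cases p) (auto simp: mem_box Basis_prod_def)
    qed
    have K: "set_integrable lborel ?K (\<lambda>p. ?F (fst p) (snd p))" unfolding set_integrable_def
      by (rule borel_integrable_compact[OF compact_cbox continuous_on_subset[OF c[unfolded cont2_def] subset_UNIV]])
    have "?D \<in> sets lborel" using mD by simp
    from set_integrable_subset[OF K this \<open>?D \<subseteq> ?K\<close>] show ?thesis unfolding set_integrable_def .
  qed
  have "(LINT p:fundamental_domain a b|lborel. \<phi> p) = (\<integral>p. indicat_real ?D p *\<^sub>R ?F (fst p) (snd p) \<partial>lborel)"
  proof -
    have "(\<lambda>z. indicat_real (fundamental_domain a b) z *\<^sub>R \<phi> z) \<in> borel_measurable borel"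
      using fdm borel_measurable_continuous_onI[OF \<phi>] by (intro borel_measurable_scaleR borel_measurable_indicator) auto
    from integral_distr[OF measurable_Complex_pair this]
    have "(LINT p:fundamental_domain a b|lborel. \<phi> p) =
        (\<integral>p. indicat_real (fundamental_domain a b) (Complex (fst p) (snd p)) *\<^sub>R ?F (fst p) (snd p) \<partial>lborel)"
      unfolding set_lebesgue_integral_def lborel_complex[symmetric] .
    also have "\<dots> = (\<integral>p. indicat_real ?D p *\<^sub>R ?F (fst p) (snd p) \<partial>lborel)"
      by (rule arg_cong[where f = "integral\<^sup>L lborel"]) (auto simp: fundamental_domain_eq[OF b] indicator_def)
    finally show ?thesis .
  qed
  also have "\<dots> = (\<integral>y. (\<integral>x. indicat_real ?D (x, y) *\<^sub>R ?F x y \<partial>lborel) \<partial>lborel)"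
    using lborel_pair_iterated[of "\<lambda>x y. indicat_real ?D (x, y) *\<^sub>R ?F x y"] int by simp
  also have "\<dots> = (\<integral>y. indicat_real {0..<b} y *\<^sub>R xint ?F y \<partial>lborel)"
  proof (rule Bochner_Integration.integral_cong[OF refl])
    fix y :: real
    have "(\<integral>x. indicat_real ?D (x, y) *\<^sub>R ?F x y \<partial>lborel) =
        indicat_real {0..<b} y *\<^sub>R (LINT x:{y / b * a..<y / b * a + 1}|lborel. ?F x y)"
      by (cases "y \<in> {0..<b}") (auto simp: set_lebesgue_integral_def indicator_def intro!: Bochner_Integration.integral_cong)
    also have "(LINT x:{y / b * a..<y / b * a + 1}|lborel. ?F x y) = xint ?F y" unfolding xint_def
      using integral_half_open[OF cont2_line(1)[OF c]] periodic_integral_any[OF cont2_line(1)[OF c], of 1 y] p by simp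
    finally show "(\<integral>x. indicat_real ?D (x, y) *\<^sub>R ?F x y \<partial>lborel) = indicat_real {0..<b} y *\<^sub>R xint ?F y" .
  qed
  also have "\<dots> = integral {0..b} (xint ?F)"
    using integral_half_open[OF xint_cont[OF c]] by (simp add: set_lebesgue_integral_def)
  finally show ?thesis .
qed

section \<open>An eigenspinor for constant conformal factors\<close>

lemma has_derivative_cis_Im:
  "((\<lambda>z. w * cis (\<omega> * Im z)) has_derivative (\<lambda>v. (w * (\<i> * of_real (\<omega> * Im v))) * cis (\<omega> * Im z))) (at z)"
proof -
  have "((\<lambda>z. \<i> * of_real (\<omega> * Im z)) has_derivative (\<lambda>v. \<i> * of_real (\<omega> * Im v))) (at z)"
    by (auto intro!: derivative_eq_intros)
  from has_derivative_mult_right[OF has_derivative_compose[OF this DERIV_exp[unfolded has_field_derivative_def]], of w]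
  show ?thesis by (simp add: cis_conv_exp mult_ac)
qed

text \<open>The arbitrary factor \<open>w\<close> makes the family closed under directional
  derivatives, so the induction on the order of differentiability goes through.\<close>

lemma smooth_cis_Im:
  fixes w :: complex
  shows "smooth (\<lambda>z. w * cis (\<omega> * Im z))"
proof -
  have "Ck k (\<lambda>z. w * cis (\<omega> * Im z))" for k
  proof (induction k arbitrary: w)
    case 0
    show ?case by (auto intro!: continuous_intros)
  next
    case (Suc k)
    show ?case unfolding Ck.simps frechet_derivative_at[OF has_derivative_cis_Im, symmetric]
      using has_derivative_cis_Im Suc unfolding differentiable_def by blast
  qed
  then show ?thesis by (simp add: smooth_def)
qed

text \<open>The spinor \<open>(f, f)\<close> with \<open>f = cis (2 \<pi> y / b)\<close> is constant
  in \<open>x\<close>, hence periodic for every shear.\<close>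

lemma flat_eigenvalue:
  assumes b: "0 < b" and c: "0 < c"
  shows "dirac_eigenvalue a b (\<lambda>p u v. c * flat_metric p u v) (2 * pi / b / sqrt c)"
proof -
  define \<omega> where "\<omega> = 2 * pi / b"
  define f where "f z = 1 * cis (\<omega> * Im z)" for z
  have sm: "smooth f" unfolding f_def[abs_def] by (rule smooth_cis_Im)
  have per: "periodic a b f" unfolding periodic_def
  proof (intro ballI allI)
    fix \<gamma> z assume "\<gamma> \<in> lattice a b"
    then obtain m n :: int where "\<gamma> = of_int m + of_int n * Complex a b" unfolding lattice_def by blast
    then have "\<omega> * Im (z + \<gamma>) = \<omega> * Im z + 2 * pi * of_int n" using b by (simp add: \<omega>_def field_simps)
    then show "f (z + \<gamma>) = f z" by (simp add: f_def flip: cis_mult)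
  qed
  have d: "(f has_derivative (\<lambda>v. (\<i> * of_real (\<omega> * Im v)) * f z)) (at z)" for z
    using has_derivative_cis_Im[of 1 \<omega> z] unfolding f_def[abs_def] by simp
  note fd = frechet_derivative_at[OF d, symmetric]
  have D: "2 * d_z f z = of_real \<omega> * f z" "- 2 * d_zbar f z = of_real \<omega> * f z" for z
    unfolding d_z_def d_zbar_def fd by (simp_all flip: mult.assoc)
  have s: "s0_norm_sq (\<lambda>p u v. c * flat_metric p u v) z = 1 / sqrt c" for z
    by (simp add: s0_norm_sq_def flat_metric_def)
  have "dirac (\<lambda>p u v. c * flat_metric p u v) (f, f) = ((\<lambda>z. of_real (\<omega> / sqrt c) * f z), (\<lambda>z. of_real (\<omega> / sqrt c) * f z))"
  proof -
    have "2 * (of_real (1 / sqrt c) * d_z f z) = of_real (1 / sqrt c) * (2 * d_z f z)" for z by (simp only: mult_ac)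
    moreover have "2 * - (of_real (1 / sqrt c) * d_zbar f z) = of_real (1 / sqrt c) * (- 2 * d_zbar f z)" for z by simp
    moreover have "of_real (1 / sqrt c) * (of_real \<omega> * f z) = of_real (\<omega> / sqrt c) * f z" for z by simp
    ultimately show ?thesis unfolding dirac_def s fst_conv snd_conv D by (simp only:)
  qed
  moreover have "f 0 \<noteq> 0" by (simp add: f_def)
  ultimately show ?thesis unfolding dirac_eigenvalue_def \<omega>_def[symmetric]
    using sm per by (intro exI[of _ "(f, f)"]) (auto simp: smooth_spinor_def fun_eq_iff)
qed

section \<open>Lower bounds in the conformal class and the case of equality\<close>

lemma conformal_classE:
  assumes "g \<in> conformal_class a b flat_metric"
  obtains \<phi> where "smooth \<phi>" "periodic a b \<phi>" "\<And>p. 0 < \<phi> p" "g = (\<lambda>p u v. \<phi> p * flat_metric p u v)"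
  using assms unfolding conformal_class_def by blast

lemma torus_area_conformal:
  fixes \<phi> :: "complex \<Rightarrow> real"
  assumes b: "0 < b" and \<phi>: "continuous_on UNIV \<phi>" "periodic a b \<phi>" "\<And>p. 0 < \<phi> p"
  shows "torus_area a b (\<lambda>p u v. \<phi> p * flat_metric p u v) = II b (\<lambda>x y. \<phi> (Complex x y))"
proof -
  have "sqrt (\<phi> p * (\<phi> p)) = \<phi> p" for p using \<phi>(3)[of p] by simp
  then have "torus_area a b (\<lambda>p u v. \<phi> p * flat_metric p u v) = (LINT p:fundamental_domain a b|lborel. \<phi> p)"
    unfolding torus_area_def by (simp add: flat_metric_def)
  then show ?thesis
    using fundamental_domain_integral[OF b \<phi>(1) periodic_shift(1)[OF \<phi>(2)]] by (simp add: II_def)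
qed

text \<open>Both bounds come from \<open>specbd\<close> for \<open>t U\<close>, with
  \<open>t = 1\<close> in general and some \<open>t > 1\<close> for a nonconstant conformal factor.
  Strictness is thus uniform over all positive eigenvalues and passes to their infimum.\<close>

lemma conformal_bounds:
  fixes \<phi> :: "complex \<Rightarrow> real"
  assumes b: "2 * pi < b" and \<phi>: "smooth \<phi>" "periodic a b \<phi>" "\<And>p. 0 < \<phi> p"
  defines "g \<equiv> (\<lambda>p u v. \<phi> p * flat_metric p u v)"
  shows "ereal (2 * pi / sqrt b) \<le> lambda1_bar a b g"
    and "\<phi> p \<noteq> \<phi> 0 \<Longrightarrow> ereal (2 * pi / sqrt b) < lambda1_bar a b g"
proof -
  have b0: "0 < b" using b pi_gt_zero by linarith
  have c\<phi>: "continuous_on UNIV \<phi>" using \<phi>(1) unfolding smooth_def by (metis Ck.simps(1))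
  define A where "A = II b (\<lambda>x y. \<phi> (Complex x y))"
  have A: "torus_area a b g = A" unfolding g_def A_def by (rule torus_area_conformal[OF b0 c\<phi> \<phi>(2,3)])
  have c2: "cont2 (\<lambda>x y. \<phi> (Complex x y))" unfolding cont2_def Complex_eq
    by (intro continuous_on_compose2[OF c\<phi>] continuous_intros) auto
  have A0: "0 < A" unfolding A_def
    by (rule II_pos[OF b0 c2, of a 0 0]) (use \<phi> periodic_shift[OF \<phi>(2)] in \<open>auto simp: less_imp_le less_imp_neq[THEN not_sym]\<close>)
  \<comment> \<open>Normalised so that \<open>\<kappa> sqrt A\<close> is the claimed bound
    \<open>2 \<pi> / sqrt b\<close>.\<close>
  define \<kappa> where "\<kappa> = 2 * pi / sqrt (b * A)"
  have \<kappa>: "0 < \<kappa>" using b0 A0 by (simp add: \<kappa>_def)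
  have \<kappa>A: "\<kappa> * sqrt A = 2 * pi / sqrt b" using A0 by (simp add: \<kappa>_def real_sqrt_mult)
  define U where "U x y = \<kappa> * sqrt (\<phi> (Complex x y))" for x y
  interpret weight a b U
  proof
    show "2 * pi \<le> b" using b by simp
    show "cont2 U" unfolding U_def by (intro cont2_mult cont2_const cont2_sqrt c2)
    show "0 < U x y" "U (x + 1) y = U x y" "U (x + a) (y + b) = U x y" for x y
      using \<kappa> \<phi>(3) by (simp_all add: U_def periodic_shift[OF \<phi>(2)])
    have "(U x y)\<^sup>2 = \<kappa>\<^sup>2 * \<phi> (Complex x y)" for x y using \<phi>(3) by (simp add: U_def power_mult_distrib less_imp_le)
    then have "integral {0..b} (xint (\<lambda>x y. (U x y)\<^sup>2)) = \<kappa>\<^sup>2 * A"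
      by (simp add: II_cmult[unfolded II_def] A_def II_def)
    also have "\<dots> = 4 * pi\<^sup>2 / b" using b0 A0 by (simp add: \<kappa>_def power_divide power_mult_distrib)
    finally show "integral {0..b} (xint (\<lambda>x y. (U x y)\<^sup>2)) = 4 * pi\<^sup>2 / b" .
  qed
  have lower: "ereal (t * (2 * pi / sqrt b)) \<le> lambda1_bar a b g" if t: "0 < t" and sp: "specbd 1 a b (\<lambda>x y. t * U x y)" for t
  proof -
    have "t * \<kappa> \<le> l" if l: "0 < l" "dirac_eigenvalue a b g l" for l
    proof (rule eigenvalue_ge[OF b0 c\<phi> \<phi>(3,2) _ l(1)])
      show "0 < t * \<kappa>" using t \<kappa> by simp
      show "specbd 1 a b (\<lambda>x y. t * \<kappa> * sqrt (\<phi> (Complex x y)))" using sp by (simp add: U_def mult.assoc)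
      show "dirac_eigenvalue a b (\<lambda>p u v. \<phi> p * flat_metric p u v) l" using l(2) by (simp add: g_def)
    qed
    then have "ereal (t * \<kappa>) \<le> lambda1 a b g" unfolding lambda1_def by (intro Inf_greatest) auto
    then have "ereal (t * \<kappa>) * ereal (sqrt A) \<le> lambda1 a b g * ereal (sqrt A)" using A0 by (intro ereal_mult_right_mono) auto
    then show ?thesis unfolding lambda1_bar_def A \<kappa>A[symmetric] by (simp add: mult.assoc)
  qed
  show "ereal (2 * pi / sqrt b) \<le> lambda1_bar a b g" using lower[of 1] specbd_weight by simp
  assume "\<phi> p \<noteq> \<phi> 0"
  then have "U (Re p) (Im p) \<noteq> U 0 0" using \<kappa> by (simp add: U_def zero_complex.code[symmetric])
  then obtain t where t: "1 < t" "specbd 1 a b (\<lambda>x y. t * U x y)" using spectral_gap by blast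
  have "1 * (2 * pi / sqrt b) < t * (2 * pi / sqrt b)" using t(1) b0 by (intro mult_strict_right_mono) auto
  then have "ereal (2 * pi / sqrt b) < ereal (t * (2 * pi / sqrt b))" by simp
  also have "\<dots> \<le> lambda1_bar a b g" using t by (intro lower) auto
  finally show "ereal (2 * pi / sqrt b) < lambda1_bar a b g" .
qed

text \<open>The eigenvalue of \<open>flat_eigenvalue\<close> meets the lower bound; the area
  \<open>b c\<close> compensates the scaling of the metric.\<close>

lemma lambda1_bar_flat:
  assumes b: "2 * pi < b" and c: "0 < c"
  shows "lambda1_bar a b (\<lambda>p u v. c * flat_metric p u v) = ereal (2 * pi / sqrt b)"
proof (rule antisym)
  have b0: "0 < b" using b pi_gt_zero by linarith
  have p: "periodic a b (\<lambda>_. c)" by (simp add: periodic_def)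
  have "Ck k (\<lambda>_::complex. d)" for k and d :: real by (induction k arbitrary: d) auto
  then have s: "smooth (\<lambda>_::complex. c)" by (simp add: smooth_def)
  show "ereal (2 * pi / sqrt b) \<le> lambda1_bar a b (\<lambda>p u v. c * flat_metric p u v)"
    by (rule conformal_bounds(1)[OF b s p c])
  have A: "torus_area a b (\<lambda>p u v. c * flat_metric p u v) = b * c"
    using torus_area_conformal[OF b0 continuous_on_const p c] b0 by (simp add: II_const)
  have "lambda1 a b (\<lambda>p u v. c * flat_metric p u v) \<le> ereal (2 * pi / b / sqrt c)"
    unfolding lambda1_def by (rule Inf_lower) (use flat_eigenvalue[OF b0 c] b0 c in auto)
  then have "lambda1_bar a b (\<lambda>p u v. c * flat_metric p u v) \<le> ereal (2 * pi / b / sqrt c) * ereal (sqrt (b * c))"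
    unfolding lambda1_bar_def A using b0 c by (intro ereal_mult_right_mono) auto
  also have "\<dots> = ereal (2 * pi / sqrt b)"
    using b0 c real_sqrt_mult_self[of b] by (simp add: real_sqrt_mult field_simps)
  finally show "lambda1_bar a b (\<lambda>p u v. c * flat_metric p u v) \<le> ereal (2 * pi / sqrt b)" .
qed

theorem theorem1p7:
  fixes a b :: real
  assumes "0 \<le> a" and "a \<le> 1 / 2" and "b > 2 * pi"
  shows "Lambda1 a b (conformal_class a b flat_metric) = lambda1_bar a b flat_metric \<and>
    lambda1_bar a b flat_metric = ereal (2 * pi / sqrt b) \<and>
    (\<forall>g \<in> conformal_class a b flat_metric.
       lambda1_bar a b g = Lambda1 a b (conformal_class a b flat_metric) \<longleftrightarrow>
       (\<exists>c>0. g = (\<lambda>p u v. c * flat_metric p u v)))"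
proof -
  have flat: "lambda1_bar a b flat_metric = ereal (2 * pi / sqrt b)"
    using lambda1_bar_flat[OF assms(3), of 1 a] by simp
  have lower: "ereal (2 * pi / sqrt b) \<le> lambda1_bar a b g" if "g \<in> conformal_class a b flat_metric" for g
    using that by (rule conformal_classE) (simp add: conformal_bounds(1)[OF assms(3)])
  have L: "Lambda1 a b (conformal_class a b flat_metric) = ereal (2 * pi / sqrt b)" unfolding Lambda1_def
  proof (rule antisym)
    show "(INF g\<in>conformal_class a b flat_metric. lambda1_bar a b g) \<le> ereal (2 * pi / sqrt b)"
      unfolding flat[symmetric] by (rule INF_lower[OF flat_metric_in_conformal_class])
    show "ereal (2 * pi / sqrt b) \<le> (INF g\<in>conformal_class a b flat_metric. lambda1_bar a b g)"
      by (rule INF_greatest) (rule lower)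
  qed
  have "lambda1_bar a b g = ereal (2 * pi / sqrt b) \<longleftrightarrow> (\<exists>c>0. g = (\<lambda>p u v. c * flat_metric p u v))"
    if g: "g \<in> conformal_class a b flat_metric" for g
  proof
    obtain \<phi> where \<phi>: "smooth \<phi>" "periodic a b \<phi>" "\<And>p. 0 < \<phi> p" and g: "g = (\<lambda>p u v. \<phi> p * flat_metric p u v)"
      using g by (rule conformal_classE) (rule that)
    assume "lambda1_bar a b g = ereal (2 * pi / sqrt b)"
    then have "\<phi> p = \<phi> 0" for p using conformal_bounds(2)[OF assms(3) \<phi>, of p] unfolding g by (metis less_irrefl)
    then have "g = (\<lambda>p u v. \<phi> 0 * flat_metric p u v)" unfolding g by (intro ext arg_cong2[where f = times]) auto
    then show "\<exists>c>0. g = (\<lambda>p u v. c * flat_metric p u v)" using \<phi>(3) by blast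
  next
    assume "\<exists>c>0. g = (\<lambda>p u v. c * flat_metric p u v)"
    then show "lambda1_bar a b g = ereal (2 * pi / sqrt b)" using lambda1_bar_flat[OF assms(3)] by blast
  qed
  then show ?thesis using flat L by simp
qed

end
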